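(* Let $n\ge 3$. There exists $\varepsilon_0>0$ such that if $(u,d)\in C^\infty(\mathbb{R}^n\setminus\{0\},\mathbb{R}^n\times\mathbb{S}^{n-1})$ is a solution of the steady simplified Ericksen-Leslie system in $\mathbb{R}^n\setminus\{0\}$ satisfying $$\max\{|u(x)|,|\nabla d(x)|\}\le\frac{\varepsilon_0}{|x|}\qquad\text{for all }x\in\mathbb{R}^n\setminus\{0\},$$ then: (i) if $n\ge 4$, then $u\equiv 0$ and $d$ is a constant map; (ii) if $n=3$, then $d$ is a constant map, and $u$ is either $0$ or a Landau solution of the steady Navier-Stokes equations.
   Context: The steady simplified Ericksen-Leslie system for $u$ with values in $\mathbb{R}^n$, a scalar pressure $p$, and $d$ with values in $\mathbb{S}^{n-1}\subset\mathbb{R}^n$ is $$-\Delta u+u\cdot\nabla u+\nabla p=-\operatorname{div}(\nabla d\odot\nabla d),\qquad \operatorname{div}u=0,\qquad \Delta d+|\nabla d|^2d=u\cdot\nabla d,$$ where $(\nabla d\odot\nabla d)_{ij}=\partial_{x_i}d\cdot\partial_{x_j}d$. Saying that $(u,d)$ is a solution means that the system holds for some smooth pressure $p$ on $\mathbb{R}^n\setminus\{0\}$. The steady Navier-Stokes equations are $-\Delta u+u\cdot\nabla u+\nabla p=0$, $\operatorname{div}u=0$. Landau solutions ($n=3$) are the vector fields on $\mathbb{R}^3\setminus\{0\}$ given, in spherical coordinates with polar angle $\phi\in(0,\pi)$ and azimuthal angle $\theta\in[0,2\pi)$ about some axis through the origin (any direction of the axis is allowed), by $$u_a=\operatorname{curl}(\psi_a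 e_\theta),\qquad \psi_a=\frac{2\sin\phi}{a-\cos\phi},\qquad a\in(1,\infty],$$ where $e_\theta$ is the azimuthal unit vector and $a=\infty$ corresponds to $u\equiv0$. *)

theory Defs
  imports "HOL-Analysis.Analysis"
begin

unbundle cross3_syntax

text \<open>Fields on the punctured space are total functions on \<open>real ^ 'n\<close>. All conditions below are imposed
  away from the origin only, and derivatives are local, so the value at \<open>0\<close> plays no role.\<close>

definition partial_deriv ::
    "'n::finite \<Rightarrow> (real ^ 'n \<Rightarrow> 'b::real_normed_vector) \<Rightarrow> real ^ 'n \<Rightarrow> 'b" where
  "partial_deriv i f x = frechet_derivative f (at x) (axis i 1)"

primrec Ck_on ::
    "nat \<Rightarrow> ('a::real_normed_vector) set \<Rightarrow> ('a \<Rightarrow> 'b::real_normed_vector) \<Rightarrow> bool" where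
  "Ck_on 0 S f \<longleftrightarrow> continuous_on S f"
| "Ck_on (Suc k) S f \<longleftrightarrow>
     (\<forall>x\<in>S. f differentiable (at x)) \<and>
     (\<forall>v. Ck_on k S (\<lambda>x. frechet_derivative f (at x) v))"

text \<open>The set \<open>S\<close> is meant to be open, since derivatives are taken with respect to the full
  neighbourhood filter.\<close>

definition smooth_on ::
    "('a::real_normed_vector) set \<Rightarrow> ('a \<Rightarrow> 'b::real_normed_vector) \<Rightarrow> bool" where
  "smooth_on S f \<longleftrightarrow> (\<forall>k. Ck_on k S f)"

definition grad :: "(real ^ 'n \<Rightarrow> real) \<Rightarrow> real ^ 'n \<Rightarrow> real ^ 'n" where
  "grad p x = (\<chi> i. partial_deriv i p x)"

definition divergence :: "(real ^ 'n \<Rightarrow> real ^ 'n) \<Rightarrow> real ^ 'n \<Rightarrow> real" where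
  "divergence u x = (\<Sum>i\<in>UNIV. partial_deriv i (\<lambda>y. u y $ i) x)"

definition laplacian :: "(real ^ 'n \<Rightarrow> real ^ 'm) \<Rightarrow> real ^ 'n \<Rightarrow> real ^ 'm" where
  "laplacian f x = (\<Sum>i\<in>UNIV. partial_deriv i (partial_deriv i f) x)"

text \<open>\<open>advection u f\<close> is $u \cdot \nabla f$.\<close>

definition advection ::
    "(real ^ 'n \<Rightarrow> real ^ 'n) \<Rightarrow> (real ^ 'n \<Rightarrow> real ^ 'm) \<Rightarrow> real ^ 'n \<Rightarrow> real ^ 'm" where
  "advection u f x = (\<Sum>i\<in>UNIV. u x $ i *\<^sub>R partial_deriv i f x)"

text \<open>The Euclidean (Frobenius) norm of the Jacobian matrix.\<close>

definition grad_norm :: "(real ^ 'n \<Rightarrow> real ^ 'm) \<Rightarrow> real ^ 'n \<Rightarrow> real" where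
  "grad_norm d x = sqrt (\<Sum>i\<in>UNIV. (norm (partial_deriv i d x))\<^sup>2)"

text \<open>\<open>ericksen_stress d\<close> is $\nabla d \odot \nabla d$.\<close>

definition ericksen_stress :: "(real ^ 'n \<Rightarrow> real ^ 'm) \<Rightarrow> real ^ 'n \<Rightarrow> real ^ 'n ^ 'n" where
  "ericksen_stress d x = (\<chi> i j. partial_deriv i d x \<bullet> partial_deriv j d x)"

definition div_matrix :: "(real ^ 'n \<Rightarrow> real ^ 'n ^ 'n) \<Rightarrow> real ^ 'n \<Rightarrow> real ^ 'n" where
  "div_matrix M x = (\<chi> i. \<Sum>j\<in>UNIV. partial_deriv j (\<lambda>y. M y $ i $ j) x)"

definition steady_ericksen_leslie ::
    "(real ^ 'n \<Rightarrow> real ^ 'n) \<Rightarrow> (real ^ 'n \<Rightarrow> real ^ 'n) \<Rightarrow> bool" where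
  "steady_ericksen_leslie u d \<longleftrightarrow>
     (\<exists>p :: real ^ 'n \<Rightarrow> real. smooth_on (- {0}) p \<and>
       (\<forall>x. x \<noteq> 0 \<longrightarrow>
          - laplacian u x + advection u u x + grad p x = - div_matrix (ericksen_stress d) x \<and>
          divergence u x = 0 \<and>
          laplacian d x + (grad_norm d x)\<^sup>2 *\<^sub>R d x = advection u d x))"

definition steady_navier_stokes :: "(real ^ 'n \<Rightarrow> real ^ 'n) \<Rightarrow> bool" where
  "steady_navier_stokes u \<longleftrightarrow>
     (\<exists>p :: real ^ 'n \<Rightarrow> real. smooth_on (- {0}) p \<and>
       (\<forall>x. x \<noteq> 0 \<longrightarrow>
          - laplacian u x + advection u u x + grad p x = 0 \<and> divergence u x = 0))"

definition curl :: "(real ^ 3 \<Rightarrow> real ^ 3) \<Rightarrow> real ^ 3 \<Rightarrow> real ^ 3" where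
  "curl A x = vector
     [partial_deriv 2 (\<lambda>y. A y $ 3) x - partial_deriv 3 (\<lambda>y. A y $ 2) x,
      partial_deriv 3 (\<lambda>y. A y $ 1) x - partial_deriv 1 (\<lambda>y. A y $ 3) x,
      partial_deriv 1 (\<lambda>y. A y $ 2) x - partial_deriv 2 (\<lambda>y. A y $ 1) x]"

text \<open>Spherical coordinates about the axis spanned by the unit vector \<open>k\<close>. On the axis itself
  the azimuthal unit vector is undefined (here it takes the value \<open>0\<close>).\<close>

definition polar_angle :: "real ^ 3 \<Rightarrow> real ^ 3 \<Rightarrow> real" where
  "polar_angle k x = arccos (k \<bullet> x / norm x)"

definition azimuthal_unit :: "real ^ 3 \<Rightarrow> real ^ 3 \<Rightarrow> real ^ 3" where
  "azimuthal_unit k x = (1 / norm (k \<times> x)) *\<^sub>R (k \<times> x)"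

definition landau_psi :: "ereal \<Rightarrow> real \<Rightarrow> real" where
  "landau_psi a \<phi> = (if a = \<infinity> then 0 else 2 * sin \<phi> / (real_of_ereal a - cos \<phi>))"

text \<open>For finite \<open>a\<close> the vector potential equals \<open>(2 / (a * norm x - k \<bullet> x)) *\<^sub>R (k \<times> x)\<close> at every
  \<open>x \<noteq> 0\<close>, see \<open>landau_potential_eq\<close> below. In particular it is smooth across the axis, and
  \<open>landau_field\<close> has the intended values there too.\<close>

definition landau_potential :: "real ^ 3 \<Rightarrow> ereal \<Rightarrow> real ^ 3 \<Rightarrow> real ^ 3" where
  "landau_potential k a x = landau_psi a (polar_angle k x) *\<^sub>R azimuthal_unit k x"

definition landau_field :: "real ^ 3 \<Rightarrow> ereal \<Rightarrow> real ^ 3 \<Rightarrow> real ^ 3" where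
  "landau_field k a = curl (landau_potential k a)"

lemma landau_potential_eq:
  fixes k x :: "real ^ 3" and a :: real
  assumes k: "norm k = 1" and x: "x \<noteq> 0"
  shows "landau_potential k (ereal a) x = (2 / (a * norm x - k \<bullet> x)) *\<^sub>R (k \<times> x)"
proof -
  have nx: "norm x > 0" using x by simp
  have cs: "\<bar>k \<bullet> x\<bar> \<le> norm x" using Cauchy_Schwarz_ineq2[of k x] k by simp
  have rng: "-1 \<le> k \<bullet> x / norm x" "k \<bullet> x / norm x \<le> 1"
    using cs nx by (auto simp: field_simps abs_le_iff)
  have c: "cos (polar_angle k x) = k \<bullet> x / norm x"
    unfolding polar_angle_def by (rule cos_arccos[OF rng])
  have n: "(norm (k \<times> x))\<^sup>2 = (norm x)\<^sup>2 - (k \<bullet> x)\<^sup>2"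
    using norm_cross[of k x] k by simp
  have "sin (polar_angle k x) = sqrt (1 - (k \<bullet> x / norm x)\<^sup>2)"
    unfolding polar_angle_def by (rule sin_arccos[OF rng])
  also have "1 - (k \<bullet> x / norm x)\<^sup>2 = (norm (k \<times> x) / norm x)\<^sup>2"
    using nx n by (simp add: field_simps power_divide)
  finally have s: "sin (polar_angle k x) = norm (k \<times> x) / norm x"
    by simp
  show ?thesis
  proof (cases "k \<times> x = 0")
    case True
    then show ?thesis by (simp add: landau_potential_def azimuthal_unit_def)
  next
    case False
    have "a - k \<bullet> x / norm x = (a * norm x - k \<bullet> x) / norm x"
      using nx by (simp add: field_simps)
    with False nx show ?thesis
      by (simp add: landau_potential_def azimuthal_unit_def landau_psi_def c s)
  qed
qed

text \<open>For an index type \<open>'n\<close> with three elements, \<open>real ^ 'n\<close> is identified with \<open>real ^ 3\<close> by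
  naming the coordinates through a bijection \<open>\<sigma>\<close>. The choice of \<open>\<sigma>\<close> does not affect the class:
  a permutation \<open>P\<close> of the coordinates, even or odd, turns the field with axis \<open>k\<close> into the field
  with axis \<open>P k\<close>, since both \<open>azimuthal_unit\<close> and \<open>curl\<close> pick up the factor \<open>det P\<close>.\<close>

definition landau_solution :: "(real ^ 'n \<Rightarrow> real ^ 'n) \<Rightarrow> bool" where
  "landau_solution u \<longleftrightarrow>
     (\<exists>(\<sigma> :: 3 \<Rightarrow> 'n) k a. bij \<sigma> \<and> norm k = 1 \<and> 1 < a \<and>
        (\<forall>x. x \<noteq> 0 \<longrightarrow> (\<chi> i. u x $ \<sigma> i) = landau_field k a (\<chi> i. x $ \<sigma> i)))"

end

theory Submission
  imports Defs "HOL-Analysis.Analysis"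
begin

text \<open>The hypotheses are invariant under dilations of space, and the proof rests on two estimates on the punctured
space whose constants depend on the dimension \<open>n\<close> only. By \<open>gradient_estimate\<close>, a bounded function with \<open>\<nabla>g = O(1 / \<bar>y\<bar>)\<close> and
\<open>\<bar>\<Delta>g\<bar> \<le> K / \<bar>y\<bar>\<^sup>2\<close> satisfies \<open>\<bar>\<nabla>g\<bar> \<le> C K / \<bar>y\<bar>\<close>. By \<open>stokes_estimate\<close>, a solenoidal solution \<open>w = O(1 / \<bar>y\<bar>)\<close> of the
Stokes system with force \<open>div H\<close>, \<open>\<bar>H\<bar> \<le> K / \<bar>y\<bar>\<^sup>2\<close>, satisfies \<open>\<bar>w\<bar> \<le> C K / \<bar>y\<bar>\<close>, provided that no momentum flux
emanates from the origin. Whenever \<open>K\<close> is a small multiple of the quantity that is estimated, that quantity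
vanishes (\<open>bound_zero_by_halving\<close>).

For the director, \<open>\<bar>\<nabla>d\<bar> \<le> M / \<bar>y\<bar>\<close> and the smallness of \<open>u\<close> and \<open>\<nabla>d\<close> give \<open>\<bar>\<Delta>d\<bar> \<le> C \<epsilon> M / \<bar>y\<bar>\<^sup>2\<close>, hence \<open>\<nabla>d = 0\<close>
(\<open>small_director_constant\<close>). The elastic stress then disappears and \<open>u\<close> solves the Navier-Stokes equations.

Two small Navier-Stokes solutions \<open>u\<close>, \<open>U\<close> with the same flux coincide, because \<open>w = u - U\<close> solves the Stokes
system with \<open>H = u \<otimes> u - U \<otimes> U\<close>, which satisfies \<open>\<bar>H\<bar> \<le> 2 \<delta> M / \<bar>y\<bar>\<^sup>2\<close> when \<open>\<bar>w\<bar> \<le> M / \<bar>y\<bar>\<close> and \<open>\<bar>u\<bar>, \<bar>U\<bar> \<le> \<delta> / \<bar>y\<bar>\<close>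
(\<open>small_solution_determined_by_flux\<close>). For \<open>n \<ge> 4\<close> the flux is zero, as the singularity is too weak to carry any
(\<open>zero_flux_of_dim_ge_4\<close>), and one compares with \<open>U = 0\<close>. For \<open>n = 3\<close> the flux is a vector of size \<open>O(\<epsilon>)\<close>. The flux
of a Landau solution is parallel to its axis, and by continuity in the parameter \<open>a\<close> its length takes
all small positive values (\<open>landau_flux_realises\<close>), so \<open>u\<close> has the flux of \<open>0\<close> or of a Landau solution.

Both estimates come from testing with an explicit kernel centred at \<open>x\<close>, regularised by writing
\<open>\<bar>y - x\<bar>\<^sup>2 + \<delta>\<^sup>2\<close> for \<open>\<bar>y - x\<bar>\<^sup>2\<close>. Up to gradients, the differential operator turns it into an approximate identity, and the remaining
integral is at most \<open>K \<integral> \<bar>y - x\<bar>\<^sup>1\<^sup>-\<^sup>n \<bar>y\<bar>\<^sup>-\<^sup>2 dy = C K / \<bar>x\<bar>\<close>. Cutoffs at the origin and at infinity are removed by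
dominated convergence. In the Stokes case the kernel is the divergence of an antisymmetric potential and
the cutoff multiplies the potential: all test fields stay solenoidal and the pressure never enters.\<close>

section \<open>Partial derivatives\<close>

lemma partial_deriv_eq:
  fixes f :: "real ^ 'n::finite \<Rightarrow> 'b::real_normed_vector"
  assumes "(f has_derivative F) (at x)"
  shows "partial_deriv i f x = F (axis i 1)"
  unfolding partial_deriv_def using frechet_derivative_at[OF assms] by simp

lemma has_derivative_cong_open:
  fixes f g :: "'a::real_normed_vector \<Rightarrow> 'b::real_normed_vector"
  assumes "open S" "x \<in> S" "\<And>y. y \<in> S \<Longrightarrow> f y = g y"
  shows "(f has_derivative F) (at x) \<longleftrightarrow> (g has_derivative F) (at x)"
  using has_derivative_transform_within_open[of f F x UNIV S g]
    has_derivative_transform_within_open[of g F x UNIV S f] assms by auto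

lemma partial_deriv_cong:
  fixes f g :: "real ^ 'n::finite \<Rightarrow> 'b::real_normed_vector"
  assumes "open S" "x \<in> S" "\<And>y. y \<in> S \<Longrightarrow> f y = g y"
  shows "partial_deriv i f x = partial_deriv i g x"
  unfolding partial_deriv_def frechet_derivative_def
  using has_derivative_cong_open[OF assms] by simp

lemma differentiable_cong_open:
  fixes f g :: "'a::real_normed_vector \<Rightarrow> 'b::real_normed_vector"
  assumes "open S" "x \<in> S" "\<And>y. y \<in> S \<Longrightarrow> f y = g y"
  shows "f differentiable (at x) \<longleftrightarrow> g differentiable (at x)"
  unfolding differentiable_def using has_derivative_cong_open[OF assms] by simp

lemma partial_deriv_const [simp]: "partial_deriv i (\<lambda>y. c) x = 0"
  by (simp add: partial_deriv_def)

lemma partial_deriv_coord [simp]: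
  "partial_deriv i (\<lambda>y::real ^ 'n::finite. y $ j) x = (if i = j then 1 else 0)"
proof -
  have "((\<lambda>y::real ^ 'n. y $ j) has_derivative (\<lambda>y. y $ j)) (at x)"
    by (rule bounded_linear_imp_has_derivative[OF bounded_linear_vec_nth])
  from partial_deriv_eq[OF this, of i] show ?thesis by (auto simp: axis_def)
qed

lemma differentiable_coord [simp]: "(\<lambda>y::real ^ 'n::finite. y $ j) differentiable (at x)"
proof -
  have "((\<lambda>y::real ^ 'n. y $ j) has_derivative (\<lambda>y. y $ j)) (at x)"
    by (rule bounded_linear_imp_has_derivative[OF bounded_linear_vec_nth])
  then show ?thesis by (auto simp: differentiable_def)
qed

context
  fixes f g :: "real ^ 'n::finite \<Rightarrow> real" and x :: "real ^ 'n"
  assumes df: "f differentiable (at x)"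
begin

lemma partial_deriv_works:
  "(f has_derivative frechet_derivative f (at x)) (at x)"
  using df frechet_derivative_works by blast

lemma partial_deriv_add:
  assumes "g differentiable (at x)"
  shows "partial_deriv i (\<lambda>y. f y + g y) x = partial_deriv i f x + partial_deriv i g x"
  using partial_deriv_eq[OF has_derivative_add[OF partial_deriv_works
      assms[unfolded frechet_derivative_works]], of i] by (simp add: partial_deriv_def)

lemma partial_deriv_diff:
  assumes "g differentiable (at x)"
  shows "partial_deriv i (\<lambda>y. f y - g y) x = partial_deriv i f x - partial_deriv i g x"
  using partial_deriv_eq[OF has_derivative_diff[OF partial_deriv_works
      assms[unfolded frechet_derivative_works]], of i] by (simp add: partial_deriv_def)

lemma partial_deriv_mult:
  assumes "g differentiable (at x)"
  shows "partial_deriv i (\<lambda>y. f y * g y) x = partial_deriv i f x * g x + f x * partial_deriv i g x"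
  using partial_deriv_eq[OF has_derivative_mult[OF partial_deriv_works
      assms[unfolded frechet_derivative_works]], of i] by (simp add: partial_deriv_def)

lemma partial_deriv_cmult:
  "partial_deriv i (\<lambda>y. c * f y) x = c * partial_deriv i f x"
  using partial_deriv_eq[OF has_derivative_mult_right[OF partial_deriv_works], of i c]
  by (simp add: partial_deriv_def)

lemma partial_deriv_minus:
  "partial_deriv i (\<lambda>y. - f y) x = - partial_deriv i f x"
  using partial_deriv_eq[OF has_derivative_minus[OF partial_deriv_works], of i]
  by (simp add: partial_deriv_def)

lemma has_derivative_real_chain:
  assumes "(h has_real_derivative h') (at (f x))"
  shows "((\<lambda>y. h (f y)) has_derivative (\<lambda>v. h' * frechet_derivative f (at x) v)) (at x)"
  using has_derivative_compose[OF partial_deriv_works assms[unfolded has_field_derivative_def]]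
  by simp

lemma partial_deriv_chain:
  assumes "(h has_real_derivative h') (at (f x))"
  shows "partial_deriv i (\<lambda>y. h (f y)) x = h' * partial_deriv i f x"
  using partial_deriv_eq[OF has_derivative_real_chain[OF assms], of i]
  by (simp add: partial_deriv_def)

end

lemma partial_deriv_sum:
  fixes f :: "'k \<Rightarrow> real ^ 'n::finite \<Rightarrow> real"
  assumes "\<And>k. k \<in> A \<Longrightarrow> f k differentiable (at x)"
  shows "partial_deriv i (\<lambda>y. \<Sum>k\<in>A. f k y) x = (\<Sum>k\<in>A. partial_deriv i (f k) x)"
proof -
  have "((\<lambda>y. \<Sum>k\<in>A. f k y) has_derivative (\<lambda>v. \<Sum>k\<in>A. frechet_derivative (f k) (at x) v)) (at x)"
    by (intro has_derivative_sum) (use assms frechet_derivative_works in blast)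
  from partial_deriv_eq[OF this, of i] show ?thesis by (simp add: partial_deriv_def)
qed

lemma has_derivative_scaleR_arg:
  fixes f :: "real ^ 'n::finite \<Rightarrow> real"
  assumes "f differentiable (at (c *\<^sub>R x))"
  shows "((\<lambda>y. f (c *\<^sub>R y)) has_derivative (\<lambda>v. c * frechet_derivative f (at (c *\<^sub>R x)) v)) (at x)"
proof -
  have "((\<lambda>y. c *\<^sub>R y) has_derivative (\<lambda>v. c *\<^sub>R v)) (at x)"
    by (intro derivative_eq_intros) auto
  from has_derivative_compose[OF this partial_deriv_works[OF assms]]
  have *: "((\<lambda>y. f (c *\<^sub>R y)) has_derivative (\<lambda>v. frechet_derivative f (at (c *\<^sub>R x)) (c *\<^sub>R v))) (at x)" .
  have "linear (frechet_derivative f (at (c *\<^sub>R x)))"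
    using partial_deriv_works[OF assms] has_derivative_linear by blast
  then show ?thesis using * by (simp add: linear_cmul)
qed

lemma partial_deriv_scaleR_arg:
  fixes f :: "real ^ 'n::finite \<Rightarrow> real"
  assumes "f differentiable (at (c *\<^sub>R x))"
  shows "partial_deriv i (\<lambda>y. f (c *\<^sub>R y)) x = c * partial_deriv i f (c *\<^sub>R x)"
  using partial_deriv_eq[OF has_derivative_scaleR_arg[OF assms], of i] by (simp add: partial_deriv_def)

lemma frechet_derivative_partial:
  fixes f :: "real ^ 'n::finite \<Rightarrow> real"
  assumes "f differentiable (at x)"
  shows "frechet_derivative f (at x) v = (\<Sum>i\<in>UNIV. v $ i * partial_deriv i f x)"
proof -
  have lin: "linear (frechet_derivative f (at x))"
    using partial_deriv_works[OF assms] has_derivative_linear by blast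
  have "v = (\<Sum>i\<in>UNIV. v $ i *\<^sub>R axis i 1)"
    using basis_expansion[of v] by (simp add: scalar_mult_eq_scaleR)
  then have "frechet_derivative f (at x) v = frechet_derivative f (at x) (\<Sum>i\<in>UNIV. v $ i *\<^sub>R axis i 1)"
    by simp
  also have "\<dots> = (\<Sum>i\<in>UNIV. v $ i * partial_deriv i f x)"
    using lin by (simp add: linear_sum linear_cmul partial_deriv_def)
  finally show ?thesis .
qed

lemma partial_deriv_component:
  fixes f :: "real ^ 'n::finite \<Rightarrow> real ^ 'm::finite"
  assumes "f differentiable (at x)"
  shows "partial_deriv i (\<lambda>y. f y $ j) x = partial_deriv i f x $ j"
    and "(\<lambda>y. f y $ j) differentiable (at x)"
proof -
  have *: "((\<lambda>y. f y $ j) has_derivative (\<lambda>v. frechet_derivative f (at x) v $ j)) (at x)"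
    using assms frechet_derivative_works bounded_linear.has_derivative[OF bounded_linear_vec_nth] by blast
  show "partial_deriv i (\<lambda>y. f y $ j) x = partial_deriv i f x $ j"
    using partial_deriv_eq[OF *, of i] by (simp add: partial_deriv_def)
  show "(\<lambda>y. f y $ j) differentiable (at x)" using * by (auto simp: differentiable_def)
qed

section \<open>Functions with continuous partial derivatives\<close>

text \<open>Differentiability of order \<open>k\<close> in terms of partial derivatives only, so that these can be iterated without
passing through linear maps.\<close>

primrec cdiff :: "nat \<Rightarrow> (real ^ 'n::finite) set \<Rightarrow> (real ^ 'n \<Rightarrow> real) \<Rightarrow> bool" where
  "cdiff 0 S f \<longleftrightarrow> continuous_on S f"
| "cdiff (Suc k) S f \<longleftrightarrow>
     (\<forall>x\<in>S. f differentiable (at x)) \<and> (\<forall>i. cdiff k S (partial_deriv i f))"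

lemma cdiff_SucD:
  assumes "cdiff (Suc k) S f"
  shows "x \<in> S \<Longrightarrow> f differentiable (at x)" "cdiff k S (partial_deriv i f)"
  using assms by auto

lemma cdiff_Suc_imp: "cdiff (Suc k) S f \<Longrightarrow> cdiff k S f"
proof (induction k arbitrary: f)
  case 0
  then show ?case
    by (auto intro!: continuous_at_imp_continuous_on differentiable_imp_continuous_within)
qed auto

lemma cdiff_le: "cdiff k S f \<Longrightarrow> j \<le> k \<Longrightarrow> cdiff j S f"
  by (induction k) (auto simp: le_Suc_eq simp del: cdiff.simps dest: cdiff_Suc_imp)

lemma cdiff_continuous: "cdiff k S f \<Longrightarrow> continuous_on S f"
  using cdiff_le[of k S f 0] by simp

lemma cdiff_subset: "cdiff k S f \<Longrightarrow> T \<subseteq> S \<Longrightarrow> cdiff k T f"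
  by (induction k arbitrary: f) (auto intro: continuous_on_subset)

lemma cdiff_cong_imp:
  assumes "open S" "\<And>y. y \<in> S \<Longrightarrow> f y = g y" "cdiff k S f"
  shows "cdiff k S g"
  using assms(2,3)
proof (induction k arbitrary: f g)
  case 0
  then show ?case using continuous_on_cong[of S S f g] by simp
next
  case (Suc k)
  have "cdiff k S (partial_deriv i g)" for i
    by (rule Suc.IH[of "partial_deriv i f"])
       (use Suc.prems partial_deriv_cong[OF assms(1) _ Suc.prems(1)] in auto)
  then show ?case
    using Suc.prems differentiable_cong_open[OF assms(1) _ Suc.prems(1)] by auto
qed

lemma cdiff_const [simp]: "cdiff k (S :: (real ^ 'n::finite) set) (\<lambda>y. c)"
proof (induction k arbitrary: c)
  case (Suc k)
  have "partial_deriv i (\<lambda>y::real^'n. c) = (\<lambda>y. 0)" for i by (auto simp: fun_eq_iff)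
  then show ?case using Suc by simp
qed simp

lemma cdiff_coord [simp]: "cdiff k (S :: (real ^ 'n::finite) set) (\<lambda>y. y $ j)"
proof (cases k)
  case (Suc m)
  have "partial_deriv i (\<lambda>y::real^'n. y $ j) = (\<lambda>y. if i = j then 1 else 0)" for i
    by (auto simp: fun_eq_iff)
  then show ?thesis using Suc by simp
qed (auto intro: continuous_intros)

lemma cdiff_add:
  assumes "open S" "cdiff k S f" "cdiff k S g"
  shows "cdiff k S (\<lambda>y. f y + g y)"
  using assms(2,3)
proof (induction k arbitrary: f g)
  case (Suc k)
  have "cdiff k S (partial_deriv i (\<lambda>y. f y + g y))" for i
    by (rule cdiff_cong_imp[OF assms(1) _ Suc.IH[of "partial_deriv i f" "partial_deriv i g"]])
       (use Suc.prems in \<open>auto simp: partial_deriv_add\<close>)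
  then show ?case using Suc.prems by auto
qed (auto intro: continuous_intros)

lemma cdiff_mult:
  assumes "open S" "cdiff k S f" "cdiff k S g"
  shows "cdiff k S (\<lambda>y. f y * g y)"
  using assms(2,3)
proof (induction k arbitrary: f g)
  case (Suc k)
  have "cdiff k S (partial_deriv i (\<lambda>y. f y * g y))" for i
    by (rule cdiff_cong_imp[OF assms(1) _ cdiff_add[OF assms(1)
          Suc.IH[of "partial_deriv i f" "g"] Suc.IH[of "f" "partial_deriv i g"]]])
       (use Suc.prems in \<open>auto dest: cdiff_Suc_imp simp del: cdiff.simps simp: cdiff_SucD partial_deriv_mult\<close>)
  then show ?case using Suc.prems by auto
qed (auto intro: continuous_intros)

lemma cdiff_cmult: "open S \<Longrightarrow> cdiff k S f \<Longrightarrow> cdiff k S (\<lambda>y. c * f y)"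
  by (rule cdiff_mult) auto

lemma cdiff_minus: "open S \<Longrightarrow> cdiff k S f \<Longrightarrow> cdiff k S (\<lambda>y. - f y)"
  using cdiff_cmult[of S k f "-1"] by simp

lemma cdiff_diff: "open S \<Longrightarrow> cdiff k S f \<Longrightarrow> cdiff k S g \<Longrightarrow> cdiff k S (\<lambda>y. f y - g y)"
  using cdiff_add[of S k f "\<lambda>y. - g y"] cdiff_minus[of S k g] by simp

lemma cdiff_sum:
  assumes "open S" "finite A" "\<And>j. j \<in> A \<Longrightarrow> cdiff k S (f j)"
  shows "cdiff k S (\<lambda>y. \<Sum>j\<in>A. f j y)"
  using assms(2,3) by (induction A rule: finite_induct) (simp_all add: cdiff_add assms(1))

lemma cdiff_inverse:
  assumes "open S" "cdiff k S f" "\<And>y. y \<in> S \<Longrightarrow> f y \<noteq> 0"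
  shows "cdiff k S (\<lambda>y. inverse (f y))"
  using assms(2)
proof (induction k)
  case (Suc k)
  have D: "partial_deriv i (\<lambda>y. inverse (f y)) x = - (inverse (f x) * inverse (f x)) * partial_deriv i f x"
    "(\<lambda>y. inverse (f y)) differentiable (at x)" if "x \<in> S" for i x
  proof -
    have "(inverse has_real_derivative - (inverse (f x) * inverse (f x))) (at (f x))"
      using assms(3)[OF that] by (auto intro!: derivative_eq_intros simp: power2_eq_square)
    from partial_deriv_chain[where f = f and x = x, OF _ this] has_derivative_real_chain[where f = f and x = x, OF _ this] that Suc.prems
    show "partial_deriv i (\<lambda>y. inverse (f y)) x = - (inverse (f x) * inverse (f x)) * partial_deriv i f x"
      "(\<lambda>y. inverse (f y)) differentiable (at x)" by (auto simp: differentiable_def)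
  qed
  have IH: "cdiff k S (\<lambda>y. inverse (f y))" using Suc cdiff_Suc_imp by blast
  have 1: "cdiff k S (\<lambda>x. - (inverse (f x) * inverse (f x)) * partial_deriv i f x)" for i
    by (intro cdiff_mult cdiff_minus IH assms(1)) (use Suc.prems in auto)
  have "cdiff k S (partial_deriv i (\<lambda>y. inverse (f y)))" for i
    by (rule cdiff_cong_imp[OF assms(1) _ 1[of i]]) (simp add: D)
  then show ?case using D by auto
qed (use assms in \<open>auto intro: continuous_intros\<close>)

lemma cdiff_scaleR_arg:
  assumes "open S" "c \<noteq> 0" "cdiff k S f"
  shows "cdiff k ((\<lambda>y. c *\<^sub>R y) -` S) (\<lambda>y. f (c *\<^sub>R y))"
  using assms(3)
proof (induction k arbitrary: f)
  case 0
  have "continuous_on ((\<lambda>y. c *\<^sub>R y) -` S) (f \<circ> (\<lambda>y. c *\<^sub>R y))"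
    by (intro continuous_on_compose continuous_intros) (use 0 continuous_on_subset in fastforce)
  then show ?case by (simp add: o_def)
next
  case (Suc k)
  have "open ((\<lambda>y. c *\<^sub>R y) -` S)" 
    by (intro open_vimage assms continuous_intros)
  note o = this
  have 1: "cdiff k ((\<lambda>y. c *\<^sub>R y) -` S) (\<lambda>y. c * partial_deriv i f (c *\<^sub>R y))" for i
    by (intro cdiff_cmult o Suc.IH) (use Suc.prems in auto)
  have "cdiff k ((\<lambda>y. c *\<^sub>R y) -` S) (partial_deriv i (\<lambda>y. f (c *\<^sub>R y)))" for i
    by (rule cdiff_cong_imp[OF o _ 1[of i]]) (use Suc.prems in \<open>auto simp: partial_deriv_scaleR_arg\<close>)
  then show ?case
    using Suc.prems has_derivative_scaleR_arg[of f c] unfolding cdiff.simps differentiable_def by fastforce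
qed

lemma Ck_on_imp_cdiff:
  fixes f :: "real ^ 'n::finite \<Rightarrow> real"
  shows "Ck_on k S f \<Longrightarrow> cdiff k S f"
  by (induction k arbitrary: f) (auto simp: partial_deriv_def[abs_def])

lemma Ck_on_component:
  fixes f :: "real ^ 'n::finite \<Rightarrow> real ^ 'm::finite"
  assumes "open S" "Ck_on k S f"
  shows "cdiff k S (\<lambda>y. f y $ j)"
  using assms(2)
proof (induction k arbitrary: f)
  case 0
  then show ?case by (auto intro: continuous_intros)
next
  case (Suc k)
  have 1: "cdiff k S (\<lambda>x. partial_deriv i f x $ j)" for i
    using Suc by (auto simp: partial_deriv_def[abs_def])
  have "cdiff k S (partial_deriv i (\<lambda>y. f y $ j))" for i
    by (rule cdiff_cong_imp[OF assms(1) _ 1[of i]]) (use Suc.prems in \<open>auto simp: partial_deriv_component\<close>)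
  then show ?case using Suc.prems by (auto intro: partial_deriv_component(2))
qed

section \<open>Symmetry of second derivatives\<close>

lemma line_deriv:
  fixes f :: "real ^ 'n::finite \<Rightarrow> real"
  assumes "f differentiable (at (x + t *\<^sub>R axis i 1))"
  shows "((\<lambda>t. f (x + t *\<^sub>R axis i 1)) has_real_derivative partial_deriv i f (x + t *\<^sub>R axis i 1)) (at t)"
proof -
  have "((\<lambda>t. x + t *\<^sub>R axis i 1) has_derivative (\<lambda>s. s *\<^sub>R axis i 1)) (at t)"
    by (auto intro!: derivative_eq_intros)
  from has_derivative_compose[OF this partial_deriv_works[OF assms]]
  have *: "((\<lambda>t. f (x + t *\<^sub>R axis i 1)) has_derivative
     (\<lambda>s. frechet_derivative f (at (x + t *\<^sub>R axis i 1)) (s *\<^sub>R axis i 1))) (at t)" .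
  have "linear (frechet_derivative f (at (x + t *\<^sub>R axis i 1)))"
    using partial_deriv_works[OF assms] has_derivative_linear by blast
  then show ?thesis using *
    by (simp add: linear_cmul has_field_derivative_def partial_deriv_def mult_commute_abs)
qed

lemma line_mvt:
  fixes f :: "real ^ 'n::finite \<Rightarrow> real"
  assumes "0 < h" "\<And>t. 0 \<le> t \<Longrightarrow> t \<le> h \<Longrightarrow> f differentiable (at (x + t *\<^sub>R axis i 1))"
  shows "\<exists>t. 0 < t \<and> t < h \<and> f (x + h *\<^sub>R axis i 1) - f x = h * partial_deriv i f (x + t *\<^sub>R axis i 1)"
proof -
  have "\<exists>t>0. t < h \<and> (\<lambda>t. f (x + t *\<^sub>R axis i 1)) h - (\<lambda>t. f (x + t *\<^sub>R axis i 1)) 0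
        = (h - 0) * partial_deriv i f (x + t *\<^sub>R axis i 1)"
    by (rule MVT2[OF assms(1)]) (use assms in \<open>auto intro: line_deriv\<close>)
  then show ?thesis by auto
qed

lemma second_difference:
  fixes f :: "real ^ 'n::finite \<Rightarrow> real"
  assumes S: "open S" "cdiff 2 S f" and h: "0 < h" and b: "ball x (3 * h) \<subseteq> S"
  shows "\<exists>z\<in>ball x (3 * h). f (x + h *\<^sub>R axis i 1 + h *\<^sub>R axis j 1) - f (x + h *\<^sub>R axis i 1)
     - f (x + h *\<^sub>R axis j 1) + f x = h * h * partial_deriv i (partial_deriv j f) z"
proof -
  let ?g = "\<lambda>y. f (y + h *\<^sub>R axis i 1) - f y"
  have inb: "x + s *\<^sub>R axis i 1 + t *\<^sub>R axis j 1 \<in> ball x (3 * h)" if "0 \<le> s" "s \<le> h" "0 \<le> t" "t \<le> h" for s t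
  proof -
    have "norm (s *\<^sub>R axis i 1 + t *\<^sub>R (axis j 1 :: real^'n)) \<le> s + t"
      using norm_triangle_ineq[of "s *\<^sub>R axis i 1" "t *\<^sub>R (axis j 1 :: real^'n)"] that
      by (simp add: norm_axis_1)
    moreover have "dist x (x + s *\<^sub>R axis i 1 + t *\<^sub>R axis j 1) = norm (s *\<^sub>R axis i 1 + t *\<^sub>R (axis j 1 :: real^'n))"
      by (subst dist_commute) (simp add: dist_norm)
    ultimately show ?thesis using that h by simp
  qed
  have d1: "f differentiable (at y)" if "y \<in> ball x (3*h)" for y
    using S b that by (auto simp: numeral_2_eq_2)
  have d2: "partial_deriv j f differentiable (at y)" if "y \<in> ball x (3*h)" for y
    using S b that by (auto simp: numeral_2_eq_2)
  have shift: "((\<lambda>y. f (y + h *\<^sub>R axis i 1)) has_derivative frechet_derivative f (at (y + h *\<^sub>R axis i 1))) (at y)"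
    if "y + h *\<^sub>R axis i 1 \<in> ball x (3 * h)" for y
  proof -
    have "((\<lambda>y. y + h *\<^sub>R axis i 1) has_derivative (\<lambda>v. v)) (at y)"
      by (auto intro!: derivative_eq_intros)
    from has_derivative_compose[OF this partial_deriv_works[OF d1[OF that]]] show ?thesis .
  qed
  have gd: "?g differentiable (at y)"
       "partial_deriv j ?g y = partial_deriv j f (y + h *\<^sub>R axis i 1) - partial_deriv j f y"
    if "y \<in> ball x (3 * h)" "y + h *\<^sub>R axis i 1 \<in> ball x (3 * h)" for y
  proof -
    have *: "(?g has_derivative (\<lambda>v. frechet_derivative f (at (y + h *\<^sub>R axis i 1)) v - frechet_derivative f (at y) v)) (at y)"
      by (intro has_derivative_diff shift that partial_deriv_works d1)
    then show "?g differentiable (at y)" by (auto simp: differentiable_def)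
    show "partial_deriv j ?g y = partial_deriv j f (y + h *\<^sub>R axis i 1) - partial_deriv j f y"
      using partial_deriv_eq[OF *, of j] by (simp add: partial_deriv_def)
  qed
  have m: "x + t *\<^sub>R axis j 1 \<in> ball x (3*h)" "x + t *\<^sub>R axis j 1 + h *\<^sub>R axis i 1 \<in> ball x (3*h)"
    if "0 \<le> t" "t \<le> h" for t
    using inb[of 0 t] inb[of h t] that h by (auto simp: algebra_simps)
  have "\<exists>t. 0 < t \<and> t < h \<and> ?g (x + h *\<^sub>R axis j 1) - ?g x = h * partial_deriv j ?g (x + t *\<^sub>R axis j 1)"
    by (rule line_mvt[OF h]) (use gd m in auto)
  then obtain t where t: "0 < t" "t < h" and e1: "?g (x + h *\<^sub>R axis j 1) - ?g x = h * partial_deriv j ?g (x + t *\<^sub>R axis j 1)"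
    by blast
  have "\<exists>s. 0 < s \<and> s < h \<and> partial_deriv j f (x + t *\<^sub>R axis j 1 + h *\<^sub>R axis i 1) - partial_deriv j f (x + t *\<^sub>R axis j 1)
     = h * partial_deriv i (partial_deriv j f) (x + t *\<^sub>R axis j 1 + s *\<^sub>R axis i 1)"
    by (rule line_mvt[OF h]) (use d2 inb t in \<open>auto simp: algebra_simps\<close>)
  then obtain s where s: "0 < s" "s < h"
    and e2: "partial_deriv j f (x + t *\<^sub>R axis j 1 + h *\<^sub>R axis i 1) - partial_deriv j f (x + t *\<^sub>R axis j 1)
     = h * partial_deriv i (partial_deriv j f) (x + t *\<^sub>R axis j 1 + s *\<^sub>R axis i 1)" by blast
  have "x + t *\<^sub>R axis j 1 + s *\<^sub>R axis i 1 \<in> ball x (3*h)"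
    using inb[of s t] s t by (simp add: algebra_simps)
  moreover have "f (x + h *\<^sub>R axis i 1 + h *\<^sub>R axis j 1) - f (x + h *\<^sub>R axis i 1) - f (x + h *\<^sub>R axis j 1) + f x
     = ?g (x + h *\<^sub>R axis j 1) - ?g x" by (simp add: algebra_simps)
  ultimately show ?thesis using e1 e2 gd(2)[OF m(1)[of t] m(2)[of t]] t
    by (intro bexI[of _ "x + t *\<^sub>R axis j 1 + s *\<^sub>R axis i 1"]) auto
qed

text \<open>If the mixed derivatives differed at \<open>x\<close>, they would be separated on a small square, whose second
difference equals a value of either of them by two applications of the mean value theorem.\<close>

lemma partial_deriv_commute:
  fixes f :: "real ^ 'n::finite \<Rightarrow> real"
  assumes S: "open S" "cdiff 2 S f" and x: "x \<in> S"
  shows "partial_deriv i (partial_deriv j f) x = partial_deriv j (partial_deriv i f) x"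
proof (rule ccontr)
  define A where "A = partial_deriv i (partial_deriv j f)"
  define B where "B = partial_deriv j (partial_deriv i f)"
  assume "\<not> ?thesis"
  then have e: "\<bar>A x - B x\<bar> > 0" (is "?e > 0") by (simp add: A_def B_def)
  have "continuous_on S A" "continuous_on S B"
    using S by (auto simp: A_def B_def numeral_2_eq_2)
  then have "isCont A x" "isCont B x"
    using S(1) x continuous_on_eq_continuous_at by auto
  then obtain r1 r2 where r: "r1 > 0" "\<And>y. dist y x < r1 \<Longrightarrow> dist (A y) (A x) < ?e / 2"
      "r2 > 0" "\<And>y. dist y x < r2 \<Longrightarrow> dist (B y) (B x) < ?e / 2"
    using e unfolding continuous_at_eps_delta by (metis half_gt_zero)
  obtain r0 where r0: "r0 > 0" "ball x r0 \<subseteq> S" using S x open_contains_ball by blast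
  define h where "h = min r0 (min r1 r2) / 3"
  have h: "h > 0" "3 * h \<le> r0" "3 * h \<le> r1" "3 * h \<le> r2" using r r0 by (auto simp: h_def)
  then have b: "ball x (3 * h) \<subseteq> S" using r0 by (meson order_trans subset_ball)
  obtain z where z: "z \<in> ball x (3*h)" and z': "f (x + h *\<^sub>R axis i 1 + h *\<^sub>R axis j 1) - f (x + h *\<^sub>R axis i 1)
     - f (x + h *\<^sub>R axis j 1) + f x = h * h * A z"
    using second_difference[OF S h(1) b, of i j] by (auto simp: A_def)
  obtain w where w: "w \<in> ball x (3*h)" and w': "f (x + h *\<^sub>R axis j 1 + h *\<^sub>R axis i 1) - f (x + h *\<^sub>R axis j 1)
     - f (x + h *\<^sub>R axis i 1) + f x = h * h * B w"
    using second_difference[OF S h(1) b, of j i] by (auto simp: B_def)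
  have "h * h * A z = h * h * B w" using z' w' by (simp add: algebra_simps)
  then have "A z = B w" using h by simp
  moreover have "dist (A z) (A x) < ?e / 2" "dist (B w) (B x) < ?e / 2"
    using r(2)[of z] r(4)[of w] z w h by (auto simp: dist_commute)
  ultimately show False unfolding dist_real_def by argo
qed

section \<open>Families with symbol-type bounds\<close>

text \<open>Symbol estimates that are uniform in a parameter \<open>p\<close>: a derivative of order \<open>j \<le> k\<close> is at most a constant
times \<open>W / L ^ j\<close>. They are stable under products, sums and differentiation, so truncated kernels and
their Taylor remainders are estimated without computing any derivative.\<close>

primrec symb :: "nat \<Rightarrow> 'p set \<Rightarrow> (real ^ 'n::finite) set \<Rightarrow> ('p \<Rightarrow> real ^ 'n \<Rightarrow> real) \<Rightarrow>
    ('p \<Rightarrow> real ^ 'n \<Rightarrow> real) \<Rightarrow> ('p \<Rightarrow> real ^ 'n \<Rightarrow> real) \<Rightarrow> bool" where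
  "symb 0 P S L W f \<longleftrightarrow> (\<forall>p\<in>P. continuous_on S (f p)) \<and>
     (\<exists>C\<ge>0. \<forall>p\<in>P. \<forall>y\<in>S. \<bar>f p y\<bar> \<le> C * W p y)"
| "symb (Suc k) P S L W f \<longleftrightarrow> (\<forall>p\<in>P. \<forall>y\<in>S. f p differentiable (at y)) \<and>
     (\<exists>C\<ge>0. \<forall>p\<in>P. \<forall>y\<in>S. \<bar>f p y\<bar> \<le> C * W p y) \<and>
     (\<forall>i. symb k P S L (\<lambda>p y. W p y / L p y) (\<lambda>p. partial_deriv i (f p)))"

lemma symb_bound:
  assumes "symb k P S L W f"
  obtains C where "C \<ge> 0" "\<And>p y. p \<in> P \<Longrightarrow> y \<in> S \<Longrightarrow> \<bar>f p y\<bar> \<le> C * W p y"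
proof -
  have "\<exists>C\<ge>0. \<forall>p\<in>P. \<forall>y\<in>S. \<bar>f p y\<bar> \<le> C * W p y"
    using assms by (cases k) auto
  then show ?thesis using that by blast
qed

lemma symb_partial:
  "symb (Suc k) P S L W f \<Longrightarrow> symb k P S L (\<lambda>p y. W p y / L p y) (\<lambda>p. partial_deriv i (f p))"
  by simp

lemma symb_differentiable:
  "symb (Suc k) P S L W f \<Longrightarrow> p \<in> P \<Longrightarrow> y \<in> S \<Longrightarrow> f p differentiable (at y)"
  by simp

lemma symb_cdiff: "symb k P S L W f \<Longrightarrow> p \<in> P \<Longrightarrow> cdiff k S (f p)"
proof (induction k arbitrary: f W)
  case (Suc k)
  have "cdiff k S (partial_deriv i (f p))" for i
    using Suc.IH[of "\<lambda>p y. W p y / L p y" "\<lambda>p. partial_deriv i (f p)"] Suc.prems by simp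
  then show ?case using Suc.prems by simp
qed simp

lemma symb_Suc_imp: "symb (Suc k) P S L W f \<Longrightarrow> symb k P S L W f"
proof (induction k arbitrary: f W)
  case 0
  then show ?case
    by (auto intro!: continuous_at_imp_continuous_on differentiable_imp_continuous_within)
next
  case (Suc k)
  have "symb k P S L (\<lambda>p y. W p y / L p y) (\<lambda>p. partial_deriv i (f p))" for i
    using Suc.prems by (intro Suc.IH) simp
  then show ?case using Suc.prems by simp
qed

lemma symb_le: "symb k P S L W f \<Longrightarrow> j \<le> k \<Longrightarrow> symb j P S L W f"
  by (induction k) (auto simp: le_Suc_eq simp del: symb.simps dest: symb_Suc_imp)

lemma symb_weaken:
  assumes "symb k P S L W f" "T \<subseteq> S" "Q \<subseteq> P"
    and "c \<ge> 0" "\<And>p y. p \<in> Q \<Longrightarrow> y \<in> T \<Longrightarrow> 0 < L' p y \<and> L' p y \<le> c' * L p y"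
    and "\<And>p y. p \<in> Q \<Longrightarrow> y \<in> T \<Longrightarrow> 0 \<le> W p y \<and> W p y \<le> c * W' p y"
    and "\<And>p y. p \<in> Q \<Longrightarrow> y \<in> T \<Longrightarrow> 0 < L p y" 
  shows "symb k Q T L' W' f"
  using assms(1,4,6)
proof (induction k arbitrary: f W W' c)
  case (0 f W W' c)
  obtain C where C: "C \<ge> 0" "\<And>p y. p \<in> P \<Longrightarrow> y \<in> S \<Longrightarrow> \<bar>f p y\<bar> \<le> C * W p y"
    using symb_bound[OF 0(1)] by blast
  have "\<bar>f p y\<bar> \<le> C * c * W' p y" if "p \<in> Q" "y \<in> T" for p y
    using order_trans[OF C(2)[of p y] mult_left_mono[OF conjunct2[OF 0(3)[OF that]] C(1)]]
      subsetD[OF assms(3) that(1)] subsetD[OF assms(2) that(2)] by (simp add: mult.assoc)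
  then have "\<exists>C\<ge>0. \<forall>p\<in>Q. \<forall>y\<in>T. \<bar>f p y\<bar> \<le> C * W' p y"
    using C(1) 0(2) by (intro exI[of _ "C * c"]) auto
  then show ?case using 0(1) assms(2,3) by (auto intro: continuous_on_subset)
next
  case (Suc k f W W' c)
  obtain C where C: "C \<ge> 0" "\<And>p y. p \<in> P \<Longrightarrow> y \<in> S \<Longrightarrow> \<bar>f p y\<bar> \<le> C * W p y"
    using symb_bound[OF Suc.prems(1)] by blast
  have "\<bar>f p y\<bar> \<le> C * c * W' p y" if "p \<in> Q" "y \<in> T" for p y
    using order_trans[OF C(2)[of p y] mult_left_mono[OF conjunct2[OF Suc.prems(3)[OF that]] C(1)]]
      subsetD[OF assms(3) that(1)] subsetD[OF assms(2) that(2)] by (simp add: mult.assoc)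
  then have 1: "\<exists>C\<ge>0. \<forall>p\<in>Q. \<forall>y\<in>T. \<bar>f p y\<bar> \<le> C * W' p y"
    using C(1) Suc.prems(2) by (intro exI[of _ "C * c"]) auto
  have 2: "W p y / L p y \<le> (c * \<bar>c'\<bar>) * (W' p y / L' p y)" "0 \<le> W p y / L p y" if "p \<in> Q" "y \<in> T" for p y
  proof -
    have L: "0 < L' p y" "L' p y \<le> c' * L p y" "0 < L p y" and W: "0 \<le> W p y" "W p y \<le> c * W' p y"
      using assms(5,7) Suc.prems(3) that by blast+
    have "L' p y \<le> \<bar>c'\<bar> * L p y" using L by (meson abs_ge_self less_imp_le mult_right_mono order_trans)
    then have "W p y * L' p y \<le> (c * W' p y) * (\<bar>c'\<bar> * L p y)"
      using W L by (intro mult_mono) auto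
    then show "W p y / L p y \<le> (c * \<bar>c'\<bar>) * (W' p y / L' p y)"
      using L by (simp add: field_simps)
    show "0 \<le> W p y / L p y" using L W by simp
  qed
  have 3: "symb k Q T L' (\<lambda>p y. W' p y / L' p y) (\<lambda>p. partial_deriv i (f p))" for i
    by (rule Suc.IH[of "\<lambda>p y. W p y / L p y" _ "c * \<bar>c'\<bar>"])
       (use Suc.prems 2 in auto)
  have 4: "f p differentiable (at y)" if "p \<in> Q" "y \<in> T" for p y
    using symb_differentiable[OF Suc.prems(1)] subsetD[OF assms(3) that(1)] subsetD[OF assms(2) that(2)] .
  show ?case using 1 3 4 by simp
qed

lemma symb_weight_cong:
  assumes "symb k P S L W f" "\<And>p y. p \<in> P \<Longrightarrow> y \<in> S \<Longrightarrow> W p y = W' p y"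
  shows "symb k P S L W' f"
  using assms
proof (induction k arbitrary: f W W')
  case (Suc k)
  have "symb k P S L (\<lambda>p y. W' p y / L p y) (\<lambda>p. partial_deriv i (f p))" for i
    by (rule Suc.IH[of "\<lambda>p y. W p y / L p y"]) (use Suc.prems in auto)
  then show ?case using Suc.prems by auto
qed auto

lemma symb_cong:
  assumes "open S" "symb k P S L W f" "\<And>p y. p \<in> P \<Longrightarrow> y \<in> S \<Longrightarrow> f p y = g p y"
  shows "symb k P S L W g"
  using assms(2,3)
proof (induction k arbitrary: f g W)
  case 0
  then show ?case using continuous_on_cong[of S S] by simp
next
  case (Suc k)
  have "symb k P S L (\<lambda>p y. W p y / L p y) (\<lambda>p. partial_deriv i (g p))" for i
    by (rule Suc.IH[of _ "\<lambda>p. partial_deriv i (f p)"])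
       (use Suc.prems partial_deriv_cong[OF assms(1) _ Suc.prems(2)] in auto)
  then show ?case
    using Suc.prems differentiable_cong_open[OF assms(1) _ Suc.prems(2)] by auto
qed

lemma symb_add:
  assumes S: "open S" and "symb k P S L W f" "symb k P S L W g"
  shows "symb k P S L W (\<lambda>p y. f p y + g p y)"
  using assms(2,3)
proof (induction k arbitrary: f g W)
  case (0 f g W)
  obtain C D where C: "C \<ge> 0" "\<And>p y. p \<in> P \<Longrightarrow> y \<in> S \<Longrightarrow> \<bar>f p y\<bar> \<le> C * W p y"
    and D: "D \<ge> 0" "\<And>p y. p \<in> P \<Longrightarrow> y \<in> S \<Longrightarrow> \<bar>g p y\<bar> \<le> D * W p y"
    using symb_bound[OF 0(1)] symb_bound[OF 0(2)] by metis
  have "\<bar>f p y + g p y\<bar> \<le> (C + D) * W p y" if "p \<in> P" "y \<in> S" for p y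
    using C(2)[OF that] D(2)[OF that] by (simp add: distrib_right)
  then have "\<exists>C\<ge>0. \<forall>p\<in>P. \<forall>y\<in>S. \<bar>f p y + g p y\<bar> \<le> C * W p y"
    using C D by (intro exI[of _ "C + D"]) auto
  then show ?case using 0 by (auto intro: continuous_intros)
next
  case (Suc k f g W)
  obtain C D where C: "C \<ge> 0" "\<And>p y. p \<in> P \<Longrightarrow> y \<in> S \<Longrightarrow> \<bar>f p y\<bar> \<le> C * W p y"
    and D: "D \<ge> 0" "\<And>p y. p \<in> P \<Longrightarrow> y \<in> S \<Longrightarrow> \<bar>g p y\<bar> \<le> D * W p y"
    using symb_bound[OF Suc.prems(1)] symb_bound[OF Suc.prems(2)] by metis
  have "\<bar>f p y + g p y\<bar> \<le> (C + D) * W p y" if "p \<in> P" "y \<in> S" for p y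
    using C(2)[OF that] D(2)[OF that] by (simp add: distrib_right)
  then have 1: "\<exists>C\<ge>0. \<forall>p\<in>P. \<forall>y\<in>S. \<bar>f p y + g p y\<bar> \<le> C * W p y"
    using C D by (intro exI[of _ "C + D"]) auto
  have "symb k P S L (\<lambda>p y. W p y / L p y) (\<lambda>p. partial_deriv i (\<lambda>y. f p y + g p y))" for i
    by (rule symb_cong[OF S Suc.IH[of _ "\<lambda>p. partial_deriv i (f p)" "\<lambda>p. partial_deriv i (g p)"]])
       (use Suc.prems in \<open>auto simp: partial_deriv_add\<close>)
  then show ?case using 1 Suc.prems by auto
qed

lemma symb_mult:
  assumes S: "open S" and "symb k P S L W f" "symb k P S L V g"
  shows "symb k P S L (\<lambda>p y. W p y * V p y) (\<lambda>p y. f p y * g p y)"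
  using assms(2,3)
proof (induction k arbitrary: f g W V)
  case (0 f g W V)
  obtain C D where C: "C \<ge> 0" "\<And>p y. p \<in> P \<Longrightarrow> y \<in> S \<Longrightarrow> \<bar>f p y\<bar> \<le> C * W p y"
    and D: "D \<ge> 0" "\<And>p y. p \<in> P \<Longrightarrow> y \<in> S \<Longrightarrow> \<bar>g p y\<bar> \<le> D * V p y"
    using symb_bound[OF 0(1)] symb_bound[OF 0(2)] by metis
  have "\<bar>f p y * g p y\<bar> \<le> (C * D) * (W p y * V p y)" if "p \<in> P" "y \<in> S" for p y
    using mult_mono'[OF C(2)[OF that] D(2)[OF that]] by (simp add: abs_mult mult_ac)
  then have "\<exists>C\<ge>0. \<forall>p\<in>P. \<forall>y\<in>S. \<bar>f p y * g p y\<bar> \<le> C * (W p y * V p y)"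
    using C D by (intro exI[of _ "C * D"]) auto
  then show ?case using 0 by (auto intro: continuous_intros)
next
  case (Suc k f g W V)
  obtain C D where C: "C \<ge> 0" "\<And>p y. p \<in> P \<Longrightarrow> y \<in> S \<Longrightarrow> \<bar>f p y\<bar> \<le> C * W p y"
    and D: "D \<ge> 0" "\<And>p y. p \<in> P \<Longrightarrow> y \<in> S \<Longrightarrow> \<bar>g p y\<bar> \<le> D * V p y"
    using symb_bound[OF Suc.prems(1)] symb_bound[OF Suc.prems(2)] by metis
  have "\<bar>f p y * g p y\<bar> \<le> (C * D) * (W p y * V p y)" if "p \<in> P" "y \<in> S" for p y
    using mult_mono'[OF C(2)[OF that] D(2)[OF that]] by (simp add: abs_mult mult_ac)
  then have 1: "\<exists>C\<ge>0. \<forall>p\<in>P. \<forall>y\<in>S. \<bar>f p y * g p y\<bar> \<le> C * (W p y * V p y)"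
    using C D by (intro exI[of _ "C * D"]) auto
  have a: "symb k P S L (\<lambda>p y. W p y * V p y / L p y) (\<lambda>p y. partial_deriv i (f p) y * g p y)" for i
    by (rule symb_weight_cong[OF Suc.IH[of "\<lambda>p y. W p y / L p y" _ V]])
       (use Suc.prems symb_Suc_imp in \<open>auto simp: simp del: symb.simps intro: symb_partial\<close>)
  have b: "symb k P S L (\<lambda>p y. W p y * V p y / L p y) (\<lambda>p y. f p y * partial_deriv i (g p) y)" for i
    by (rule symb_weight_cong[OF Suc.IH[of W _ "\<lambda>p y. V p y / L p y"]])
       (use Suc.prems symb_Suc_imp in \<open>auto simp: simp del: symb.simps intro: symb_partial\<close>)
  have "symb k P S L (\<lambda>p y. W p y * V p y / L p y) (\<lambda>p. partial_deriv i (\<lambda>y. f p y * g p y))" for i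
    by (rule symb_cong[OF S symb_add[OF S a[of i] b[of i]]])
       (use Suc.prems in \<open>auto simp: partial_deriv_mult\<close>)
  then show ?case using 1 Suc.prems by auto
qed

lemma symb_zero: "symb k P S L W (\<lambda>p y::real^'n::finite. 0)"
proof (induction k arbitrary: W)
  case (Suc k)
  have "partial_deriv i (\<lambda>y::real^'n. 0::real) = (\<lambda>y. 0)" for i by (auto simp: fun_eq_iff)
  then show ?case using Suc by (auto intro!: exI[of _ 0])
qed (auto intro!: exI[of _ 0])

lemma symb_const:
  assumes "\<And>p. p \<in> P \<Longrightarrow> \<bar>c p\<bar> \<le> C" "C \<ge> 0"
  shows "symb k P S L (\<lambda>p y. 1) (\<lambda>p y::real^'n::finite. c p)"
proof -
  have "partial_deriv i (\<lambda>y::real^'n. c p) = (\<lambda>y. 0)" for i p by (auto simp: fun_eq_iff)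
  then show ?thesis using assms symb_zero
    by (cases k) (auto intro!: exI[of _ C])
qed

lemma symb_cmult:
  assumes "open S" "symb k P S L W f"
  shows "symb k P S L W (\<lambda>p y. c * f p y)"
  using symb_mult[OF assms(1) symb_const[of P "\<lambda>_. c" "\<bar>c\<bar>"] assms(2)] by simp

lemma symb_minus:
  assumes "open S" "symb k P S L W f"
  shows "symb k P S L W (\<lambda>p y. - f p y)"
  using symb_cmult[OF assms, of "-1"] by simp

lemma symb_diff:
  assumes "open S" "symb k P S L W f" "symb k P S L W g"
  shows "symb k P S L W (\<lambda>p y. f p y - g p y)"
  using symb_add[OF assms(1,2) symb_minus[OF assms(1,3)]] by simp

lemma symb_sum:
  assumes "open S" "finite A" "\<And>j. j \<in> A \<Longrightarrow> symb k P S L W (f j)"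
  shows "symb k P S L W (\<lambda>p y. \<Sum>j\<in>A. f j p y)"
  using assms(2,3)
  by (induction A rule: finite_induct) (simp_all add: symb_add assms(1) symb_zero)

lemma symb_reparam:
  assumes "symb k P S L W f" "\<And>q. q \<in> Q \<Longrightarrow> h q \<in> P"
  shows "symb k Q S (\<lambda>q. L (h q)) (\<lambda>q. W (h q)) (\<lambda>q. f (h q))"
  using assms(1)
proof (induction k arbitrary: f W)
  case 0
  obtain C where C: "C \<ge> 0" "\<And>p y. p \<in> P \<Longrightarrow> y \<in> S \<Longrightarrow> \<bar>f p y\<bar> \<le> C * W p y"
    using symb_bound[OF 0] by blast
  then show ?case using 0 assms(2) by (auto intro!: exI[of _ C])
next
  case (Suc k)
  obtain C where C: "C \<ge> 0" "\<And>p y. p \<in> P \<Longrightarrow> y \<in> S \<Longrightarrow> \<bar>f p y\<bar> \<le> C * W p y"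
    using symb_bound[OF Suc.prems] by blast
  have "symb k Q S (\<lambda>q. L (h q)) (\<lambda>q y. W (h q) y / L (h q) y) (\<lambda>q. partial_deriv i (f (h q)))" for i
    using Suc.IH[of "\<lambda>p y. W p y / L p y" "\<lambda>p. partial_deriv i (f p)"] Suc.prems by simp
  then show ?case using Suc.prems assms(2) C by auto
qed

lemma open_punctured: "open (- {0 :: 'a::real_normed_vector})"
  by (simp add: open_Compl)

text \<open>Each derivative of \<open>f (r *\<^sub>R y)\<close> gains a factor \<open>r\<close>, which the length scale \<open>norm\<close> absorbs.\<close>

lemma symb_dilate:
  fixes f :: "real ^ 'n::finite \<Rightarrow> real"
  assumes "symb k UNIV (-{0}) (\<lambda>_. norm) (\<lambda>(_::unit). W) (\<lambda>_. f)"
  shows "symb k {0<..} (-{0}) (\<lambda>_. norm) (\<lambda>r y. W (r *\<^sub>R y)) (\<lambda>r y. f (r *\<^sub>R y))"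
  using assms
proof (induction k arbitrary: f W)
  case (0 f W)
  obtain C where C: "C \<ge> 0" "\<And>y. y \<noteq> 0 \<Longrightarrow> \<bar>f y\<bar> \<le> C * W y"
    using symb_bound[OF 0] by (metis ComplI UNIV_I singletonD)
  have "continuous_on (-{0}) (\<lambda>y. f (r *\<^sub>R y))" if "r > 0" for r
  proof -
    have "(\<lambda>y::real^'n. r *\<^sub>R y) -` (- {0}) = - {0}" using that by auto
    then show ?thesis
      using cdiff_scaleR_arg[OF open_punctured, of r 0 f] symb_cdiff[OF 0] that by simp
  qed
  moreover have "\<bar>f (r *\<^sub>R y)\<bar> \<le> C * W (r *\<^sub>R y)" if "r > 0" "y \<noteq> 0" for r y using C that by simp
  ultimately show ?case using C(1) by (auto intro!: exI[of _ C])
next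
  case (Suc k f W)
  obtain C where C: "C \<ge> 0" "\<And>y. y \<noteq> 0 \<Longrightarrow> \<bar>f y\<bar> \<le> C * W y"
    using symb_bound[OF Suc.prems] by (metis ComplI UNIV_I singletonD)
  have df: "f differentiable (at y)" if "y \<noteq> 0" for y using Suc.prems that by auto
  have d: "(\<lambda>y. f (r *\<^sub>R y)) differentiable (at y)" if "r > 0" "y \<noteq> 0" for r y
    using has_derivative_scaleR_arg[OF df, of r y] that by (auto simp: differentiable_def)
  have "symb k {0<..} (-{0}) (\<lambda>_. norm) (\<lambda>r y. W (r *\<^sub>R y) / norm (r *\<^sub>R y)) (\<lambda>r y. partial_deriv i f (r *\<^sub>R y))" for i
    using Suc.IH[of "\<lambda>y. W y / norm y" "partial_deriv i f"] symb_partial[OF Suc.prems, of i] by simp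
  then have *: "symb k {0<..} (-{0}) (\<lambda>_. norm) (\<lambda>r y. r * (W (r *\<^sub>R y) / norm (r *\<^sub>R y))) (\<lambda>r y. r * partial_deriv i f (r *\<^sub>R y))" for i
  proof -
    assume a: "\<And>i. symb k {0<..} (-{0}) (\<lambda>_. norm) (\<lambda>r y. W (r *\<^sub>R y) / norm (r *\<^sub>R y)) (\<lambda>r y. partial_deriv i f (r *\<^sub>R y))"
    have "symb k {0<..} (-{0}) (\<lambda>_. norm) (\<lambda>r y. r) (\<lambda>r y::real^'n. r)"
    proof -
      have "partial_deriv i (\<lambda>y::real^'n. r) = (\<lambda>y. 0)" for i and r :: real by (auto simp: fun_eq_iff)
      then show ?thesis using symb_zero by (cases k) (auto intro!: exI[of _ 1])
    qed
    from symb_mult[OF _ this a[of i]] show ?thesis by (simp add: open_Compl)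
  qed
  have **: "symb k {0<..} (-{0}) (\<lambda>_. norm) (\<lambda>r y. W (r *\<^sub>R y) / norm y) (\<lambda>r. partial_deriv i (\<lambda>y. f (r *\<^sub>R y)))" for i
    by (rule symb_cong[OF _ symb_weight_cong[OF *[of i]]])
       (use df in \<open>auto simp: partial_deriv_scaleR_arg\<close>)
  have "\<bar>f (r *\<^sub>R y)\<bar> \<le> C * W (r *\<^sub>R y)" if "r > 0" "y \<noteq> 0" for r y using C that by simp
  then show ?case using C(1) d ** by (auto intro!: exI[of _ C])
qed

section \<open>Powers of the regularised distance\<close>

definition rsq :: "(real ^ 'n::finite) \<times> real \<Rightarrow> real ^ 'n \<Rightarrow> real" where
  "rsq p y = (norm (y - fst p))\<^sup>2 + (snd p)\<^sup>2"

definition rho :: "(real ^ 'n::finite) \<times> real \<Rightarrow> real ^ 'n \<Rightarrow> real" where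
  "rho p y = sqrt (rsq p y)"

definition rpow :: "real \<Rightarrow> (real ^ 'n::finite) \<times> real \<Rightarrow> real ^ 'n \<Rightarrow> real" where
  "rpow a p y = rsq p y powr a"

lemma has_derivative_rsq:
  "(rsq p has_derivative (\<lambda>v. 2 * ((y - fst p) \<bullet> v))) (at y)"
proof -
  have "rsq p = (\<lambda>y. (y - fst p) \<bullet> (y - fst p) + (snd p)\<^sup>2)"
    by (auto simp: rsq_def fun_eq_iff power2_norm_eq_inner)
  then show ?thesis by (auto intro!: derivative_eq_intros simp: inner_commute)
qed

lemma partial_deriv_rpow:
  assumes "rsq p y > 0"
  shows "partial_deriv i (rpow a p) y = 2 * a * (y $ i - fst p $ i) * rpow (a - 1) p y"
    and "rpow a p differentiable (at y)"
proof -
  have "((\<lambda>t. t powr a) has_real_derivative a * rsq p y powr (a - 1)) (at (rsq p y))"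
    using assms by (auto intro!: derivative_eq_intros)
  from has_derivative_compose[OF has_derivative_rsq this[unfolded has_field_derivative_def]]
  have *: "(rpow a p has_derivative (\<lambda>v. a * rsq p y powr (a - 1) * (2 * ((y - fst p) \<bullet> v)))) (at y)"
    by (simp add: rpow_def[abs_def])
  show "partial_deriv i (rpow a p) y = 2 * a * (y $ i - fst p $ i) * rpow (a - 1) p y"
    using partial_deriv_eq[OF *, of i] by (simp add: rpow_def inner_axis)
  show "rpow a p differentiable (at y)" using * by (auto simp: differentiable_def)
qed

lemma rho_pos: "snd p \<noteq> 0 \<Longrightarrow> rho p y > 0" "snd p \<noteq> 0 \<Longrightarrow> rsq p y > 0"
  by (auto simp: rho_def rsq_def intro!: add_nonneg_pos)

lemma rho_eq_powr: "snd p \<noteq> 0 \<Longrightarrow> rho p y = rsq p y powr (1/2)"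
  using rho_pos[of p y] by (simp add: rho_def powr_half_sqrt)

lemma norm_le_rho: "norm (y - fst p) \<le> rho p y" "\<bar>snd p\<bar> \<le> rho p y"
  unfolding rho_def rsq_def by (auto intro!: real_le_rsqrt)

lemma coord_le_rho: "\<bar>y $ i - fst p $ i\<bar> \<le> rho p y"
  using order_trans[OF component_le_norm_cart[of "y - fst p" i] norm_le_rho(1)] by simp

lemma symb_coord_diff:
  "symb k {p. snd p \<noteq> 0} (S :: (real ^ 'n::finite) set) rho rho (\<lambda>p y. y $ i - fst p $ i)"
proof (cases k)
  case 0
  then show ?thesis 
    by (auto intro!: continuous_intros exI[of _ 1] coord_le_rho[of _ _ "(a, b)" for a b, simplified])
next
  case (Suc m)
  have 1: "partial_deriv j (\<lambda>y::real^'n. y $ i - c) = (\<lambda>y. if j = i then 1 else 0)" for j and c :: real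
    by (auto simp: fun_eq_iff partial_deriv_diff)
  have q: "rho p y / rho p y = 1" if "snd p \<noteq> 0" for p and y :: "real^'n"
    using rho_pos(1)[OF that, of y] by simp
  have "symb m {p. snd p \<noteq> 0} S rho (\<lambda>p y. rho p y / rho p y) (\<lambda>p y. if j = i then 1 else 0)" for j
    by (rule symb_weight_cong[OF symb_const[of _ _ 1]]) (simp_all add: q rho_pos(1)[THEN less_imp_neq, THEN not_sym])
  then show ?thesis using Suc 1
    by (auto intro!: continuous_intros exI[of _ 1] coord_le_rho[of _ _ "(a, b)" for a b, simplified])
qed

lemma symb_rpow:
  assumes S: "open S"
  shows "symb k {p. snd p \<noteq> 0} S rho (\<lambda>p y. rho p y powr (2 * a)) (rpow a)"
proof (induction k arbitrary: a)
  case 0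
  have "continuous_on S (rpow a p)" if "snd p \<noteq> 0" for p
    using partial_deriv_rpow(2)[OF rho_pos(2)[OF that]]
    by (auto intro!: continuous_at_imp_continuous_on differentiable_imp_continuous_within)
  then show ?case
    by (auto intro!: exI[of _ 1] simp: rpow_def rho_eq_powr powr_powr)
next
  case (Suc k)
  have W: "rho p y powr (2 * a) / rho p y = rho p y * rho p y powr (2 * (a - 1))" if "snd p \<noteq> 0" for p and y :: "real^'n"
  proof -
    have "rho p y powr (2 * a) = rho p y powr (2 * (a - 1)) * rho p y powr 2"
      by (simp add: powr_add[symmetric])
    also have "\<dots> = rho p y powr (2 * (a - 1)) * (rho p y * rho p y)"
      using rho_pos(1)[OF that, of y] by (simp add: power2_eq_square)
    finally show ?thesis using rho_pos(1)[OF that, of y] by simp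
  qed
  have "symb k {p. snd p \<noteq> 0} S rho (\<lambda>p y. rho p y powr (2 * a) / rho p y) (\<lambda>p. partial_deriv i (rpow a p))" for i
    by (rule symb_cong[OF S symb_weight_cong[OF symb_cmult[OF S symb_mult[OF S symb_coord_diff[of _ _ i] Suc[of "a - 1"]], of "2 * a"]]])
       (simp_all add: W partial_deriv_rpow(1)[OF rho_pos(2)] mult.assoc del: prod.collapse split_paired_All split_paired_Ex)
  moreover have "\<bar>rpow a p y\<bar> \<le> 1 * rho p y powr (2 * a)" if "snd p \<noteq> 0" for p and y :: "real^'n"
    using that by (simp add: rpow_def rho_eq_powr powr_powr)
  then have "\<exists>C\<ge>0. \<forall>p\<in>{p. snd p \<noteq> 0}. \<forall>y\<in>S. \<bar>rpow a p y\<bar> \<le> C * rho p y powr (2 * a)"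
    using zero_le_one by blast
  ultimately show ?case
    using partial_deriv_rpow(2)[OF rho_pos(2)] by (auto simp del: split_paired_All)
qed

section \<open>Integration over the whole space\<close>

lemma borel_measurable_punctured:
  fixes f :: "'a::euclidean_space \<Rightarrow> real"
  assumes "continuous_on (-{0}) f"
  shows "f \<in> borel_measurable borel"
proof -
  have "(\<lambda>x. if x \<in> -{0} then f x else f x) \<in> borel_measurable borel"
    by (rule borel_measurable_continuous_on_if) (use assms in auto)
  then show ?thesis by simp
qed

lemma AE_nonzero: "AE y in (lborel :: 'a::euclidean_space measure). y \<noteq> 0"
  by (rule AE_lborel_singleton)

lemma integrable_bound_punctured:
  fixes f w :: "'a::euclidean_space \<Rightarrow> real"
  assumes "integrable lborel w" "f \<in> borel_measurable borel" "\<And>y. y \<noteq> 0 \<Longrightarrow> \<bar>f y\<bar> \<le> w y"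
  shows "integrable lborel f"
proof (rule Bochner_Integration.integrable_bound[OF assms(1)])
  show "AE y in lborel. norm (f y) \<le> norm (w y)"
    using AE_nonzero
  proof eventually_elim
    case (elim y)
    then show ?case using assms(3)[of y] by simp
  qed
qed (use assms in simp)

lemma dominated_convergence_punctured:
  fixes f :: "nat \<Rightarrow> 'a::euclidean_space \<Rightarrow> real"
  assumes "integrable lborel w" "\<And>m. f m \<in> borel_measurable borel" "g \<in> borel_measurable borel"
    and "\<And>m y. y \<noteq> 0 \<Longrightarrow> \<bar>f m y\<bar> \<le> w y"
    and "\<And>y. y \<noteq> 0 \<Longrightarrow> (\<lambda>m. f m y) \<longlonglongrightarrow> g y"
  shows "(\<lambda>m. integral\<^sup>L lborel (f m)) \<longlonglongrightarrow> integral\<^sup>L lborel g" "integrable lborel g"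
proof -
  have 1: "AE y in lborel. (\<lambda>m. f m y) \<longlonglongrightarrow> g y"
    using AE_nonzero by eventually_elim (use assms in auto)
  have 2: "AE y in lborel. norm (f m y) \<le> w y" for m
    using AE_nonzero by eventually_elim (use assms in auto)
  show "(\<lambda>m. integral\<^sup>L lborel (f m)) \<longlonglongrightarrow> integral\<^sup>L lborel g"
    by (rule integral_dominated_convergence[OF _ _ assms(1) 1 2]) (use assms in auto)
  show "integrable lborel g"
    by (rule integrable_dominated_convergence[OF _ _ assms(1) 1 2]) (use assms in auto)
qed

lemma integral_translate:
  fixes f :: "'a::euclidean_space \<Rightarrow> real"
  assumes "f \<in> borel_measurable borel"
  shows "(\<integral>y. f (c + y) \<partial>lborel) = (\<integral>y. f y \<partial>lborel)"
    and "integrable lborel (\<lambda>y. f (c + y)) \<longleftrightarrow> integrable lborel f"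
proof -
  have "(\<integral>y. f y \<partial>lborel) = (\<integral>y. f y \<partial>(distr lborel borel ((+) c)))" by (simp add: lborel_distr_plus)
  also have "\<dots> = (\<integral>y. f (c + y) \<partial>lborel)" by (rule integral_distr) (use assms in auto)
  finally show "(\<integral>y. f (c + y) \<partial>lborel) = (\<integral>y. f y \<partial>lborel)" by simp
  have "integrable (distr lborel borel ((+) c)) f \<longleftrightarrow> integrable lborel (\<lambda>y. f (c + y))"
    by (rule integrable_distr_eq) (use assms in auto)
  then show "integrable lborel (\<lambda>y. f (c + y)) \<longleftrightarrow> integrable lborel f" by (simp add: lborel_distr_plus)
qed

lemma integral_affine:
  fixes f :: "'a::euclidean_space \<Rightarrow> real"
  assumes [measurable]: "f \<in> borel_measurable borel" and c: "c > 0"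
  shows "(\<integral>y. f y \<partial>lborel) = c ^ DIM('a) * (\<integral>y. f (t + c *\<^sub>R y) \<partial>lborel)"
    and "integrable lborel (\<lambda>y. f (t + c *\<^sub>R y)) \<longleftrightarrow> integrable lborel f"
proof -
  have [measurable]: "(\<lambda>x::'a. t + c *\<^sub>R x) \<in> borel \<rightarrow>\<^sub>M borel" by simp
  have e: "lborel = density (distr lborel borel (\<lambda>x::'a. t + c *\<^sub>R x)) (\<lambda>_. \<bar>c\<bar>^DIM('a))"
    using lborel_affine[of c t] c by simp
  show "(\<integral>y. f y \<partial>lborel) = c ^ DIM('a) * (\<integral>y. f (t + c *\<^sub>R y) \<partial>lborel)"
    by (subst e) (use c in \<open>simp add: integral_density integral_distr\<close>)
  have "integrable lborel f \<longleftrightarrow> integrable (density (distr lborel borel (\<lambda>x::'a. t + c *\<^sub>R x)) (\<lambda>_. \<bar>c\<bar>^DIM('a))) f"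
    using e by simp
  also have "\<dots> \<longleftrightarrow> integrable lborel (\<lambda>y. f (t + c *\<^sub>R y))"
    using c by (subst integrable_density) (auto simp: integrable_distr_eq)
  finally show "integrable lborel (\<lambda>y. f (t + c *\<^sub>R y)) \<longleftrightarrow> integrable lborel f" by simp
qed

subsection \<open>Compactly supported functions\<close>

definition annular :: "('a::real_normed_vector \<Rightarrow> real) \<Rightarrow> bool" where
  "annular f \<longleftrightarrow> (\<exists>r>0. \<exists>R. \<forall>y. norm y < r \<or> R < norm y \<longrightarrow> f y = 0)"

lemma annular_mult: "annular g \<Longrightarrow> annular (\<lambda>y. f y * g y)"
  unfolding annular_def by fastforce

lemma annular_add: assumes "annular f" "annular g" shows "annular (\<lambda>y. f y + g y)"
proof -
  obtain r R where 1: "r > 0" "\<And>y. norm y < r \<or> R < norm y \<Longrightarrow> f y = 0" using assms unfolding annular_def by blast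
  obtain s T where 2: "s > 0" "\<And>y. norm y < s \<or> T < norm y \<Longrightarrow> g y = 0" using assms unfolding annular_def by blast
  show ?thesis unfolding annular_def
    by (rule exI[of _ "min r s"], rule conjI, use 1 2 in simp, rule exI[of _ "max R T"]) (use 1 2 in auto)
qed

lemma annular_zero: "annular (\<lambda>y. 0)" by (auto simp: annular_def intro: exI[of _ 1])

lemma annular_sum: "finite A \<Longrightarrow> (\<And>j. j \<in> A \<Longrightarrow> annular (f j)) \<Longrightarrow> annular (\<lambda>y. \<Sum>j\<in>A. f j y)"
  by (induction A rule: finite_induct) (auto intro: annular_add annular_zero)

lemma annular_partial:
  fixes f :: "real ^ 'n::finite \<Rightarrow> real"
  assumes "annular f"
  shows "annular (partial_deriv i f)"
proof -
  obtain r R where r: "r > 0" "\<And>y. norm y < r \<or> R < norm y \<Longrightarrow> f y = 0" using assms unfolding annular_def by blast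
  have o: "open {y::real^'n. norm y < r \<or> R < norm y}"
    by (intro open_Collect_disj open_Collect_less continuous_intros)
  have "partial_deriv i f y = 0" if "norm y < r \<or> R < norm y" for y
    using partial_deriv_cong[OF o, of y f "\<lambda>_. 0" i] that r by simp
  then show ?thesis using r(1) unfolding annular_def by blast
qed

lemma cdiff_Un:
  assumes "open S" "open T" "cdiff k S f" "cdiff k T f"
  shows "cdiff k (S \<union> T) f"
  using assms(3,4)
proof (induction k arbitrary: f)
  case 0 then show ?case using assms by (auto intro: continuous_on_open_Un)
qed auto

lemma cdiff_annular:
  fixes f :: "real ^ 'n::finite \<Rightarrow> real"
  assumes "cdiff k (-{0}) f" "annular f"
  shows "cdiff k UNIV f"
proof -
  obtain r R where r: "r > 0" "\<And>y. norm y < r \<or> R < norm y \<Longrightarrow> f y = 0" using assms unfolding annular_def by blast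
  have "cdiff k (ball 0 r) f"
    by (rule cdiff_cong_imp[of _ "\<lambda>_. 0"]) (use r in auto)
  then have "cdiff k (-{0} \<union> ball 0 r) f" using assms by (intro cdiff_Un) auto
  moreover have "-{0} \<union> ball 0 r = (UNIV :: (real^'n) set)" using r by auto
  ultimately show ?thesis by simp
qed

lemma annular_compact:
  assumes "annular f"
  shows "\<exists>R>0. \<forall>y. R < norm y \<longrightarrow> f y = 0"
proof -
  obtain r R where r: "r > 0" "\<And>y. norm y < r \<or> R < norm y \<Longrightarrow> f y = 0" using assms unfolding annular_def by blast
  then show ?thesis by (intro exI[of _ "max R 1"]) auto
qed

lemma integrable_annular:
  fixes f :: "real ^ 'n::finite \<Rightarrow> real"
  assumes "continuous_on (-{0}) f" "annular f"
  shows "integrable lborel f"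
proof -
  obtain R where R: "\<And>y. R < norm y \<Longrightarrow> f y = 0" using annular_compact[OF assms(2)] by blast
  have "continuous_on UNIV f" using cdiff_annular[of 0 f] assms by simp
  then have "integrable lborel (\<lambda>x. indicator (cball 0 R) x *\<^sub>R f x)"
    by (intro borel_integrable_compact) (auto intro: continuous_on_subset)
  moreover have "(\<lambda>x. indicator (cball 0 R) x *\<^sub>R f x) = f"
    using R by (auto simp: fun_eq_iff indicator_def)
  ultimately show ?thesis by simp
qed

text \<open>The integral is the limit of integrals of difference quotients, and these vanish by translation invariance.\<close>

lemma integral_partial_deriv_zero:
  fixes f :: "real ^ 'n::finite \<Rightarrow> real"
  assumes "cdiff 1 (-{0}) f" "annular f"
  shows "(\<integral>y. partial_deriv i f y \<partial>lborel) = 0"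
proof -
  have f: "cdiff 1 UNIV f" using cdiff_annular[OF assms] .
  then have df: "f differentiable (at y)" for y by simp
  have contd: "continuous_on UNIV (partial_deriv i f)" using f by simp
  have contf: "continuous_on UNIV f" using cdiff_continuous[OF f] .
  have [measurable]: "f \<in> borel_measurable borel" "partial_deriv i f \<in> borel_measurable borel"
    using contd contf borel_measurable_continuous_onI by blast+
  obtain R where R: "R > 0" "\<And>y. R < norm y \<Longrightarrow> f y = 0" using annular_compact[OF assms(2)] by blast
  have "compact (partial_deriv i f ` cball 0 (R + 2))"
    by (intro compact_continuous_image continuous_on_subset[OF contd]) auto
  then obtain B where B: "\<And>y. y \<in> cball 0 (R + 2) \<Longrightarrow> \<bar>partial_deriv i f y\<bar> \<le> B"
    using compact_imp_bounded bounded_iff[of "partial_deriv i f ` cball 0 (R + 2)"] by (metis imageI real_norm_def)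
  have B0: "B \<ge> 0" using B[of 0] R by auto
  define h where "h m = inverse (real (Suc m))" for m
  have h: "0 < h m" "h m \<le> 1" for m by (auto simp: h_def inverse_le_1_iff)
  define q where "q m y = (f (y + h m *\<^sub>R axis i 1) - f y) / h m" for m y
  have [measurable]: "q m \<in> borel_measurable borel" for m unfolding q_def[abs_def] by measurable
  have fi: "integrable lborel f" by (rule integrable_annular) (use contf assms in \<open>auto intro: continuous_on_subset\<close>)
  have qb: "\<bar>q m y\<bar> \<le> indicator (cball 0 (R + 1)) y * B" for m y
  proof (cases "norm y \<le> R + 1")
    case True
    obtain t where t: "0 < t" "t < h m" "f (y + h m *\<^sub>R axis i 1) - f y = h m * partial_deriv i f (y + t *\<^sub>R axis i 1)"
      using line_mvt[OF h(1)[of m], of f y i] df by blast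
    have "norm (y + t *\<^sub>R axis i 1) \<le> norm y + t" 
      using norm_triangle_ineq[of y "t *\<^sub>R axis i 1"] t by (simp add: norm_axis_1)
    then have "\<bar>partial_deriv i f (y + t *\<^sub>R axis i 1)\<bar> \<le> B"
      using B[of "y + t *\<^sub>R axis i 1"] t h(2)[of m] True by simp
    then show ?thesis using t h(1)[of m] True by (simp add: q_def)
  next
    case False
    have "norm y - h m \<le> norm (y + h m *\<^sub>R axis i 1)"
      using norm_diff_ineq[of y "h m *\<^sub>R axis i 1"] h(1)[of m] by (simp add: norm_axis_1)
    then have "R < norm (y + h m *\<^sub>R axis i 1)" using False h(2)[of m] by simp
    then show ?thesis using False R by (simp add: q_def)
  qed
  have lim: "(\<lambda>m. q m y) \<longlonglongrightarrow> partial_deriv i f y" for y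
  proof -
    have "((\<lambda>t. f (y + t *\<^sub>R axis i 1)) has_real_derivative partial_deriv i f y) (at 0)"
      using line_deriv[of f y 0 i] df by simp
    then have "((\<lambda>s. (f (y + s *\<^sub>R axis i 1) - f y) / s) \<longlongrightarrow> partial_deriv i f y) (at 0)"
      by (simp add: DERIV_def)
    moreover have "filterlim h (at 0) sequentially"
      unfolding filterlim_at using h(1) LIMSEQ_inverse_real_of_nat
      by (auto simp: h_def[abs_def] less_le[symmetric] intro!: always_eventually)
    ultimately show ?thesis unfolding q_def using filterlim_compose by blast
  qed
  have "(\<lambda>m. integral\<^sup>L lborel (q m)) \<longlonglongrightarrow> integral\<^sup>L lborel (partial_deriv i f)"
  proof (rule integral_dominated_convergence[where w = "\<lambda>y. indicator (cball 0 (R + 1)) y * B"])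
    show "integrable lborel (\<lambda>y. indicator (cball 0 (R + 1)) y * B)"
      using borel_integrable_compact[of "cball 0 (R + 1)" "\<lambda>_. B"] by simp
  qed (use qb lim in auto)
  moreover have "integral\<^sup>L lborel (q m) = 0" for m
  proof -
    have "integrable lborel (\<lambda>y. f (h m *\<^sub>R axis i 1 + y))" using integral_translate(2)[of f] fi by simp
    then have "integral\<^sup>L lborel (q m) = ((\<integral>y. f (h m *\<^sub>R axis i 1 + y) \<partial>lborel) - integral\<^sup>L lborel f) / h m"
      unfolding q_def using fi by (simp add: add.commute)
    then show ?thesis using integral_translate(1)[of f] by simp
  qed
  ultimately show ?thesis by (simp add: LIMSEQ_const_iff)
qed

lemma integration_by_parts:
  fixes f g :: "real ^ 'n::finite \<Rightarrow> real"
  assumes "cdiff 1 (-{0}) f" "cdiff 1 (-{0}) g" "annular g"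
  shows "(\<integral>y. partial_deriv i f y * g y \<partial>lborel) = - (\<integral>y. f y * partial_deriv i g y \<partial>lborel)"
    and "integrable lborel (\<lambda>y. partial_deriv i f y * g y)"
    and "integrable lborel (\<lambda>y. f y * partial_deriv i g y)"
proof -
  have c: "continuous_on (-{0}) f" "continuous_on (-{0}) g"
    using assms cdiff_continuous by blast+
  show 1: "integrable lborel (\<lambda>y. partial_deriv i f y * g y)"
    by (intro integrable_annular annular_mult continuous_intros c) (use assms in auto)
  show 2: "integrable lborel (\<lambda>y. f y * partial_deriv i g y)"
    by (intro integrable_annular annular_mult annular_partial continuous_intros c) (use assms in auto)
  have "(\<integral>y. partial_deriv i (\<lambda>y. f y * g y) y \<partial>lborel) = 0"
    by (intro integral_partial_deriv_zero cdiff_mult open_punctured annular_mult assms)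
  also have "(\<integral>y. partial_deriv i (\<lambda>y. f y * g y) y \<partial>lborel) =
     (\<integral>y. partial_deriv i f y * g y + f y * partial_deriv i g y \<partial>lborel)"
  proof (rule integral_cong_AE)
    show "AE y in lborel. partial_deriv i (\<lambda>y. f y * g y) y = partial_deriv i f y * g y + f y * partial_deriv i g y"
      using AE_nonzero by eventually_elim (use assms in \<open>simp add: partial_deriv_mult\<close>)
    have "continuous_on (-{0}) (partial_deriv i (\<lambda>y. f y * g y))"
      using cdiff_mult[OF open_punctured assms(1,2)] by simp
    then show "partial_deriv i (\<lambda>y. f y * g y) \<in> borel_measurable lborel"
      using borel_measurable_punctured by simp
    show "(\<lambda>y. partial_deriv i f y * g y + f y * partial_deriv i g y) \<in> borel_measurable lborel"
      using 1 2 by (intro borel_measurable_add borel_measurable_integrable)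
  qed
  finally show "(\<integral>y. partial_deriv i f y * g y \<partial>lborel) = - (\<integral>y. f y * partial_deriv i g y \<partial>lborel)"
    using 1 2 by simp
qed

section \<open>Integrability of homogeneous majorants\<close>

text \<open>Comparison with a sum of multiples of indicators of balls. Applied to dyadic balls it does
the work of polar coordinates.\<close>

lemma integrable_dyadic:
  fixes f :: "'a::euclidean_space \<Rightarrow> real"
  assumes [measurable]: "f \<in> borel_measurable borel"
    and c: "\<And>k. c k \<ge> 0" "\<And>k. r k > 0" and s: "summable (\<lambda>k. c k * r k ^ DIM('a))"
    and ex: "\<And>y. y \<noteq> 0 \<Longrightarrow> f y \<noteq> 0 \<Longrightarrow> \<exists>k. norm y < r k \<and> \<bar>f y\<bar> \<le> c k"
  shows "integrable lborel f"
proof (rule integrableI_bounded)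
  let ?V = "measure lborel (ball (0::'a) 1)"
  have em: "emeasure lborel (ball (0::'a) (r k)) = ennreal (r k ^ DIM('a) * ?V)" for k
    using emeasure_eq_ennreal_measure[of lborel "ball (0::'a) (r k)"] emeasure_lborel_ball_finite[of "0::'a" "r k"]
      content_ball_conv_unit_ball[of "r k" "0::'a"] c(2)[of k] by (simp add: top.not_eq_extremum)
  have "(\<integral>\<^sup>+ y. ennreal (norm (f y)) \<partial>lborel) \<le> (\<integral>\<^sup>+ y. (\<Sum>k. ennreal (c k) * indicator (ball (0::'a) (r k)) y) \<partial>lborel)"
  proof (rule nn_integral_mono_AE)
    show "AE y in lborel. ennreal (norm (f y)) \<le> (\<Sum>k. ennreal (c k) * indicator (ball (0::'a) (r k)) y)"
      using AE_nonzero
    proof eventually_elim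
      case (elim y)
      show ?case
      proof (cases "f y = 0")
        case False
        obtain k where k: "norm y < r k" "\<bar>f y\<bar> \<le> c k" using ex[OF elim False] by blast
        have "ennreal (norm (f y)) \<le> ennreal (c k) * indicator (ball (0::'a) (r k)) y"
          using k by (simp add: ennreal_leI)
        also have "\<dots> = (\<Sum>j\<in>{k}. ennreal (c j) * indicator (ball (0::'a) (r j)) y)"
            by (simp only: sum.insert finite.emptyI empty_iff not_False_eq_True sum.empty add_0_right)
        also have "\<dots> \<le> (\<Sum>k. ennreal (c k) * indicator (ball (0::'a) (r k)) y)"
          by (rule sum_le_suminf) auto
        finally show ?thesis .
      qed simp
    qed
  qed
  also have "\<dots> = (\<Sum>k. \<integral>\<^sup>+ y. ennreal (c k) * indicator (ball (0::'a) (r k)) y \<partial>lborel)"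
    by (rule nn_integral_suminf) (auto intro!: borel_measurable_times_ennreal borel_measurable_indicator)
  also have "\<dots> = (\<Sum>k. ennreal (c k * r k ^ DIM('a) * ?V))"
    by (intro arg_cong[of _ _ suminf] ext) (use c in \<open>simp add: nn_integral_cmult_indicator em ennreal_mult'[symmetric] mult.assoc\<close>)
  also have "\<dots> = ennreal (\<Sum>k. c k * r k ^ DIM('a) * ?V)"
  proof (rule suminf_ennreal2)
    show "0 \<le> c k * r k ^ DIM('a) * ?V" for k using c(1)[of k] less_imp_le[OF c(2)[of k]] by simp
    show "summable (\<lambda>k. c k * r k ^ DIM('a) * ?V)" using s by (rule summable_mult2)
  qed
  also have "\<dots> < \<infinity>" by simp
  finally show "(\<integral>\<^sup>+ y. ennreal (norm (f y)) \<partial>lborel) < \<infinity>" .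
qed simp

definition majorant :: "real \<Rightarrow> real \<Rightarrow> 'a::euclidean_space \<Rightarrow> real" where
  "majorant a b y = (if norm y < 1 then norm y powr (-a) else norm y powr (-b))"

lemma majorant_nonneg: "majorant a b y \<ge> 0" by (simp add: majorant_def)

lemma majorant_measurable [measurable]: "majorant a b \<in> borel_measurable borel"
  unfolding majorant_def[abs_def] by measurable

lemma integrable_near:
  assumes a: "0 \<le> a" "a < real DIM('a::euclidean_space)"
  shows "integrable lborel (\<lambda>y::'a. if norm y < 1 then norm y powr (-a) else 0)"
proof (rule integrable_dyadic[of _ "\<lambda>k. ((1/2) ^ Suc k) powr (-a)" "\<lambda>k. (1/2) ^ k"])
  let ?q = "2 powr (a - real DIM('a))"
  have q: "?q < 1" using a powr_less_cancel_iff[of 2 "a - real DIM('a)" 0] by simp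
  have "((1/2) ^ Suc k) powr (-a) * ((1/2) ^ k) ^ DIM('a) = 2 powr a * ?q ^ k" for k :: nat
  proof -
    have h: "((1/2::real) ^ m) = 2 powr (- real m)" for m
      by (simp add: powr_minus powr_realpow power_one_over inverse_eq_divide)
    have "((1/2::real) ^ k) ^ DIM('a) = 2 powr (- real k * real DIM('a))"
      by (simp only: h powr_power) (simp add: mult.commute)
    moreover have "((1/2::real) ^ Suc k) powr (-a) = 2 powr (a * (real k + 1))"
      by (simp only: h powr_powr) (simp add: algebra_simps)
    moreover have "?q ^ k = 2 powr (real k * (a - real DIM('a)))" by (simp add: powr_power mult.commute)
    ultimately show ?thesis by (simp add: powr_add[symmetric] algebra_simps)
  qed
  then show "summable (\<lambda>k. ((1/2) ^ Suc k) powr (-a) * ((1/2) ^ k) ^ DIM('a))"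
    using q by (simp add: summable_mult summable_geometric)
next
  fix y :: 'a assume y: "y \<noteq> 0" and ne: "(if norm y < 1 then norm y powr (-a) else 0) \<noteq> 0"
  then have y1: "norm y < 1" by (auto split: if_splits)
  obtain m where "(1/2) ^ m < norm y" using real_arch_pow_inv[of "norm y" "1/2"] y by auto
  then have ex: "\<exists>k. (1/2) ^ Suc k \<le> norm y" by (intro exI[of _ m]) (simp, smt (verit) norm_ge_zero)
  define k where "k = (LEAST k. (1/2) ^ Suc k \<le> norm y)"
  have k: "(1/2) ^ Suc k \<le> norm y" unfolding k_def by (rule LeastI_ex[OF ex])
  have "norm y < (1/2) ^ k"
  proof (cases k)
    case (Suc j)
    then have "j < k" by simp
    then show ?thesis using not_less_Least[of j "\<lambda>k. (1/2) ^ Suc k \<le> norm y"] Suc by (simp add: k_def)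
  qed (use y1 in simp)
  moreover have "norm y powr (-a) \<le> ((1/2) ^ Suc k) powr (-a)"
    using k a by (intro powr_mono2') auto
  ultimately show "\<exists>k. norm y < (1/2) ^ k \<and> \<bar>if norm y < 1 then norm y powr (-a) else 0\<bar> \<le> ((1/2) ^ Suc k) powr (-a)"
    using y1 by auto
qed auto

lemma integrable_far:
  assumes b: "b > real DIM('a::euclidean_space)"
  shows "integrable lborel (\<lambda>y::'a. if norm y < 1 then 0 else norm y powr (-b))"
proof (rule integrable_dyadic[of _ "\<lambda>k. (2 ^ k) powr (-b)" "\<lambda>k. 2 ^ Suc k"])
  let ?q = "2 powr (real DIM('a) - b)"
  have q: "?q < 1" using b powr_less_cancel_iff[of 2 "real DIM('a) - b" 0] by simp
  have "(2 ^ k) powr (-b) * (2 ^ Suc k) ^ DIM('a) = 2 ^ DIM('a) * ?q ^ k" for k :: nat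
  proof -
    have h: "((2::real) ^ m) = 2 powr (real m)" for m by (simp add: powr_realpow)
    have "((2::real) ^ Suc k) ^ DIM('a) = 2 powr (real k * real DIM('a)) * 2 ^ DIM('a)"
      by (simp add: power_mult_distrib powr_realpow[symmetric] powr_powr mult.commute)
    moreover have "((2::real) ^ k) powr (-b) = 2 powr (- b * real k)"
      by (simp only: h powr_powr) (simp add: algebra_simps)
    moreover have "?q ^ k = 2 powr (real k * (real DIM('a) - b))" by (simp add: powr_power mult.commute)
    ultimately show ?thesis by (simp add: powr_add[symmetric] algebra_simps)
  qed
  then show "summable (\<lambda>k. (2 ^ k) powr (-b) * (2 ^ Suc k) ^ DIM('a))"
    by (simp only:) (use q in \<open>simp add: summable_mult summable_geometric\<close>)
next
  fix y :: 'a assume y: "y \<noteq> 0" and ne: "(if norm y < 1 then 0 else norm y powr (-b)) \<noteq> 0"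
  then have y1: "norm y \<ge> 1" by (auto split: if_splits)
  obtain m where "norm y < 2 ^ m" using real_arch_pow[of 2 "norm y"] by auto
  then have ex: "\<exists>k. norm y < 2 ^ Suc k" by (intro exI[of _ m]) (simp, smt (verit) norm_ge_zero)
  define k where "k = (LEAST k. norm y < 2 ^ Suc k)"
  have k: "norm y < 2 ^ Suc k" unfolding k_def by (rule LeastI_ex[OF ex])
  have "2 ^ k \<le> norm y"
  proof (cases k)
    case (Suc j)
    then have "j < k" by simp
    then show ?thesis using not_less_Least[of j "\<lambda>k. norm y < 2 ^ Suc k"] Suc by (simp add: k_def)
  qed (use y1 in simp)
  then have "norm y powr (-b) \<le> (2 ^ k) powr (-b)"
    using b by (intro powr_mono2') auto
  then show "\<exists>k. norm y < 2 ^ Suc k \<and> \<bar>if norm y < 1 then 0 else norm y powr (-b)\<bar> \<le> (2 ^ k) powr (-b)"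
    using y1 k by (auto intro!: exI[of _ k])
qed auto

lemma integrable_majorant:
  assumes "0 \<le> a" "a < real DIM('a::euclidean_space)" "real DIM('a) < b"
  shows "integrable lborel (majorant a b :: 'a \<Rightarrow> real)"
proof -
  have "majorant a b = (\<lambda>y::'a. (if norm y < 1 then norm y powr (-a) else 0) + (if norm y < 1 then 0 else norm y powr (-b)))"
    by (auto simp: majorant_def fun_eq_iff)
  then show ?thesis using integrable_near[OF assms(1,2)] integrable_far[OF assms(3)] by simp
qed

lemma integrable_by_majorant:
  fixes f :: "'a::euclidean_space \<Rightarrow> real"
  assumes "f \<in> borel_measurable borel" "0 \<le> a" "a < real DIM('a)" "real DIM('a) < b"
    and "\<And>y. y \<noteq> 0 \<Longrightarrow> \<bar>f y\<bar> \<le> C * majorant a b y"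
  shows "integrable lborel f"
  by (rule integrable_bound_punctured[where w = "\<lambda>y. C * majorant a b y"])
     (use assms integrable_majorant[OF assms(2-4)] in auto)

lemma majorant_near: "norm y < 1 \<Longrightarrow> majorant a b y = norm y powr (-a)"
  and majorant_far: "1 \<le> norm y \<Longrightarrow> majorant a b y = norm y powr (-b)"
  by (auto simp: majorant_def)

subsection \<open>The Riesz-type potential of the inverse square\<close>

lemma recip_powr: "c > 0 \<Longrightarrow> (1 / c) powr (1 - t) = c powr (t - 1)" for c t :: real
proof -
  assume c: "c > 0"
  have "(1 / c) powr (- (t - 1)) = 1 / ((1 / c) powr (t - 1))" by (rule powr_minus_divide)
  also have "(1 / c) powr (t - 1) = 1 / c powr (t - 1)" using c by (simp add: powr_divide)
  finally show ?thesis by simp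
qed

text \<open>Close to the origin the first factor is bounded, close to \<open>e\<close> the second one is, and elsewhere
\<open>norm (y - e) \<ge> norm y / 3\<close>, so that both can be compared with powers of \<open>norm y\<close>.\<close>

lemma riesz_bound_unit:
  fixes e y :: "real ^ 'n::finite"
  defines "N \<equiv> real CARD('n)"
  assumes e: "norm e = 1" and N: "N \<ge> 3"
  shows "norm (y - e) powr (1 - N) * norm y powr (-2)
    \<le> 6 powr N * (majorant 2 (N + 1) y + majorant (N - 1) (N + 1) (y - e))"
proof -
  let ?a = "norm (y - e)" and ?b = "norm y"
  let ?M = "majorant 2 (N + 1) y" and ?K = "majorant (N - 1) (N + 1) (y - e)"
  have tri: "1 \<le> ?a + ?b" using norm_triangle_ineq4[of y "y - e"] e by simp
  have tri2: "?b \<le> ?a + 1" using norm_triangle_ineq[of "y - e" e] e by simp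
  have nn: "?M \<ge> 0" "?K \<ge> 0" by (auto intro: majorant_nonneg)
  have six: "1 \<le> 6 powr N" "2 powr (N - 1) \<le> 6 powr N" "4 \<le> 6 powr N" "6 powr (N - 1) \<le> 6 powr N"
  proof -
    show "1 \<le> 6 powr N" using N by (simp add: ge_one_powr_ge_zero)
    have "2 powr (N - 1) \<le> 6 powr (N - 1)" using N by (intro powr_mono2) auto
    moreover show "6 powr (N - 1) \<le> 6 powr N" by (intro powr_mono) auto
    ultimately show "2 powr (N - 1) \<le> 6 powr N" by linarith
    have "(6::real) powr 1 \<le> 6 powr N" using N by (intro powr_mono) auto
    then show "4 \<le> 6 powr N" by simp
  qed
  consider "?b < 1/2" | "?a < 1/2" | "?b \<ge> 1/2" "?a \<ge> 1/2" by linarith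
  then have "norm (y - e) powr (1 - N) * norm y powr (-2) \<le> 6 powr N * ?M \<or>
      norm (y - e) powr (1 - N) * norm y powr (-2) \<le> 6 powr N * ?K"
  proof cases
    case 1
    then have "?a powr (1 - N) \<le> (1/2) powr (1 - N)" using tri N by (intro powr_mono2') auto
    also have "\<dots> = 2 powr (N - 1)" by (rule recip_powr) simp
    finally have "?a powr (1 - N) * ?b powr (-2) \<le> 6 powr N * ?b powr (-2)"
      using six by (intro mult_right_mono) auto
    then show ?thesis using 1 by (simp add: majorant_near)
  next
    case 2
    then have b: "?b powr (-2) \<le> (1/2) powr (-2)" using tri by (intro powr_mono2') auto
    have "(1/2::real) powr (-2) = 4" by (simp add: powr_minus powr_numeral power_divide)
    with b have "?a powr (1 - N) * ?b powr (-2) \<le> ?a powr (1 - N) * 6 powr N"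
      using six by (intro mult_left_mono) auto
    then show ?thesis using 2 by (simp add: majorant_near mult.commute)
  next
    case 3
    have "?b / 3 \<le> ?a" using 3 tri2 by linarith
    then have "?a powr (1 - N) \<le> (?b / 3) powr (1 - N)" using 3 N by (intro powr_mono2') auto
    also have "\<dots> = 3 powr (N - 1) * ?b powr (1 - N)"
    proof -
      have "(?b / 3) powr (1 - N) = (?b * (1 / 3)) powr (1 - N)" by simp
      also have "\<dots> = ?b powr (1 - N) * (1 / 3) powr (1 - N)" by (rule powr_mult)
      finally show ?thesis using recip_powr[of 3 N] by simp
    qed
    finally have k: "?a powr (1 - N) * ?b powr (-2) \<le> 3 powr (N - 1) * ?b powr (1 - N) * ?b powr (-2)"
      by (intro mult_right_mono) auto
    show ?thesis
    proof (cases "?b < 1")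
      case True
      have "?b powr (1 - N) \<le> (1/2) powr (1 - N)" using 3 N by (intro powr_mono2') auto
      also have "\<dots> = 2 powr (N - 1)" by (rule recip_powr) simp
      finally have "3 powr (N - 1) * ?b powr (1 - N) * ?b powr (-2) \<le> 3 powr (N - 1) * 2 powr (N - 1) * ?b powr (-2)"
        by (intro mult_right_mono mult_left_mono) auto
      also have "\<dots> = 6 powr (N - 1) * ?b powr (-2)" by (simp add: powr_mult[symmetric])
      also have "\<dots> \<le> 6 powr N * ?b powr (-2)" using six by (intro mult_right_mono) auto
      finally show ?thesis using k True by (simp add: majorant_near)
    next
      case False
      have "3 powr (N - 1) * ?b powr (1 - N) * ?b powr (-2) = 3 powr (N - 1) * ?b powr (- (N + 1))"
        by (simp only: mult.assoc powr_add[symmetric]) (simp add: algebra_simps)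
      also have "\<dots> \<le> 6 powr N * ?b powr (- (N + 1))"
      proof -
        have "3 powr (N - 1) \<le> 6 powr (N - 1)" using N by (intro powr_mono2) auto
        then have "3 powr (N - 1) \<le> 6 powr N" using six by linarith
        then show ?thesis by (intro mult_right_mono) auto
      qed
      finally show ?thesis using k False by (simp add: majorant_far)
    qed
  qed
  moreover have "6 powr N * ?M \<ge> 0" "6 powr N * ?K \<ge> 0" using nn by auto
  ultimately show ?thesis by (simp only: distrib_left) linarith
qed

text \<open>For unit vectors \<open>x\<close> the integrand has a majorant whose integral does not depend on \<open>x\<close>. The general case
follows by scaling, since the integrand is homogeneous of degree \<open>-1 - n\<close> in \<open>(x, y)\<close>.\<close>

lemma riesz_potential_bound:
  assumes N: "3 \<le> CARD('n::finite)"
  obtains C where "C \<ge> 0"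
    "\<And>x :: real ^ 'n. x \<noteq> 0 \<Longrightarrow> integrable lborel (\<lambda>y. norm (y - x) powr (1 - real CARD('n)) * norm y powr (-2))"
    "\<And>x :: real ^ 'n. x \<noteq> 0 \<Longrightarrow> (\<integral>y. norm (y - x) powr (1 - real CARD('n)) * norm y powr (-2) \<partial>lborel) \<le> C / norm x"
proof -
  define n where "n = real CARD('n)"
  have n: "n \<ge> 3" using N by (simp add: n_def)
  let ?k = "\<lambda>x y :: real ^ 'n. norm (y - x) powr (1 - n) * norm y powr (-2)"
  let ?m = "\<lambda>e y :: real ^ 'n. 6 powr n * (majorant 2 (n + 1) y + majorant (n - 1) (n + 1) (y - e))"
  define I1 where "I1 = (\<integral>y. majorant 2 (n + 1) y \<partial>(lborel :: (real ^ 'n) measure))"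
  define I2 where "I2 = (\<integral>y. majorant (n - 1) (n + 1) y \<partial>(lborel :: (real ^ 'n) measure))"
  have i1: "integrable lborel (majorant 2 (n + 1) :: real ^ 'n \<Rightarrow> real)"
    and i2: "integrable lborel (majorant (n - 1) (n + 1) :: real ^ 'n \<Rightarrow> real)"
    by (intro integrable_majorant; use n in \<open>simp add: n_def\<close>)+
  have km: "?k x \<in> borel_measurable borel" for x by measurable
  have mi: "integrable lborel (?m e)" "integral\<^sup>L lborel (?m e) = 6 powr n * (I1 + I2)" for e
  proof -
    have t: "integrable lborel (\<lambda>y. majorant (n - 1) (n + 1) (y - e))"
      "(\<integral>y. majorant (n - 1) (n + 1) (y - e) \<partial>lborel) = I2"
      using integral_translate[of "majorant (n - 1) (n + 1)" "- e"] i2 by (simp_all add: I2_def)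
    show "integrable lborel (?m e)" using t i1 by simp
    show "integral\<^sup>L lborel (?m e) = 6 powr n * (I1 + I2)" using t i1 by (simp add: I1_def)
  qed
  have ku: "integrable lborel (?k e)" "integral\<^sup>L lborel (?k e) \<le> 6 powr n * (I1 + I2)" if e: "norm e = 1" for e
  proof -
    have b: "?k e y \<le> ?m e y" for y using riesz_bound_unit[OF e, of y] n by (simp add: n_def)
    show i: "integrable lborel (?k e)"
      by (rule integrable_bound_punctured[OF mi(1)[of e] km]) (use b in simp)
    show "integral\<^sup>L lborel (?k e) \<le> 6 powr n * (I1 + I2)"
      unfolding mi(2)[of e, symmetric] by (rule integral_mono[OF i mi(1)]) (rule b)
  qed
  have sc: "integrable lborel (?k x) \<and> integral\<^sup>L lborel (?k x) \<le> 6 powr n * (I1 + I2) / norm x" if x: "x \<noteq> 0" for x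
  proof -
    let ?r = "norm x" and ?e = "(1 / norm x) *\<^sub>R x"
    have r: "?r > 0" and e: "norm ?e = 1" using x by auto
    have "?k x (0 + ?r *\<^sub>R y) = ?r powr (- 1 - n) * ?k ?e y" for y
    proof -
      have "?r *\<^sub>R y - x = ?r *\<^sub>R (y - ?e)" using r by (simp add: scaleR_diff_right)
      then have "norm (?r *\<^sub>R y - x) = ?r * norm (y - ?e)" by simp
      then show ?thesis using r by (simp add: powr_mult powr_add[symmetric] mult_ac)
    qed
    then have eq: "(\<lambda>y. ?k x (0 + ?r *\<^sub>R y)) = (\<lambda>y. ?r powr (- 1 - n) * ?k ?e y)" by auto
    have "integrable lborel (\<lambda>y. ?k x (0 + ?r *\<^sub>R y))" unfolding eq using ku(1)[OF e] by simp
    then have 1: "integrable lborel (?k x)" using integral_affine(2)[OF km r] by blast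
    have "integral\<^sup>L lborel (?k x) = ?r ^ CARD('n) * (\<integral>y. ?k x (0 + ?r *\<^sub>R y) \<partial>lborel)"
      using integral_affine(1)[OF km r, of x 0] by simp
    also have "\<dots> = ?r ^ CARD('n) * ?r powr (- 1 - n) * integral\<^sup>L lborel (?k ?e)"
      unfolding eq by simp
    also have "?r ^ CARD('n) * ?r powr (- 1 - n) = 1 / ?r"
      using r by (simp add: n_def powr_realpow[symmetric] powr_add[symmetric] powr_minus inverse_eq_divide)
    also have "1 / ?r * integral\<^sup>L lborel (?k ?e) \<le> 1 / ?r * (6 powr n * (I1 + I2))"
      by (intro mult_left_mono ku(2)[OF e]) (use r in auto)
    finally show ?thesis using 1 by simp
  qed
  show ?thesis
  proof (rule that[of "6 powr n * (I1 + I2)"])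
    show "6 powr n * (I1 + I2) \<ge> 0"
      by (auto simp: I1_def I2_def intro!: integral_nonneg_AE add_nonneg_nonneg mult_nonneg_nonneg majorant_nonneg)
  qed (use sc in \<open>auto simp: n_def\<close>)
qed

subsection \<open>An approximate identity\<close>

definition bump_mass :: "'n::finite itself \<Rightarrow> real \<Rightarrow> real" where
  "bump_mass _ a = (\<integral>z. (1 + (norm z)\<^sup>2) powr (- (real CARD('n) + a) / 2) \<partial>(lborel :: (real ^ 'n) measure))"

lemma bump_integrable:
  assumes a: "a > 0"
  shows "integrable lborel (\<lambda>z :: real ^ 'n::finite. (1 + (norm z)\<^sup>2) powr (- (real CARD('n) + a) / 2))"
proof (rule integrable_by_majorant[where a = 0 and b = "real CARD('n) + a" and C = 1])
  fix y :: "real ^ 'n" assume y: "y \<noteq> 0"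
  let ?p = "- (real CARD('n) + a) / 2"
  have p: "?p \<le> 0" using a by simp
  show "\<bar>(1 + (norm y)\<^sup>2) powr ?p\<bar> \<le> 1 * majorant 0 (real CARD('n) + a) y"
  proof (cases "norm y < 1")
    case True
    have "(1 + (norm y)\<^sup>2) powr ?p \<le> 1 powr ?p" using p by (intro powr_mono2') auto
    then show ?thesis using True y by (simp add: majorant_near)
  next
    case False
    have "(1 + (norm y)\<^sup>2) powr ?p \<le> ((norm y)\<^sup>2) powr ?p" using p y by (intro powr_mono2') auto
    also have "((norm y)\<^sup>2) powr ?p = norm y powr (2 * ?p)"
      using y by (simp add: powr_powr flip: powr_numeral)
    also have "2 * ?p = - (real CARD('n) + a)" by simp
    finally show ?thesis using False by (simp add: majorant_far)
  qed
qed (use a in \<open>auto simp: zero_less_card_finite\<close>)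

lemma bump_mass_pos:
  assumes a: "a > 0"
  shows "bump_mass TYPE('n::finite) a > 0"
proof -
  let ?f = "\<lambda>z :: real ^ 'n. (1 + (norm z)\<^sup>2) powr (- (real CARD('n) + a) / 2)"
  have i: "integrable lborel ?f" by (rule bump_integrable[OF a])
  have "\<not> (AE z in lborel. ?f z = 0)"
  proof
    assume "AE z in lborel. ?f z = 0"
    then have "AE z in (lborel :: (real^'n) measure). False"
      by eventually_elim (simp add: add_nonneg_eq_0_iff)
    then show False by (simp add: eventually_False ae_filter_eq_bot_iff)
  qed
  then have "integral\<^sup>L lborel ?f \<noteq> 0"
    using integral_nonneg_eq_0_iff_AE[OF i] by simp
  moreover have "integral\<^sup>L lborel ?f \<ge> 0" by simp
  ultimately show ?thesis unfolding bump_mass_def by linarith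
qed

text \<open>After the substitution \<open>y = x + d m *\<^sub>R z\<close> the kernel no longer depends on \<open>m\<close>. Since \<open>v\<close> may be unbounded
at the origin, this is used for \<open>norm y \<ge> norm x / 2\<close> only; on the complement \<open>v\<close> is integrable and the
kernel is \<open>O(d m powr a)\<close>.\<close>

lemma approximate_identity:
  fixes v :: "real ^ 'n::finite \<Rightarrow> real"
  assumes N: "2 \<le> CARD('n)" and v: "continuous_on (-{0}) v" "\<And>y. y \<noteq> 0 \<Longrightarrow> \<bar>v y\<bar> \<le> M / norm y"
    and x: "x \<noteq> 0" and a: "a > 0" and d: "d \<longlonglongrightarrow> 0" "\<And>m. d m > 0"
  shows "(\<lambda>m. \<integral>y. v y * (d m powr a * rpow (- (real CARD('n) + a) / 2) (x, d m) y) \<partial>lborel)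
     \<longlonglongrightarrow> v x * bump_mass TYPE('n) a"
proof -
  define n where "n = real CARD('n)"
  define p where "p = - (n + a) / 2"
  let ?e = "\<lambda>m y. d m powr a * rpow p (x, d m) y"
  let ?W = "\<lambda>z :: real ^ 'n. (1 + (norm z)\<^sup>2) powr p"
  let ?far = "{y :: real^'n. norm x / 2 \<le> norm y}"
  define v1 where "v1 y = indicator ?far y * v y" for y
  define v2 where "v2 y = indicator (- ?far) y * v y" for y
  have r: "norm x > 0" using x by simp
  have M: "M \<ge> 0" using v(2)[OF x] r by (smt (verit) divide_less_0_iff)
  have [measurable]: "v \<in> borel_measurable borel" by (rule borel_measurable_punctured[OF v(1)])
  have [measurable]: "?far \<in> sets borel" by (intro borel_closed closed_Collect_le continuous_intros)
  have [measurable]: "v1 \<in> borel_measurable borel" "v2 \<in> borel_measurable borel"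
    unfolding v1_def[abs_def] v2_def[abs_def] by measurable
  have em [measurable]: "?e m \<in> borel_measurable borel" for m unfolding rpow_def[abs_def] rsq_def[abs_def] by measurable
  have v1b: "\<bar>v1 y\<bar> \<le> 2 * M / norm x" for y
  proof (cases "y \<in> ?far")
    case True
    then have "y \<noteq> 0" using r by auto
    then have "\<bar>v y\<bar> \<le> M / norm y" by (rule v(2))
    also have "\<dots> \<le> M / (norm x / 2)"
    proof (rule divide_left_mono)
      have "norm y > 0" using True r by auto
      then show "0 < norm y * (norm x / 2)" using r by simp
    qed (use True M in auto)
    finally show ?thesis using True by (simp add: v1_def mult.commute)
  qed (use r M in \<open>simp add: v1_def\<close>)
  have dpos: "d m \<noteq> 0" for m using d(2)[of m] by simp
  have resc: "d m ^ CARD('n) * ?e m (x + d m *\<^sub>R z) = ?W z" for m z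
  proof -
    have "rsq (x, d m) (x + d m *\<^sub>R z) = (d m)\<^sup>2 * (1 + (norm z)\<^sup>2)"
      using d(2)[of m] by (simp add: rsq_def power_mult_distrib algebra_simps)
    then have "rpow p (x, d m) (x + d m *\<^sub>R z) = d m powr (2 * p) * ?W z"
      using d(2)[of m] by (simp add: rpow_def powr_mult powr_powr flip: powr_numeral)
    then have "d m ^ CARD('n) * ?e m (x + d m *\<^sub>R z) = (d m ^ CARD('n) * d m powr a * d m powr (2 * p)) * ?W z"
      by (simp only: mult.assoc)
    also have "d m ^ CARD('n) * d m powr a * d m powr (2 * p) = d m powr (n + a + 2 * p)"
      using d(2)[of m] by (simp only: n_def powr_realpow[symmetric] powr_add)
    also have "n + a + 2 * p = 0" by (simp add: field_simps p_def)
    finally show ?thesis using d(2)[of m] by simp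
  qed
  have ie: "integrable lborel (?e m)" for m
  proof -
    have "(\<lambda>z. ?e m (x + d m *\<^sub>R z)) = (\<lambda>z. ?W z / d m ^ CARD('n))"
      using resc[of m] dpos[of m] by (simp add: fun_eq_iff field_simps)
    then have "integrable lborel (\<lambda>z. ?e m (x + d m *\<^sub>R z))"
      using bump_integrable[OF a, where 'n='n] by (simp add: n_def p_def)
    then show ?thesis using integral_affine(2)[OF em[of m] d(2)[of m], of x] by blast
  qed
  have i2: "integrable lborel v2"
  proof (rule integrable_by_majorant[where a = 1 and b = "n + 1" and C = "M * (1 + norm x powr n)"])
    fix y :: "real ^ 'n" assume y: "y \<noteq> 0"
    show "\<bar>v2 y\<bar> \<le> M * (1 + norm x powr n) * majorant 1 (n + 1) y"
    proof (cases "y \<in> ?far")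
      case False
      have "\<bar>v2 y\<bar> \<le> M * norm y powr (-1)" using v(2)[OF y] False
        by (simp add: v2_def powr_minus_divide)
      also have "M * norm y powr (-1) \<le> M * ((1 + norm x powr n) * majorant 1 (n + 1) y)"
      proof (rule mult_left_mono[OF _ M], cases "norm y < 1")
        case True
        have "1 * norm y powr (-1) \<le> (1 + norm x powr n) * norm y powr (-1)"
          by (intro mult_right_mono) auto
        then show "norm y powr (-1) \<le> (1 + norm x powr n) * majorant 1 (n + 1) y"
          using True by (simp add: majorant_near)
      next
        case ge: False
        have "norm y powr (-1) = norm y powr n * norm y powr (- (n + 1))"
          by (simp add: powr_add[symmetric])
        also have "\<dots> \<le> norm x powr n * norm y powr (- (n + 1))"
        proof (intro mult_right_mono powr_mono2)
          have "norm y < norm x / 2" using False by simp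
          then show "norm y \<le> norm x" using r by linarith
        qed (auto simp: n_def)
        also have "\<dots> \<le> (1 + norm x powr n) * norm y powr (- (n + 1))" by (simp add: distrib_right)
        finally show "norm y powr (-1) \<le> (1 + norm x powr n) * majorant 1 (n + 1) y"
          using ge by (simp add: majorant_far)
      qed
      finally show ?thesis by (simp add: mult.assoc)
    qed (use M in \<open>simp add: v2_def majorant_nonneg\<close>)
  qed (use N in \<open>auto simp: n_def\<close>)
  have p0: "p \<le> 0" using a by (simp add: n_def p_def)
  have e2: "\<bar>v2 y * ?e m y\<bar> \<le> \<bar>v2 y\<bar> * (d m powr a * (norm x / 2) powr (2 * p))" for m y
  proof (cases "y \<in> ?far")
    case False
    have "norm x / 2 \<le> norm (y - x)" using norm_triangle_ineq3[of y x] False by (simp add: norm_minus_commute)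
    then have "(norm x / 2)\<^sup>2 \<le> (norm (y - x))\<^sup>2" using r by (intro power_mono) auto
    then have "(norm x / 2)\<^sup>2 \<le> rsq (x, d m) y" unfolding rsq_def fst_conv snd_conv
      by (rule order_trans) simp
    then have "rpow p (x, d m) y \<le> ((norm x / 2)\<^sup>2) powr p"
      unfolding rpow_def using p0 r by (intro powr_mono2') auto
    also have "((norm x / 2)\<^sup>2) powr p = (norm x / 2) powr (2 * p)"
      using r by (simp add: powr_powr flip: powr_numeral)
    finally have "?e m y \<le> d m powr a * (norm x / 2) powr (2 * p)" by (intro mult_left_mono) auto
    moreover have "?e m y \<ge> 0" by (simp add: rpow_def)
    ultimately show ?thesis by (simp add: abs_mult mult_left_mono)
  qed (simp add: v2_def)
  have j2: "integrable lborel (\<lambda>y. v2 y * ?e m y)" for m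
  proof (rule Bochner_Integration.integrable_bound)
    show "integrable lborel (\<lambda>y. \<bar>v2 y\<bar> * (d m powr a * (norm x / 2) powr (2 * p)))"
      by (intro integrable_mult_left integrable_abs i2)
    show "(\<lambda>y. v2 y * ?e m y) \<in> borel_measurable lborel"
      using em[of m] by measurable
    show "AE y in lborel. norm (v2 y * ?e m y) \<le> norm (\<bar>v2 y\<bar> * (d m powr a * (norm x / 2) powr (2 * p)))"
      unfolding real_norm_def by (rule AE_I2, rule order_trans[OF e2 abs_ge_self])
  qed
  have b2: "\<bar>\<integral>y. v2 y * ?e m y \<partial>lborel\<bar> \<le> (\<integral>y. \<bar>v2 y\<bar> \<partial>lborel) * (norm x / 2) powr (2 * p) * d m powr a" for m
  proof -
    have "\<bar>\<integral>y. v2 y * ?e m y \<partial>lborel\<bar> \<le> (\<integral>y. \<bar>v2 y * ?e m y\<bar> \<partial>lborel)" by simp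
    also have "\<dots> \<le> (\<integral>y. \<bar>v2 y\<bar> * (d m powr a * (norm x / 2) powr (2 * p)) \<partial>lborel)"
      by (rule integral_mono[OF integrable_abs[OF j2] integrable_mult_left[OF integrable_abs[OF i2]] e2])
    finally show ?thesis by (simp add: mult_ac)
  qed
  have da: "(\<lambda>m. d m powr a) \<longlonglongrightarrow> 0"
    using tendsto_powr'[OF d(1) tendsto_const[of a]] a d(2) by (simp add: less_imp_le)
  have lim2: "(\<lambda>m. \<integral>y. v2 y * ?e m y \<partial>lborel) \<longlonglongrightarrow> 0"
  proof (rule Lim_null_comparison)
    show "\<forall>\<^sub>F m in sequentially. norm (\<integral>y. v2 y * ?e m y \<partial>lborel) \<le> (\<integral>y. \<bar>v2 y\<bar> \<partial>lborel) * (norm x / 2) powr (2 * p) * d m powr a"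
      using b2 by simp
    show "(\<lambda>m. (\<integral>y. \<bar>v2 y\<bar> \<partial>lborel) * (norm x / 2) powr (2 * p) * d m powr a) \<longlonglongrightarrow> 0"
      using tendsto_mult_left[OF da] by simp
  qed
  have j1: "integrable lborel (\<lambda>y. v1 y * ?e m y)" for m
  proof (rule Bochner_Integration.integrable_bound[where f = "\<lambda>y. 2 * M / norm x * ?e m y"])
    show "AE y in lborel. norm (v1 y * ?e m y) \<le> norm (2 * M / norm x * ?e m y)"
    proof (rule AE_I2)
      fix y
      have "?e m y \<ge> 0" by (simp add: rpow_def)
      moreover have "\<bar>v1 y\<bar> \<le> \<bar>2 * M / norm x\<bar>" using v1b[of y] by linarith
      ultimately have "\<bar>v1 y\<bar> * \<bar>?e m y\<bar> \<le> \<bar>2 * M / norm x\<bar> * \<bar>?e m y\<bar>"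
        by (intro mult_right_mono) auto
      then show "norm (v1 y * ?e m y) \<le> norm (2 * M / norm x * ?e m y)"
        by (simp only: real_norm_def abs_mult)
    qed
    show "integrable lborel (\<lambda>y. 2 * M / norm x * ?e m y)" by (rule integrable_mult_right[OF ie])
    show "(\<lambda>y. v1 y * ?e m y) \<in> borel_measurable lborel" using em[of m] by measurable
  qed
  have s1: "(\<integral>y. v1 y * ?e m y \<partial>lborel) = (\<integral>z. v1 (x + d m *\<^sub>R z) * ?W z \<partial>lborel)" for m
  proof -
    have mm: "(\<lambda>y. v1 y * ?e m y) \<in> borel_measurable borel" using em[of m] by measurable
    have "(\<integral>y. v1 y * ?e m y \<partial>lborel) = d m ^ CARD('n) * (\<integral>z. v1 (x + d m *\<^sub>R z) * ?e m (x + d m *\<^sub>R z) \<partial>lborel)"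
      using integral_affine(1)[OF mm d(2)[of m], of x] by (simp only: DIM_cart DIM_real mult_1_right)
    also have "\<dots> = (\<integral>z. d m ^ CARD('n) * (v1 (x + d m *\<^sub>R z) * ?e m (x + d m *\<^sub>R z)) \<partial>lborel)"
      by (rule integral_mult_right_zero[symmetric])
    also have "\<dots> = (\<integral>z. v1 (x + d m *\<^sub>R z) * ?W z \<partial>lborel)"
      by (simp only: mult.left_commute[of "d m ^ CARD('n)" "v1 _"] resc)
    finally show ?thesis .
  qed
  have "(\<lambda>m. \<integral>z. v1 (x + d m *\<^sub>R z) * ?W z \<partial>lborel) \<longlonglongrightarrow> (\<integral>z. v x * ?W z \<partial>lborel)"
  proof (rule integral_dominated_convergence[where w = "\<lambda>z. 2 * M / norm x * ?W z"])
    show "integrable lborel (\<lambda>z. 2 * M / norm x * ?W z)" using bump_integrable[OF a, where 'n='n] by (simp add: n_def p_def)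
    show "AE z in lborel. norm (v1 (x + d m *\<^sub>R z) * ?W z) \<le> 2 * M / norm x * ?W z" for m
    proof (rule AE_I2)
      fix z
      have "?W z \<ge> 0" by simp
      then have "\<bar>v1 (x + d m *\<^sub>R z)\<bar> * \<bar>?W z\<bar> \<le> 2 * M / norm x * \<bar>?W z\<bar>"
        by (intro mult_right_mono v1b) simp
      then show "norm (v1 (x + d m *\<^sub>R z) * ?W z) \<le> 2 * M / norm x * ?W z"
        by (simp add: abs_mult)
    qed
    show "AE z in lborel. (\<lambda>m. v1 (x + d m *\<^sub>R z) * ?W z) \<longlonglongrightarrow> v x * ?W z"
    proof (intro AE_I2 tendsto_mult tendsto_const)
      fix z
      have l: "(\<lambda>m. x + d m *\<^sub>R z) \<longlonglongrightarrow> x" using d(1) by (auto intro!: tendsto_eq_intros)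
      have "isCont v x" using v(1) x continuous_on_eq_continuous_at[OF open_punctured, of v] by auto
      then have l1: "(\<lambda>m. v (x + d m *\<^sub>R z)) \<longlonglongrightarrow> v x" using l isCont_tendsto_compose by blast
      have "(\<lambda>m. norm (x + d m *\<^sub>R z)) \<longlonglongrightarrow> norm x" by (rule tendsto_norm[OF l])
      then have "\<forall>\<^sub>F m in sequentially. norm x / 2 < norm (x + d m *\<^sub>R z)" using r by (intro order_tendstoD) auto
      then have "\<forall>\<^sub>F m in sequentially. v1 (x + d m *\<^sub>R z) = v (x + d m *\<^sub>R z)"
        by eventually_elim (simp add: v1_def)
      from tendsto_cong[OF this] show "(\<lambda>m. v1 (x + d m *\<^sub>R z)) \<longlonglongrightarrow> v x" using l1 by blast
    qed
  qed auto
  then have "(\<lambda>m. (\<integral>y. v1 y * ?e m y \<partial>lborel) + (\<integral>y. v2 y * ?e m y \<partial>lborel)) \<longlonglongrightarrow> (\<integral>z. v x * ?W z \<partial>lborel) + 0"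
    unfolding s1[symmetric] by (rule tendsto_add[OF _ lim2])
  moreover have "(\<integral>y. v y * ?e m y \<partial>lborel) = (\<integral>y. v1 y * ?e m y \<partial>lborel) + (\<integral>y. v2 y * ?e m y \<partial>lborel)" for m
  proof -
    have "v y * ?e m y = v1 y * ?e m y + v2 y * ?e m y" for y by (simp add: v1_def v2_def indicator_def)
    then show ?thesis using j1[of m] j2[of m] by simp
  qed
  ultimately show ?thesis by (simp add: n_def p_def bump_mass_def)
qed

section \<open>Cutoff functions\<close>

lemma DERIV_pos_part_power:
  "((\<lambda>t. (max 0 t) ^ (k + 2)) has_real_derivative real (k + 2) * (max 0 t) ^ (k + 1)) (at t)"
proof -
  consider "t > 0" | "t < 0" | "t = 0" by linarith
  then show ?thesis
  proof cases
    case 1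
    have "((\<lambda>t. t ^ (k + 2)) has_real_derivative real (k + 2) * t ^ (k + 1)) (at t)"
      using DERIV_pow[of "k + 2" t] by simp
    moreover have "\<forall>\<^sub>F s in nhds t. s ^ (k + 2) = (max 0 s) ^ (k + 2)"
      by (rule eventually_mono[OF eventually_nhds_in_open[of "{0<..}"]]) (use 1 in auto)
    ultimately show ?thesis using 1 DERIV_cong_ev[of t t "\<lambda>t. t ^ (k + 2)"] by simp
  next
    case 2
    have "((\<lambda>t::real. 0::real) has_real_derivative 0) (at t)" by simp
    moreover have E: "\<forall>\<^sub>F s in nhds t. 0 = (max 0 s) ^ (k + 2)"
      by (rule eventually_mono[OF eventually_nhds_in_open[of "{..<0}"]]) (use 2 in auto)
    ultimately have "((\<lambda>t. (max 0 t) ^ (k + 2)) has_real_derivative 0) (at t)"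
      using DERIV_cong_ev[OF refl E refl] by blast
    then show ?thesis using 2 by simp
  next
    case 3
    have "((\<lambda>h::real. ((max 0 h) ^ (k + 2)) / h) \<longlongrightarrow> 0) (at 0)"
    proof (rule Lim_null_comparison)
      show "\<forall>\<^sub>F h in at 0. norm (((max 0 h) ^ (k + 2)) / h) \<le> \<bar>h\<bar> ^ (k + 1)"
      proof (intro always_eventually allI)
        fix h :: real
        show "norm (((max 0 h) ^ (k + 2)) / h) \<le> \<bar>h\<bar> ^ (k + 1)"
        proof (cases "0 < h")
          case False
          then have "norm (((max 0 h) ^ (k + 2)) / h) = 0" by simp
          moreover have "0 \<le> \<bar>h\<bar> ^ (k + 1)" by (rule zero_le_power) simp
          ultimately show ?thesis by linarith
        qed (auto simp: max_def abs_mult)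
      qed
      have "((\<lambda>h::real. \<bar>h\<bar> ^ (k + 1)) \<longlongrightarrow> \<bar>0\<bar> ^ (k + 1)) (at 0)" by (intro tendsto_intros)
      then show "((\<lambda>h::real. \<bar>h\<bar> ^ (k + 1)) \<longlongrightarrow> 0) (at 0)" by simp
    qed
    then show ?thesis using 3 by (simp add: DERIV_def)
  qed
qed

lemma cdiff_pos_part_power:
  assumes "open S" "cdiff k S g"
  shows "cdiff k S (\<lambda>y. (max 0 (g y)) ^ (k + 1))"
  using assms(2)
proof (induction k)
  case 0
  then show ?case by (auto intro!: continuous_intros)
next
  case (Suc k)
  have g: "g differentiable (at x)" if "x \<in> S" for x using Suc.prems that by simp
  have 1: "cdiff k S (\<lambda>y. real (k + 2) * (max 0 (g y)) ^ (k + 1) * partial_deriv i g y)" for i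
    by (intro cdiff_mult cdiff_cmult assms(1) Suc.IH cdiff_Suc_imp[OF Suc.prems]) (use Suc.prems in simp)
  have D: "partial_deriv i (\<lambda>y. (max 0 (g y)) ^ (k + 2)) x = real (k + 2) * (max 0 (g x)) ^ (k + 1) * partial_deriv i g x"
    "(\<lambda>y. (max 0 (g y)) ^ (k + 2)) differentiable (at x)" if "x \<in> S" for i x
    using partial_deriv_chain[where f = g and x = x, OF g[OF that] DERIV_pos_part_power]
      has_derivative_real_chain[where f = g and x = x, OF g[OF that] DERIV_pos_part_power[of k]]
    by (auto simp: differentiable_def)
  have "cdiff k S (partial_deriv i (\<lambda>y. (max 0 (g y)) ^ (k + 2)))" for i
    by (rule cdiff_cong_imp[OF assms(1) _ 1[of i]]) (use D in simp)
  then show ?case using D by simp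
qed

text \<open>The quotient is at least \<open>1\<close> for \<open>norm y \<le> 1\<close> and at most \<open>0\<close> for \<open>norm y \<ge> 2\<close>. Fourth powers of positive parts make
the function three times continuously differentiable, which is what potentials of test fields need.\<close>

definition cutoff :: "real ^ 'n::finite \<Rightarrow> real" where
  "cutoff y = 1 - (max 0 (1 - (max 0 ((4 - y \<bullet> y) / 3)) ^ 4)) ^ 4"

lemma cdiff_inner_self: "cdiff k UNIV (\<lambda>y :: real ^ 'n::finite. y \<bullet> y)"
proof -
  have "cdiff k UNIV (\<lambda>y :: real ^ 'n. \<Sum>i\<in>UNIV. y $ i * y $ i)"
    by (intro cdiff_sum cdiff_mult) auto
  then show ?thesis by (simp add: inner_vec_def)
qed

lemma cutoff_cdiff: "cdiff 3 UNIV (cutoff :: real ^ 'n::finite \<Rightarrow> real)"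
proof -
  have 1: "cdiff 3 UNIV (\<lambda>y :: real ^ 'n. (4 - y \<bullet> y) / 3)"
    using cdiff_cmult[OF open_UNIV cdiff_diff[OF open_UNIV cdiff_const cdiff_inner_self], of 3 "1/3" 4] by simp
  have 2: "cdiff 3 UNIV (\<lambda>y :: real ^ 'n. (max 0 ((4 - y \<bullet> y) / 3)) ^ 4)"
    using cdiff_pos_part_power[OF open_UNIV 1] by simp
  have 3: "cdiff 3 UNIV (\<lambda>y :: real ^ 'n. (max 0 (1 - (max 0 ((4 - y \<bullet> y) / 3)) ^ 4)) ^ 4)"
    using cdiff_pos_part_power[OF open_UNIV cdiff_diff[OF open_UNIV cdiff_const 2]] by simp
  show ?thesis unfolding cutoff_def[abs_def]
    by (rule cdiff_diff[OF open_UNIV cdiff_const 3])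
qed

lemma cutoff_near: "norm y \<le> 1 \<Longrightarrow> cutoff y = 1"
proof -
  assume "norm y \<le> 1"
  then have "y \<bullet> y \<le> 1" by (simp add: norm_le_square)
  then have "1 ^ 4 \<le> (max 0 ((4 - y \<bullet> y) / 3)) ^ 4" by (intro power_mono) auto
  then show ?thesis by (simp add: cutoff_def max_def)
qed

lemma cutoff_far: "2 \<le> norm y \<Longrightarrow> cutoff y = 0"
proof -
  assume "2 \<le> norm y"
  then have "2\<^sup>2 \<le> (norm y)\<^sup>2" by (intro power_mono) auto
  then have "4 \<le> y \<bullet> y" by (simp add: power2_norm_eq_inner)
  then show ?thesis by (simp add: cutoff_def max_def)
qed

lemma cutoff_bounds: "0 \<le> cutoff y" "cutoff y \<le> 1"
proof -
  have "0 \<le> (max 0 ((4 - y \<bullet> y) / 3)) ^ 4" by simp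
  then have "(max 0 (1 - (max 0 ((4 - y \<bullet> y) / 3)) ^ 4)) ^ 4 \<le> 1"
    by (intro power_le_one) auto
  then show "0 \<le> cutoff y" by (simp add: cutoff_def)
  show "cutoff y \<le> 1" by (simp add: cutoff_def)
qed

text \<open>Constants suffice on a shell, so smoothness alone gives the estimates.\<close>

lemma symb_shell:
  fixes f :: "real ^ 'n::finite \<Rightarrow> real"
  assumes "cdiff k UNIV f" "\<And>y. norm y < 1 \<or> 2 < norm y \<Longrightarrow> f y = 0"
    and "c > 0" "\<And>y. 1 \<le> norm y \<Longrightarrow> norm y \<le> 2 \<Longrightarrow> c \<le> W y" "\<And>y. 0 \<le> W y"
  shows "symb k (UNIV :: unit set) (-{0}) (\<lambda>_. norm) (\<lambda>_. W) (\<lambda>_. f)"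
  using assms
proof (induction k arbitrary: f W c)
  case (0 f W c)
  have b: "\<exists>B\<ge>0. \<forall>y. \<bar>f y\<bar> \<le> B * W y"
  proof -
    have "compact (f ` cball 0 2)"
      by (intro compact_continuous_image) (use 0(1) in \<open>auto intro: continuous_on_subset\<close>)
    then obtain B where B: "\<And>y. norm y \<le> 2 \<Longrightarrow> \<bar>f y\<bar> \<le> B"
      using compact_imp_bounded bounded_iff[of "f ` cball 0 2"] by (metis imageI mem_cball_0 real_norm_def)
    have B0: "B \<ge> 0" using B[of 0] by auto
    have "\<bar>f y\<bar> \<le> B / c * W y" for y
    proof (cases "norm y < 1 \<or> 2 < norm y")
      case True
      then show ?thesis using 0 B0 by simp
    next
      case False
      then have "c \<le> W y" "\<bar>f y\<bar> \<le> B" using 0 B by auto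
      moreover have "B = B / c * c" using 0 by simp
      ultimately show ?thesis using B0 0(3) by (metis divide_nonneg_pos mult_left_mono order_trans)
    qed
    then show ?thesis using B0 0(3) by (intro exI[of _ "B / c"]) auto
  qed
  then show ?case using 0(1) by (auto intro: continuous_on_subset)
next
  case (Suc k f W c)
  have b: "\<exists>B\<ge>0. \<forall>y. \<bar>f y\<bar> \<le> B * W y"
  proof -
    have "compact (f ` cball 0 2)"
      by (intro compact_continuous_image) (use cdiff_continuous[OF Suc.prems(1)] in \<open>auto intro: continuous_on_subset\<close>)
    then obtain B where B: "\<And>y. norm y \<le> 2 \<Longrightarrow> \<bar>f y\<bar> \<le> B"
      using compact_imp_bounded bounded_iff[of "f ` cball 0 2"] by (metis imageI mem_cball_0 real_norm_def)
    have B0: "B \<ge> 0" using B[of 0] by auto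
    have "\<bar>f y\<bar> \<le> B / c * W y" for y
    proof (cases "norm y < 1 \<or> 2 < norm y")
      case True
      then show ?thesis using Suc.prems B0 by simp
    next
      case False
      then have "c \<le> W y" "\<bar>f y\<bar> \<le> B" using Suc.prems B by auto
      moreover have "B = B / c * c" using Suc.prems by simp
      ultimately show ?thesis using B0 Suc.prems(3) by (metis divide_nonneg_pos mult_left_mono order_trans)
    qed
    then show ?thesis using B0 Suc.prems(3) by (intro exI[of _ "B / c"]) auto
  qed
  have o: "open {y::real^'n. norm y < 1 \<or> 2 < norm y}"
    by (intro open_Collect_disj open_Collect_less continuous_intros)
  have z: "partial_deriv i f y = 0" if "norm y < 1 \<or> 2 < norm y" for y i
    using partial_deriv_cong[OF o, of y f "\<lambda>_. 0" i] that Suc.prems(2) by simp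
  have "symb k (UNIV :: unit set) (-{0}) (\<lambda>_. norm) (\<lambda>_ y. W y / norm y) (\<lambda>_. partial_deriv i f)" for i
  proof (rule Suc.IH[of "partial_deriv i f" "c / 2"])
    fix y :: "real ^ 'n" assume y: "1 \<le> norm y" "norm y \<le> 2"
    have "c / 2 \<le> c / norm y" using y Suc.prems(3) by (intro divide_left_mono) auto
    also have "\<dots> \<le> W y / norm y" using y Suc.prems by (intro divide_right_mono) auto
    finally show "c / 2 \<le> W y / norm y" .
  qed (use Suc.prems z in auto)
  then show ?case using b Suc.prems by auto
qed

lemma symb_cutoff:
  "symb 3 (UNIV :: unit set) (-{0}) (\<lambda>_. norm) (\<lambda>_. indicator (cball 0 2)) (\<lambda>_. cutoff :: real ^ 'n::finite \<Rightarrow> real)"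
proof -
  have c: "cdiff (Suc 2) UNIV (cutoff :: real ^ 'n \<Rightarrow> real)" using cutoff_cdiff by (simp add: numeral_3_eq_3)
  have o: "open {y::real^'n. norm y < 1}" "open {y::real^'n. 2 < norm y}"
    by (intro open_Collect_less continuous_intros)+
  have z: "partial_deriv i cutoff y = 0" if "norm y < 1 \<or> 2 < norm y" for y :: "real^'n" and i
    using that
  proof
    assume "norm y < 1"
    then have "partial_deriv i cutoff y = partial_deriv i (\<lambda>_::real^'n. 1::real) y"
      by (intro partial_deriv_cong[OF o(1)]) (simp_all add: cutoff_near)
    then show ?thesis by simp
  next
    assume "2 < norm y"
    then have "partial_deriv i cutoff y = partial_deriv i (\<lambda>_::real^'n. 0::real) y"
      by (intro partial_deriv_cong[OF o(2)]) (simp_all add: cutoff_far)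
    then show ?thesis by simp
  qed
  have "symb 2 (UNIV :: unit set) (-{0}) (\<lambda>_. norm) (\<lambda>_ y. indicator (cball 0 2) y / norm y) (\<lambda>_. partial_deriv i cutoff :: real ^ 'n \<Rightarrow> real)" for i
  proof (rule symb_shell[where c = "1/2"])
    fix y :: "real ^ 'n" assume y: "1 \<le> norm y" "norm y \<le> 2"
    then have "1 / 2 \<le> 1 / norm y" by (intro divide_left_mono) auto
    then show "1 / 2 \<le> indicator (cball 0 2) y / norm y" using y by simp
  qed (use cdiff_SucD(2)[OF c] z in auto)
  moreover have "\<bar>cutoff y\<bar> \<le> 1 * indicator (cball 0 2) y" for y :: "real ^ 'n"
    using cutoff_bounds[of y] cutoff_far[of y] by (auto simp: indicator_def)
  then have "\<exists>C\<ge>0. \<forall>y::real^'n. \<bar>cutoff y\<bar> \<le> C * indicator (cball 0 2) y" using zero_le_one by blast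
  ultimately have "symb (Suc 2) (UNIV :: unit set) (-{0}) (\<lambda>_. norm) (\<lambda>_. indicator (cball 0 2)) (\<lambda>_. cutoff :: real ^ 'n::finite \<Rightarrow> real)"
    using cdiff_SucD(1)[OF c] unfolding symb.simps by blast
  then show ?thesis by (simp only: eval_nat_numeral)
qed

text \<open>Cutoffs that exhaust the punctured space. By scaling, their symbol bounds do not depend on \<open>m\<close>.\<close>

definition chi :: "nat \<Rightarrow> real ^ 'n::finite \<Rightarrow> real" where
  "chi m y = (1 - cutoff (real (Suc m) *\<^sub>R y)) * cutoff (inverse (real (Suc m)) *\<^sub>R y)"

lemma symb_chi:
  "symb 3 UNIV (-{0}) (\<lambda>_. norm) (\<lambda>_ _. 1) (chi :: nat \<Rightarrow> real ^ 'n::finite \<Rightarrow> real)"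
proof -
  have d: "symb 3 {0<..} (-{0}) (\<lambda>_. norm) (\<lambda>_ _. 1) (\<lambda>r y::real^'n. cutoff (r *\<^sub>R y))"
    by (rule symb_weaken[OF symb_dilate[OF symb_cutoff], where c = 1 and c' = 1]) (auto simp: indicator_def)
  have 1: "symb 3 UNIV (-{0}) (\<lambda>_. norm) (\<lambda>_ _. 1) (\<lambda>m y::real^'n. 1 - cutoff (real (Suc m) *\<^sub>R y))"
    by (rule symb_diff[OF open_punctured symb_const[of _ _ 1]])
       (use symb_reparam[OF d, of UNIV "\<lambda>m. real (Suc m)"] in auto)
  have 2: "symb 3 UNIV (-{0}) (\<lambda>_. norm) (\<lambda>_ _. 1) (\<lambda>m y::real^'n. cutoff (inverse (real (Suc m)) *\<^sub>R y))"
    using symb_reparam[OF d, of UNIV "\<lambda>m. inverse (real (Suc m))"] by auto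
  show ?thesis unfolding chi_def[abs_def] using symb_mult[OF open_punctured 1 2] by simp
qed

lemma annular_chi: "annular (chi m)"
  unfolding annular_def
proof (intro exI conjI allI impI)
  show "0 < inverse (real (Suc m))" by simp
  fix y :: "real ^ 'n" assume "norm y < inverse (real (Suc m)) \<or> 2 * real (Suc m) < norm y"
  then show "chi m y = 0"
  proof
    assume "norm y < inverse (real (Suc m))"
    then have "real (Suc m) * norm y \<le> 1" by (simp add: field_simps)
    then have "norm (real (Suc m) *\<^sub>R y) \<le> 1" by (simp only: norm_scaleR abs_of_nat)
    then show ?thesis by (simp add: chi_def cutoff_near)
  next
    assume "2 * real (Suc m) < norm y"
    then have "2 \<le> inverse (real (Suc m)) * norm y" by (simp add: field_simps)
    then have "2 \<le> norm (inverse (real (Suc m)) *\<^sub>R y)" by (simp only: norm_scaleR abs_inverse abs_of_nat)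
    then show ?thesis by (simp add: chi_def cutoff_far)
  qed
qed

lemma chi_eventually_one:
  assumes "y \<noteq> (0 :: real ^ 'n::finite)"
  shows "\<forall>\<^sub>F m in sequentially. \<exists>S. open S \<and> y \<in> S \<and> (\<forall>z\<in>S. chi m z = 1)"
proof -
  obtain M1 where M1: "2 / norm y < real M1" using reals_Archimedean2 by blast
  obtain M2 where M2: "norm y < real M2" using reals_Archimedean2 by blast
  have r: "norm y > 0" using assms by simp
  have "\<exists>S. open S \<and> y \<in> S \<and> (\<forall>z\<in>S. chi m z = 1)" if m: "m \<ge> max M1 M2" for m
  proof (intro exI conjI ballI)
    let ?S = "{z :: real ^ 'n. 2 < real (Suc m) * norm z \<and> norm z < real (Suc m)}"
    show "open ?S" by (intro open_Collect_conj open_Collect_less continuous_intros)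
    have "2 / norm y < real (Suc m)" "norm y < real (Suc m)" using M1 M2 m by auto
    then show "y \<in> ?S" using r by (simp add: field_simps)
    fix z assume z: "z \<in> ?S"
    then have "2 \<le> \<bar>real (Suc m)\<bar> * norm z" by simp
    then have "cutoff (real (Suc m) *\<^sub>R z) = 0" by (intro cutoff_far) (simp only: norm_scaleR)
    moreover have "\<bar>inverse (real (Suc m))\<bar> * norm z \<le> 1" using z by (simp add: field_simps)
    then have "cutoff (inverse (real (Suc m)) *\<^sub>R z) = 1"
      by (intro cutoff_near) (simp only: norm_scaleR)
    ultimately show "chi m z = 1" by (simp add: chi_def)
  qed
  then show ?thesis unfolding eventually_sequentially by blast
qed

abbreviation symb1 :: "nat \<Rightarrow> (real ^ 'n::finite \<Rightarrow> real) \<Rightarrow> (real ^ 'n \<Rightarrow> real) \<Rightarrow> bool" where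
  "symb1 k W f \<equiv> symb k (UNIV :: unit set) (-{0}) (\<lambda>_. norm) (\<lambda>_. W) (\<lambda>_. f)"

lemma symb_chi_mult:
  assumes "symb1 k W f" "k \<le> 3"
  shows "symb k UNIV (-{0}) (\<lambda>_. norm) (\<lambda>_. W) (\<lambda>m y. chi m y * f y)"
  using symb_mult[OF open_punctured symb_le[OF symb_chi assms(2)] symb_reparam[OF assms(1), of UNIV "\<lambda>_. ()"]]
  by simp

lemma symb1_cdiff: "symb1 k W f \<Longrightarrow> cdiff k (-{0}) f"
  by (rule symb_cdiff[of k UNIV _ _ _ "\<lambda>_. f" "()"]) simp_all

text \<open>A quantity at \<open>y\<close> that depends on \<open>chi m\<close> only near \<open>y\<close>, such as a derivative of \<open>chi m * f\<close>, is eventually constant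
in \<open>m\<close>. This gives the pointwise limits in dominated convergence.\<close>

lemma tendsto_chi:
  assumes "y \<noteq> (0 :: real ^ 'n::finite)"
    and "\<And>m S. open S \<Longrightarrow> y \<in> S \<Longrightarrow> (\<And>z. z \<in> S \<Longrightarrow> chi m z = 1) \<Longrightarrow> h m = (l::real)"
  shows "h \<longlonglongrightarrow> l"
proof (rule tendsto_eventually)
  show "\<forall>\<^sub>F m in sequentially. h m = l"
    using chi_eventually_one[OF assms(1)]
  proof eventually_elim
    case (elim m)
    then obtain S where "open S" "y \<in> S" "\<forall>z\<in>S. chi m z = 1" by blast
    then show ?case using assms(2)[of S m] by blast
  qed
qed

text \<open>For \<open>chi m * q\<close> in place of \<open>q\<close> this is the divergence theorem. A derivative of \<open>chi m\<close> costs a factor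
\<open>1 / norm y\<close>, just as a derivative of \<open>q\<close>, so \<open>w\<close> dominates all these integrands.\<close>

lemma divergence_free_pairing:
  fixes v :: "'n::finite \<Rightarrow> real ^ 'n \<Rightarrow> real"
  assumes v: "\<And>j. cdiff 1 (-{0}) (v j)" "\<And>y. y \<noteq> 0 \<Longrightarrow> (\<Sum>j\<in>UNIV. partial_deriv j (v j) y) = 0"
    and q: "symb1 1 W q" and w: "integrable lborel w"
    and b: "\<And>j y. y \<noteq> 0 \<Longrightarrow> \<bar>v j y\<bar> * (W y / norm y) \<le> w y"
  shows "(\<integral>y. (\<Sum>j\<in>UNIV. v j y * partial_deriv j q y) \<partial>lborel) = 0"
    and "\<And>j. integrable lborel (\<lambda>y. v j y * partial_deriv j q y)"
proof -
  let ?q = "\<lambda>m y. chi m y * q y"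
  have sq: "symb 1 UNIV (-{0}) (\<lambda>_. norm) (\<lambda>_. W) ?q" by (rule symb_chi_mult[OF q]) simp
  have cq: "cdiff 1 (-{0}) (?q m)" "annular (?q m)" for m
    using symb_cdiff[OF sq, of m] annular_mult[OF annular_chi, of q m] by (auto simp: mult.commute)
  have qc: "cdiff 1 (-{0}) q" using symb1_cdiff[OF q] .
  have zero: "(\<integral>y. (\<Sum>j\<in>UNIV. v j y * partial_deriv j (?q m) y) \<partial>lborel) = 0" for m
  proof -
    have "(\<integral>y. (\<Sum>j\<in>UNIV. v j y * partial_deriv j (?q m) y) \<partial>lborel)
        = (\<Sum>j\<in>UNIV. \<integral>y. v j y * partial_deriv j (?q m) y \<partial>lborel)"
      by (intro Bochner_Integration.integral_sum integration_by_parts(3)[OF v(1) cq])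
    also have "\<dots> = - (\<Sum>j\<in>UNIV. \<integral>y. partial_deriv j (v j) y * ?q m y \<partial>lborel)"
      using integration_by_parts(1)[OF v(1) cq] by (simp add: sum_negf)
    also have "(\<Sum>j\<in>UNIV. \<integral>y. partial_deriv j (v j) y * ?q m y \<partial>lborel)
        = (\<integral>y. (\<Sum>j\<in>UNIV. partial_deriv j (v j) y * ?q m y) \<partial>lborel)"
      by (intro Bochner_Integration.integral_sum[symmetric] integration_by_parts(2)[OF v(1) cq])
    also have "(\<lambda>y. \<Sum>j\<in>UNIV. partial_deriv j (v j) y * ?q m y) = (\<lambda>y. 0)"
    proof
      fix y :: "real ^ 'n"
      show "(\<Sum>j\<in>UNIV. partial_deriv j (v j) y * ?q m y) = 0"
      proof (cases "y = 0")
        case True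
        then show ?thesis by (simp add: chi_def cutoff_near)
      next
        case False
        then show ?thesis using v(2)[of y] by (simp add: sum_distrib_right[symmetric])
      qed
    qed
    finally show ?thesis by simp
  qed
  have each: "(\<lambda>m. \<integral>y. v j y * partial_deriv j (?q m) y \<partial>lborel) \<longlonglongrightarrow> (\<integral>y. v j y * partial_deriv j q y \<partial>lborel)
     \<and> integrable lborel (\<lambda>y. v j y * partial_deriv j q y)" for j
  proof -
    obtain C where C: "C \<ge> 0" "\<And>m y. y \<noteq> 0 \<Longrightarrow> \<bar>partial_deriv j (?q m) y\<bar> \<le> C * (W y / norm y)"
      using symb_bound[OF symb_partial[OF sq[unfolded One_nat_def], of j]] by (metis ComplI UNIV_I singletonD)
    have "continuous_on (-{0}) (\<lambda>y. v j y * partial_deriv j (?q m) y)"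
         "continuous_on (-{0}) (\<lambda>y. v j y * partial_deriv j q y)" for m
      using cq(1)[of m] qc cdiff_continuous[OF v(1)[of j]] by (auto intro!: continuous_intros)
    note m = this[THEN borel_measurable_punctured]
    have bd: "\<bar>v j y * partial_deriv j (?q m) y\<bar> \<le> C * w y" if "y \<noteq> 0" for m y
    proof -
      have "\<bar>v j y * partial_deriv j (?q m) y\<bar> \<le> \<bar>v j y\<bar> * (C * (W y / norm y))"
        unfolding abs_mult by (intro mult_left_mono C that) auto
      also have "\<dots> = C * (\<bar>v j y\<bar> * (W y / norm y))" by simp
      also have "\<dots> \<le> C * w y" by (intro mult_left_mono b C that)
      finally show ?thesis .
    qed
    have li: "(\<lambda>m. v j y * partial_deriv j (?q m) y) \<longlonglongrightarrow> v j y * partial_deriv j q y" if "y \<noteq> 0" for y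
    proof (rule tendsto_chi[OF that])
      fix m S assume S: "open S" "y \<in> S" "\<And>z. z \<in> S \<Longrightarrow> chi m z = 1"
      show "v j y * partial_deriv j (?q m) y = v j y * partial_deriv j q y"
        using partial_deriv_cong[OF S(1,2), of "?q m" q j] S(3) by simp
    qed
    show ?thesis using dominated_convergence_punctured[OF _ m(1) m(2) bd li] w by auto
  qed
  then show i: "\<And>j. integrable lborel (\<lambda>y. v j y * partial_deriv j q y)" by blast
  have "(\<lambda>m. \<Sum>j\<in>UNIV. \<integral>y. v j y * partial_deriv j (?q m) y \<partial>lborel) \<longlonglongrightarrow> (\<Sum>j\<in>UNIV. \<integral>y. v j y * partial_deriv j q y \<partial>lborel)"
    by (intro tendsto_sum) (use each in blast)
  moreover have "(\<Sum>j\<in>UNIV. \<integral>y. v j y * partial_deriv j (?q m) y \<partial>lborel) = 0" for m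
  proof -
    have "(\<Sum>j\<in>UNIV. \<integral>y. v j y * partial_deriv j (?q m) y \<partial>lborel)
        = (\<integral>y. (\<Sum>j\<in>UNIV. v j y * partial_deriv j (?q m) y) \<partial>lborel)"
      by (intro Bochner_Integration.integral_sum[symmetric] integration_by_parts(3)[OF v(1) cq])
    then show ?thesis using zero[of m] by simp
  qed
  ultimately have "(\<Sum>j\<in>UNIV. \<integral>y. v j y * partial_deriv j q y \<partial>lborel) = 0"
    by (simp add: LIMSEQ_const_iff)
  moreover have "(\<integral>y. (\<Sum>j\<in>UNIV. v j y * partial_deriv j q y) \<partial>lborel) = (\<Sum>j\<in>UNIV. \<integral>y. v j y * partial_deriv j q y \<partial>lborel)"
    by (intro Bochner_Integration.integral_sum i)
  ultimately show "(\<integral>y. (\<Sum>j\<in>UNIV. v j y * partial_deriv j q y) \<partial>lborel) = 0" by simp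
qed

section \<open>Integration by parts on the punctured space\<close>

text \<open>As in \<open>divergence_free_pairing\<close>, the boundary terms disappear by truncation with \<open>chi m\<close>.\<close>

lemma by_parts_decay:
  fixes f q :: "real ^ 'n::finite \<Rightarrow> real"
  assumes f: "cdiff 1 (-{0}) f" and q: "symb1 1 W q"
    and w: "integrable lborel w" "integrable lborel w'"
    and b1: "\<And>y. y \<noteq> 0 \<Longrightarrow> \<bar>f y\<bar> * (W y / norm y) \<le> w y"
    and b2: "\<And>y. y \<noteq> 0 \<Longrightarrow> \<bar>partial_deriv i f y\<bar> * W y \<le> w' y"
  shows "(\<integral>y. f y * partial_deriv i q y \<partial>lborel) = - (\<integral>y. partial_deriv i f y * q y \<partial>lborel)"
proof -
  let ?q = "\<lambda>m y. chi m y * q y"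
  have sq: "symb (Suc 0) UNIV (-{0}) (\<lambda>_. norm) (\<lambda>_. W) ?q" using symb_chi_mult[OF q] by simp
  have cq: "cdiff 1 (-{0}) (?q m)" "annular (?q m)" for m
    using symb_cdiff[OF sq UNIV_I, of m] annular_mult[OF annular_chi, of q m] by (auto simp: mult.commute)
  have qc: "cdiff 1 (-{0}) q" using symb1_cdiff[OF q] .
  have cf: "continuous_on (-{0}) f" "continuous_on (-{0}) (partial_deriv i f)"
    using f cdiff_continuous[OF f] by simp_all
  obtain C0 where C0: "C0 \<ge> 0" "\<And>m y. y \<noteq> 0 \<Longrightarrow> \<bar>?q m y\<bar> \<le> C0 * W y"
    using symb_bound[OF sq] by (metis ComplI UNIV_I singletonD)
  obtain C where C: "C \<ge> 0" "\<And>m y. y \<noteq> 0 \<Longrightarrow> \<bar>partial_deriv i (?q m) y\<bar> \<le> C * (W y / norm y)"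
    using symb_bound[OF symb_partial[OF sq, of i]] by (metis ComplI UNIV_I singletonD)
  have l1: "(\<lambda>m. \<integral>y. f y * partial_deriv i (?q m) y \<partial>lborel) \<longlonglongrightarrow> (\<integral>y. f y * partial_deriv i q y \<partial>lborel)"
  proof (rule dominated_convergence_punctured(1)[OF integrable_mult_right[OF w(1), of C]])
    show "(\<lambda>y. f y * partial_deriv i (?q m) y) \<in> borel_measurable borel" for m
      using cq(1)[of m] by (intro borel_measurable_punctured continuous_on_mult cf) simp
    show "(\<lambda>y. f y * partial_deriv i q y) \<in> borel_measurable borel"
      using qc by (intro borel_measurable_punctured continuous_on_mult cf) simp
    fix y :: "real ^ 'n" assume y: "y \<noteq> 0"
    show "\<bar>f y * partial_deriv i (?q m) y\<bar> \<le> C * w y" for m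
    proof -
      have "\<bar>f y * partial_deriv i (?q m) y\<bar> \<le> \<bar>f y\<bar> * (C * (W y / norm y))"
        unfolding abs_mult by (intro mult_left_mono C y) auto
      also have "\<dots> = C * (\<bar>f y\<bar> * (W y / norm y))" by simp
      also have "\<dots> \<le> C * w y" by (intro mult_left_mono b1 C y)
      finally show ?thesis .
    qed
    show "(\<lambda>m. f y * partial_deriv i (?q m) y) \<longlonglongrightarrow> f y * partial_deriv i q y"
    proof (rule tendsto_chi[OF y])
      fix m S assume S: "open S" "y \<in> S" "\<And>z. z \<in> S \<Longrightarrow> chi m z = 1"
      show "f y * partial_deriv i (?q m) y = f y * partial_deriv i q y"
        using partial_deriv_cong[OF S(1,2), of "?q m" q i] S(3) by simp
    qed
  qed
  have l2: "(\<lambda>m. \<integral>y. partial_deriv i f y * ?q m y \<partial>lborel) \<longlonglongrightarrow> (\<integral>y. partial_deriv i f y * q y \<partial>lborel)"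
  proof (rule dominated_convergence_punctured(1)[OF integrable_mult_right[OF w(2), of C0]])
    show "(\<lambda>y. partial_deriv i f y * ?q m y) \<in> borel_measurable borel" for m
      by (intro borel_measurable_punctured continuous_on_mult cf cdiff_continuous[OF cq(1)])
    show "(\<lambda>y. partial_deriv i f y * q y) \<in> borel_measurable borel"
      by (intro borel_measurable_punctured continuous_on_mult cf cdiff_continuous[OF qc])
    fix y :: "real ^ 'n" assume y: "y \<noteq> 0"
    show "\<bar>partial_deriv i f y * ?q m y\<bar> \<le> C0 * w' y" for m
    proof -
      have "\<bar>partial_deriv i f y * ?q m y\<bar> \<le> \<bar>partial_deriv i f y\<bar> * (C0 * W y)"
        unfolding abs_mult[of "partial_deriv i f y"] by (intro mult_left_mono C0 y) auto
      also have "\<dots> = C0 * (\<bar>partial_deriv i f y\<bar> * W y)" by simp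
      also have "\<dots> \<le> C0 * w' y" by (intro mult_left_mono b2 C0 y)
      finally show ?thesis .
    qed
    show "(\<lambda>m. partial_deriv i f y * ?q m y) \<longlonglongrightarrow> partial_deriv i f y * q y"
      by (rule tendsto_chi[OF y]) simp
  qed
  have "(\<integral>y. f y * partial_deriv i (?q m) y \<partial>lborel) = - (\<integral>y. partial_deriv i f y * ?q m y \<partial>lborel)" for m
    using integration_by_parts(1)[OF f cq, of i m] by simp
  then have "(\<lambda>m. \<integral>y. f y * partial_deriv i (?q m) y \<partial>lborel) \<longlonglongrightarrow> - (\<integral>y. partial_deriv i f y * q y \<partial>lborel)"
    using tendsto_minus[OF l2] by simp
  then show ?thesis using l1 LIMSEQ_unique by blast
qed

lemma partial_deriv_cong2:
  fixes f g :: "real ^ 'n::finite \<Rightarrow> real"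
  assumes "open S" "\<And>y. y \<in> S \<Longrightarrow> f y = g y" "y \<in> S"
  shows "partial_deriv i (partial_deriv j f) y = partial_deriv i (partial_deriv j g) y"
  by (rule partial_deriv_cong[OF assms(1,3)]) (rule partial_deriv_cong[OF assms(1)], use assms in auto)

lemma Green_formula:
  fixes g k :: "real ^ 'n::finite \<Rightarrow> real"
  assumes g: "cdiff 2 (-{0}) g" and k: "symb1 2 W k"
    and w: "integrable lborel w" "integrable lborel w'"
    and b1: "\<And>y. y \<noteq> 0 \<Longrightarrow> \<bar>g y\<bar> * (W y / norm y / norm y) \<le> w y"
    and b2: "\<And>y. y \<noteq> 0 \<Longrightarrow> \<bar>\<Sum>j\<in>UNIV. partial_deriv j (partial_deriv j g) y\<bar> * W y \<le> w' y"
  shows "(\<integral>y. (\<Sum>j\<in>UNIV. partial_deriv j (partial_deriv j g) y) * k y \<partial>lborel)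
       = (\<integral>y. g y * (\<Sum>j\<in>UNIV. partial_deriv j (partial_deriv j k) y) \<partial>lborel)" (is ?eq)
    and "integrable lborel (\<lambda>y. (\<Sum>j\<in>UNIV. partial_deriv j (partial_deriv j g) y) * k y)" (is ?int)
proof -
  let ?G = "\<lambda>y. \<Sum>j\<in>UNIV. partial_deriv j (partial_deriv j g) y"
  let ?k = "\<lambda>m y. chi m y * k y"
  have g2: "cdiff (Suc 1) (-{0}) g" using g by (simp only: numeral_2_eq_2 One_nat_def)
  have sk: "symb (Suc 1) UNIV (-{0}) (\<lambda>_. norm) (\<lambda>_. W) ?k"
  proof -
    have "symb 2 UNIV (-{0}) (\<lambda>_. norm) (\<lambda>_. W) ?k" by (rule symb_chi_mult[OF k]) simp
    then show ?thesis by (simp only: numeral_2_eq_2 One_nat_def)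
  qed
  have ck: "cdiff (Suc 1) (-{0}) (?k m)" "annular (?k m)" for m
    using symb_cdiff[OF sk UNIV_I, of m] annular_mult[OF annular_chi, of k m] by (auto simp: mult.commute)
  have kc: "cdiff (Suc 1) (-{0}) k" using symb1_cdiff[OF k] by (simp only: numeral_2_eq_2 One_nat_def)
  have cG: "continuous_on (-{0}) ?G" using g2 by (auto intro!: continuous_intros)
  have cg: "continuous_on (-{0}) g" using cdiff_continuous[OF g] .
  have by_parts: "(\<integral>y. partial_deriv j (partial_deriv j g) y * ?k m y \<partial>lborel) = (\<integral>y. g y * partial_deriv j (partial_deriv j (?k m)) y \<partial>lborel)"
    "integrable lborel (\<lambda>y. partial_deriv j (partial_deriv j g) y * ?k m y)"
    "integrable lborel (\<lambda>y. g y * partial_deriv j (partial_deriv j (?k m)) y)" for j m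
  proof -
    note p1 = integration_by_parts[OF cdiff_SucD(2)[OF g2, of j] cdiff_Suc_imp[OF ck(1)[of m]] ck(2)[of m], of j]
    note p2 = integration_by_parts[OF cdiff_Suc_imp[OF g2] cdiff_SucD(2)[OF ck(1)[of m], of j] annular_partial[OF ck(2)[of m]], of j]
    show "(\<integral>y. partial_deriv j (partial_deriv j g) y * ?k m y \<partial>lborel) = (\<integral>y. g y * partial_deriv j (partial_deriv j (?k m)) y \<partial>lborel)"
      using p1(1) p2(1) by simp
    show "integrable lborel (\<lambda>y. partial_deriv j (partial_deriv j g) y * ?k m y)" by (rule p1(2))
    show "integrable lborel (\<lambda>y. g y * partial_deriv j (partial_deriv j (?k m)) y)" by (rule p2(3))
  qed
  have pre: "(\<integral>y. ?G y * ?k m y \<partial>lborel) = (\<Sum>j\<in>UNIV. \<integral>y. g y * partial_deriv j (partial_deriv j (?k m)) y \<partial>lborel)" for m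
  proof -
    have "(\<integral>y. ?G y * ?k m y \<partial>lborel) = (\<integral>y. (\<Sum>j\<in>UNIV. partial_deriv j (partial_deriv j g) y * ?k m y) \<partial>lborel)"
      by (simp add: sum_distrib_right)
    also have "\<dots> = (\<Sum>j\<in>UNIV. \<integral>y. partial_deriv j (partial_deriv j g) y * ?k m y \<partial>lborel)"
      by (intro Bochner_Integration.integral_sum by_parts(2))
    finally show ?thesis by (simp only: by_parts(1))
  qed
  obtain C0 where C0: "C0 \<ge> 0" "\<And>m y. y \<noteq> 0 \<Longrightarrow> \<bar>?k m y\<bar> \<le> C0 * W y"
    using symb_bound[OF sk] by (metis ComplI UNIV_I singletonD)
  have l1: "(\<lambda>m. \<integral>y. ?G y * ?k m y \<partial>lborel) \<longlonglongrightarrow> (\<integral>y. ?G y * k y \<partial>lborel)"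
    and i1: "integrable lborel (\<lambda>y. ?G y * k y)"
  proof -
    have m: "(\<lambda>y. ?G y * ?k m y) \<in> borel_measurable borel" for m
      by (intro borel_measurable_punctured continuous_on_mult cG cdiff_continuous[OF ck(1)])
    have m': "(\<lambda>y. ?G y * k y) \<in> borel_measurable borel"
      by (intro borel_measurable_punctured continuous_on_mult cG cdiff_continuous[OF kc])
    have bd: "\<bar>?G y * ?k m y\<bar> \<le> C0 * w' y" if "y \<noteq> 0" for m y
    proof -
      have "\<bar>?G y * ?k m y\<bar> \<le> \<bar>?G y\<bar> * (C0 * W y)"
        unfolding abs_mult[of "?G y"] by (intro mult_left_mono C0(2)[OF that]) auto
      also have "\<dots> = C0 * (\<bar>?G y\<bar> * W y)" by simp
      also have "\<dots> \<le> C0 * w' y" by (intro mult_left_mono b2 C0(1) that)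
      finally show ?thesis .
    qed
    have li: "(\<lambda>m. ?G y * ?k m y) \<longlonglongrightarrow> ?G y * k y" if "y \<noteq> 0" for y
      by (rule tendsto_chi[OF that]) simp
    show "(\<lambda>m. \<integral>y. ?G y * ?k m y \<partial>lborel) \<longlonglongrightarrow> (\<integral>y. ?G y * k y \<partial>lborel)"
      "integrable lborel (\<lambda>y. ?G y * k y)"
      using dominated_convergence_punctured[OF integrable_mult_right[OF w(2)] m m' bd li] by blast+
  qed
  have l2: "(\<lambda>m. \<integral>y. g y * partial_deriv j (partial_deriv j (?k m)) y \<partial>lborel) \<longlonglongrightarrow> (\<integral>y. g y * partial_deriv j (partial_deriv j k) y \<partial>lborel)
     \<and> integrable lborel (\<lambda>y. g y * partial_deriv j (partial_deriv j k) y)" for j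
  proof -
    obtain C where C: "C \<ge> 0" "\<And>m y. y \<noteq> 0 \<Longrightarrow> \<bar>partial_deriv j (partial_deriv j (?k m)) y\<bar> \<le> C * (W y / norm y / norm y)"
      using symb_bound[OF symb_partial[OF symb_partial[OF sk, of j, unfolded One_nat_def], of j]]
      by (metis ComplI UNIV_I singletonD)
    have m: "(\<lambda>y. g y * partial_deriv j (partial_deriv j (?k m)) y) \<in> borel_measurable borel" for m
      using ck(1)[of m] by (intro borel_measurable_punctured continuous_on_mult cg) simp
    have m': "(\<lambda>y. g y * partial_deriv j (partial_deriv j k) y) \<in> borel_measurable borel"
      using kc by (intro borel_measurable_punctured continuous_on_mult cg) simp
    have bd: "\<bar>g y * partial_deriv j (partial_deriv j (?k m)) y\<bar> \<le> C * w y" if "y \<noteq> 0" for m y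
    proof -
      have "\<bar>g y * partial_deriv j (partial_deriv j (?k m)) y\<bar> \<le> \<bar>g y\<bar> * (C * (W y / norm y / norm y))"
        unfolding abs_mult by (intro mult_left_mono C that) auto
      also have "\<dots> = C * (\<bar>g y\<bar> * (W y / norm y / norm y))" by simp
      also have "\<dots> \<le> C * w y" by (intro mult_left_mono b1 C that)
      finally show ?thesis .
    qed
    have li: "(\<lambda>m. g y * partial_deriv j (partial_deriv j (?k m)) y) \<longlonglongrightarrow> g y * partial_deriv j (partial_deriv j k) y" if "y \<noteq> 0" for y
    proof (rule tendsto_chi[OF that])
      fix m S assume S: "open S" "y \<in> S" "\<And>z. z \<in> S \<Longrightarrow> chi m z = 1"
      show "g y * partial_deriv j (partial_deriv j (?k m)) y = g y * partial_deriv j (partial_deriv j k) y"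
        using partial_deriv_cong2[OF S(1) _ S(2), of "?k m" k j j] S(3) by simp
    qed
    show ?thesis
      using dominated_convergence_punctured[OF integrable_mult_right[OF w(1)] m m' bd li] by blast
  qed
  have "(\<lambda>m. \<integral>y. ?G y * ?k m y \<partial>lborel) \<longlonglongrightarrow> (\<Sum>j\<in>UNIV. \<integral>y. g y * partial_deriv j (partial_deriv j k) y \<partial>lborel)"
    unfolding pre by (intro tendsto_sum) (use l2 in blast)
  then have "(\<integral>y. ?G y * k y \<partial>lborel) = (\<Sum>j\<in>UNIV. \<integral>y. g y * partial_deriv j (partial_deriv j k) y \<partial>lborel)"
    using l1 LIMSEQ_unique by blast
  also have "\<dots> = (\<integral>y. (\<Sum>j\<in>UNIV. g y * partial_deriv j (partial_deriv j k) y) \<partial>lborel)"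
    by (intro Bochner_Integration.integral_sum[symmetric]) (use l2 in blast)
  also have "\<dots> = (\<integral>y. g y * (\<Sum>j\<in>UNIV. partial_deriv j (partial_deriv j k) y) \<partial>lborel)"
    by (simp add: sum_distrib_left)
  finally show ?eq .
  show ?int by (rule i1)
qed

text \<open>For a fixed positive regularisation \<open>rho p y\<close> is comparable to \<open>1 + norm y\<close>, so the estimates at the scale
\<open>rho\<close> imply those at the scale \<open>norm\<close>, which fit the cutoffs \<open>chi\<close>.\<close>

lemma symb1_of_kernel:
  fixes f :: "(real ^ 'n::finite) \<times> real \<Rightarrow> real ^ 'n \<Rightarrow> real"
  assumes f: "symb k {p. snd p \<noteq> 0} (-{0}) rho (\<lambda>p y. rho p y powr (-t)) f" and p: "snd p \<noteq> 0" and t: "0 \<le> t"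
  shows "symb1 k (\<lambda>y. (1 + norm y) powr (-t)) (f p)"
proof -
  define c where "c = 1 + (1 + norm (fst p)) / \<bar>snd p\<bar>"
  have c: "c > 0" using p by (auto simp: c_def intro!: add_pos_nonneg)
  have le: "1 + norm y \<le> c * rho p y" for y
  proof -
    have "norm y \<le> norm (y - fst p) + norm (fst p)" using norm_triangle_ineq[of "y - fst p" "fst p"] by simp
    then have "1 + norm y \<le> rho p y + (1 + norm (fst p)) / \<bar>snd p\<bar> * \<bar>snd p\<bar>"
      using norm_le_rho(1)[of y p] p by simp
    also have "\<dots> \<le> rho p y + (1 + norm (fst p)) / \<bar>snd p\<bar> * rho p y"
      using norm_le_rho(2)[of p y] by (intro add_left_mono mult_left_mono) auto
    finally show ?thesis by (simp add: c_def distrib_right)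
  qed
  have W: "rho p y powr (-t) \<le> c powr t * (1 + norm y) powr (-t)" for y
  proof -
    have "(c * rho p y) powr (-t) \<le> (1 + norm y) powr (-t)" using le[of y] t
      by (intro powr_mono2') (auto intro: add_pos_nonneg)
    then have "c powr t * (c * rho p y) powr (-t) \<le> c powr t * (1 + norm y) powr (-t)" by (intro mult_left_mono) auto
    also have "c powr t * (c * rho p y) powr (-t) = rho p y powr (-t)"
      using c rho_pos(1)[OF p, of y] by (simp add: powr_mult powr_minus)
    finally show ?thesis .
  qed
  have "symb k (UNIV :: unit set) (-{0}) (\<lambda>_. rho p) (\<lambda>_ y. rho p y powr (-t)) (\<lambda>_. f p)"
    using symb_reparam[OF f, of "UNIV :: unit set" "\<lambda>_. p"] p by simp
  then show ?thesis
  proof (rule symb_weaken[where c = "c powr t" and c' = c])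
    fix u :: unit and y :: "real ^ 'n" assume "y \<in> -{0}"
    then show "0 < norm y \<and> norm y \<le> c * rho p y" using le[of y] by simp
  qed (use W rho_pos(1)[OF p] in auto)
qed

lemma one_plus_norm_powr:
  assumes "0 \<le> t" "y \<noteq> (0::'a::euclidean_space)"
  shows "(1 + norm y) powr (-t) \<le> 1" "(1 + norm y) powr (-t) \<le> norm y powr (-t)"
proof -
  have "(1 + norm y) powr (-t) \<le> 1 powr (-t)" using assms by (intro powr_mono2') auto
  then show "(1 + norm y) powr (-t) \<le> 1" by simp
  show "(1 + norm y) powr (-t) \<le> norm y powr (-t)" using assms by (intro powr_mono2') auto
qed

lemma weight_le_majorant:
  assumes "0 \<le> t" "y \<noteq> (0::'a::euclidean_space)"
  shows "norm y powr (-a) * (1 + norm y) powr (-t) \<le> majorant a (a + t) y"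
proof (cases "norm y < 1")
  case True
  have "norm y powr (-a) * (1 + norm y) powr (-t) \<le> norm y powr (-a) * 1"
    using one_plus_norm_powr(1)[OF assms] by (intro mult_left_mono) auto
  then show ?thesis using True by (simp add: majorant_near)
next
  case False
  have "norm y powr (-a) * (1 + norm y) powr (-t) \<le> norm y powr (-a) * norm y powr (-t)"
    using one_plus_norm_powr(2)[OF assms] by (intro mult_left_mono) auto
  also have "\<dots> = norm y powr (- (a + t))" by (simp add: powr_add[symmetric])
  finally show ?thesis using False by (simp add: majorant_far)
qed

section \<open>The gradient estimate for the Laplacian\<close>

text \<open>Up to a constant, the gradient of the fundamental solution of the Laplacian, regularised.\<close>

definition grad_kernel :: "'n::finite \<Rightarrow> (real ^ 'n) \<times> real \<Rightarrow> real ^ 'n \<Rightarrow> real" where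
  "grad_kernel i p y = (y $ i - fst p $ i) * rpow (- real CARD('n) / 2) p y"

lemma rho_nonneg [simp]: "0 \<le> rho p y"
  by (simp add: rho_def rsq_def)

lemma symb_coord_rpow:
  assumes "open S"
  shows "symb k {p. snd p \<noteq> 0} S rho (\<lambda>p y. rho p y powr (1 + 2 * a)) (\<lambda>p y. (y $ i - fst p $ i) * rpow a p y)"
  by (rule symb_weight_cong[OF symb_mult[OF assms symb_coord_diff symb_rpow[OF assms]]])
     (simp add: powr_add)

lemma partial_deriv_coord_rpow:
  fixes p :: "(real ^ 'n::finite) \<times> real"
  assumes "snd p \<noteq> 0"
  shows "partial_deriv j (\<lambda>y. (y $ i - fst p $ i) * rpow a p y) y
    = (if i = j then rpow a p y else 0) + 2 * a * (y $ i - fst p $ i) * (y $ j - fst p $ j) * rpow (a - 1) p y"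
proof -
  have d: "(\<lambda>y::real^'n. y $ i - fst p $ i) differentiable (at y)" by simp
  have "partial_deriv j (\<lambda>y::real^'n. y $ i - fst p $ i) y = (if j = i then 1 else 0)"
    by (simp add: partial_deriv_diff)
  then show ?thesis
    using partial_deriv_mult[OF d partial_deriv_rpow(2)[OF rho_pos(2)[OF assms]], of j a]
      partial_deriv_rpow(1)[OF rho_pos(2)[OF assms], of j a y] by auto
qed

lemma norm_eq_sum_squares: "(norm (x :: real ^ 'n::finite))\<^sup>2 = (\<Sum>i\<in>UNIV. x $ i * x $ i)"
  by (simp add: power2_norm_eq_inner inner_vec_def)

lemma rpow_step: "snd p \<noteq> 0 \<Longrightarrow> rsq p y * rpow (a - 1) p y = rpow a p y"
  using rho_pos(2)[of p y] by (simp add: rpow_def powr_diff)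

lemma divergence_coord_rpow:
  fixes p :: "(real ^ 'n::finite) \<times> real"
  assumes "snd p \<noteq> 0"
  shows "(\<Sum>j\<in>UNIV. partial_deriv j (\<lambda>y. (y $ j - fst p $ j) * rpow a p y) y)
    = (real CARD('n) + 2 * a) * rpow a p y - 2 * a * (snd p)\<^sup>2 * rpow (a - 1) p y"
proof -
  have "(\<Sum>j\<in>UNIV. partial_deriv j (\<lambda>y. (y $ j - fst p $ j) * rpow a p y) y)
     = real CARD('n) * rpow a p y + 2 * a * (\<Sum>j\<in>UNIV. (y - fst p) $ j * (y - fst p) $ j) * rpow (a - 1) p y"
  proof -
    have "partial_deriv j (\<lambda>y. (y $ j - fst p $ j) * rpow a p y) y
       = rpow a p y + (2 * a * rpow (a - 1) p y) * ((y - fst p) $ j * (y - fst p) $ j)" for j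
      using partial_deriv_coord_rpow[OF assms, of j j a y]
      by (simp only: if_True vector_minus_component mult.assoc mult.commute mult.left_commute refl)
    then show ?thesis by (simp add: sum.distrib sum_distrib_left[symmetric])
  qed
  also have "(\<Sum>j\<in>UNIV. (y - fst p) $ j * (y - fst p) $ j) = rsq p y - (snd p)\<^sup>2"
    by (simp only: norm_eq_sum_squares[symmetric] rsq_def add_diff_cancel_right')
  finally show ?thesis using rpow_step[OF assms, of y a] by (simp add: algebra_simps)
qed

text \<open>The kernels for \<open>i = 1, \<dots>, n\<close> form a curl-free vector field, so the Laplacian of a component is a derivative
of the divergence. The divergence is a multiple of the approximate identity.\<close>

lemma grad_kernel_facts:
  fixes p :: "(real ^ 'n::finite) \<times> real"
  assumes p: "snd p \<noteq> 0" and y: "y \<noteq> 0"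
  shows "(\<Sum>j\<in>UNIV. partial_deriv j (partial_deriv j (grad_kernel i p)) y)
    = partial_deriv i (\<lambda>y. real CARD('n) * ((snd p)\<^sup>2 * rpow (- (real CARD('n) + 2) / 2) p y)) y"
proof -
  have s: "symb 2 {p. snd p \<noteq> 0} (-{0}) rho (\<lambda>p y. rho p y powr (1 + 2 * (- real CARD('n) / 2))) (grad_kernel i)" for i :: 'n
    unfolding grad_kernel_def[abs_def] by (rule symb_coord_rpow[OF open_punctured])
  have c: "cdiff 2 (-{0}) (grad_kernel i p)" for i using symb_cdiff[OF s] p by simp
  have sw: "partial_deriv j (grad_kernel i p) = partial_deriv i (grad_kernel j p)" for i j
    unfolding grad_kernel_def[abs_def] partial_deriv_coord_rpow[OF p, abs_def] by (auto simp: fun_eq_iff)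
  have d: "partial_deriv j (grad_kernel j p) differentiable (at y)" for j
    using c[of j] y by (simp add: numeral_2_eq_2)
  have "(\<Sum>j\<in>UNIV. partial_deriv j (partial_deriv j (grad_kernel i p)) y) = (\<Sum>j\<in>UNIV. partial_deriv j (partial_deriv i (grad_kernel j p)) y)"
    by (simp only: sw[of _ i])
  also have "\<dots> = (\<Sum>j\<in>UNIV. partial_deriv i (partial_deriv j (grad_kernel j p)) y)"
    by (intro sum.cong refl partial_deriv_commute[OF open_punctured c]) (use y in simp)
  also have "\<dots> = partial_deriv i (\<lambda>y. \<Sum>j\<in>UNIV. partial_deriv j (grad_kernel j p) y) y"
    by (rule partial_deriv_sum[symmetric]) (rule d)
  also have "(\<lambda>y. \<Sum>j\<in>UNIV. partial_deriv j (grad_kernel j p) y) = (\<lambda>y. real CARD('n) * ((snd p)\<^sup>2 * rpow (- (real CARD('n) + 2) / 2) p y))"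
  proof
    fix y :: "real ^ 'n"
    have e: "- real CARD('n) / 2 - 1 = - (real CARD('n) + 2) / 2" by (simp add: field_simps)
    show "(\<Sum>j\<in>UNIV. partial_deriv j (grad_kernel j p) y) = real CARD('n) * ((snd p)\<^sup>2 * rpow (- (real CARD('n) + 2) / 2) p y)"
      unfolding grad_kernel_def[abs_def] divergence_coord_rpow[OF p] e by simp
  qed
  finally show ?thesis .
qed

text \<open>Green's formula moves the Laplacian from \<open>g\<close> to the kernel, which produces a derivative of an
approximate identity, and integrating that derivative back by parts gives an approximation of
\<open>partial_deriv i g x\<close>. The bounds \<open>B\<close> and \<open>M\<close> make the integrals converge; the size of the
result is governed by \<open>K\<close>, through the Riesz potential of \<open>\<bar>y\<bar>\<^sup>-\<^sup>2\<close>.\<close>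

lemma gradient_estimate:
  assumes N: "3 \<le> CARD('n::finite)"
  obtains C where "C > 0" "\<And>g :: real ^ 'n \<Rightarrow> real. \<And>B M K i x.
     cdiff 2 (-{0}) g \<Longrightarrow> (\<And>y. y \<noteq> 0 \<Longrightarrow> \<bar>g y\<bar> \<le> B) \<Longrightarrow>
     (\<And>y j. y \<noteq> 0 \<Longrightarrow> \<bar>partial_deriv j g y\<bar> \<le> M / norm y) \<Longrightarrow>
     (\<And>y. y \<noteq> 0 \<Longrightarrow> \<bar>\<Sum>j\<in>UNIV. partial_deriv j (partial_deriv j g) y\<bar> \<le> K / (norm y)\<^sup>2) \<Longrightarrow>
     x \<noteq> 0 \<Longrightarrow> \<bar>partial_deriv i g x\<bar> \<le> C * K / norm x"
proof -
  define n where "n = real CARD('n)"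
  have n: "n \<ge> 3" using N by (simp add: n_def)
  obtain R where R: "R \<ge> 0"
    "\<And>x :: real ^ 'n. x \<noteq> 0 \<Longrightarrow> integrable lborel (\<lambda>y. norm (y - x) powr (1 - n) * norm y powr (-2))"
    "\<And>x :: real ^ 'n. x \<noteq> 0 \<Longrightarrow> (\<integral>y. norm (y - x) powr (1 - n) * norm y powr (-2) \<partial>lborel) \<le> R / norm x"
    using riesz_potential_bound[OF N] unfolding n_def by blast
  define bm where "bm = bump_mass TYPE('n) 2"
  have bm: "bm > 0" unfolding bm_def by (rule bump_mass_pos) simp
  have main: "\<bar>partial_deriv i g x\<bar> \<le> (R / (n * bm)) * K / norm x"
    if g: "cdiff 2 (-{0}) g" and B: "\<And>y. y \<noteq> 0 \<Longrightarrow> \<bar>g y\<bar> \<le> B"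
     and M: "\<And>y j. y \<noteq> 0 \<Longrightarrow> \<bar>partial_deriv j g y\<bar> \<le> M / norm y"
     and K: "\<And>y. y \<noteq> 0 \<Longrightarrow> \<bar>\<Sum>j\<in>UNIV. partial_deriv j (partial_deriv j g) y\<bar> \<le> K / (norm y)\<^sup>2"
     and x: "x \<noteq> 0" for g :: "real ^ 'n \<Rightarrow> real" and B M K i x
  proof -
    let ?G = "\<lambda>y. \<Sum>j\<in>UNIV. partial_deriv j (partial_deriv j g) y"
    have B0: "B \<ge> 0" and M0: "M \<ge> 0" and K0: "K \<ge> 0"
    proof -
      have e: "axis undefined 1 \<noteq> (0 :: real ^ 'n)" "norm (axis undefined 1 :: real ^ 'n) = 1"
        by (simp_all add: axis_eq_0_iff norm_axis_1)
      show "B \<ge> 0" "M \<ge> 0" "K \<ge> 0" using B[OF e(1)] M[OF e(1), of undefined] K[OF e(1)] e(2) by auto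
    qed
    define d where "d m = inverse (real (Suc m))" for m
    have d0: "d m > 0" for m by (simp add: d_def)
    have dl: "d \<longlonglongrightarrow> 0" unfolding d_def[abs_def] by (rule LIMSEQ_inverse_real_of_nat)
    let ?eta = "\<lambda>m y. d m powr 2 * rpow (- (n + 2) / 2) (x, d m) y"
    have est: "\<bar>\<integral>y. partial_deriv i g y * ?eta m y \<partial>lborel\<bar> \<le> K * R / norm x / n" for m
    proof -
      define p where "p = (x, d m)"
      have p: "snd p \<noteq> 0" using d0[of m] by (simp add: p_def)
      let ?k = "grad_kernel i p"
      have "symb 2 {p. snd p \<noteq> 0} (-{0}) rho (\<lambda>p y. rho p y powr (- (n - 1))) (grad_kernel i)"
        using symb_coord_rpow[OF open_punctured, of 2 "- n / 2" i] by (simp add: grad_kernel_def[abs_def] n_def)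
      from symb1_of_kernel[OF this p] have sk: "symb1 2 (\<lambda>y. (1 + norm y) powr (- (n - 1))) ?k" using n by simp
      have "symb 1 {p. snd p \<noteq> 0} (-{0}) rho (\<lambda>p y. rho p y powr (- (n + 2))) (rpow (- (n + 2) / 2) :: _ \<Rightarrow> real ^ 'n \<Rightarrow> real)"
      proof (rule symb_weight_cong[OF symb_rpow[OF open_punctured, of 1 "- (n + 2) / 2"]])
        fix p and y :: "real ^ 'n"
        have h: "2 * (t / 2) = t" for t :: real by simp
        show "rho p y powr (2 * (- (n + 2) / 2)) = rho p y powr (- (n + 2))" by (simp only: h)
      qed
      from symb1_of_kernel[OF this p] have se: "symb1 1 (\<lambda>y. (1 + norm y) powr (- (n + 2))) (rpow (- (n + 2) / 2) p)"
        using n by simp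
      let ?e = "\<lambda>y. n * ((snd p)\<^sup>2 * rpow (- (n + 2) / 2) p y)"
      have se': "symb1 1 (\<lambda>y. (1 + norm y) powr (- (n + 2))) ?e"
        by (intro symb_cmult[OF open_punctured] se)
      have maj: "integrable lborel (majorant a b :: real ^ 'n \<Rightarrow> real)" if "0 \<le> a" "a < n" "n < b" for a b
        by (rule integrable_majorant) (use that in \<open>simp_all add: n_def\<close>)
      have maj2: "integrable lborel (\<lambda>y :: real ^ 'n. c * majorant 2 (n + 1) y)" for c
        using maj[of 2 "n + 1"] n by simp
      have maj1: "integrable lborel (\<lambda>y :: real ^ 'n. c * majorant 1 (n + 3) y)" for c
        using maj[of 1 "n + 3"] n by simp
      have green: "(\<integral>y. ?G y * ?k y \<partial>lborel) = (\<integral>y. g y * (\<Sum>j\<in>UNIV. partial_deriv j (partial_deriv j ?k) y) \<partial>lborel)"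
        and iG: "integrable lborel (\<lambda>y. ?G y * ?k y)"
      proof -
        have b1: "\<bar>g y\<bar> * ((1 + norm y) powr (- (n - 1)) / norm y / norm y) \<le> B * majorant 2 (n + 1) y" if "y \<noteq> 0" for y
        proof -
          have "(1 + norm y) powr (- (n - 1)) / norm y / norm y = norm y powr (-2) * (1 + norm y) powr (- (n - 1))"
            using that by (simp add: powr_minus powr_numeral power2_eq_square field_simps)
          also have "\<dots> \<le> majorant 2 (2 + (n - 1)) y" by (rule weight_le_majorant) (use n that in auto)
          finally have "(1 + norm y) powr (- (n - 1)) / norm y / norm y \<le> majorant 2 (n + 1) y" by (simp add: add.commute)
          then show ?thesis using B[OF that] B0 by (intro mult_mono) auto
        qed
        have b2: "\<bar>?G y\<bar> * (1 + norm y) powr (- (n - 1)) \<le> K * majorant 2 (n + 1) y" if "y \<noteq> 0" for y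
        proof -
          have "\<bar>?G y\<bar> * (1 + norm y) powr (- (n - 1)) \<le> (K * norm y powr (-2)) * (1 + norm y) powr (- (n - 1))"
            using K[OF that] that by (intro mult_right_mono) (auto simp: powr_minus powr_numeral field_simps)
          also have "\<dots> = K * (norm y powr (-2) * (1 + norm y) powr (- (n - 1)))" by simp
          also have "\<dots> \<le> K * majorant 2 (2 + (n - 1)) y" by (intro mult_left_mono weight_le_majorant) (use n that K0 in auto)
          finally show ?thesis by (simp add: add.commute)
        qed
        show "(\<integral>y. ?G y * ?k y \<partial>lborel) = (\<integral>y. g y * (\<Sum>j\<in>UNIV. partial_deriv j (partial_deriv j ?k) y) \<partial>lborel)"
          "integrable lborel (\<lambda>y. ?G y * ?k y)"
          by (rule Green_formula[OF g sk maj2[of B] maj2[of K] b1 b2]; assumption)+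
      qed
      \<comment> \<open>the Laplacian of the kernel is a derivative of the approximate identity, and this derivative is moved back to \<open>g\<close>\<close>
      let ?v = "\<lambda>j y. if j = i then g y else (0::real)"
      have "(\<integral>y. ?G y * ?k y \<partial>lborel) = (\<integral>y. g y * partial_deriv i ?e y \<partial>lborel)"
      proof -
        have ae: "AE y in lborel. g y * (\<Sum>j\<in>UNIV. partial_deriv j (partial_deriv j ?k) y) = g y * partial_deriv i ?e y"
          using AE_nonzero by eventually_elim (simp add: grad_kernel_facts[OF p] n_def)
        have m1: "(\<lambda>y. g y * (\<Sum>j\<in>UNIV. partial_deriv j (partial_deriv j ?k) y)) \<in> borel_measurable lborel"
          using symb1_cdiff[OF sk] cdiff_continuous[OF g]
          by (auto intro!: borel_measurable_punctured continuous_intros simp: numeral_2_eq_2)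
        have "continuous_on (-{0}) (partial_deriv i ?e)" using symb1_cdiff[OF se'] by simp
        then have m2: "(\<lambda>y. g y * partial_deriv i ?e y) \<in> borel_measurable lborel"
          using borel_measurable_punctured[OF continuous_on_mult[OF cdiff_continuous[OF g]]] by simp
        show ?thesis by (rule trans[OF green integral_cong_AE[OF m1 m2 ae]])
      qed
      also have "\<dots> = - (\<integral>y. partial_deriv i g y * ?e y \<partial>lborel)"
      proof (rule by_parts_decay[OF _ se' maj1[of B] maj1[of M]])
        show "cdiff 1 (-{0}) g" by (rule cdiff_le[OF g]) simp
        fix y :: "real ^ 'n" assume y: "y \<noteq> 0"
        have w: "norm y powr (-1) * (1 + norm y) powr (- (n + 2)) \<le> majorant 1 (n + 3) y"
          using weight_le_majorant[of "n + 2" y 1] n y by (simp add: add.commute)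
        have "\<bar>g y\<bar> * ((1 + norm y) powr (- (n + 2)) / norm y) = \<bar>g y\<bar> * (norm y powr (-1) * (1 + norm y) powr (- (n + 2)))"
          using y by (simp add: powr_minus field_simps)
        also have "\<dots> \<le> B * majorant 1 (n + 3) y" using B[OF y] w B0 by (intro mult_mono) auto
        finally show "\<bar>g y\<bar> * ((1 + norm y) powr (- (n + 2)) / norm y) \<le> B * majorant 1 (n + 3) y" .
        have "\<bar>partial_deriv i g y\<bar> * (1 + norm y) powr (- (n + 2)) \<le> (M * norm y powr (-1)) * (1 + norm y) powr (- (n + 2))"
          using M[OF y, of i] y by (intro mult_right_mono) (auto simp: powr_minus field_simps)
        also have "\<dots> = M * (norm y powr (-1) * (1 + norm y) powr (- (n + 2)))" by simp
        also have "\<dots> \<le> M * majorant 1 (n + 3) y" by (intro mult_left_mono w M0)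
        finally show "\<bar>partial_deriv i g y\<bar> * (1 + norm y) powr (- (n + 2)) \<le> M * majorant 1 (n + 3) y" .
      qed
      finally have eq: "(\<integral>y. ?G y * ?k y \<partial>lborel) = - (\<integral>y. partial_deriv i g y * ?e y \<partial>lborel)" .
      have kb: "\<bar>?G y * ?k y\<bar> \<le> K * (norm (y - x) powr (1 - n) * norm y powr (-2))" if y: "y \<noteq> 0" for y
      proof -
        have "\<bar>?k y\<bar> \<le> norm (y - x) powr (1 - n)"
        proof (cases "y = x")
          case True
          then show ?thesis by (simp add: grad_kernel_def p_def)
        next
          case False
          then have r: "norm (y - x) > 0" by simp
          have "rpow (- n / 2) p y \<le> ((norm (y - x))\<^sup>2) powr (- n / 2)"
            unfolding rpow_def using r n by (intro powr_mono2') (auto simp: rsq_def p_def)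
          also have "\<dots> = norm (y - x) powr (- n)" using r by (simp add: powr_powr flip: powr_numeral)
          finally have "\<bar>(y - x) $ i\<bar> * rpow (- n / 2) p y \<le> norm (y - x) powr 1 * norm (y - x) powr (- n)"
            using r component_le_norm_cart[of "y - x" i] by (intro mult_mono) (auto simp: rpow_def)
          also have "\<dots> = norm (y - x) powr (1 - n)" by (simp only: powr_add[symmetric]) simp
          finally show ?thesis
            by (simp add: grad_kernel_def abs_mult n_def p_def rpow_def)
        qed
        moreover have "\<bar>?G y\<bar> \<le> K * norm y powr (-2)"
          using K[OF y] y by (simp add: powr_minus powr_numeral field_simps)
        ultimately have "\<bar>?G y\<bar> * \<bar>?k y\<bar> \<le> K * norm y powr (-2) * norm (y - x) powr (1 - n)"
          using K0 by (intro mult_mono) auto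
        then show ?thesis by (simp add: abs_mult mult_ac)
      qed
      have "\<bar>\<integral>y. ?G y * ?k y \<partial>lborel\<bar> \<le> (\<integral>y. \<bar>?G y * ?k y\<bar> \<partial>lborel)" by simp
      also have "\<dots> \<le> (\<integral>y. K * (norm (y - x) powr (1 - n) * norm y powr (-2)) \<partial>lborel)"
      proof (rule integral_mono_AE[OF integrable_abs[OF iG] integrable_mult_right[OF R(2)[OF x]]])
        show "AE y in lborel. \<bar>?G y * ?k y\<bar> \<le> K * (norm (y - x) powr (1 - n) * norm y powr (-2))"
          using AE_nonzero by eventually_elim (rule kb)
      qed
      also have "\<dots> = K * (\<integral>y. norm (y - x) powr (1 - n) * norm y powr (-2) \<partial>lborel)" by simp
      also have "\<dots> \<le> K * (R / norm x)" by (intro mult_left_mono R(3)[OF x] K0)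
      finally have "\<bar>\<integral>y. partial_deriv i g y * ?e y \<partial>lborel\<bar> \<le> K * (R / norm x)" unfolding eq by simp
      moreover have "(\<integral>y. partial_deriv i g y * ?e y \<partial>lborel) = n * (\<integral>y. partial_deriv i g y * ?eta m y \<partial>lborel)"
      proof -
        have "(\<lambda>y. partial_deriv i g y * ?e y) = (\<lambda>y. n * (partial_deriv i g y * ?eta m y))"
          using d0[of m] by (simp add: p_def fun_eq_iff powr_numeral)
        then show ?thesis by simp
      qed
      ultimately have nle: "n * \<bar>\<integral>y. partial_deriv i g y * ?eta m y \<partial>lborel\<bar> \<le> K * R / norm x"
        using n by (simp add: abs_mult)
      have n0: "0 < n" using n by simp
      show ?thesis by (rule mult_imp_le_div_pos[OF n0]) (subst mult.commute, rule nle)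
    qed
    have "(\<lambda>m. \<integral>y. partial_deriv i g y * ?eta m y \<partial>lborel) \<longlonglongrightarrow> partial_deriv i g x * bm"
      unfolding n_def bm_def
    proof (rule approximate_identity[OF _ _ _ x _ dl d0])
      have "cdiff 1 (-{0}) g" by (rule cdiff_le[OF g]) simp
      then show "continuous_on (-{0}) (partial_deriv i g)" by simp
      show "\<bar>partial_deriv i g y\<bar> \<le> M / norm y" if "y \<noteq> 0" for y using M[OF that] .
    qed (use N in auto)
    then have "(\<lambda>m. \<bar>\<integral>y. partial_deriv i g y * ?eta m y \<partial>lborel\<bar>) \<longlonglongrightarrow> \<bar>partial_deriv i g x * bm\<bar>"
      by (rule tendsto_rabs)
    then have "\<bar>partial_deriv i g x * bm\<bar> \<le> K * R / norm x / n"
      by (rule LIMSEQ_le_const2) (use est in blast)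
    then have "\<bar>partial_deriv i g x\<bar> \<le> K * R / norm x / n / bm"
      using mult_imp_le_div_pos[OF bm] bm by (simp only: abs_mult abs_of_pos)
    then show ?thesis by (simp add: field_simps)
  qed
  have K0: "K \<ge> 0" if "\<And>y. y \<noteq> 0 \<Longrightarrow> \<bar>f y\<bar> \<le> K / (norm y)\<^sup>2" for f :: "real ^ 'n \<Rightarrow> real" and K
    using that[of "axis undefined 1"] by (simp add: axis_eq_0_iff norm_axis_1)
  show ?thesis
  proof (rule that[of "R / (n * bm) + 1"])
    show "R / (n * bm) + 1 > 0" using R(1) n bm by (intro add_nonneg_pos divide_nonneg_pos mult_pos_pos) auto
    fix g :: "real ^ 'n \<Rightarrow> real" and B M K and i and x :: "real ^ 'n"
    assume a: "cdiff 2 (-{0}) g" "\<And>y. y \<noteq> 0 \<Longrightarrow> \<bar>g y\<bar> \<le> B"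
     "\<And>y j. y \<noteq> 0 \<Longrightarrow> \<bar>partial_deriv j g y\<bar> \<le> M / norm y"
     "\<And>y. y \<noteq> 0 \<Longrightarrow> \<bar>\<Sum>j\<in>UNIV. partial_deriv j (partial_deriv j g) y\<bar> \<le> K / (norm y)\<^sup>2" "x \<noteq> 0"
    have "\<bar>partial_deriv i g x\<bar> \<le> (R / (n * bm)) * K / norm x" by (rule main[OF a])
    also have "\<dots> \<le> (R / (n * bm) + 1) * K / norm x"
      using K0[OF a(4)] by (intro divide_right_mono mult_right_mono) auto
    finally show "\<bar>partial_deriv i g x\<bar> \<le> (R / (n * bm) + 1) * K / norm x" .
  qed
qed

section \<open>Weak solutions of the linear system\<close>

lemma symb_punctured_bound:
  assumes "symb k UNIV (-{0}) L W f"
  obtains C where "C \<ge> 0" "\<And>m y. y \<noteq> 0 \<Longrightarrow> \<bar>f m y\<bar> \<le> C * W m y"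
  using symb_bound[OF assms] that by (metis ComplI UNIV_I singletonD)

lemma symb_partialD:
  "symb k P S L W f \<Longrightarrow> k = Suc l \<Longrightarrow> symb l P S L (\<lambda>p y. W p y / L p y) (\<lambda>p. partial_deriv i (f p))"
  by simp

lemma cdiff_partialD: "cdiff k S f \<Longrightarrow> k = Suc l \<Longrightarrow> cdiff l S (partial_deriv i f)"
  by simp

lemma cdiff_differentiableD: "cdiff k S f \<Longrightarrow> k = Suc l \<Longrightarrow> x \<in> S \<Longrightarrow> f differentiable (at x)"
  by simp

text \<open>The integrand of the weak form of \<open>\<Delta>w = div H + \<nabla>q\<close>. The pressure \<open>q\<close> is absent, since it is
invisible to solenoidal test fields.\<close>

definition weak_term :: "('n::finite \<Rightarrow> real ^ 'n \<Rightarrow> real) \<Rightarrow> ('n \<Rightarrow> 'n \<Rightarrow> real ^ 'n \<Rightarrow> real) \<Rightarrow>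
    ('n \<Rightarrow> real ^ 'n \<Rightarrow> real) \<Rightarrow> real ^ 'n \<Rightarrow> real" where
  "weak_term w H \<phi> y = (\<Sum>j\<in>UNIV. w j y * (\<Sum>l\<in>UNIV. partial_deriv l (partial_deriv l (\<phi> j)) y))
     + (\<Sum>j\<in>UNIV. \<Sum>k\<in>UNIV. H j k y * partial_deriv j (\<phi> k) y)"

definition annihilates :: "('n::finite \<Rightarrow> real ^ 'n \<Rightarrow> real) \<Rightarrow> ('n \<Rightarrow> 'n \<Rightarrow> real ^ 'n \<Rightarrow> real) \<Rightarrow>
    ('n \<Rightarrow> real ^ 'n \<Rightarrow> real) \<Rightarrow> bool" where
  "annihilates w H \<phi> \<longleftrightarrow> integrable lborel (weak_term w H \<phi>) \<and> integral\<^sup>L lborel (weak_term w H \<phi>) = 0"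

definition weak_solution :: "('n::finite \<Rightarrow> real ^ 'n \<Rightarrow> real) \<Rightarrow> ('n \<Rightarrow> 'n \<Rightarrow> real ^ 'n \<Rightarrow> real) \<Rightarrow> bool" where
  "weak_solution w H \<longleftrightarrow> (\<forall>\<phi>. (\<forall>j. cdiff 2 (-{0}) (\<phi> j)) \<and> (\<forall>j. annular (\<phi> j)) \<and>
      (\<forall>y. y \<noteq> 0 \<longrightarrow> (\<Sum>j\<in>UNIV. partial_deriv j (\<phi> j) y) = 0) \<longrightarrow> annihilates w H \<phi>)"

definition div_pot :: "('n::finite \<Rightarrow> 'n \<Rightarrow> real ^ 'n \<Rightarrow> real) \<Rightarrow> 'n \<Rightarrow> real ^ 'n \<Rightarrow> real" where
  "div_pot A j y = (\<Sum>k\<in>UNIV. partial_deriv k (A k j) y)"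

text \<open>Near the origin the divergence of this potential is the constant field \<open>(n - 1) *\<^sub>R e\<close>. Testing a solution with it
measures the momentum that is created at the origin, in the direction \<open>e\<close>.\<close>

definition flux_pot :: "('n::finite \<Rightarrow> real) \<Rightarrow> 'n \<Rightarrow> 'n \<Rightarrow> real ^ 'n \<Rightarrow> real" where
  "flux_pot e k j y = cutoff y * (y $ k * e j - y $ j * e k)"

definition zero_flux :: "('n::finite \<Rightarrow> real ^ 'n \<Rightarrow> real) \<Rightarrow> ('n \<Rightarrow> 'n \<Rightarrow> real ^ 'n \<Rightarrow> real) \<Rightarrow> bool" where
  "zero_flux w H \<longleftrightarrow> (\<forall>e. annihilates w H (div_pot (flux_pot e)))"

lemma weak_term_cong:
  assumes "open S" "y \<in> S" "\<And>j z. z \<in> S \<Longrightarrow> \<phi> j z = \<psi> j z"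
  shows "weak_term w H \<phi> y = weak_term w H \<psi> y"
  unfolding weak_term_def
  using partial_deriv_cong2[OF assms(1,3,2)] partial_deriv_cong[OF assms(1,2,3)] by simp

lemma weak_term_add:
  assumes "\<And>j. cdiff 2 (-{0}) (\<phi> j)" "\<And>j. cdiff 2 (-{0}) (\<psi> j)" "y \<noteq> 0"
  shows "weak_term w H (\<lambda>j z. \<phi> j z + \<psi> j z) y = weak_term w H \<phi> y + weak_term w H \<psi> y"
proof -
  have d: "\<phi> j differentiable (at z)" "\<psi> j differentiable (at z)"
     "partial_deriv l (\<phi> j) differentiable (at z)" "partial_deriv l (\<psi> j) differentiable (at z)" if "z \<noteq> 0" for j l z
    using assms(1)[of j] assms(2)[of j] that by (simp_all add: numeral_2_eq_2)
  have 1: "partial_deriv l (\<lambda>z. \<phi> j z + \<psi> j z) z = partial_deriv l (\<phi> j) z + partial_deriv l (\<psi> j) z" if "z \<noteq> 0" for j l z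
    using partial_deriv_add d that by blast
  have 2: "partial_deriv l (partial_deriv l (\<lambda>z. \<phi> j z + \<psi> j z)) y = partial_deriv l (partial_deriv l (\<phi> j)) y + partial_deriv l (partial_deriv l (\<psi> j)) y" for j l
  proof -
    have "partial_deriv l (partial_deriv l (\<lambda>z. \<phi> j z + \<psi> j z)) y = partial_deriv l (\<lambda>z. partial_deriv l (\<phi> j) z + partial_deriv l (\<psi> j) z) y"
      by (rule partial_deriv_cong[OF open_punctured]) (use assms(3) 1 in auto)
    then show ?thesis using partial_deriv_add[OF d(3)[OF assms(3)] d(4)[OF assms(3)], of l] by simp
  qed
  show ?thesis unfolding weak_term_def 2 1[OF assms(3)]
    by (simp add: sum.distrib distrib_left)
qed

context
  fixes w :: "'n::finite \<Rightarrow> real ^ 'n \<Rightarrow> real" and H :: "'n \<Rightarrow> 'n \<Rightarrow> real ^ 'n \<Rightarrow> real"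
  assumes w0: "\<And>j. symb1 0 (\<lambda>y. 1 / norm y) (w j)"
    and H0: "\<And>j k. symb1 0 (\<lambda>y. 1 / norm y / norm y) (H j k)"
begin

lemma weak_term_symb:
  fixes \<phi> :: "'n \<Rightarrow> 'p \<Rightarrow> real ^ 'n \<Rightarrow> real"
  assumes p: "\<And>j. symb 2 P (-{0}) (\<lambda>_. norm) (\<lambda>_. V) (\<phi> j)"
  shows "symb 0 P (-{0}) (\<lambda>_. norm) (\<lambda>_ y. V y / norm y / norm y / norm y) (\<lambda>p. weak_term w H (\<lambda>j. \<phi> j p))"
proof -
  have w1: "symb 0 P (-{0}) (\<lambda>_. norm) (\<lambda>_ y. 1 / norm y) (\<lambda>_. w j)" for j
    by (rule symb_reparam[OF w0, of P "\<lambda>_. ()"]) simp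
  have H1: "symb 0 P (-{0}) (\<lambda>_. norm) (\<lambda>_ y. 1 / norm y / norm y) (\<lambda>_. H j k)" for j k
    by (rule symb_reparam[OF H0, of P "\<lambda>_. ()"]) simp
  have p1: "symb 1 P (-{0}) (\<lambda>_. norm) (\<lambda>_ y. V y / norm y) (\<lambda>p. partial_deriv i (\<phi> j p))" for i j
    by (rule symb_partialD[OF p]) simp
  have p2: "symb 0 P (-{0}) (\<lambda>_. norm) (\<lambda>_ y. V y / norm y / norm y) (\<lambda>p. partial_deriv l (partial_deriv i (\<phi> j p)))" for i j l
    by (rule symb_partialD[OF p1]) simp
  have a: "symb 0 P (-{0}) (\<lambda>_. norm) (\<lambda>_ y. V y / norm y / norm y / norm y) (\<lambda>p y. w j y * (\<Sum>l\<in>UNIV. partial_deriv l (partial_deriv l (\<phi> j p)) y))" for j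
    by (rule symb_weight_cong[OF symb_mult[OF open_punctured w1 symb_sum[OF open_punctured finite_class.finite_UNIV p2]]]) simp
  have b: "symb 0 P (-{0}) (\<lambda>_. norm) (\<lambda>_ y. V y / norm y / norm y / norm y) (\<lambda>p y. H j k y * partial_deriv j (\<phi> k p) y)" for j k
    by (rule symb_weight_cong[OF symb_mult[OF open_punctured H1 symb_le[OF p1]]]) simp_all
  show ?thesis unfolding weak_term_def[abs_def]
    by (intro symb_add[OF open_punctured] symb_sum[OF open_punctured finite_class.finite_UNIV] a b)
qed

end

lemma div_pot_symb:
  fixes A :: "'n::finite \<Rightarrow> 'n \<Rightarrow> 'p \<Rightarrow> real ^ 'n \<Rightarrow> real"
  assumes "open S" "\<And>k j. symb m P S L W (A k j)" "m = Suc l"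
  shows "symb l P S L (\<lambda>p y. W p y / L p y) (\<lambda>p. div_pot (\<lambda>k j. A k j p) j)"
  unfolding div_pot_def[abs_def]
  by (intro symb_sum[OF assms(1) finite_class.finite_UNIV] symb_partialD[OF assms(2,3)])

lemma div_pot_cdiff:
  assumes "open S" "\<And>k j. cdiff (Suc l) S (A k j)"
  shows "cdiff l S (div_pot A j)"
  unfolding div_pot_def[abs_def] by (intro cdiff_sum[OF assms(1) finite_class.finite_UNIV] cdiff_partialD[OF assms(2)] refl)

lemma div_pot_annular: "(\<And>k j. annular (A k j)) \<Longrightarrow> annular (div_pot A j)"
  unfolding div_pot_def[abs_def] by (intro annular_sum annular_partial) auto

lemma div_pot_divergence_free:
  fixes A :: "'n::finite \<Rightarrow> 'n \<Rightarrow> real ^ 'n \<Rightarrow> real"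
  assumes S: "open S" "y \<in> S" and A: "\<And>k j. cdiff 2 S (A k j)" and anti: "\<And>k j z. A k j z = - A j k z"
  shows "(\<Sum>j\<in>UNIV. partial_deriv j (div_pot A j) y) = 0"
proof -
  have d1: "partial_deriv k (A k j) differentiable (at y)" for k j
    using A[of k j] S(2) by (simp add: numeral_2_eq_2)
  have d: "A k j differentiable (at z)" if "z \<in> S" for k j z
    using A[of k j] that by (simp add: numeral_2_eq_2)
  have dd: "(\<lambda>z. \<Sum>k\<in>UNIV. partial_deriv k (A k j) z) = div_pot A j" for j
    by (simp add: div_pot_def fun_eq_iff)
  have T: "(\<Sum>j\<in>UNIV. partial_deriv j (div_pot A j) y) = (\<Sum>j\<in>UNIV. \<Sum>k\<in>UNIV. partial_deriv j (partial_deriv k (A k j)) y)"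
    unfolding dd[symmetric] by (intro sum.cong refl partial_deriv_sum d1)
  have sw: "partial_deriv k (partial_deriv j (A j k)) y = - partial_deriv j (partial_deriv k (A k j)) y" for j k
  proof -
    have "partial_deriv j (A j k) z = - partial_deriv j (A k j) z" if "z \<in> S" for z
    proof -
      have "A j k = (\<lambda>z. - A k j z)" by (rule ext) (rule anti)
      then show ?thesis using partial_deriv_minus[OF d[OF that], of j k j] by simp
    qed
    then have "partial_deriv k (partial_deriv j (A j k)) y = partial_deriv k (\<lambda>z. - partial_deriv j (A k j) z) y"
      by (intro partial_deriv_cong[OF S])
    also have "\<dots> = - partial_deriv k (partial_deriv j (A k j)) y"
      by (rule partial_deriv_minus) (use A[of k j] S in \<open>simp add: numeral_2_eq_2\<close>)
    finally show ?thesis using partial_deriv_commute[OF S(1) A S(2), of k j k j] by simp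
  qed
  have "(\<Sum>j\<in>UNIV. \<Sum>k\<in>UNIV. partial_deriv j (partial_deriv k (A k j)) y) = (\<Sum>k\<in>UNIV. \<Sum>j\<in>UNIV. partial_deriv j (partial_deriv k (A k j)) y)"
    by (rule sum.swap)
  also have "\<dots> = (\<Sum>j\<in>UNIV. \<Sum>k\<in>UNIV. - partial_deriv j (partial_deriv k (A k j)) y)"
    by (intro sum.cong refl sw)
  also have "\<dots> = - (\<Sum>j\<in>UNIV. \<Sum>k\<in>UNIV. partial_deriv j (partial_deriv k (A k j)) y)"
    by (simp add: sum_negf)
  finally show ?thesis using T by linarith
qed

lemma annihilates_add:
  assumes "annihilates w H \<phi>" "annihilates w H \<psi>"
    and "\<And>j. cdiff 2 (-{0}) (\<phi> j)" "\<And>j. cdiff 2 (-{0}) (\<psi> j)"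
    and "\<And>j y. y \<noteq> 0 \<Longrightarrow> \<theta> j y = \<phi> j y + \<psi> j y" "weak_term w H \<theta> \<in> borel_measurable borel"
  shows "annihilates w H \<theta>"
proof -
  have e: "AE y in lborel. weak_term w H \<phi> y + weak_term w H \<psi> y = weak_term w H \<theta> y"
    using AE_nonzero
  proof eventually_elim
    case (elim y)
    have "weak_term w H \<theta> y = weak_term w H (\<lambda>j z. \<phi> j z + \<psi> j z) y"
      by (rule weak_term_cong[OF open_punctured]) (use elim assms(5) in auto)
    then show ?case using weak_term_add[OF assms(3,4) elim] by simp
  qed
  have i: "integrable lborel (weak_term w H \<phi>)" "integrable lborel (weak_term w H \<psi>)"
    using assms by (auto simp: annihilates_def)
  have m: "weak_term w H \<theta> \<in> borel_measurable lborel" using assms(6) by simp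
  have "integrable lborel (weak_term w H \<theta>)"
    using integrable_cong_AE_imp[OF Bochner_Integration.integrable_add[OF i] m] e
    by (simp add: eq_commute)
  moreover have "integral\<^sup>L lborel (weak_term w H \<theta>) = (\<integral>y. weak_term w H \<phi> y + weak_term w H \<psi> y \<partial>lborel)"
    by (rule integral_cong_AE[OF m]) (use i e in \<open>auto simp: eq_commute\<close>)
  ultimately show ?thesis using assms(1,2) i by (simp add: annihilates_def)
qed

text \<open>Test fields \<open>div_pot A\<close> that are not supported away from the origin are admissible as long as the
  potential \<open>A\<close> is small at the origin: the cutoff is applied to the potential, so the truncated
  fields stay divergence free.\<close>

lemma annihilates_div_pot:
  fixes A :: "'n::finite \<Rightarrow> 'n \<Rightarrow> real ^ 'n \<Rightarrow> real"
  assumes w0: "\<And>j. symb1 0 (\<lambda>y. 1 / norm y) (w j)"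
    and H0: "\<And>j k. symb1 0 (\<lambda>y. 1 / norm y / norm y) (H j k)"
    and weak: "weak_solution w H"
    and A: "\<And>k j. symb1 3 W (A k j)" and anti: "\<And>k j z. A k j z = - A j k z"
    and g: "integrable lborel g" "\<And>y. y \<noteq> 0 \<Longrightarrow> W y / norm y / norm y / norm y / norm y \<le> g y"
  shows "annihilates w H (div_pot A)" "weak_term w H (div_pot A) \<in> borel_measurable borel"
proof -
  let ?A = "\<lambda>k j m y. chi m y * A k j y"
  let ?\<phi> = "\<lambda>j m. div_pot (\<lambda>k j. ?A k j m) j"
  let ?V = "\<lambda>y. W y / norm y / norm y / norm y / norm y"
  have sA: "symb 3 UNIV (-{0}) (\<lambda>_. norm) (\<lambda>_. W) (?A k j)" for k j
    by (rule symb_chi_mult[OF A]) simp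
  have s\<phi>: "symb 2 UNIV (-{0}) (\<lambda>_. norm) (\<lambda>_ y. W y / norm y) (?\<phi> j)" for j
    by (rule div_pot_symb[OF open_punctured sA]) simp
  have sF: "symb 0 UNIV (-{0}) (\<lambda>_. norm) (\<lambda>_. ?V) (\<lambda>m. weak_term w H (\<lambda>j. ?\<phi> j m))"
    by (rule weak_term_symb[OF w0 H0 s\<phi>])
  have s\<phi>1: "symb1 2 (\<lambda>y. W y / norm y) (div_pot A j)" for j
    by (rule div_pot_symb[OF open_punctured A]) simp
  have sF1: "symb1 0 ?V (weak_term w H (div_pot A))"
    by (rule weak_term_symb[OF w0 H0 s\<phi>1])
  have null: "annihilates w H (\<lambda>j. ?\<phi> j m)" for m
  proof -
    have c: "cdiff 3 (-{0}) (?A k j m)" for k j by (rule symb_cdiff[OF sA UNIV_I])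
    have "\<forall>j. cdiff 2 (-{0}) (?\<phi> j m)" using symb_cdiff[OF s\<phi> UNIV_I] by blast
    moreover have "annular (?A k j m)" for k j
      using annular_mult[OF annular_chi, of "A k j" m] by (simp add: mult.commute)
    then have "\<forall>j. annular (?\<phi> j m)" by (intro allI div_pot_annular)
    moreover have "\<forall>y. y \<noteq> 0 \<longrightarrow> (\<Sum>j\<in>UNIV. partial_deriv j (?\<phi> j m) y) = 0"
    proof (intro allI impI)
      fix y :: "real ^ 'n" assume "y \<noteq> 0"
      then show "(\<Sum>j\<in>UNIV. partial_deriv j (?\<phi> j m) y) = 0"
        by (intro div_pot_divergence_free[OF open_punctured] cdiff_le[OF c])
           (auto simp: anti[symmetric] simp flip: mult_minus_right)
    qed
    ultimately show ?thesis using weak unfolding weak_solution_def by blast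
  qed
  obtain C where C: "C \<ge> 0" "\<And>m y. y \<noteq> 0 \<Longrightarrow> \<bar>weak_term w H (\<lambda>j. ?\<phi> j m) y\<bar> \<le> C * ?V y"
    using symb_punctured_bound[OF sF] by blast
  have bd: "\<bar>weak_term w H (\<lambda>j. ?\<phi> j m) y\<bar> \<le> C * g y" if "y \<noteq> 0" for m y
    using order_trans[OF C(2)[OF that] mult_left_mono[OF g(2)[OF that] C(1)]] .
  have m: "weak_term w H (\<lambda>j. ?\<phi> j m) \<in> borel_measurable borel" for m
    using symb_cdiff[OF sF UNIV_I, of m] by (intro borel_measurable_punctured) simp
  show m': "weak_term w H (div_pot A) \<in> borel_measurable borel"
    using symb1_cdiff[OF sF1] by (intro borel_measurable_punctured) simp
  have li: "(\<lambda>m. weak_term w H (\<lambda>j. ?\<phi> j m) y) \<longlonglongrightarrow> weak_term w H (div_pot A) y" if "y \<noteq> 0" for y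
  proof (rule tendsto_chi[OF that])
    fix m S assume S: "open S" "y \<in> S" "\<And>z. z \<in> S \<Longrightarrow> chi m z = 1"
    show "weak_term w H (\<lambda>j. ?\<phi> j m) y = weak_term w H (div_pot A) y"
    proof (rule weak_term_cong[OF S(1,2)])
      fix j z assume z: "z \<in> S"
      have "partial_deriv k (?A k j m) z = partial_deriv k (A k j) z" for k
        by (rule partial_deriv_cong[OF S(1) z]) (simp add: S(3))
      then show "?\<phi> j m z = div_pot A j z" by (simp add: div_pot_def)
    qed
  qed
  note dc = dominated_convergence_punctured[OF integrable_mult_right[OF g(1)] m m' bd li]
  have "(\<lambda>m. 0) \<longlonglongrightarrow> integral\<^sup>L lborel (weak_term w H (div_pot A))"
    using dc(1) null by (simp add: annihilates_def)
  then show "annihilates w H (div_pot A)"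
    using dc(2) by (simp add: annihilates_def LIMSEQ_const_iff)
qed

lemma symb1_coord: "symb1 k norm (\<lambda>y :: real ^ 'n::finite. y $ i)"
proof (cases k)
  case (Suc m)
  have 1: "partial_deriv j (\<lambda>y::real^'n. y $ i) = (\<lambda>y. if j = i then 1 else 0)" for j
    by (auto simp: fun_eq_iff)
  have "symb1 m (\<lambda>y. norm y / norm y) (\<lambda>y::real^'n. if j = i then 1 else 0)" for j
    by (rule symb_weight_cong[OF symb_const[of _ _ 1]]) auto
  moreover have "\<exists>C\<ge>0. \<forall>y :: real ^ 'n. \<bar>y $ i\<bar> \<le> C * norm y"
    using component_le_norm_cart by (intro exI[of _ 1]) auto
  ultimately show ?thesis using Suc 1 by auto
next
  case 0
  have "\<exists>C\<ge>0. \<forall>y :: real ^ 'n. \<bar>y $ i\<bar> \<le> C * norm y"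
    using component_le_norm_cart by (intro exI[of _ 1]) auto
  then show ?thesis using 0 by (auto intro: continuous_intros)
qed

lemma flux_pot_symb:
  "symb1 3 (\<lambda>y. indicator (cball 0 2) y * norm y) (flux_pot e k j)"
  unfolding flux_pot_def[abs_def]
  by (rule symb_mult[OF open_punctured symb_cutoff symb_diff[OF open_punctured]])
     (use symb_cmult[OF open_punctured symb1_coord] in \<open>simp_all add: mult.commute[of "_ $ _"]\<close>)

lemma flux_pot_antisym: "flux_pot e k j y = - flux_pot e j k y"
  by (simp add: flux_pot_def algebra_simps)

text \<open>The potential is \<open>O(norm y)\<close> at the origin, so the weak form of the system is \<open>O(1 / norm y ^ 3)\<close> there. This is
integrable for \<open>n \<ge> 4\<close>, and the test field may be cut off at the origin.\<close>

lemma zero_flux_of_dim_ge_4: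
  fixes w :: "'n::finite \<Rightarrow> real ^ 'n \<Rightarrow> real"
  assumes N: "4 \<le> CARD('n)"
    and w0: "\<And>j. symb1 0 (\<lambda>y. 1 / norm y) (w j)"
    and H0: "\<And>j k. symb1 0 (\<lambda>y. 1 / norm y / norm y) (H j k)"
    and weak: "weak_solution w H"
  shows "zero_flux w H"
  unfolding zero_flux_def
proof
  fix e
  let ?n = "real CARD('n)"
  have g: "integrable lborel (\<lambda>y :: real ^ 'n. 2 powr (?n - 2) * majorant 3 (?n + 1) y)"
    by (intro integrable_mult_right integrable_majorant) (use N in auto)
  have b: "indicator (cball 0 2) y * norm y / norm y / norm y / norm y / norm y \<le> 2 powr (?n - 2) * majorant 3 (?n + 1) y"
    if y: "y \<noteq> 0" for y :: "real ^ 'n"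
  proof -
    have e: "indicator (cball 0 2) y * norm y / norm y / norm y / norm y / norm y = indicator (cball 0 2) y * norm y powr (-3)"
      using y by (simp add: powr_minus powr_numeral power3_eq_cube field_simps)
    show ?thesis
    proof (cases "norm y < 1")
      case True
      have "1 * norm y powr (-3) \<le> 2 powr (?n - 2) * norm y powr (-3)"
        using N by (intro mult_right_mono ge_one_powr_ge_zero) auto
      then show ?thesis unfolding e using True by (simp add: majorant_near)
    next
      case False
      have "norm y powr (-3) = norm y powr (?n - 2) * norm y powr (- (?n + 1))" by (simp add: powr_add[symmetric])
      also have "\<dots> \<le> 2 powr (?n - 2) * norm y powr (- (?n + 1))" if "norm y \<le> 2"
        using that N by (intro mult_right_mono powr_mono2) auto
      finally show ?thesis unfolding e using False by (auto simp: majorant_far indicator_def)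
    qed
  qed
  show "annihilates w H (div_pot (flux_pot e))"
    by (rule annihilates_div_pot(1)[OF w0 H0 weak flux_pot_symb flux_pot_antisym g b])
qed

lemma div_pot_add:
  assumes "\<And>k j. A k j differentiable (at y)" "\<And>k j. B k j differentiable (at y)"
    and "open S" "y \<in> S" "\<And>k j z. z \<in> S \<Longrightarrow> C k j z = A k j z + B k j z"
  shows "div_pot C j y = div_pot A j y + div_pot B j y"
proof -
  have "partial_deriv k (C k j) y = partial_deriv k (A k j) y + partial_deriv k (B k j) y" for k
  proof -
    have "partial_deriv k (C k j) y = partial_deriv k (\<lambda>z. A k j z + B k j z) y"
      by (rule partial_deriv_cong[OF assms(3,4)]) (rule assms(5))
    also have "\<dots> = partial_deriv k (A k j) y + partial_deriv k (B k j) y"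
      by (rule partial_deriv_add[OF assms(1,2)])
    finally show ?thesis .
  qed
  then show ?thesis by (simp add: div_pot_def sum.distrib)
qed

definition affine_pot :: "('n::finite \<Rightarrow> 'n \<Rightarrow> real) \<Rightarrow> ('n \<Rightarrow> 'n \<Rightarrow> 'n \<Rightarrow> real) \<Rightarrow> 'n \<Rightarrow> 'n \<Rightarrow> real ^ 'n \<Rightarrow> real" where
  "affine_pot a b k j y = a k j + (\<Sum>m\<in>UNIV. b k j m * y $ m)"

lemma affine_pot_partial: "partial_deriv l (affine_pot a b k j) y = b k j l"
  "affine_pot a b k j differentiable (at y)"
proof -
  have d: "(\<lambda>y. b k j m * y $ m) differentiable (at y)" for m and y :: "real ^ 'a" by simp
  have s: "(\<lambda>y :: real ^ 'a. \<Sum>m\<in>UNIV. b k j m * y $ m) differentiable (at y)" by simp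
  have "partial_deriv l (affine_pot a b k j) y = partial_deriv l (\<lambda>y. \<Sum>m\<in>UNIV. b k j m * y $ m) y"
    using partial_deriv_add[of "\<lambda>_. a k j" y "\<lambda>y. \<Sum>m\<in>UNIV. b k j m * y $ m" l] s
    by (simp add: affine_pot_def[abs_def])
  also have "\<dots> = (\<Sum>m\<in>UNIV. b k j m * (if l = m then 1 else 0))"
    using partial_deriv_sum[of UNIV "\<lambda>m y. b k j m * y $ m" y l] d
    by (simp add: partial_deriv_cmult)
  finally show "partial_deriv l (affine_pot a b k j) y = b k j l" by (simp add: if_distrib cong: if_cong)
  show "affine_pot a b k j differentiable (at y)" using s by (simp add: affine_pot_def[abs_def])
qed

lemma affine_pot_cdiff: "cdiff m UNIV (affine_pot a b k j)"
  unfolding affine_pot_def[abs_def] by (intro cdiff_add cdiff_sum cdiff_cmult) auto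

text \<open>The divergence of an affine potential is a constant, which a multiple of the linear part of \<open>flux_pot\<close>
produces as well. The difference of the two potentials is divergence free, and after multiplication by
\<open>cutoff\<close> its divergence lives on the shell \<open>1 \<le> norm y \<le> 2\<close>, where the equation may be tested.\<close>

lemma annihilates_affine:
  fixes w :: "'n::finite \<Rightarrow> real ^ 'n \<Rightarrow> real"
  assumes N: "2 \<le> CARD('n)"
    and w0: "\<And>j. symb1 0 (\<lambda>y. 1 / norm y) (w j)"
    and H0: "\<And>j k. symb1 0 (\<lambda>y. 1 / norm y / norm y) (H j k)"
    and weak: "weak_solution w H" and zf: "zero_flux w H"
    and anti: "\<And>k j y. affine_pot a b k j y = - affine_pot a b j k y"
  shows "annihilates w H (div_pot (\<lambda>k j y. cutoff y * affine_pot a b k j y))"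
proof -
  let ?n = "real CARD('n)"
  define e where "e j = (\<Sum>k\<in>UNIV. b k j k) / (?n - 1)" for j
  let ?P = "affine_pot a b"
  let ?D = "\<lambda>k j y. ?P k j y - (y $ k * e j - y $ j * e k)"
  let ?A = "\<lambda>k j y. cutoff y * ?D k j y"
  let ?\<psi> = "div_pot ?A"
  have cD: "cdiff 3 UNIV (?D k j)" for k j
    by (intro cdiff_diff cdiff_mult affine_pot_cdiff) auto
  have cA: "cdiff (Suc 2) UNIV (?A k j)" for k j
    using cdiff_mult[OF open_UNIV cutoff_cdiff cD] by (simp only: numeral_3_eq_3 numeral_2_eq_2)
  have cP: "cdiff (Suc 2) UNIV (\<lambda>y. cutoff y * ?P k j y)" for k j
    using cdiff_mult[OF open_UNIV cutoff_cdiff affine_pot_cdiff] by (simp only: numeral_3_eq_3 numeral_2_eq_2)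
  have cF: "cdiff (Suc 2) UNIV (flux_pot e k j)" for k j
  proof -
    have "cdiff 3 UNIV (flux_pot e k j)" unfolding flux_pot_def[abs_def]
      by (intro cdiff_mult cutoff_cdiff cdiff_diff) auto
    then show ?thesis by (simp only: numeral_3_eq_3 numeral_2_eq_2)
  qed
  have divD: "div_pot ?D j y = 0" for j y
  proof -
    have "partial_deriv k (?D k j) y = b k j k - (e j - (if k = j then e j else 0))" for k
    proof -
      have d1: "(\<lambda>y::real^'n. y $ k * e j - y $ j * e k) differentiable (at y)" by simp
      have d2: "partial_deriv k (\<lambda>y::real^'n. y $ k * e j - y $ j * e k) y = e j - (if k = j then e j else 0)"
        by (subst partial_deriv_diff) (simp_all add: partial_deriv_mult)
      show ?thesis
        by (subst partial_deriv_diff[OF affine_pot_partial(2) d1]) (simp only: affine_pot_partial(1) d2)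
    qed
    then have "div_pot ?D j y = (\<Sum>k\<in>UNIV. b k j k) - (?n * e j - e j)"
      by (simp add: div_pot_def sum_subtractf)
    also have "\<dots> = (\<Sum>k\<in>UNIV. b k j k) - (?n - 1) * e j" by (simp add: algebra_simps)
    also have "(?n - 1) * e j = (\<Sum>k\<in>UNIV. b k j k)" using N by (simp add: e_def)
    finally show ?thesis by simp
  qed
  have o: "open {y::real^'n. norm y < 1}" "open {y::real^'n. 2 < norm y}"
    by (intro open_Collect_less continuous_intros)+
  have near: "?\<psi> j y = 0" if "norm y < 1" for j y
  proof -
    have "partial_deriv k (?A k j) y = partial_deriv k (?D k j) y" for k
      by (rule partial_deriv_cong[OF o(1)]) (use that in \<open>simp_all add: cutoff_near\<close>)
    then show ?thesis using divD[of j y] by (simp add: div_pot_def)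
  qed
  have far: "?\<psi> j y = 0" if "2 < norm y" for j y
  proof -
    have "partial_deriv k (?A k j) y = partial_deriv k (\<lambda>_. 0) y" for k
      by (rule partial_deriv_cong[OF o(2)]) (use that in \<open>simp_all add: cutoff_far\<close>)
    then show ?thesis by (simp add: div_pot_def)
  qed
  have c\<psi>: "cdiff 2 UNIV (?\<psi> j)" for j by (rule div_pot_cdiff[OF open_UNIV cA])
  have n1: "annihilates w H ?\<psi>"
  proof -
    have "\<forall>j. cdiff 2 (-{0}) (?\<psi> j)" using cdiff_subset[OF c\<psi>] by blast
    moreover have "\<forall>j. annular (?\<psi> j)"
      unfolding annular_def using near far by (intro allI exI[of _ 1] conjI exI[of _ 2]) auto
    moreover have "\<forall>y. y \<noteq> 0 \<longrightarrow> (\<Sum>j\<in>UNIV. partial_deriv j (?\<psi> j) y) = 0"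
    proof (intro allI impI)
      fix y :: "real ^ 'n"
      show "(\<Sum>j\<in>UNIV. partial_deriv j (?\<psi> j) y) = 0"
      proof (rule div_pot_divergence_free[OF open_UNIV UNIV_I])
        show "cdiff 2 UNIV (?A k j)" for k j by (rule cdiff_Suc_imp[OF cA])
        show "?A k j z = - ?A j k z" for k j z
          by (subst anti) (simp add: algebra_simps)
      qed
    qed
    ultimately show ?thesis using weak unfolding weak_solution_def by blast
  qed
  have n2: "annihilates w H (div_pot (flux_pot e))" using zf unfolding zero_flux_def by blast
  have n3: "div_pot (\<lambda>k j y. cutoff y * ?P k j y) j y = ?\<psi> j y + div_pot (flux_pot e) j y" for j y
  proof (rule div_pot_add[OF _ _ open_UNIV UNIV_I])
    show "?A k j differentiable (at y)" for k j using cdiff_SucD(1)[OF cA UNIV_I] .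
    show "flux_pot e k j differentiable (at y)" for k j using cdiff_SucD(1)[OF cF UNIV_I] .
  qed (simp add: flux_pot_def algebra_simps)
  have n4: "weak_term w H (div_pot (\<lambda>k j y. cutoff y * ?P k j y)) \<in> borel_measurable borel"
  proof -
    have c2: "cdiff 2 (-{0}) (div_pot (\<lambda>k j y. cutoff y * ?P k j y) j)" for j
      by (rule cdiff_subset[OF div_pot_cdiff[OF open_UNIV cP]]) simp
    have "continuous_on (-{0}) (weak_term w H (div_pot (\<lambda>k j y. cutoff y * ?P k j y)))"
      unfolding weak_term_def[abs_def]
    proof (intro continuous_intros)
      show "continuous_on (-{0}) (w j)" for j using symb1_cdiff[OF w0] by simp
      show "continuous_on (-{0}) (H j k)" for j k using symb1_cdiff[OF H0] by simp
      show "continuous_on (-{0}) (partial_deriv l (partial_deriv l (div_pot (\<lambda>k j y. cutoff y * ?P k j y) j)))" for l j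
        using c2[of j] by (simp add: numeral_2_eq_2)
      show "continuous_on (-{0}) (partial_deriv l (div_pot (\<lambda>k j y. cutoff y * ?P k j y) j))" for l j
        using cdiff_le[OF c2[of j], of 1] by simp
    qed
    then show ?thesis by (rule borel_measurable_punctured)
  qed
  show ?thesis
  proof (rule annihilates_add[OF n1 n2 _ _ n3 n4])
    show "cdiff 2 (-{0}) (?\<psi> j)" for j by (rule cdiff_subset[OF c\<psi>]) simp
    show "cdiff 2 (-{0}) (div_pot (flux_pot e) j)" for j
      by (rule cdiff_subset[OF div_pot_cdiff[OF open_UNIV cF]]) simp
  qed
qed

section \<open>The regularised Stokes kernel\<close>

lemma mean_value_bound:
  fixes f :: "real ^ 'n::finite \<Rightarrow> real"
  assumes f: "\<And>z. f differentiable (at z)" and D: "\<And>z m. norm z \<le> norm y \<Longrightarrow> \<bar>partial_deriv m f z\<bar> \<le> D"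
  shows "\<bar>f y - f 0\<bar> \<le> real CARD('n) * D * norm y"
proof -
  have der: "((\<lambda>t. f (t *\<^sub>R y)) has_real_derivative frechet_derivative f (at (t *\<^sub>R y)) y) (at t)" for t
  proof -
    have "((\<lambda>t. t *\<^sub>R y) has_derivative (\<lambda>s. s *\<^sub>R y)) (at t)" by (auto intro!: derivative_eq_intros)
    from has_derivative_compose[OF this partial_deriv_works[OF f]]
    have *: "((\<lambda>t. f (t *\<^sub>R y)) has_derivative (\<lambda>s. frechet_derivative f (at (t *\<^sub>R y)) (s *\<^sub>R y))) (at t)" .
    have "linear (frechet_derivative f (at (t *\<^sub>R y)))"
      using partial_deriv_works[OF f] has_derivative_linear by blast
    then show ?thesis using * by (simp add: linear_cmul has_field_derivative_def mult_commute_abs)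
  qed
  obtain t where t: "0 < t" "t < 1" "f (1 *\<^sub>R y) - f (0 *\<^sub>R y) = (1 - 0) * frechet_derivative f (at (t *\<^sub>R y)) y"
    using MVT2[of 0 1 "\<lambda>t. f (t *\<^sub>R y)" "\<lambda>t. frechet_derivative f (at (t *\<^sub>R y)) y"] der by auto
  have n: "norm (t *\<^sub>R y) \<le> norm y" using t by (simp add: mult_left_le_one_le)
  have D0: "D \<ge> 0" using D[of 0 undefined] by auto
  have "\<bar>f y - f 0\<bar> = \<bar>\<Sum>i\<in>UNIV. y $ i * partial_deriv i f (t *\<^sub>R y)\<bar>"
    using t(3) by (simp add: frechet_derivative_partial[OF f])
  also have "\<dots> \<le> (\<Sum>i\<in>UNIV. \<bar>y $ i * partial_deriv i f (t *\<^sub>R y)\<bar>)" by (rule sum_abs)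
  also have "\<dots> \<le> (\<Sum>i\<in>(UNIV::'n set). norm y * D)"
    unfolding abs_mult by (intro sum_mono mult_mono component_le_norm_cart D n) auto
  finally show ?thesis by (simp add: mult_ac)
qed

lemma symb_one_minus_cutoff:
  "symb1 3 (indicator (- ball 0 1)) (\<lambda>y :: real ^ 'n::finite. 1 - cutoff y)"
proof -
  have c: "cdiff (Suc 2) UNIV (\<lambda>y :: real ^ 'n. 1 - cutoff y)"
    using cdiff_diff[OF open_UNIV cdiff_const cutoff_cdiff] by (simp only: numeral_3_eq_3 numeral_2_eq_2)
  have o: "open {y::real^'n. norm y < 1}" "open {y::real^'n. 2 < norm y}"
    by (intro open_Collect_less continuous_intros)+
  have z: "partial_deriv i (\<lambda>y. 1 - cutoff y) y = 0" if "norm y < 1 \<or> 2 < norm y" for y :: "real^'n" and i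
    using that
  proof
    assume "norm y < 1"
    then have "partial_deriv i (\<lambda>y. 1 - cutoff y) y = partial_deriv i (\<lambda>_::real^'n. 0::real) y"
      by (intro partial_deriv_cong[OF o(1)]) (simp_all add: cutoff_near)
    then show ?thesis by simp
  next
    assume "2 < norm y"
    then have "partial_deriv i (\<lambda>y. 1 - cutoff y) y = partial_deriv i (\<lambda>_::real^'n. 1::real) y"
      by (intro partial_deriv_cong[OF o(2)]) (simp_all add: cutoff_far)
    then show ?thesis by simp
  qed
  have 1: "symb 2 (UNIV :: unit set) (-{0}) (\<lambda>_. norm) (\<lambda>_ y. indicator (- ball 0 1) y / norm y) (\<lambda>_. partial_deriv i (\<lambda>y :: real ^ 'n. 1 - cutoff y))" for i
  proof (rule symb_shell[where c = "1/2"])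
    fix y :: "real ^ 'n" assume y: "1 \<le> norm y" "norm y \<le> 2"
    then have "1 / 2 \<le> 1 / norm y" by (intro divide_left_mono) auto
    then show "1 / 2 \<le> indicator (- ball 0 1) y / norm y" using y by simp
  qed (use cdiff_SucD(2)[OF c] z in auto)
  have "\<bar>1 - cutoff y\<bar> \<le> 1 * indicator (- ball 0 1) y" for y :: "real ^ 'n"
    using cutoff_bounds[of y] cutoff_near[of y] by (auto simp: indicator_def)
  then have "\<exists>C\<ge>0. \<forall>y::real^'n. \<bar>1 - cutoff y\<bar> \<le> C * indicator (- ball 0 1) y" using zero_le_one by blast
  then have "symb (Suc 2) (UNIV :: unit set) (-{0}) (\<lambda>_. norm) (\<lambda>_. indicator (- ball 0 1)) (\<lambda>_ y :: real ^ 'n. 1 - cutoff y)"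
    using cdiff_SucD(1)[OF c] 1 unfolding symb.simps by blast
  then show ?thesis by (simp only: numeral_3_eq_3 numeral_2_eq_2)
qed

text \<open>The derivatives of order two and three are those of \<open>X\<close>. The lower orders follow by integrating from the
origin, where the remainder and its gradient vanish.\<close>

lemma symb_taylor_remainder:
  fixes X :: "real ^ 'n::finite \<Rightarrow> real"
  assumes X: "cdiff 3 UNIV X" and D: "\<And>l m y. \<bar>partial_deriv l (partial_deriv m X) y\<bar> \<le> D"
    and D3: "\<And>l m k y. y \<noteq> 0 \<Longrightarrow> \<bar>partial_deriv k (partial_deriv l (partial_deriv m X)) y\<bar> \<le> D / norm y"
  shows "symb1 3 (\<lambda>y. norm y * norm y) (\<lambda>y. X y - (X 0 + (\<Sum>m\<in>UNIV. partial_deriv m X 0 * y $ m)))"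
proof -
  let ?n = "real CARD('n)"
  let ?p = "\<lambda>y :: real ^ 'n. X 0 + (\<Sum>m\<in>UNIV. partial_deriv m X 0 * y $ m)"
  let ?r = "\<lambda>y. X y - ?p y"
  have D0: "D \<ge> 0" using D[of undefined undefined 0] by auto
  have dX: "X differentiable (at y)" "partial_deriv m X differentiable (at y)"
      "partial_deriv l (partial_deriv m X) differentiable (at y)" for y m l
    using X by (simp_all add: numeral_3_eq_3)
  have p: "partial_deriv m ?p y = partial_deriv m X 0" "?p differentiable (at y)" for m y
    using affine_pot_partial(1)[where a = "\<lambda>_ _. X 0" and b = "\<lambda>_ _ m. partial_deriv m X 0" and l = m and y = y]
      affine_pot_partial(2)[where a = "\<lambda>_ _. X 0" and b = "\<lambda>_ _ m. partial_deriv m X 0" and y = y]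
    by (simp_all add: affine_pot_def[abs_def])
  have r1: "partial_deriv m ?r = (\<lambda>y. partial_deriv m X y - partial_deriv m X 0)" for m
    using partial_deriv_diff[OF dX(1) p(2)] p(1) by (simp add: fun_eq_iff)
  have r2: "partial_deriv l (partial_deriv m ?r) = partial_deriv l (partial_deriv m X)" for l m
  proof
    fix y
    show "partial_deriv l (partial_deriv m ?r) y = partial_deriv l (partial_deriv m X) y"
      unfolding r1 by (subst partial_deriv_diff[OF dX(2)]) simp_all
  qed
  have dr: "?r differentiable (at y)" "partial_deriv m ?r differentiable (at y)" for y m
    using dX p(2) unfolding r1 by simp_all
  have b1: "\<bar>partial_deriv m ?r y\<bar> \<le> ?n * D * norm y" for m y
    unfolding r1 using mean_value_bound[where f = "partial_deriv m X" and y = y and D = D, OF dX(2) D] .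
  have b0: "\<bar>?r y\<bar> \<le> (?n * (?n * D)) * (norm y * norm y)" for y
  proof -
    have "\<bar>?r y - ?r 0\<bar> \<le> ?n * (?n * D * norm y) * norm y"
    proof (rule mean_value_bound[OF dr(1)])
      fix z :: "real ^ 'n" and m assume "norm z \<le> norm y"
      then have "?n * D * norm z \<le> ?n * D * norm y" using D0 by (intro mult_left_mono) auto
      then show "\<bar>partial_deriv m ?r z\<bar> \<le> ?n * D * norm y" using b1[of m z] by linarith
    qed
    then show ?thesis by (simp add: mult_ac)
  qed
  have w: "norm y * norm y / norm y = norm y" "norm y / norm y = 1" if "y \<noteq> 0" for y :: "real ^ 'n" using that by auto
  have s3: "symb1 0 (\<lambda>y. 1 / norm y) (partial_deriv k (partial_deriv l (partial_deriv m X)))" for k l m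
  proof -
    have "continuous_on (-{0}) (partial_deriv k (partial_deriv l (partial_deriv m X)))"
      using cdiff_subset[OF X] by (simp add: numeral_3_eq_3)
    then show ?thesis using D3 D0 by (auto intro!: exI[of _ D])
  qed
  have s2: "symb1 (Suc 0) (\<lambda>y. 1) (partial_deriv l (partial_deriv m X))" for l m
    using s3 dX D D0 by (auto simp del: symb.simps(1) intro!: exI[of _ D])
  have s1: "symb1 (Suc (Suc 0)) norm (partial_deriv m ?r)" for m
  proof -
    have "symb1 (Suc 0) (\<lambda>y. norm y / norm y) (partial_deriv l (partial_deriv m ?r))" for l
      unfolding r2 by (rule symb_weight_cong[OF s2]) (simp add: w)
    moreover have "\<exists>C\<ge>0. \<forall>y. \<bar>partial_deriv m ?r y\<bar> \<le> C * norm y"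
      using b1 D0 by (intro exI[of _ "?n * D"]) auto
    ultimately show ?thesis using dr unfolding symb.simps(2)[of "Suc 0"] by blast
  qed
  have "symb1 (Suc (Suc 0)) (\<lambda>y. norm y * norm y / norm y) (partial_deriv m ?r)" for m
    by (rule symb_weight_cong[OF s1]) (simp add: w)
  moreover have "\<exists>C\<ge>0. \<forall>y. \<bar>?r y\<bar> \<le> C * (norm y * norm y)"
    using b0 D0 by (intro exI[of _ "?n * (?n * D)"]) auto
  ultimately have "symb1 (Suc (Suc (Suc 0))) (\<lambda>y. norm y * norm y) ?r"
    using dr unfolding symb.simps(2)[of "Suc (Suc 0)"] by blast
  then show ?thesis by (simp only: numeral_3_eq_3)
qed


lemma symb_if:
  assumes "open S" "c \<Longrightarrow> symb k P S L W f"
  shows "symb k P S L W (\<lambda>p y. if c then f p y else 0)"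
  using assms symb_zero by (cases c) auto

lemma laplacian_rpow:
  fixes p :: "(real ^ 'n::finite) \<times> real"
  assumes p: "snd p \<noteq> 0"
  shows "(\<Sum>l\<in>UNIV. partial_deriv l (partial_deriv l (rpow a p)) y)
    = 2 * a * ((real CARD('n) + 2 * (a - 1)) * rpow (a - 1) p y - 2 * (a - 1) * (snd p)\<^sup>2 * rpow (a - 2) p y)"
proof -
  have 1: "partial_deriv l (rpow a p) = (\<lambda>y. (2 * a) * ((y $ l - fst p $ l) * rpow (a - 1) p y))" for l
    using partial_deriv_rpow(1)[OF rho_pos(2)[OF p]] by (simp add: fun_eq_iff mult.assoc)
  have d: "(\<lambda>y. (y $ l - fst p $ l) * rpow (a - 1) p y) differentiable (at y)" for l
    by (intro differentiable_mult differentiable_diff differentiable_coord differentiable_const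
        partial_deriv_rpow(2)[OF rho_pos(2)[OF p]])
  have "(\<Sum>l\<in>UNIV. partial_deriv l (partial_deriv l (rpow a p)) y)
      = (2 * a) * (\<Sum>l\<in>UNIV. partial_deriv l (\<lambda>y. (y $ l - fst p $ l) * rpow (a - 1) p y) y)"
    unfolding 1 partial_deriv_cmult[OF d] by (simp add: sum_distrib_left)
  then show ?thesis unfolding divergence_coord_rpow[OF p] by simp
qed

definition stokes_X :: "'n::finite \<Rightarrow> (real ^ 'n) \<times> real \<Rightarrow> real ^ 'n \<Rightarrow> real" where
  "stokes_X k p y = (y $ k - fst p $ k) * rpow (1 - real CARD('n) / 2) p y"

text \<open>Antisymmetric in \<open>k\<close>, \<open>j\<close>. Its divergence is \<open>\<delta>\<^sub>i\<^sub>j div X - \<partial>\<^sub>i X\<^sub>j\<close>, up to a constant a regularisation of the \<open>i\<close>-th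
column of the fundamental tensor of the Stokes system.\<close>

definition stokes_pot :: "'n::finite \<Rightarrow> (real ^ 'n) \<times> real \<Rightarrow> 'n \<Rightarrow> 'n \<Rightarrow> real ^ 'n \<Rightarrow> real" where
  "stokes_pot i p k j y = (if i = j then stokes_X k p y else 0) - (if i = k then stokes_X j p y else 0)"

lemma stokes_X_symb:
  assumes "open S"
  shows "symb m {p. snd p \<noteq> 0} S rho (\<lambda>p y. rho p y powr (3 - real CARD('n))) (stokes_X (k :: 'n::finite))"
  unfolding stokes_X_def[abs_def]
  by (rule symb_weight_cong[OF symb_coord_rpow[OF assms]]) (simp add: algebra_simps)

lemma stokes_pot_symb:
  assumes "open S"
  shows "symb m {p. snd p \<noteq> 0} S rho (\<lambda>p y. rho p y powr (3 - real CARD('n))) (\<lambda>p. stokes_pot (i :: 'n::finite) p k j)"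
  unfolding stokes_pot_def[abs_def]
  by (intro symb_diff[OF assms] symb_if[OF assms] stokes_X_symb[OF assms])

lemma stokes_pot_antisym: "stokes_pot i p k j y = - stokes_pot i p j k y"
  by (auto simp: stokes_pot_def)

lemma stokes_X_partial_swap:
  assumes "snd p \<noteq> 0"
  shows "partial_deriv i (stokes_X j p) = partial_deriv j (stokes_X i p)"
  unfolding stokes_X_def[abs_def] partial_deriv_coord_rpow[OF assms, abs_def] by (auto simp: fun_eq_iff)

context
  fixes p :: "(real ^ 'n::finite) \<times> real"
  assumes p: "snd p \<noteq> 0"
begin

lemma stokes_X_cdiff: "cdiff m UNIV (stokes_X k p)"
  by (rule symb_cdiff[OF stokes_X_symb[OF open_UNIV]]) (use p in simp)

definition stokes_S :: "real ^ 'n \<Rightarrow> real" where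
  "stokes_S y = (\<Sum>k\<in>UNIV. partial_deriv k (stokes_X k p) y)"

lemma stokes_S_eq:
  "stokes_S = (\<lambda>y. 2 * rpow (1 - real CARD('n) / 2) p y - (2 * (1 - real CARD('n) / 2) * (snd p)\<^sup>2) * rpow (- real CARD('n) / 2) p y)"
proof
  fix y
  have e: "real CARD('n) + 2 * (1 - real CARD('n) / 2) = 2" "1 - real CARD('n) / 2 - 1 = - real CARD('n) / 2" by auto
  show "stokes_S y = 2 * rpow (1 - real CARD('n) / 2) p y - (2 * (1 - real CARD('n) / 2) * (snd p)\<^sup>2) * rpow (- real CARD('n) / 2) p y"
    unfolding stokes_S_def stokes_X_def[abs_def] divergence_coord_rpow[OF p] e by simp
qed

lemma rpow_cdiff: "cdiff m UNIV (rpow a p)"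
  by (rule symb_cdiff[OF symb_rpow[OF open_UNIV]]) (use p in simp)

lemma laplacian_stokes_S:
  "(\<Sum>l\<in>UNIV. partial_deriv l (partial_deriv l stokes_S) y)
   = (8 * (1 - real CARD('n) / 2) * (- real CARD('n) / 2) * (- real CARD('n) / 2 - 1)) * ((snd p) ^ 4 * rpow (- (real CARD('n) + 4) / 2) p y)"
proof -
  define n where "n = real CARD('n)"
  define a where "a = 1 - n / 2"
  have e: "- n / 2 = a - 1" "- (n + 4) / 2 = a - 3" "n = 2 - 2 * a" by (auto simp: a_def field_simps)
  let ?c = "2 * a * (snd p)\<^sup>2"
  have d: "rpow b p differentiable (at y)" "partial_deriv l (rpow b p) differentiable (at y)" for b l y
    using rpow_cdiff[of 2 b] by (simp_all add: numeral_2_eq_2)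
  have 1: "partial_deriv l stokes_S = (\<lambda>y. 2 * partial_deriv l (rpow a p) y - ?c * partial_deriv l (rpow (a - 1) p) y)" for l
  proof
    fix y
    have "stokes_S = (\<lambda>y. 2 * rpow a p y - ?c * rpow (a - 1) p y)"
      unfolding stokes_S_eq n_def[symmetric] e(1) a_def[symmetric] by simp
    then show "partial_deriv l stokes_S y = 2 * partial_deriv l (rpow a p) y - ?c * partial_deriv l (rpow (a - 1) p) y"
      using d by (simp only: partial_deriv_diff partial_deriv_cmult differentiable_mult differentiable_const)
  qed
  have "(\<Sum>l\<in>UNIV. partial_deriv l (partial_deriv l stokes_S) y)
     = 2 * (\<Sum>l\<in>UNIV. partial_deriv l (partial_deriv l (rpow a p)) y) - ?c * (\<Sum>l\<in>UNIV. partial_deriv l (partial_deriv l (rpow (a - 1) p)) y)"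
    unfolding 1 using d by (simp only: partial_deriv_diff partial_deriv_cmult differentiable_mult differentiable_const
        sum_subtractf sum_distrib_left)
  also have "\<dots> = (8 * a * (a - 1) * (a - 1 - 1)) * ((snd p) ^ 4 * rpow (a - 3) p y)"
  proof -
    have h: "a - 1 - 1 = a - 2" "a - 1 - 2 = a - 3" by auto
    show ?thesis unfolding laplacian_rpow[OF p] n_def[symmetric] h e(3)
      by (simp add: algebra_simps power2_eq_square power4_eq_xxxx)
  qed
  finally show ?thesis unfolding n_def[symmetric] e(1,2) a_def[symmetric] .
qed

definition stokes_Q :: "'n \<Rightarrow> real ^ 'n \<Rightarrow> real" where
  "stokes_Q i y = (\<Sum>l\<in>UNIV. partial_deriv l (partial_deriv l (stokes_X i p)) y)"

lemma laplacian_partial_stokes_X: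
  "(\<Sum>l\<in>UNIV. partial_deriv l (partial_deriv l (partial_deriv i (stokes_X j p))) y) = partial_deriv j (stokes_Q i) y"
proof -
  have c: "cdiff 2 UNIV (partial_deriv l (stokes_X i p))" for l
    by (rule cdiff_partialD[OF stokes_X_cdiff]) simp
  have s: "partial_deriv l (partial_deriv i (stokes_X j p)) = partial_deriv j (partial_deriv l (stokes_X i p))" for l
    unfolding stokes_X_partial_swap[OF p, of i j]
    using partial_deriv_commute[OF open_UNIV stokes_X_cdiff UNIV_I] by (simp add: fun_eq_iff)
  have "(\<Sum>l\<in>UNIV. partial_deriv l (partial_deriv l (partial_deriv i (stokes_X j p))) y)
      = (\<Sum>l\<in>UNIV. partial_deriv j (partial_deriv l (partial_deriv l (stokes_X i p))) y)"
    unfolding s by (intro sum.cong refl partial_deriv_commute[OF open_UNIV c UNIV_I])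
  also have "\<dots> = partial_deriv j (\<lambda>y. \<Sum>l\<in>UNIV. partial_deriv l (partial_deriv l (stokes_X i p)) y) y"
    by (rule partial_deriv_sum[symmetric]) (use c in \<open>simp add: numeral_2_eq_2\<close>)
  finally show ?thesis by (simp add: stokes_Q_def[abs_def])
qed

lemma div_stokes_pot:
  "div_pot (stokes_pot i p) j = (\<lambda>y. (if i = j then stokes_S y else 0) - partial_deriv i (stokes_X j p) y)"
proof
  fix y
  have d: "stokes_X k p differentiable (at y)" for k using stokes_X_cdiff[of 1 k] by simp
  have "partial_deriv k (stokes_pot i p k j) y
     = (if i = j then partial_deriv k (stokes_X k p) y else 0) - (if i = k then partial_deriv k (stokes_X j p) y else 0)" for k
    using d by (cases "i = j"; cases "i = k")
      (simp_all add: stokes_pot_def[abs_def] partial_deriv_diff partial_deriv_minus)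
  then show "div_pot (stokes_pot i p) j y = (if i = j then stokes_S y else 0) - partial_deriv i (stokes_X j p) y"
    by (simp add: div_pot_def stokes_S_def sum_subtractf)
qed

lemma laplacian_div_stokes_pot:
  "(\<Sum>l\<in>UNIV. partial_deriv l (partial_deriv l (div_pot (stokes_pot i p) j)) y)
    = (if i = j then \<Sum>l\<in>UNIV. partial_deriv l (partial_deriv l stokes_S) y else 0) - partial_deriv j (stokes_Q i) y"
proof -
  have cS: "cdiff 2 UNIV stokes_S"
    unfolding stokes_S_def[abs_def] by (intro cdiff_sum cdiff_partialD[OF stokes_X_cdiff]) auto
  have cX: "cdiff 2 UNIV (partial_deriv i (stokes_X j p))"
    by (rule cdiff_partialD[OF stokes_X_cdiff]) simp
  have d: "stokes_S differentiable (at y)" "partial_deriv l stokes_S differentiable (at y)"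
     "partial_deriv i (stokes_X j p) differentiable (at y)" "partial_deriv l (partial_deriv i (stokes_X j p)) differentiable (at y)" for y l
    using cS cX by (simp_all add: numeral_2_eq_2)
  have 1: "partial_deriv l (div_pot (stokes_pot i p) j)
      = (\<lambda>y. (if i = j then partial_deriv l stokes_S y else 0) - partial_deriv l (partial_deriv i (stokes_X j p)) y)" for l
    unfolding div_stokes_pot using d by (cases "i = j") (simp_all add: fun_eq_iff partial_deriv_diff partial_deriv_minus)
  have 2: "partial_deriv l (partial_deriv l (div_pot (stokes_pot i p) j)) y
      = (if i = j then partial_deriv l (partial_deriv l stokes_S) y else 0) - partial_deriv l (partial_deriv l (partial_deriv i (stokes_X j p))) y" for l
    unfolding 1 using d by (cases "i = j") (simp_all add: partial_deriv_diff partial_deriv_minus)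
  show ?thesis unfolding 2 laplacian_partial_stokes_X[symmetric] by (simp add: sum_subtractf)
qed

end


lemma rho_ge_const: "snd p \<noteq> 0 \<Longrightarrow> 0 \<le> t \<Longrightarrow> rho p y powr (-t) \<le> \<bar>snd p\<bar> powr (-t)"
  using norm_le_rho(2)[of p y] by (intro powr_mono2') auto

text \<open>The potential does not vanish at the origin. Its affine Taylor polynomial there, multiplied by \<open>cutoff\<close>,
is annihilated because the flux is zero; the remainder is \<open>O(norm y ^ 2)\<close> and can be cut off.\<close>

lemma annihilates_stokes_pot:
  fixes w :: "'n::finite \<Rightarrow> real ^ 'n \<Rightarrow> real"
  assumes N: "3 \<le> CARD('n)"
    and w0: "\<And>j. symb1 0 (\<lambda>y. 1 / norm y) (w j)"
    and H0: "\<And>j k. symb1 0 (\<lambda>y. 1 / norm y / norm y) (H j k)"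
    and weak: "weak_solution w H" and zf: "zero_flux w H" and p: "snd p \<noteq> 0"
  shows "annihilates w H (div_pot (stokes_pot i p))"
proof -
  let ?n = "real CARD('n)"
  have n: "?n \<ge> 3" using N by simp
  let ?X = "\<lambda>k. stokes_X k p"
  let ?p = "\<lambda>k y :: real ^ 'n. ?X k 0 + (\<Sum>m\<in>UNIV. partial_deriv m (?X k) 0 * y $ m)"
  define a where "a k j = (if i = j then ?X k 0 else 0) - (if i = k then ?X j 0 else 0)" for k j
  define b where "b k j m = (if i = j then partial_deriv m (?X k) 0 else 0) - (if i = k then partial_deriv m (?X j) 0 else 0)" for k j m
  let ?A = "stokes_pot i p"
  let ?P = "affine_pot a b"
  have P: "?P k j y = (if i = j then ?p k y else 0) - (if i = k then ?p j y else 0)" for k j y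
    by (auto simp: affine_pot_def a_def b_def left_diff_distrib sum_subtractf)
  have antiP: "?P k j y = - ?P j k y" for k j y unfolding P by auto
  have sX: "symb m {p. snd p \<noteq> 0} UNIV rho (\<lambda>p y. rho p y powr (3 - ?n)) (stokes_X k)" for m and k :: 'n
    by (rule stokes_X_symb[OF open_UNIV])
  have rem: "symb1 3 (\<lambda>y. norm y * norm y) (\<lambda>y. ?X k y - ?p k y)" for k
  proof -
    have s2: "symb 1 {p. snd p \<noteq> 0} UNIV rho (\<lambda>p y. rho p y powr (3 - ?n) / rho p y / rho p y) (\<lambda>p. partial_deriv l (partial_deriv m (stokes_X k p)))" for l m
      by (rule symb_partialD[OF symb_partialD[OF sX[of 3]]]) simp_all
    have s3: "symb 0 {p. snd p \<noteq> 0} UNIV rho (\<lambda>p y. rho p y powr (3 - ?n) / rho p y / rho p y / rho p y) (\<lambda>p. partial_deriv q (partial_deriv l (partial_deriv m (stokes_X k p))))" for q l m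
      by (rule symb_partialD[OF s2]) simp
    have e2: "rho p y powr (3 - ?n) / rho p y / rho p y = rho p y powr (- (?n - 1))" for y
      using rho_pos(1)[OF p, of y] by (simp add: powr_diff powr_add powr_minus field_simps power3_eq_cube)
    have "\<exists>D\<ge>0. \<forall>y. \<bar>partial_deriv l (partial_deriv m (?X k)) y\<bar> \<le> D" for l m
    proof -
      obtain C where C: "C \<ge> 0" "\<And>q y. q \<in> {p. snd p \<noteq> 0} \<Longrightarrow> y \<in> UNIV \<Longrightarrow> \<bar>partial_deriv l (partial_deriv m (stokes_X k q)) y\<bar> \<le> C * (rho q y powr (3 - ?n) / rho q y / rho q y)"
        using symb_bound[OF s2] by blast
      have "\<bar>partial_deriv l (partial_deriv m (?X k)) y\<bar> \<le> C * \<bar>snd p\<bar> powr (- (?n - 1))" for y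
        using C(2)[of p y] p mult_left_mono[OF rho_ge_const[OF p, of "?n - 1" y] C(1)] n unfolding e2 by simp
      then show ?thesis using C(1) by (intro exI[of _ "C * \<bar>snd p\<bar> powr (- (?n - 1))"]) auto
    qed
    then obtain D2 where D2: "\<And>l m. D2 l m \<ge> 0" "\<And>l m y. \<bar>partial_deriv l (partial_deriv m (?X k)) y\<bar> \<le> D2 l m" by metis
    have "\<exists>D\<ge>0. \<forall>y. y \<noteq> 0 \<longrightarrow> \<bar>partial_deriv q (partial_deriv l (partial_deriv m (?X k))) y\<bar> \<le> D / norm y" for q l m
    proof -
      obtain C where C: "C \<ge> 0" "\<And>r y. r \<in> {p. snd p \<noteq> 0} \<Longrightarrow> y \<in> UNIV \<Longrightarrow> \<bar>partial_deriv q (partial_deriv l (partial_deriv m (stokes_X k r))) y\<bar> \<le> C * (rho r y powr (3 - ?n) / rho r y / rho r y / rho r y)"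
        using symb_bound[OF s3] by blast
      define c where "c = 1 + (1 + norm (fst p)) / \<bar>snd p\<bar>"
      have "\<bar>partial_deriv q (partial_deriv l (partial_deriv m (?X k))) y\<bar> \<le> (C * \<bar>snd p\<bar> powr (- (?n - 1)) * (1 + norm (fst p) / \<bar>snd p\<bar>)) / norm y" if y: "y \<noteq> 0" for y
      proof -
        have r: "rho p y > 0" using rho_pos(1)[OF p] .
        have "norm y \<le> norm (y - fst p) + norm (fst p)" using norm_triangle_ineq[of "y - fst p" "fst p"] by simp
        also have "\<dots> \<le> rho p y + norm (fst p) / \<bar>snd p\<bar> * \<bar>snd p\<bar>"
          using norm_le_rho(1)[of y p] p by simp
        also have "\<dots> \<le> rho p y + norm (fst p) / \<bar>snd p\<bar> * rho p y"
          using norm_le_rho(2)[of p y] by (intro add_left_mono mult_left_mono) auto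
        finally have le: "norm y \<le> (1 + norm (fst p) / \<bar>snd p\<bar>) * rho p y" by (simp add: distrib_right)
        have "1 / rho p y \<le> (1 + norm (fst p) / \<bar>snd p\<bar>) / norm y"
          using le y r by (simp add: field_simps)
        then have "\<bar>snd p\<bar> powr (- (?n - 1)) * (1 / rho p y) \<le> \<bar>snd p\<bar> powr (- (?n - 1)) * ((1 + norm (fst p) / \<bar>snd p\<bar>) / norm y)"
          by (intro mult_left_mono) auto
        moreover have "rho p y powr (- (?n - 1)) * (1 / rho p y) \<le> \<bar>snd p\<bar> powr (- (?n - 1)) * (1 / rho p y)"
          using r n by (intro mult_right_mono rho_ge_const[OF p]) auto
        ultimately have "rho p y powr (- (?n - 1)) * (1 / rho p y) \<le> \<bar>snd p\<bar> powr (- (?n - 1)) * ((1 + norm (fst p) / \<bar>snd p\<bar>) / norm y)"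
          by linarith
        then have "C * (rho p y powr (- (?n - 1)) * (1 / rho p y)) \<le> C * (\<bar>snd p\<bar> powr (- (?n - 1)) * ((1 + norm (fst p) / \<bar>snd p\<bar>) / norm y))"
          by (rule mult_left_mono[OF _ C(1)])
        then show ?thesis using C(2)[of p y] p unfolding e2 by (simp add: mult_ac)
      qed
      then show ?thesis using C(1)
        by (intro exI[of _ "C * \<bar>snd p\<bar> powr (- (?n - 1)) * (1 + norm (fst p) / \<bar>snd p\<bar>)"])
           (auto intro!: mult_nonneg_nonneg add_nonneg_nonneg)
    qed
    then obtain D3 where D3: "\<And>q l m. D3 q l m \<ge> 0" "\<And>q l m y. y \<noteq> 0 \<Longrightarrow> \<bar>partial_deriv q (partial_deriv l (partial_deriv m (?X k))) y\<bar> \<le> D3 q l m / norm y"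
      by metis
    define D where "D = (\<Sum>l\<in>UNIV. \<Sum>m\<in>UNIV. D2 l m) + (\<Sum>q\<in>UNIV. \<Sum>l\<in>UNIV. \<Sum>m\<in>UNIV. D3 q l m)"
    have "D2 l m \<le> D" for l m
    proof -
      have "D2 l m \<le> (\<Sum>m\<in>UNIV. D2 l m)" by (rule member_le_sum) (use D2(1) in auto)
      also have "\<dots> \<le> (\<Sum>l\<in>UNIV. \<Sum>m\<in>UNIV. D2 l m)"
        by (rule member_le_sum[of l UNIV "\<lambda>l. \<Sum>m\<in>UNIV. D2 l m"]) (use D2(1) in \<open>auto intro: sum_nonneg\<close>)
      also have "\<dots> \<le> D" unfolding D_def using D3(1) by (simp add: sum_nonneg)
      finally show ?thesis .
    qed
    moreover have "D3 q l m \<le> D" for q l m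
    proof -
      have "D3 q l m \<le> (\<Sum>m\<in>UNIV. D3 q l m)" by (rule member_le_sum) (use D3(1) in auto)
      also have "\<dots> \<le> (\<Sum>l\<in>UNIV. \<Sum>m\<in>UNIV. D3 q l m)"
        by (rule member_le_sum[of l UNIV "\<lambda>l. \<Sum>m\<in>UNIV. D3 q l m"]) (use D3(1) in \<open>auto intro: sum_nonneg\<close>)
      also have "\<dots> \<le> (\<Sum>q\<in>UNIV. \<Sum>l\<in>UNIV. \<Sum>m\<in>UNIV. D3 q l m)"
        by (rule member_le_sum[of q UNIV "\<lambda>q. \<Sum>l\<in>UNIV. \<Sum>m\<in>UNIV. D3 q l m"]) (use D3(1) in \<open>auto intro!: sum_nonneg\<close>)
      also have "\<dots> \<le> D" unfolding D_def using D2(1) by (simp add: sum_nonneg)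
      finally show ?thesis .
    qed
    ultimately show ?thesis
      by (intro symb_taylor_remainder[where D = D] stokes_X_cdiff[OF p])
         (meson D2(2) order_trans, meson D3(2) divide_right_mono norm_ge_zero order_trans)
  qed
  let ?V = "\<lambda>y :: real ^ 'n. (norm y * norm y) * (1 + norm y) powr (- (?n - 1))"
  let ?B = "\<lambda>k j y. cutoff y * (?A k j y - ?P k j y) + (1 - cutoff y) * ?A k j y"
  have s1: "symb1 3 ?V (\<lambda>y. cutoff y * (?A k j y - ?P k j y))" for k j
  proof -
    have AP: "symb1 3 (\<lambda>y. norm y * norm y) (\<lambda>y. ?A k j y - ?P k j y)"
    proof (rule symb_cong[OF open_punctured])
      show "symb1 3 (\<lambda>y. norm y * norm y) (\<lambda>y. (if i = j then ?X k y - ?p k y else 0) - (if i = k then ?X j y - ?p j y else 0))"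
        by (intro symb_diff[OF open_punctured] symb_if[OF open_punctured] rem)
    qed (auto simp: P stokes_pot_def)
    show ?thesis
    proof (rule symb_weaken[OF symb_mult[OF open_punctured symb_cutoff AP], where c = "3 powr (?n - 1)" and c' = 1])
      fix u :: unit and y :: "real ^ 'n" assume "y \<in> -{0}"
      show "0 \<le> indicator (cball 0 2) y * (norm y * norm y) \<and> indicator (cball 0 2) y * (norm y * norm y) \<le> 3 powr (?n - 1) * ?V y"
      proof (cases "norm y \<le> 2")
        case True
        have "1 = 3 powr (?n - 1) * 3 powr (- (?n - 1))" by (simp only: powr_add[symmetric]) simp
        also have "\<dots> \<le> 3 powr (?n - 1) * (1 + norm y) powr (- (?n - 1))"
          using True n by (intro mult_left_mono powr_mono2') (auto intro: add_pos_nonneg)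
        finally have "(norm y * norm y) * 1 \<le> (norm y * norm y) * (3 powr (?n - 1) * (1 + norm y) powr (- (?n - 1)))"
          by (intro mult_left_mono) auto
        then show ?thesis using True by (simp add: mult_ac)
      qed auto
    qed auto
  qed
  have s2: "symb1 3 ?V (\<lambda>y. (1 - cutoff y) * ?A k j y)" for k j
  proof -
    have "symb 3 {p. snd p \<noteq> 0} (-{0}) rho (\<lambda>p y. rho p y powr (- (?n - 3))) (\<lambda>p. stokes_pot i p k j)"
      by (rule symb_weight_cong[OF stokes_pot_symb[OF open_punctured]]) simp
    from symb1_of_kernel[OF this p] have sA: "symb1 3 (\<lambda>y. (1 + norm y) powr (- (?n - 3))) (?A k j)" using n by simp
    show ?thesis
    proof (rule symb_weaken[OF symb_mult[OF open_punctured symb_one_minus_cutoff sA], where c = 4 and c' = 1])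
      fix u :: unit and y :: "real ^ 'n" assume "y \<in> -{0}"
      show "0 \<le> indicator (- ball 0 1) y * (1 + norm y) powr (- (?n - 3)) \<and> indicator (- ball 0 1) y * (1 + norm y) powr (- (?n - 3)) \<le> 4 * ?V y"
      proof (cases "norm y < 1")
        case False
        have "(1 + norm y) * (1 + norm y) \<le> (2 * norm y) * (2 * norm y)" using False by (intro mult_mono) auto
        then have f1: "((1 + norm y) * (1 + norm y)) * (1 + norm y) powr (- (?n - 1)) \<le> (4 * (norm y * norm y)) * (1 + norm y) powr (- (?n - 1))"
          by (intro mult_right_mono) auto
        have f2: "((1 + norm y) * (1 + norm y)) * (1 + norm y) powr (- (?n - 1)) = (1 + norm y) powr (- (?n - 3))"
        proof -
          have "(1 + norm y) * (1 + norm y) = (1 + norm y) powr 2" by (simp add: power2_eq_square add_pos_nonneg)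
          then have "((1 + norm y) * (1 + norm y)) * (1 + norm y) powr (- (?n - 1)) = (1 + norm y) powr (2 + - (?n - 1))"
            by (simp only: powr_add)
          then show ?thesis by simp
        qed
        show ?thesis using False f1[unfolded f2] by (simp add: mult.assoc)
      qed auto
    qed auto
  qed
  have sB: "symb1 3 ?V (?B k j)" for k j by (rule symb_add[OF open_punctured s1 s2])
  have antiB: "?B k j y = - ?B j k y" for k j y
    by (subst (1 2) stokes_pot_antisym, subst antiP) (simp add: algebra_simps)
  have g: "integrable lborel (majorant 2 (2 + (?n - 1)) :: real ^ 'n \<Rightarrow> real)"
    by (rule integrable_majorant) (use n in auto)
  have gV: "?V y / norm y / norm y / norm y / norm y \<le> majorant 2 (2 + (?n - 1)) y" if y: "y \<noteq> 0" for y :: "real ^ 'n"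
  proof -
    have "?V y / norm y / norm y / norm y / norm y = norm y powr (-2) * (1 + norm y) powr (- (?n - 1))"
      using y by (simp add: powr_minus powr_numeral power2_eq_square field_simps)
    then show ?thesis using weight_le_majorant[of "?n - 1" y 2] n y by simp
  qed
  note nB = annihilates_div_pot[where A = ?B, OF w0 H0 weak sB antiB g gV]
  have nP: "annihilates w H (div_pot (\<lambda>k j y. cutoff y * ?P k j y))"
    by (rule annihilates_affine[OF _ w0 H0 weak zf antiP]) (use N in simp)
  have c3: "cdiff 3 UNIV (\<lambda>y. cutoff y * ?P k j y)" for k j
    by (rule cdiff_mult[OF open_UNIV cutoff_cdiff affine_pot_cdiff])
  have cA: "cdiff m UNIV (?A k j)" for m k j
    by (rule symb_cdiff[OF stokes_pot_symb[OF open_UNIV]]) (use p in simp)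
  have cB: "cdiff 3 (-{0}) (?B k j)" for k j by (rule symb1_cdiff[OF sB])
  have sum: "div_pot ?A j y = div_pot ?B j y + div_pot (\<lambda>k j y. cutoff y * ?P k j y) j y" if "y \<noteq> 0" for j y
  proof (rule div_pot_add[OF _ _ open_punctured])
    show "?B k j differentiable (at y)" for k j
      by (rule cdiff_differentiableD[OF cB numeral_3_eq_3]) (use that in simp)
    show "(\<lambda>y. cutoff y * ?P k j y) differentiable (at y)" for k j
      by (rule cdiff_differentiableD[OF c3 numeral_3_eq_3]) simp
  qed (use that in \<open>auto simp: algebra_simps\<close>)
  have mA: "weak_term w H (div_pot ?A) \<in> borel_measurable borel"
  proof -
    have c2: "cdiff 2 (-{0}) (div_pot ?A j)" for j
      by (rule cdiff_subset[OF div_pot_cdiff[OF open_UNIV cA]]) simp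
    have "continuous_on (-{0}) (weak_term w H (div_pot ?A))"
      unfolding weak_term_def[abs_def]
    proof (intro continuous_intros)
      show "continuous_on (-{0}) (w j)" for j using symb1_cdiff[OF w0] by simp
      show "continuous_on (-{0}) (H j k)" for j k using symb1_cdiff[OF H0] by simp
      show "continuous_on (-{0}) (partial_deriv l (partial_deriv l (div_pot ?A j)))" for l j
        using c2[of j] by (simp add: numeral_2_eq_2)
      show "continuous_on (-{0}) (partial_deriv l (div_pot ?A j))" for l j
        using cdiff_le[OF c2[of j], of 1] by simp
    qed
    then show ?thesis by (rule borel_measurable_punctured)
  qed
  show ?thesis
  proof (rule annihilates_add[OF nB(1) nP _ _ sum mA])
    show "cdiff 2 (-{0}) (div_pot ?B j)" for j
      by (rule div_pot_cdiff[OF open_punctured]) (use cB in \<open>simp only: numeral_3_eq_3 numeral_2_eq_2\<close>)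
    show "cdiff 2 (-{0}) (div_pot (\<lambda>k j y. cutoff y * ?P k j y) j)" for j
      by (rule cdiff_subset[OF div_pot_cdiff[OF open_UNIV]]) (use c3 in \<open>simp_all only: numeral_3_eq_3 numeral_2_eq_2 subset_UNIV\<close>)
  qed
qed

section \<open>The estimate for the Stokes system\<close>

lemma symb1_of_bound:
  fixes f :: "real ^ 'n::finite \<Rightarrow> real"
  assumes "continuous_on (-{0}) f" "\<And>y. y \<noteq> 0 \<Longrightarrow> \<bar>f y\<bar> \<le> M * W y" "0 \<le> M"
  shows "symb1 0 W f"
  using assms by (auto intro!: exI[of _ M])

text \<open>The Laplacian of the test field is an approximate identity in the \<open>i\<close>-th component minus the gradient of
\<open>stokes_Q p i\<close>, and the gradient drops out because \<open>w\<close> is solenoidal.\<close>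

lemma stokes_representation:
  fixes w :: "'n::finite \<Rightarrow> real ^ 'n \<Rightarrow> real"
  assumes N: "3 \<le> CARD('n)"
    and wc: "\<And>j. cdiff 1 (-{0}) (w j)" and wdiv: "\<And>y. y \<noteq> 0 \<Longrightarrow> (\<Sum>j\<in>UNIV. partial_deriv j (w j) y) = 0"
    and wb: "\<And>j y. y \<noteq> 0 \<Longrightarrow> \<bar>w j y\<bar> \<le> M / norm y"
    and Hc: "\<And>j k. continuous_on (-{0}) (H j k)" and Hb: "\<And>j k y. y \<noteq> 0 \<Longrightarrow> \<bar>H j k y\<bar> \<le> K / (norm y)\<^sup>2"
    and M0: "M \<ge> 0" and K0: "K \<ge> 0"
    and weak: "weak_solution w H" and zf: "zero_flux w H" and p: "snd p \<noteq> 0"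
    and hi: "integrable lborel (\<lambda>y. \<Sum>j\<in>UNIV. \<Sum>k\<in>UNIV. H j k y * partial_deriv j (div_pot (stokes_pot i p) k) y)"
  shows "(8 * (1 - real CARD('n) / 2) * (- real CARD('n) / 2) * (- real CARD('n) / 2 - 1)) *
      (\<integral>y. w i y * ((snd p) ^ 4 * rpow (- (real CARD('n) + 4) / 2) p y) \<partial>lborel)
    = - (\<integral>y. (\<Sum>j\<in>UNIV. \<Sum>k\<in>UNIV. H j k y * partial_deriv j (div_pot (stokes_pot i p) k) y) \<partial>lborel)"
proof -
  let ?n = "real CARD('n)"
  have n: "?n \<ge> 3" using N by simp
  let ?c = "8 * (1 - ?n / 2) * (- ?n / 2) * (- ?n / 2 - 1)"
  let ?\<phi> = "div_pot (stokes_pot i p)"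
  let ?h = "\<lambda>y. \<Sum>j\<in>UNIV. \<Sum>k\<in>UNIV. H j k y * partial_deriv j (?\<phi> k) y"
  let ?q = "\<lambda>y. \<Sum>j\<in>UNIV. w j y * partial_deriv j (stokes_Q p i) y"
  let ?L = "\<lambda>y. w i y * (\<Sum>l\<in>UNIV. partial_deriv l (partial_deriv l (stokes_S p)) y)"
  have w0: "symb1 0 (\<lambda>y. 1 / norm y) (w j)" for j
    by (rule symb1_of_bound[OF cdiff_continuous[OF wc] _ M0]) (use wb in simp)
  have H0: "symb1 0 (\<lambda>y. 1 / norm y / norm y) (H j k)" for j k
    by (rule symb1_of_bound[OF Hc _ K0]) (use Hb in \<open>simp add: power2_eq_square\<close>)
  have null: "annihilates w H ?\<phi>" by (rule annihilates_stokes_pot[OF N w0 H0 weak zf p])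
  have sQ: "symb1 1 (\<lambda>y. (1 + norm y) powr (- (?n - 1))) (stokes_Q p i)"
  proof -
    have "symb 1 {p. snd p \<noteq> 0} (-{0}) rho (\<lambda>p y. rho p y powr (- (?n - 1))) (\<lambda>p y. \<Sum>l\<in>UNIV. partial_deriv l (partial_deriv l (stokes_X i p)) y)"
    proof (rule symb_weight_cong)
      show "symb 1 {p. snd p \<noteq> 0} (-{0}) rho (\<lambda>p y. rho p y powr (3 - ?n) / rho p y / rho p y) (\<lambda>p y. \<Sum>l\<in>UNIV. partial_deriv l (partial_deriv l (stokes_X i p)) y)"
        by (intro symb_sum[OF open_punctured finite_class.finite_UNIV] symb_partialD[OF symb_partialD[OF stokes_X_symb[OF open_punctured, of 3]]]) simp_all
      fix p :: "(real ^ 'n) \<times> real" and y assume "p \<in> {p. snd p \<noteq> 0}"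
      then have "rho p y > 0" using rho_pos(1) by blast
      then show "rho p y powr (3 - ?n) / rho p y / rho p y = rho p y powr (- (?n - 1))"
        by (simp add: powr_diff powr_add powr_minus field_simps power3_eq_cube)
    qed
    then have "symb 1 {p. snd p \<noteq> 0} (-{0}) rho (\<lambda>p y. rho p y powr (- (?n - 1))) (\<lambda>p. if snd p \<noteq> 0 then stokes_Q p i else (\<lambda>_. 0))"
      by (rule symb_cong[OF open_punctured]) (simp add: stokes_Q_def)
    from symb1_of_kernel[OF this p] show ?thesis using n p by simp
  qed
  have maj: "integrable lborel (\<lambda>y :: real ^ 'n. M * majorant 2 (2 + (?n - 1)) y)"
    by (intro integrable_mult_right integrable_majorant) (use n in auto)
  have bd: "\<bar>w j y\<bar> * ((1 + norm y) powr (- (?n - 1)) / norm y) \<le> M * majorant 2 (2 + (?n - 1)) y" if y: "y \<noteq> 0" for j y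
  proof -
    have "\<bar>w j y\<bar> * ((1 + norm y) powr (- (?n - 1)) / norm y) \<le> M / norm y * ((1 + norm y) powr (- (?n - 1)) / norm y)"
      by (intro mult_right_mono wb[OF y]) auto
    also have "\<dots> = M * (norm y powr (-2) * (1 + norm y) powr (- (?n - 1)))"
      using y by (simp add: powr_minus powr_numeral power2_eq_square field_simps)
    also have "\<dots> \<le> M * majorant 2 (2 + (?n - 1)) y"
      by (intro mult_left_mono weight_le_majorant M0) (use n y in auto)
    finally show ?thesis .
  qed
  note dq = divergence_free_pairing[OF wc wdiv sQ maj bd]
  have iq: "integrable lborel ?q" by (intro Bochner_Integration.integrable_sum dq(2))
  have iw: "integrable lborel (weak_term w H ?\<phi>)" and zw: "integral\<^sup>L lborel (weak_term w H ?\<phi>) = 0"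
    using null by (auto simp: annihilates_def)
  have eq: "?L y = weak_term w H ?\<phi> y + ?q y - ?h y" for y
  proof -
    have "(\<Sum>j\<in>UNIV. w j y * (\<Sum>l\<in>UNIV. partial_deriv l (partial_deriv l (?\<phi> j)) y))
       = (\<Sum>j\<in>UNIV. (if i = j then ?L y else 0) - w j y * partial_deriv j (stokes_Q p i) y)"
      unfolding laplacian_div_stokes_pot[OF p] by (intro sum.cong refl) (auto simp: right_diff_distrib)
    also have "\<dots> = ?L y - ?q y" by (simp add: sum_subtractf)
    finally show ?thesis by (simp add: weak_term_def)
  qed
  have "(\<integral>y. ?L y \<partial>lborel) = - (\<integral>y. ?h y \<partial>lborel)"
    unfolding eq using iw iq hi zw dq(1) by simp
  then show ?thesis
    unfolding laplacian_stokes_S[OF p] by (simp only: mult.left_commute[of "w i _"] integral_mult_right_zero)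
qed

text \<open>The derivatives of the test field are bounded by \<open>norm (y - x) powr (1 - n)\<close> uniformly in the regularisation, so
the right-hand side of \<open>stokes_representation\<close> is controlled by the Riesz potential of \<open>\<bar>y\<bar>\<^sup>-\<^sup>2\<close>.\<close>

lemma stokes_estimate:
  assumes N: "3 \<le> CARD('n::finite)"
  obtains C where "C > 0" "\<And>(w :: 'n \<Rightarrow> real ^ 'n \<Rightarrow> real) H M K i x.
     (\<And>j. cdiff 1 (-{0}) (w j)) \<Longrightarrow> (\<And>y. y \<noteq> 0 \<Longrightarrow> (\<Sum>j\<in>UNIV. partial_deriv j (w j) y) = 0) \<Longrightarrow>
     (\<And>j y. y \<noteq> 0 \<Longrightarrow> \<bar>w j y\<bar> \<le> M / norm y) \<Longrightarrow>
     (\<And>j k. continuous_on (-{0}) (H j k)) \<Longrightarrow> (\<And>j k y. y \<noteq> 0 \<Longrightarrow> \<bar>H j k y\<bar> \<le> K / (norm y)\<^sup>2) \<Longrightarrow>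
     weak_solution w H \<Longrightarrow> zero_flux w H \<Longrightarrow> x \<noteq> 0 \<Longrightarrow> \<bar>w i x\<bar> \<le> C * K / norm x"
proof -
  define n where "n = real CARD('n)"
  have n: "n \<ge> 3" using N by (simp add: n_def)
  obtain R where R: "R \<ge> 0"
    "\<And>x :: real ^ 'n. x \<noteq> 0 \<Longrightarrow> integrable lborel (\<lambda>y. norm (y - x) powr (1 - n) * norm y powr (-2))"
    "\<And>x :: real ^ 'n. x \<noteq> 0 \<Longrightarrow> (\<integral>y. norm (y - x) powr (1 - n) * norm y powr (-2) \<partial>lborel) \<le> R / norm x"
    using riesz_potential_bound[OF N] unfolding n_def by blast
  define bm where "bm = bump_mass TYPE('n) 4"
  have bm: "bm > 0" unfolding bm_def by (rule bump_mass_pos) simp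
  define c where "c = \<bar>8 * (1 - n / 2) * (- n / 2) * (- n / 2 - 1)\<bar>"
  have c: "c > 0" using n by (simp add: c_def)
  have ex: "\<exists>C\<ge>0. \<forall>p y. snd p \<noteq> 0 \<longrightarrow> \<bar>partial_deriv j (div_pot (stokes_pot i p) k) y\<bar> \<le> C * rho p y powr (1 - n)" for i j k :: 'n
  proof -
    have "symb 1 {p. snd p \<noteq> 0} UNIV rho (\<lambda>p y. rho p y powr (3 - n) / rho p y) (\<lambda>p. div_pot (\<lambda>k j. stokes_pot i p k j) k)"
      unfolding n_def by (rule div_pot_symb[OF open_UNIV stokes_pot_symb[OF open_UNIV, of 2]]) simp
    from symb_partialD[OF this, of 0 j]
    have s: "symb 0 {p. snd p \<noteq> 0} UNIV rho (\<lambda>p y. rho p y powr (3 - n) / rho p y / rho p y) (\<lambda>p. partial_deriv j (div_pot (stokes_pot i p) k))"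
      by simp
    obtain C where C: "C \<ge> 0" "\<And>p y. p \<in> {p. snd p \<noteq> 0} \<Longrightarrow> y \<in> UNIV \<Longrightarrow> \<bar>partial_deriv j (div_pot (stokes_pot i p) k) y\<bar> \<le> C * (rho p y powr (3 - n) / rho p y / rho p y)"
      using symb_bound[OF s] by blast
    have "rho p y powr (3 - n) / rho p y / rho p y = rho p y powr (1 - n)" if "snd p \<noteq> 0" for p and y :: "real ^ 'n"
      using rho_pos(1)[OF that, of y] by (simp add: powr_diff powr_add powr_minus field_simps power3_eq_cube)
    then show ?thesis using C by (intro exI[of _ C]) (auto simp del: split_paired_All)
  qed
  define D where "D i j k = (SOME C. C \<ge> 0 \<and> (\<forall>p y. snd p \<noteq> 0 \<longrightarrow>
      \<bar>partial_deriv j (div_pot (stokes_pot i p) k) y\<bar> \<le> C * rho p y powr (1 - n)))" for i j k :: 'n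
  have D': "D i j k \<ge> 0 \<and> (\<forall>p y. snd p \<noteq> 0 \<longrightarrow>
      \<bar>partial_deriv j (div_pot (stokes_pot i p) k) y\<bar> \<le> D i j k * rho p y powr (1 - n))" for i j k
    unfolding D_def by (rule someI_ex) (rule ex)
  have D: "D i j k \<ge> 0"
    "snd p \<noteq> 0 \<Longrightarrow> \<bar>partial_deriv j (div_pot (stokes_pot i p) k) y\<bar> \<le> D i j k * rho p y powr (1 - n)" for i j k p y
    using D'[of i j k] by (simp_all del: split_paired_All)
  define E where "E = (\<Sum>i\<in>UNIV. \<Sum>j\<in>UNIV. \<Sum>k\<in>UNIV. D i j k)"
  have E0: "E \<ge> 0" unfolding E_def by (intro sum_nonneg D)
  have Ei: "(\<Sum>j\<in>UNIV. \<Sum>k\<in>UNIV. D i j k) \<le> E" for i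
    unfolding E_def by (rule member_le_sum[of i UNIV "\<lambda>i. \<Sum>j\<in>UNIV. \<Sum>k\<in>UNIV. D i j k"]) (use D(1) in \<open>auto intro!: sum_nonneg\<close>)
  have main: "\<bar>w i x\<bar> \<le> E * R / (c * bm) * K / norm x \<and> K \<ge> 0"
    if wc: "\<And>j. cdiff 1 (-{0}) (w j)" and wdiv: "\<And>y. y \<noteq> 0 \<Longrightarrow> (\<Sum>j\<in>UNIV. partial_deriv j (w j) y) = 0"
    and wb: "\<And>j y. y \<noteq> 0 \<Longrightarrow> \<bar>w j y\<bar> \<le> M / norm y"
    and Hc: "\<And>j k. continuous_on (-{0}) (H j k)" and Hb: "\<And>j k y. y \<noteq> 0 \<Longrightarrow> \<bar>H j k y\<bar> \<le> K / (norm y)\<^sup>2"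
    and weak: "weak_solution w H" and zf: "zero_flux w H" and x: "x \<noteq> 0"
    for w :: "'n \<Rightarrow> real ^ 'n \<Rightarrow> real" and H M K i x
  proof -
    have e: "axis undefined 1 \<noteq> (0 :: real ^ 'n)" "norm (axis undefined 1 :: real ^ 'n) = 1"
      by (simp_all add: axis_eq_0_iff norm_axis_1)
    have M0: "M \<ge> 0" and K0: "K \<ge> 0"
      using wb[OF e(1), of undefined] Hb[OF e(1), of undefined undefined] e(2) by auto
    define d where "d m = inverse (real (Suc m))" for m
    have d0: "d m > 0" for m by (simp add: d_def)
    have dl: "d \<longlonglongrightarrow> 0" unfolding d_def[abs_def] by (rule LIMSEQ_inverse_real_of_nat)
    let ?eta = "\<lambda>m y. d m powr 4 * rpow (- (n + 4) / 2) (x, d m) y"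
    have est: "\<bar>\<integral>y. w i y * ?eta m y \<partial>lborel\<bar> \<le> K * E * (R / norm x) / c" for m
    proof -
      define p where "p = (x, d m)"
      have p: "snd p \<noteq> 0" using d0[of m] by (simp add: p_def)
      let ?\<phi> = "div_pot (stokes_pot i p)"
      let ?h = "\<lambda>y. \<Sum>j\<in>UNIV. \<Sum>k\<in>UNIV. H j k y * partial_deriv j (?\<phi> k) y"
      let ?k = "\<lambda>y. K * E * (norm (y - x) powr (1 - n) * norm y powr (-2))"
      have hb: "\<bar>?h y\<bar> \<le> ?k y" if y: "y \<noteq> 0" "y \<noteq> x" for y
      proof -
        have r: "rho p y powr (1 - n) \<le> norm (y - x) powr (1 - n)"
          using y norm_le_rho(1)[of y p] n by (intro powr_mono2') (auto simp: p_def)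
        have "\<bar>?h y\<bar> \<le> (\<Sum>j\<in>UNIV. \<Sum>k\<in>UNIV. \<bar>H j k y * partial_deriv j (?\<phi> k) y\<bar>)"
          by (rule order_trans[OF sum_abs]) (intro sum_mono sum_abs)
        also have "\<dots> \<le> (\<Sum>j\<in>UNIV. \<Sum>k\<in>UNIV. (K / (norm y)\<^sup>2) * (D i j k * norm (y - x) powr (1 - n)))"
        proof (intro sum_mono)
          fix j k
          have "\<bar>partial_deriv j (?\<phi> k) y\<bar> \<le> D i j k * norm (y - x) powr (1 - n)"
            using order_trans[OF D(2)[OF p] mult_left_mono[OF r D(1)]] .
          then show "\<bar>H j k y * partial_deriv j (?\<phi> k) y\<bar> \<le> (K / (norm y)\<^sup>2) * (D i j k * norm (y - x) powr (1 - n))"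
            unfolding abs_mult using Hb[OF y(1)] K0 by (intro mult_mono) auto
        qed
        also have "\<dots> = (K / (norm y)\<^sup>2) * norm (y - x) powr (1 - n) * (\<Sum>j\<in>UNIV. \<Sum>k\<in>UNIV. D i j k)"
          by (simp only: sum_distrib_left) (intro sum.cong refl, simp only: mult_ac)
        also have "\<dots> \<le> (K / (norm y)\<^sup>2) * norm (y - x) powr (1 - n) * E"
          using K0 by (intro mult_left_mono Ei) auto
        finally show ?thesis using y by (simp add: powr_minus powr_numeral field_simps)
      qed
      have AEx: "AE y in (lborel :: (real ^ 'n) measure). y \<noteq> 0 \<and> y \<noteq> x"
        using AE_nonzero AE_lborel_singleton[of x] by eventually_elim simp
      have c\<phi>: "continuous_on (-{0}) (partial_deriv j (?\<phi> k))" for j k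
      proof -
        have "cdiff 2 UNIV (stokes_pot i p k' j')" for k' j'
          by (rule symb_cdiff[OF stokes_pot_symb[OF open_UNIV]]) (use p in simp)
        then have "cdiff (Suc 0) UNIV (?\<phi> k)" by (intro div_pot_cdiff[OF open_UNIV]) (simp only: numeral_2_eq_2)
        then show ?thesis using cdiff_subset[of "Suc 0" UNIV "?\<phi> k" "-{0}"] by simp
      qed
      have hm: "?h \<in> borel_measurable lborel"
      proof -
        have "continuous_on (-{0}) ?h" by (intro continuous_on_sum continuous_on_mult Hc c\<phi>)
        then show ?thesis using borel_measurable_punctured by simp
      qed
      have ki: "integrable lborel ?k" by (intro integrable_mult_right R(2)[OF x])
      have AEh: "AE y in lborel. norm (?h y) \<le> norm (?k y)"
        using AEx
      proof eventually_elim
        case (elim y)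
        have "?h y \<le> \<bar>?h y\<bar>" "\<bar>?h y\<bar> \<le> ?k y" using hb elim by auto
        then show ?case by (simp only: real_norm_def)
      qed
      have hi: "integrable lborel ?h"
        by (rule Bochner_Integration.integrable_bound[OF ki hm AEh])
      have "\<bar>\<integral>y. ?h y \<partial>lborel\<bar> \<le> (\<integral>y. \<bar>?h y\<bar> \<partial>lborel)" by simp
      also have "\<dots> \<le> (\<integral>y. ?k y \<partial>lborel)"
      proof (rule integral_mono_AE[OF integrable_abs[OF hi] ki])
        show "AE y in lborel. \<bar>?h y\<bar> \<le> ?k y" using AEx by eventually_elim (rule hb, auto)
      qed
      also have "\<dots> = K * E * (\<integral>y. norm (y - x) powr (1 - n) * norm y powr (-2) \<partial>lborel)" by simp
      also have "\<dots> \<le> K * E * (R / norm x)" by (intro mult_left_mono R(3)[OF x] mult_nonneg_nonneg K0 E0)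
      finally have hle: "\<bar>\<integral>y. ?h y \<partial>lborel\<bar> \<le> K * E * (R / norm x)" .
      have rep: "(8 * (1 - n / 2) * (- n / 2) * (- n / 2 - 1)) * (\<integral>y. w i y * ((snd p) ^ 4 * rpow (- (n + 4) / 2) p y) \<partial>lborel) = - (\<integral>y. ?h y \<partial>lborel)"
        unfolding n_def by (rule stokes_representation[OF N wc wdiv wb Hc Hb M0 K0 weak zf p hi])
      have eq: "(\<lambda>y. w i y * ((snd p) ^ 4 * rpow (- (n + 4) / 2) p y)) = (\<lambda>y. w i y * ?eta m y)"
        using d0[of m] by (simp add: p_def powr_numeral)
      have "c * \<bar>\<integral>y. w i y * ?eta m y \<partial>lborel\<bar>
         = \<bar>(8 * (1 - n / 2) * (- n / 2) * (- n / 2 - 1)) * (\<integral>y. w i y * ?eta m y \<partial>lborel)\<bar>"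
        unfolding c_def by (rule abs_mult[symmetric])
      also have "\<dots> = \<bar>\<integral>y. ?h y \<partial>lborel\<bar>"
        unfolding rep[unfolded eq] by (rule abs_minus_cancel)
      finally have "c * \<bar>\<integral>y. w i y * ?eta m y \<partial>lborel\<bar> = \<bar>\<integral>y. ?h y \<partial>lborel\<bar>" .
      then have nle: "c * \<bar>\<integral>y. w i y * ?eta m y \<partial>lborel\<bar> \<le> K * E * (R / norm x)" using hle by simp
      show ?thesis by (rule mult_imp_le_div_pos[OF c]) (subst mult.commute, rule nle)
    qed
    have "(\<lambda>m. \<integral>y. w i y * ?eta m y \<partial>lborel) \<longlonglongrightarrow> w i x * bm"
      unfolding n_def bm_def
      by (rule approximate_identity[OF _ cdiff_continuous[OF wc] wb x _ dl d0]) (use N in auto)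
    then have "(\<lambda>m. \<bar>\<integral>y. w i y * ?eta m y \<partial>lborel\<bar>) \<longlonglongrightarrow> \<bar>w i x * bm\<bar>"
      by (rule tendsto_rabs)
    then have "\<bar>w i x * bm\<bar> \<le> K * E * (R / norm x) / c"
      by (rule LIMSEQ_le_const2) (use est in blast)
    then have "\<bar>w i x\<bar> \<le> K * E * (R / norm x) / c / bm"
      using mult_imp_le_div_pos[OF bm] bm by (simp only: abs_mult abs_of_pos)
    also have "\<dots> = E * R / (c * bm) * K / norm x" by (simp add: field_simps)
    finally show ?thesis using K0 by simp
  qed
  show ?thesis
  proof (rule that[of "E * R / (c * bm) + 1"])
    show "E * R / (c * bm) + 1 > 0" using R(1) E0 c bm by (intro add_nonneg_pos divide_nonneg_pos mult_pos_pos mult_nonneg_nonneg) auto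
    fix w :: "'n \<Rightarrow> real ^ 'n \<Rightarrow> real" and H :: "'n \<Rightarrow> 'n \<Rightarrow> real ^ 'n \<Rightarrow> real" and M K and i and x :: "real ^ 'n"
    assume a: "\<And>j. cdiff 1 (-{0}) (w j)" "\<And>y. y \<noteq> 0 \<Longrightarrow> (\<Sum>j\<in>UNIV. partial_deriv j (w j) y) = 0"
     "\<And>j y. y \<noteq> 0 \<Longrightarrow> \<bar>w j y\<bar> \<le> M / norm y"
     "\<And>j k. continuous_on (-{0}) (H j k)" "\<And>j k y. y \<noteq> 0 \<Longrightarrow> \<bar>H j k y\<bar> \<le> K / (norm y)\<^sup>2"
     "weak_solution w H" "zero_flux w H" "x \<noteq> 0"
    have "\<bar>w i x\<bar> \<le> E * R / (c * bm) * K / norm x" using main[OF a] by blast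
    also have "\<dots> \<le> (E * R / (c * bm) + 1) * K / norm x"
      using main[OF a] by (intro divide_right_mono mult_right_mono) auto
    finally show "\<bar>w i x\<bar> \<le> (E * R / (c * bm) + 1) * K / norm x" .
  qed
qed

section \<open>Weak form of the steady Navier-Stokes equations\<close>

text \<open>The divergence of the test field is kept: the flux of a Landau solution will be computed with a field that
is not solenoidal.\<close>

lemma navier_stokes_tested:
  fixes u :: "'n::finite \<Rightarrow> real ^ 'n \<Rightarrow> real"
  assumes u: "\<And>j. cdiff 2 (-{0}) (u j)" and q: "cdiff 1 (-{0}) q"
    and mom: "\<And>j y. y \<noteq> 0 \<Longrightarrow> - (\<Sum>l\<in>UNIV. partial_deriv l (partial_deriv l (u j)) y)
        + (\<Sum>i\<in>UNIV. u i y * partial_deriv i (u j) y) + partial_deriv j q y = 0"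
    and div: "\<And>y. y \<noteq> 0 \<Longrightarrow> (\<Sum>j\<in>UNIV. partial_deriv j (u j) y) = 0"
    and \<phi>: "\<And>j. cdiff 2 (-{0}) (\<phi> j)" "\<And>j. annular (\<phi> j)"
  shows "integral\<^sup>L lborel (weak_term u (\<lambda>j k y. u j y * u k y) \<phi>) + (\<integral>y. q y * (\<Sum>j\<in>UNIV. partial_deriv j (\<phi> j) y) \<partial>lborel) = 0"
    and "integrable lborel (weak_term u (\<lambda>j k y. u j y * u k y) \<phi>)"
    and "integrable lborel (\<lambda>y. q y * (\<Sum>j\<in>UNIV. partial_deriv j (\<phi> j) y))"
proof -
  have u1: "cdiff 1 (-{0}) (u j)" "cdiff 1 (-{0}) (partial_deriv l (u j))" for j l
    using cdiff_le[OF u, of 1] cdiff_partialD[OF u, of 1] by simp_all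
  have \<phi>1: "cdiff 1 (-{0}) (\<phi> j)" "cdiff 1 (-{0}) (partial_deriv l (\<phi> j))" for j l
    using cdiff_le[OF \<phi>(1), of 1] cdiff_partialD[OF \<phi>(1), of 1] by simp_all
  have uu: "cdiff 1 (-{0}) (\<lambda>y. u j y * u k y)" for j k by (intro cdiff_mult open_punctured u1)
  note a1 = integration_by_parts[OF u1(1) \<phi>1(2) annular_partial[OF \<phi>(2)]]
  note a2 = integration_by_parts[OF u1(2) \<phi>1(1) \<phi>(2)]
  note a3 = integration_by_parts[OF uu \<phi>1(1) \<phi>(2)]
  note a4 = integration_by_parts[OF q \<phi>1(1) \<phi>(2)]
  let ?I = "\<lambda>f. integral\<^sup>L lborel f"
  let ?t1 = "\<lambda>y. \<Sum>j\<in>UNIV. \<Sum>l\<in>UNIV. u j y * partial_deriv l (partial_deriv l (\<phi> j)) y"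
  let ?t2 = "\<lambda>y. \<Sum>j\<in>UNIV. \<Sum>k\<in>UNIV. (u j y * u k y) * partial_deriv j (\<phi> k) y"
  let ?t3 = "\<lambda>y. \<Sum>j\<in>UNIV. q y * partial_deriv j (\<phi> j) y"
  have i1: "integrable lborel (\<lambda>y. u j y * partial_deriv l (partial_deriv l (\<phi> j)) y)" for j l by (rule a1(3))
  have i2: "integrable lborel (\<lambda>y. (u j y * u k y) * partial_deriv j (\<phi> k) y)" for j k by (rule a3(3))
  have i3: "integrable lborel (\<lambda>y. q y * partial_deriv j (\<phi> j) y)" for j by (rule a4(3))
  have it: "integrable lborel ?t1" "integrable lborel ?t2" "integrable lborel ?t3"
    by (intro Bochner_Integration.integrable_sum i1 i2 i3)+
  have W: "weak_term u (\<lambda>j k y. u j y * u k y) \<phi> = (\<lambda>y. ?t1 y + ?t2 y)"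
    by (simp add: fun_eq_iff weak_term_def sum_distrib_left)
  have T3: "(\<lambda>y. q y * (\<Sum>j\<in>UNIV. partial_deriv j (\<phi> j) y)) = ?t3"
    by (simp add: sum_distrib_left)
  show "integrable lborel (weak_term u (\<lambda>j k y. u j y * u k y) \<phi>)" unfolding W using it by simp
  show "integrable lborel (\<lambda>y. q y * (\<Sum>j\<in>UNIV. partial_deriv j (\<phi> j) y))" unfolding T3 by (rule it)
  let ?s1 = "\<lambda>y. \<Sum>j\<in>UNIV. \<Sum>l\<in>UNIV. partial_deriv l (partial_deriv l (u j)) y * \<phi> j y"
  let ?s2 = "\<lambda>y. \<Sum>j\<in>UNIV. \<Sum>k\<in>UNIV. partial_deriv j (\<lambda>y. u j y * u k y) y * \<phi> k y"
  let ?s3 = "\<lambda>y. \<Sum>j\<in>UNIV. partial_deriv j q y * \<phi> j y"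
  have iss: "integrable lborel ?s1" "integrable lborel ?s2" "integrable lborel ?s3"
    by (intro Bochner_Integration.integrable_sum a2(2) a3(2) a4(2))+
  have "?I ?t1 = (\<Sum>j\<in>UNIV. \<Sum>l\<in>UNIV. ?I (\<lambda>y. u j y * partial_deriv l (partial_deriv l (\<phi> j)) y))"
    by (subst Bochner_Integration.integral_sum, intro Bochner_Integration.integrable_sum i1,
        intro sum.cong refl Bochner_Integration.integral_sum i1)
  also have "\<dots> = (\<Sum>j\<in>UNIV. \<Sum>l\<in>UNIV. ?I (\<lambda>y. partial_deriv l (partial_deriv l (u j)) y * \<phi> j y))"
  proof (intro sum.cong refl)
    fix j l
    show "?I (\<lambda>y. u j y * partial_deriv l (partial_deriv l (\<phi> j)) y) = ?I (\<lambda>y. partial_deriv l (partial_deriv l (u j)) y * \<phi> j y)"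
      using a1(1)[of l j l j] a2(1)[of l l j j] by simp
  qed
  also have "\<dots> = ?I ?s1"
    by (subst Bochner_Integration.integral_sum, intro Bochner_Integration.integrable_sum a2(2),
        intro sum.cong refl Bochner_Integration.integral_sum[symmetric] a2(2))
  finally have e1: "?I ?t1 = ?I ?s1" .
  have "?I ?t2 = (\<Sum>j\<in>UNIV. \<Sum>k\<in>UNIV. ?I (\<lambda>y. (u j y * u k y) * partial_deriv j (\<phi> k) y))"
    by (subst Bochner_Integration.integral_sum, intro Bochner_Integration.integrable_sum i2,
        intro sum.cong refl Bochner_Integration.integral_sum i2)
  also have "\<dots> = (\<Sum>j\<in>UNIV. \<Sum>k\<in>UNIV. - ?I (\<lambda>y. partial_deriv j (\<lambda>y. u j y * u k y) y * \<phi> k y))"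
    by (intro sum.cong refl) (use a3(1) in simp)
  also have "\<dots> = - (\<Sum>j\<in>UNIV. \<Sum>k\<in>UNIV. ?I (\<lambda>y. partial_deriv j (\<lambda>y. u j y * u k y) y * \<phi> k y))"
    by (simp add: sum_negf)
  also have "(\<Sum>j\<in>UNIV. \<Sum>k\<in>UNIV. ?I (\<lambda>y. partial_deriv j (\<lambda>y. u j y * u k y) y * \<phi> k y)) = ?I ?s2"
    by (subst Bochner_Integration.integral_sum, intro Bochner_Integration.integrable_sum a3(2),
        intro sum.cong refl Bochner_Integration.integral_sum[symmetric] a3(2))
  finally have e2: "?I ?t2 = - ?I ?s2" .
  have "?I ?t3 = (\<Sum>j\<in>UNIV. ?I (\<lambda>y. q y * partial_deriv j (\<phi> j) y))"
    by (intro Bochner_Integration.integral_sum i3)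
  also have "\<dots> = (\<Sum>j\<in>UNIV. - ?I (\<lambda>y. partial_deriv j q y * \<phi> j y))"
    by (intro sum.cong refl) (use a4(1) in simp)
  also have "\<dots> = - (\<Sum>j\<in>UNIV. ?I (\<lambda>y. partial_deriv j q y * \<phi> j y))" by (simp add: sum_negf)
  also have "(\<Sum>j\<in>UNIV. ?I (\<lambda>y. partial_deriv j q y * \<phi> j y)) = ?I ?s3"
    by (intro Bochner_Integration.integral_sum[symmetric] a4(2))
  finally have e3: "?I ?t3 = - ?I ?s3" .
  have z: "?s1 y - ?s2 y - ?s3 y = 0" for y
  proof (cases "y = 0")
    case True
    have "\<phi> j 0 = 0" for j using \<phi>(2)[of j] unfolding annular_def by force
    then show ?thesis using True by simp
  next
    case False
    have d: "u j differentiable (at y)" for j using u1(1)[of j] False by simp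
    have "?s2 y = (\<Sum>j\<in>UNIV. \<Sum>k\<in>UNIV. (partial_deriv j (u j) y * u k y + u j y * partial_deriv j (u k) y) * \<phi> k y)"
      by (simp only: partial_deriv_mult[OF d d])
    also have "\<dots> = (\<Sum>k\<in>UNIV. \<Sum>j\<in>UNIV. (partial_deriv j (u j) y * u k y + u j y * partial_deriv j (u k) y) * \<phi> k y)"
      by (rule sum.swap)
    also have "\<dots> = (\<Sum>k\<in>UNIV. ((\<Sum>j\<in>UNIV. partial_deriv j (u j) y) * u k y + (\<Sum>j\<in>UNIV. u j y * partial_deriv j (u k) y)) * \<phi> k y)"
      by (simp add: sum_distrib_right sum.distrib distrib_right)
    also have "\<dots> = (\<Sum>k\<in>UNIV. (\<Sum>j\<in>UNIV. u j y * partial_deriv j (u k) y) * \<phi> k y)" using div[OF False] by simp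
    finally have s2: "?s2 y = (\<Sum>k\<in>UNIV. (\<Sum>j\<in>UNIV. u j y * partial_deriv j (u k) y) * \<phi> k y)" .
    have s1: "?s1 y = (\<Sum>k\<in>UNIV. (\<Sum>l\<in>UNIV. partial_deriv l (partial_deriv l (u k)) y) * \<phi> k y)"
      by (simp only: sum_distrib_right)
    have "?s1 y - ?s2 y - ?s3 y = (\<Sum>k\<in>UNIV. - ((- (\<Sum>l\<in>UNIV. partial_deriv l (partial_deriv l (u k)) y)
        + (\<Sum>i\<in>UNIV. u i y * partial_deriv i (u k) y) + partial_deriv k q y) * \<phi> k y))"
      unfolding s1 s2 sum_subtractf[symmetric] by (intro sum.cong refl) (simp add: algebra_simps)
    then show ?thesis using mom[OF False] by simp
  qed
  have "?I (\<lambda>y. ?s1 y - ?s2 y - ?s3 y) = 0" unfolding z by simp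
  then have "?I ?s1 - ?I ?s2 - ?I ?s3 = 0" using iss by simp
  then show "?I (weak_term u (\<lambda>j k y. u j y * u k y) \<phi>) + ?I (\<lambda>y. q y * (\<Sum>j\<in>UNIV. partial_deriv j (\<phi> j) y)) = 0"
    unfolding W T3 using e1 e2 e3 it by simp
qed

lemma navier_stokes_weak:
  fixes u :: "'n::finite \<Rightarrow> real ^ 'n \<Rightarrow> real"
  assumes u: "\<And>j. cdiff 2 (-{0}) (u j)" and q: "cdiff 1 (-{0}) q"
    and mom: "\<And>j y. y \<noteq> 0 \<Longrightarrow> - (\<Sum>l\<in>UNIV. partial_deriv l (partial_deriv l (u j)) y)
        + (\<Sum>i\<in>UNIV. u i y * partial_deriv i (u j) y) + partial_deriv j q y = 0"
    and div: "\<And>y. y \<noteq> 0 \<Longrightarrow> (\<Sum>j\<in>UNIV. partial_deriv j (u j) y) = 0"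
  shows "weak_solution u (\<lambda>j k y. u j y * u k y)"
  unfolding weak_solution_def annihilates_def
proof (intro allI impI, elim conjE)
  fix \<phi> :: "'n \<Rightarrow> real ^ 'n \<Rightarrow> real"
  assume \<phi>: "\<forall>j. cdiff 2 (-{0}) (\<phi> j)" "\<forall>j. annular (\<phi> j)" and d: "\<forall>y. y \<noteq> 0 \<longrightarrow> (\<Sum>j\<in>UNIV. partial_deriv j (\<phi> j) y) = 0"
  note t = navier_stokes_tested[where \<phi> = \<phi>, OF u q mom div spec[OF \<phi>(1)] spec[OF \<phi>(2)]]
  have "(\<integral>y. q y * (\<Sum>j\<in>UNIV. partial_deriv j (\<phi> j) y) \<partial>lborel) = 0"
    by (rule integral_eq_zero_AE) (use AE_nonzero d in \<open>auto elim!: eventually_mono\<close>)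
  then show "integrable lborel (weak_term u (\<lambda>j k y. u j y * u k y) \<phi>) \<and> integral\<^sup>L lborel (weak_term u (\<lambda>j k y. u j y * u k y) \<phi>) = 0"
    using t by simp
qed

section \<open>Landau solutions\<close>

text \<open>Functions of \<open>norm y\<close> and \<open>k \<bullet> y\<close> have gradients of the form \<open>\<alpha> *\<^sub>R k + \<beta> *\<^sub>R y\<close>.\<close>

definition axial_gradient :: "'a::real_inner \<Rightarrow> ('a \<Rightarrow> real) \<Rightarrow> real \<Rightarrow> real \<Rightarrow> 'a \<Rightarrow> bool" where
  "axial_gradient k f \<alpha> \<beta> y \<longleftrightarrow> (f has_derivative (\<lambda>v. \<alpha> * (k \<bullet> v) + \<beta> * (y \<bullet> v))) (at y)"

lemma axial_gradient_const: "axial_gradient k (\<lambda>y. c) 0 0 y"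
  by (simp add: axial_gradient_def)

lemma axial_gradient_axis: "axial_gradient k (\<lambda>y. k \<bullet> y) 1 0 y"
  unfolding axial_gradient_def by (auto intro!: derivative_eq_intros)

lemma axial_gradient_add:
  "axial_gradient k f \<alpha> \<beta> y \<Longrightarrow> axial_gradient k g \<alpha>' \<beta>' y \<Longrightarrow> axial_gradient k (\<lambda>y. f y + g y) (\<alpha> + \<alpha>') (\<beta> + \<beta>') y"
  unfolding axial_gradient_def by (drule (1) has_derivative_add) (simp add: algebra_simps)

lemma axial_gradient_diff:
  "axial_gradient k f \<alpha> \<beta> y \<Longrightarrow> axial_gradient k g \<alpha>' \<beta>' y \<Longrightarrow> axial_gradient k (\<lambda>y. f y - g y) (\<alpha> - \<alpha>') (\<beta> - \<beta>') y"
  unfolding axial_gradient_def by (drule (1) has_derivative_diff) (simp add: algebra_simps)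

lemma axial_gradient_mult:
  "axial_gradient k f \<alpha> \<beta> y \<Longrightarrow> axial_gradient k g \<alpha>' \<beta>' y \<Longrightarrow>
    axial_gradient k (\<lambda>y. f y * g y) (\<alpha> * g y + f y * \<alpha>') (\<beta> * g y + f y * \<beta>') y"
  unfolding axial_gradient_def by (drule (1) has_derivative_mult) (simp add: algebra_simps)

lemma axial_gradient_inverse:
  "axial_gradient k f \<alpha> \<beta> y \<Longrightarrow> f y \<noteq> 0 \<Longrightarrow>
    axial_gradient k (\<lambda>y. inverse (f y)) (- (inverse (f y) * inverse (f y)) * \<alpha>) (- (inverse (f y) * inverse (f y)) * \<beta>) y"
proof -
  assume "axial_gradient k f \<alpha> \<beta> y" "f y \<noteq> 0"
  then have "((\<lambda>y. inverse (f y)) has_derivative (\<lambda>v. - (inverse (f y) * (\<alpha> * (k \<bullet> v) + \<beta> * (y \<bullet> v)) * inverse (f y)))) (at y)"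
    unfolding axial_gradient_def by (intro Deriv.has_derivative_inverse)
  then show ?thesis unfolding axial_gradient_def by (simp add: algebra_simps)
qed

lemma axial_gradient_norm:
  "y \<noteq> 0 \<Longrightarrow> axial_gradient k norm 0 (inverse (norm y)) y"
  unfolding axial_gradient_def using has_derivative_norm[of y] by (simp add: sgn_div_norm inner_commute)

lemma axial_gradient_eq:
  "axial_gradient k f \<alpha> \<beta> y \<Longrightarrow> \<alpha> = \<alpha>' \<Longrightarrow> \<beta> = \<beta>' \<Longrightarrow> axial_gradient k f \<alpha>' \<beta>' y" by simp

lemma axial_gradient_partial:
  fixes k :: "real ^ 'n::finite"
  assumes "axial_gradient k f \<alpha> \<beta> y"
  shows "partial_deriv i f y = \<alpha> * k $ i + \<beta> * y $ i" "f differentiable (at y)"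
  using partial_deriv_eq[OF assms[unfolded axial_gradient_def], of i] assms
  by (auto simp: axial_gradient_def differentiable_def inner_axis)

lemma axial_laplacian:
  fixes k :: "real ^ 'n::finite"
  assumes k: "norm k = 1" and y: "y \<noteq> 0"
    and g: "\<And>z. z \<noteq> 0 \<Longrightarrow> axial_gradient k f (\<alpha> z) (\<beta> z) z"
    and a: "axial_gradient k \<alpha> \<alpha>1 \<alpha>2 y" and b: "axial_gradient k \<beta> \<beta>1 \<beta>2 y"
  shows "(\<Sum>l\<in>UNIV. partial_deriv l (partial_deriv l f) y)
    = \<alpha>1 + \<alpha>2 * (k \<bullet> y) + \<beta>1 * (k \<bullet> y) + \<beta>2 * (norm y * norm y) + real CARD('n) * \<beta> y"
proof -
  have "partial_deriv l (partial_deriv l f) y = (\<alpha>1 * k $ l + \<alpha>2 * y $ l) * k $ l + ((\<beta>1 * k $ l + \<beta>2 * y $ l) * y $ l + \<beta> y)" for l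
  proof -
    have "partial_deriv l (partial_deriv l f) y = partial_deriv l (\<lambda>z. \<alpha> z * k $ l + \<beta> z * z $ l) y"
      by (rule partial_deriv_cong[OF open_punctured]) (use y axial_gradient_partial(1)[OF g] in auto)
    also have "\<dots> = partial_deriv l (\<lambda>z. \<alpha> z * k $ l) y + partial_deriv l (\<lambda>z. \<beta> z * z $ l) y"
      by (rule partial_deriv_add) (use axial_gradient_partial(2)[OF a] axial_gradient_partial(2)[OF b] in auto)
    also have "partial_deriv l (\<lambda>z. \<alpha> z * k $ l) y = (\<alpha>1 * k $ l + \<alpha>2 * y $ l) * k $ l"
      using partial_deriv_mult[OF axial_gradient_partial(2)[OF a], of "\<lambda>_. k $ l" l] axial_gradient_partial(1)[OF a, of l] by simp
    also have "partial_deriv l (\<lambda>z. \<beta> z * z $ l) y = (\<beta>1 * k $ l + \<beta>2 * y $ l) * y $ l + \<beta> y"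
      using partial_deriv_mult[OF axial_gradient_partial(2)[OF b], of "\<lambda>z. z $ l" l] axial_gradient_partial(1)[OF b, of l] by simp
    finally show ?thesis .
  qed
  then have "(\<Sum>l\<in>UNIV. partial_deriv l (partial_deriv l f) y) = \<alpha>1 * (\<Sum>l\<in>UNIV. k $ l * k $ l) + \<alpha>2 * (\<Sum>l\<in>UNIV. k $ l * y $ l)
      + \<beta>1 * (\<Sum>l\<in>UNIV. k $ l * y $ l) + \<beta>2 * (\<Sum>l\<in>UNIV. y $ l * y $ l) + real CARD('n) * \<beta> y"
    by (simp add: sum.distrib sum_distrib_left algebra_simps)
  also have "(\<Sum>l\<in>UNIV. k $ l * k $ l) = 1" using norm_eq_sum_squares[of k] k by simp
  also have "(\<Sum>l\<in>UNIV. y $ l * y $ l) = norm y * norm y" using norm_eq_sum_squares[of y] by (simp add: power2_eq_square)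
  also have "(\<Sum>l\<in>UNIV. k $ l * y $ l) = k \<bullet> y" by (simp add: inner_vec_def)
  finally show ?thesis by simp
qed

definition landau_E :: "real \<Rightarrow> real ^ 'n::finite \<Rightarrow> real ^ 'n \<Rightarrow> real" where
  "landau_E a k y = inverse (a * norm y - k \<bullet> y)"

definition landau_h :: "real \<Rightarrow> real ^ 'n::finite \<Rightarrow> real ^ 'n \<Rightarrow> real" where
  "landau_h a k y = 2 * (a * ((k \<bullet> y) * inverse (norm y)) - 1) * (landau_E a k y * landau_E a k y)"

text \<open>The curl of \<open>2 *\<^sub>R E *\<^sub>R (k \<times> y)\<close> (see \<open>landau_field_eq\<close>), written without the cross product so that it is
available over every index type. The pressure that goes with it is \<open>2 h\<close>.\<close>

definition landau_U :: "real \<Rightarrow> real ^ 'n::finite \<Rightarrow> 'n \<Rightarrow> real ^ 'n \<Rightarrow> real" where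
  "landau_U a k j y = 2 * landau_E a k y * k $ j + landau_h a k y * y $ j"

context
  fixes a :: real and k :: "real ^ 'n::finite"
  assumes a: "1 < a" and k: "norm k = 1"
begin

lemma landau_denominator: "a * norm y - k \<bullet> y \<ge> (a - 1) * norm y" 
  using Cauchy_Schwarz_ineq2[of k y] k by (simp add: left_diff_distrib abs_le_iff)

lemma landau_denominator_pos: "y \<noteq> 0 \<Longrightarrow> a * norm y - k \<bullet> y > 0"
  using landau_denominator[of y] a by (smt (verit) mult_pos_pos zero_less_norm_iff)

lemma axial_gradient_R: "y \<noteq> 0 \<Longrightarrow> axial_gradient k (\<lambda>y. inverse (norm y)) 0 (- (inverse (norm y) ^ 3)) y"
  by (rule axial_gradient_eq[OF axial_gradient_inverse[OF axial_gradient_norm]]) (auto simp: power3_eq_cube)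

lemma axial_gradient_E:
  "y \<noteq> 0 \<Longrightarrow> axial_gradient k (landau_E a k) ((landau_E a k y)\<^sup>2) (- a * inverse (norm y) * (landau_E a k y)\<^sup>2) y"
  unfolding landau_E_def[abs_def]
  by (rule axial_gradient_eq[OF axial_gradient_inverse[OF axial_gradient_diff[OF
        axial_gradient_mult[OF axial_gradient_const axial_gradient_norm] axial_gradient_axis]]])
     (use landau_denominator_pos[of y] in \<open>auto simp: power2_eq_square\<close>)

lemmas axial_intros = axial_gradient_add axial_gradient_diff axial_gradient_mult axial_gradient_const
  axial_gradient_axis axial_gradient_R axial_gradient_E

abbreviation (input) "lR y \<equiv> inverse (norm y)"
abbreviation (input) "lE \<equiv> landau_E a k"

definition "h_alpha y = 2 * a * lR y * (lE y * lE y) + 4 * (a * ((k \<bullet> y) * lR y) - 1) * (lE y * lE y * lE y)"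
definition "h_beta y = - 2 * a * (k \<bullet> y) * (lR y * lR y * lR y) * (lE y * lE y) - 4 * (a * ((k \<bullet> y) * lR y) - 1) * a * lR y * (lE y * lE y * lE y)"

lemma axial_gradient_h: "y \<noteq> 0 \<Longrightarrow> axial_gradient k (landau_h a k) (h_alpha y) (h_beta y) y"
  unfolding landau_h_def[abs_def] h_alpha_def h_beta_def
  by (rule axial_gradient_eq, (rule axial_intros | assumption)+)
     (simp_all add: algebra_simps power2_eq_square power3_eq_cube)

text \<open>In terms of \<open>s = norm y\<close> and the denominator \<open>D\<close> all scalars are rational functions, and the differential
equations become polynomial identities.\<close>

lemma landau_relations:
  assumes "y \<noteq> 0"
  obtains s D where "s \<noteq> 0" "D \<noteq> 0" "norm y = s" "lE y = 1 / D" "k \<bullet> y = a * s - D"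
  using that[of "norm y" "a * norm y - k \<bullet> y"] landau_denominator_pos[OF assms] assms
  by (simp add: landau_E_def inverse_eq_divide)

lemma laplacian_landau_E:
  assumes y: "y \<noteq> 0" and n: "CARD('n) = 3"
  shows "(\<Sum>l\<in>UNIV. partial_deriv l (partial_deriv l lE) y)
    = - lE y * lE y * (2 * (a * ((k \<bullet> y) * lR y) - 1) * lE y + landau_h a k y * (a * norm y - k \<bullet> y)) + lE y * landau_h a k y"
proof -
  have g: "axial_gradient k lE ((lE z)\<^sup>2) (- a * lR z * (lE z)\<^sup>2) z" if "z \<noteq> 0" for z
    using axial_gradient_E[OF that] .
  have 1: "axial_gradient k (\<lambda>z. (lE z)\<^sup>2) (2 * (lE y * lE y * lE y)) (- 2 * a * lR y * (lE y * lE y * lE y)) y"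
    unfolding power2_eq_square
    by (rule axial_gradient_eq, (rule axial_intros y)+) (simp_all add: algebra_simps power2_eq_square)
  have 2: "axial_gradient k (\<lambda>z. - a * lR z * (lE z)\<^sup>2) (- 2 * a * lR y * (lE y * lE y * lE y))
     (a * (lR y * lR y * lR y) * (lE y * lE y) + 2 * a * a * (lR y * lR y) * (lE y * lE y * lE y)) y"
    unfolding power2_eq_square
    by (rule axial_gradient_eq, (rule axial_intros y)+) (simp_all add: algebra_simps power2_eq_square power3_eq_cube)
  obtain s D where sD: "s \<noteq> 0" "D \<noteq> 0" "norm y = s" "lE y = 1 / D" "k \<bullet> y = a * s - D"
    using landau_relations[OF y] by blast
  have L: "(\<Sum>l\<in>UNIV. partial_deriv l (partial_deriv l lE) y) = 2 * (lE y * lE y * lE y)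
      + - 2 * a * lR y * (lE y * lE y * lE y) * (k \<bullet> y) + - 2 * a * lR y * (lE y * lE y * lE y) * (k \<bullet> y)
      + (a * (lR y * lR y * lR y) * (lE y * lE y) + 2 * a * a * (lR y * lR y) * (lE y * lE y * lE y)) * (norm y * norm y)
      + real CARD('n) * (- a * lR y * (lE y)\<^sup>2)"
    by (rule axial_laplacian[OF k y g 1 2])
  show ?thesis unfolding L landau_h_def n sD(3,4,5)
    using sD(1,2) by (simp add: field_simps power2_eq_square power3_eq_cube)
qed

lemma laplacian_landau_h:
  assumes y: "y \<noteq> 0" and n: "CARD('n) = 3"
  shows "(\<Sum>l\<in>UNIV. partial_deriv l (partial_deriv l (landau_h a k)) y)
    = landau_h a k y * landau_h a k y + h_alpha y * (2 * lE y + landau_h a k y * (k \<bullet> y)) + h_beta y * (2 * lE y * (k \<bullet> y) + landau_h a k y * (norm y * norm y))"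
proof -
  obtain s D where sD: "s \<noteq> 0" "D \<noteq> 0" "norm y = s" "lE y = 1 / D" "k \<bullet> y = a * s - D"
    using landau_relations[OF y] by blast
  obtain p1 p2 where 1: "axial_gradient k h_alpha p1 p2 y" and p: "p1 = 8 * a * lR y * (lE y * lE y * lE y) + 12 * (a * ((k \<bullet> y) * lR y) - 1) * (lE y * lE y * lE y * lE y)"
     "p2 = - 2 * a * (lR y * lR y * lR y) * (lE y * lE y) - 4 * a * a * (lR y * lR y) * (lE y * lE y * lE y)
       - 4 * a * (k \<bullet> y) * (lR y * lR y * lR y) * (lE y * lE y * lE y) - 12 * (a * ((k \<bullet> y) * lR y) - 1) * a * lR y * (lE y * lE y * lE y * lE y)"
  proof -
    have "axial_gradient k h_alpha (8 * a * lR y * (lE y * lE y * lE y) + 12 * (a * ((k \<bullet> y) * lR y) - 1) * (lE y * lE y * lE y * lE y))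
     (- 2 * a * (lR y * lR y * lR y) * (lE y * lE y) - 4 * a * a * (lR y * lR y) * (lE y * lE y * lE y)
       - 4 * a * (k \<bullet> y) * (lR y * lR y * lR y) * (lE y * lE y * lE y) - 12 * (a * ((k \<bullet> y) * lR y) - 1) * a * lR y * (lE y * lE y * lE y * lE y)) y"
      unfolding h_alpha_def[abs_def]
      by (rule axial_gradient_eq, (rule axial_intros y)+) (simp_all add: algebra_simps power2_eq_square power3_eq_cube)
    then show ?thesis using that by blast
  qed
  obtain q1 q2 where 2: "axial_gradient k h_beta q1 q2 y" and q: "q1 = - 2 * a * (lR y * lR y * lR y) * (lE y * lE y) - 4 * a * (k \<bullet> y) * (lR y * lR y * lR y) * (lE y * lE y * lE y)
       - 4 * a * a * (lR y * lR y) * (lE y * lE y * lE y) - 12 * (a * ((k \<bullet> y) * lR y) - 1) * a * lR y * (lE y * lE y * lE y * lE y)"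
     "q2 = 6 * a * (k \<bullet> y) * (lR y * lR y * lR y * lR y * lR y) * (lE y * lE y) + 4 * a * a * (k \<bullet> y) * (lR y * lR y * lR y * lR y) * (lE y * lE y * lE y)
       + 8 * a * a * (k \<bullet> y) * (lR y * lR y * lR y * lR y) * (lE y * lE y * lE y) - 4 * a * (lR y * lR y * lR y) * (lE y * lE y * lE y)
       + 12 * (a * ((k \<bullet> y) * lR y) - 1) * a * a * (lR y * lR y) * (lE y * lE y * lE y * lE y)"
  proof -
    have "axial_gradient k h_beta (- 2 * a * (lR y * lR y * lR y) * (lE y * lE y) - 4 * a * (k \<bullet> y) * (lR y * lR y * lR y) * (lE y * lE y * lE y)
       - 4 * a * a * (lR y * lR y) * (lE y * lE y * lE y) - 12 * (a * ((k \<bullet> y) * lR y) - 1) * a * lR y * (lE y * lE y * lE y * lE y))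
     (6 * a * (k \<bullet> y) * (lR y * lR y * lR y * lR y * lR y) * (lE y * lE y) + 4 * a * a * (k \<bullet> y) * (lR y * lR y * lR y * lR y) * (lE y * lE y * lE y)
       + 8 * a * a * (k \<bullet> y) * (lR y * lR y * lR y * lR y) * (lE y * lE y * lE y) - 4 * a * (lR y * lR y * lR y) * (lE y * lE y * lE y)
       + 12 * (a * ((k \<bullet> y) * lR y) - 1) * a * a * (lR y * lR y) * (lE y * lE y * lE y * lE y)) y"
      unfolding h_beta_def[abs_def]
      by (rule axial_gradient_eq, (rule axial_intros y)+) (simp_all add: algebra_simps power2_eq_square power3_eq_cube)
    then show ?thesis using that by blast
  qed
  have L: "(\<Sum>l\<in>UNIV. partial_deriv l (partial_deriv l (landau_h a k)) y) = p1 + p2 * (k \<bullet> y) + q1 * (k \<bullet> y) + q2 * (norm y * norm y)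
      + real CARD('n) * h_beta y"
    by (rule axial_laplacian[OF k y axial_gradient_h 1 2])
  show ?thesis unfolding L p q h_alpha_def h_beta_def landau_h_def n sD(3,4,5)
    using sD(1,2) by (simp add: field_simps)
qed


lemma landau_scalars_cdiff: "cdiff m (-{0}) (norm :: real ^ 'n \<Rightarrow> real)" "cdiff m (-{0}) lE" "cdiff m (-{0}) (landau_h a k)"
proof -
  have N: "cdiff m (-{0}) (norm :: real ^ 'n \<Rightarrow> real)" for m
  proof (induction m)
    case (Suc m)
    have p: "partial_deriv i norm y = y $ i * inverse (norm y)" "norm differentiable (at y)" if "y \<noteq> 0" for i and y :: "real ^ 'n"
      using axial_gradient_partial(1)[OF axial_gradient_norm[OF that, of k], of i] axial_gradient_partial(2)[OF axial_gradient_norm[OF that, of k]] by simp_all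
    have c: "cdiff m (-{0}) (\<lambda>y :: real ^ 'n. y $ i * inverse (norm y))" for i
      by (intro cdiff_mult cdiff_inverse open_punctured Suc cdiff_coord) auto
    have "cdiff m (-{0}) (partial_deriv i (norm :: real ^ 'n \<Rightarrow> real))" for i
      by (rule cdiff_cong_imp[OF open_punctured _ c[of i]]) (simp add: p)
    then show ?case using p(2) by simp
  qed (auto intro: continuous_intros)
  show "cdiff m (-{0}) (norm :: real ^ 'n \<Rightarrow> real)" by (rule N)
  have I: "cdiff m (-{0}) (\<lambda>y :: real ^ 'n. k \<bullet> y)" for m
    unfolding inner_vec_def inner_real_def by (intro cdiff_sum cdiff_mult open_punctured) auto
  have E: "cdiff m (-{0}) lE" for m
    unfolding landau_E_def[abs_def]
    by (intro cdiff_inverse cdiff_diff cdiff_mult open_punctured N I cdiff_const)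
       (use landau_denominator_pos in force)
  show "cdiff m (-{0}) lE" by (rule E)
  show "cdiff m (-{0}) (landau_h a k)"
    unfolding landau_h_def[abs_def]
    by (intro cdiff_diff cdiff_mult open_punctured N I E cdiff_const cdiff_inverse) auto
qed

lemma landau_U_cdiff: "cdiff m (-{0}) (landau_U a k j)"
  unfolding landau_U_def[abs_def]
  by (intro cdiff_add cdiff_mult open_punctured landau_scalars_cdiff cdiff_const cdiff_coord)

lemma landau_gradients:
  assumes "y \<noteq> 0"
  shows "partial_deriv i lE y = lE y * lE y * k $ i - a * lR y * (lE y * lE y) * y $ i"
    and "partial_deriv i (landau_h a k) y = h_alpha y * k $ i + h_beta y * y $ i"
  using axial_gradient_partial(1)[OF axial_gradient_E[OF assms], of i]
    axial_gradient_partial(1)[OF axial_gradient_h[OF assms], of i] by (simp_all add: power2_eq_square)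

lemma landau_U_partial:
  assumes y: "y \<noteq> 0"
  shows "partial_deriv i (landau_U a k j) y
    = 2 * k $ j * partial_deriv i lE y + partial_deriv i (landau_h a k) y * y $ j + landau_h a k y * (if i = j then 1 else 0)"
proof -
  have d: "lE differentiable (at y)" "landau_h a k differentiable (at y)"
    using landau_scalars_cdiff(2,3)[of 1] y by simp_all
  have "partial_deriv i (\<lambda>y. 2 * lE y * k $ j) y = 2 * k $ j * partial_deriv i lE y"
    using partial_deriv_cmult[OF d(1), of i "2 * k $ j"] by (simp add: mult_ac)
  moreover have "partial_deriv i (\<lambda>y. landau_h a k y * y $ j) y
     = partial_deriv i (landau_h a k) y * y $ j + landau_h a k y * (if i = j then 1 else 0)"
    by (subst partial_deriv_mult[OF d(2)]) simp_all
  ultimately show ?thesis unfolding landau_U_def[abs_def]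
    by (subst partial_deriv_add) (use d in auto)
qed

lemma sum_axis_products:
  "(\<Sum>i\<in>UNIV. k $ i * k $ i) = 1" "(\<Sum>i\<in>UNIV. k $ i * y $ i) = k \<bullet> y" "(\<Sum>i\<in>UNIV. y $ i * y $ i) = norm y * norm (y :: real ^ 'n)"
  using norm_eq_sum_squares[of k] norm_eq_sum_squares[of y] k by (simp_all add: inner_vec_def power2_eq_square)

lemma landau_divergence_free:
  assumes y: "y \<noteq> 0" and n: "CARD('n) = 3"
  shows "(\<Sum>j\<in>UNIV. partial_deriv j (landau_U a k j) y) = 0"
proof -
  obtain s D where sD: "s \<noteq> 0" "D \<noteq> 0" "norm y = s" "lE y = 1 / D" "k \<bullet> y = a * s - D"
    using landau_relations[OF y] by blast
  have "(\<Sum>j\<in>UNIV. partial_deriv j (landau_U a k j) y)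
     = 2 * (lE y * lE y) * (\<Sum>j\<in>UNIV. k $ j * k $ j) - 2 * (a * lR y * (lE y * lE y)) * (\<Sum>j\<in>UNIV. k $ j * y $ j)
       + h_alpha y * (\<Sum>j\<in>UNIV. k $ j * y $ j) + h_beta y * (\<Sum>j\<in>UNIV. y $ j * y $ j) + real CARD('n) * landau_h a k y"
    unfolding landau_U_partial[OF y] landau_gradients[OF y]
    by (simp add: sum.distrib sum_subtractf sum_distrib_left algebra_simps)
  also have "\<dots> = 0" unfolding sum_axis_products h_alpha_def h_beta_def landau_h_def n sD(3,4,5)
    using sD(1,2) by (simp add: field_simps)
  finally show ?thesis .
qed

lemma landau_momentum:
  assumes y: "y \<noteq> 0" and n: "CARD('n) = 3"
  shows "- (\<Sum>l\<in>UNIV. partial_deriv l (partial_deriv l (landau_U a k j)) y)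
        + (\<Sum>i\<in>UNIV. landau_U a k i y * partial_deriv i (landau_U a k j) y) + partial_deriv j (\<lambda>y. 2 * landau_h a k y) y = 0"
proof -
  let ?h = "landau_h a k"
  have d: "lE differentiable (at z)" "?h differentiable (at z)" "partial_deriv l lE differentiable (at z)" "partial_deriv l ?h differentiable (at z)"
    if "z \<noteq> 0" for z l
    using landau_scalars_cdiff(2,3)[of 2] that by (simp_all add: numeral_2_eq_2)
  have lap: "partial_deriv l (partial_deriv l (landau_U a k j)) y = 2 * k $ j * partial_deriv l (partial_deriv l lE) y
      + partial_deriv l (partial_deriv l ?h) y * y $ j + (if l = j then 2 * partial_deriv l ?h y else 0)" for l
  proof -
    have "partial_deriv l (partial_deriv l (landau_U a k j)) y
       = partial_deriv l (\<lambda>z. 2 * k $ j * partial_deriv l lE z + (partial_deriv l ?h z * z $ j + ?h z * (if l = j then 1 else 0))) y"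
      by (rule partial_deriv_cong[OF open_punctured]) (use y landau_U_partial in \<open>auto simp: add.assoc\<close>)
    also have "\<dots> = partial_deriv l (\<lambda>z. 2 * k $ j * partial_deriv l lE z) y + (partial_deriv l (\<lambda>z. partial_deriv l ?h z * z $ j) y + partial_deriv l (\<lambda>z. ?h z * (if l = j then 1 else 0)) y)"
      using d[OF y] by (subst partial_deriv_add, simp, simp, subst partial_deriv_add) auto
    also have "partial_deriv l (\<lambda>z. 2 * k $ j * partial_deriv l lE z) y = 2 * k $ j * partial_deriv l (partial_deriv l lE) y"
      by (rule partial_deriv_cmult[OF d(3)[OF y]])
    also have "partial_deriv l (\<lambda>z. partial_deriv l ?h z * z $ j) y = partial_deriv l (partial_deriv l ?h) y * y $ j + partial_deriv l ?h y * (if l = j then 1 else 0)"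
      by (subst partial_deriv_mult[OF d(4)[OF y]]) simp_all
    also have "partial_deriv l (\<lambda>z. ?h z * (if l = j then 1 else 0)) y = (if l = j then partial_deriv l ?h y else 0)"
      by (subst partial_deriv_mult[OF d(2)[OF y]]) simp_all
    finally show ?thesis by simp
  qed
  have L: "(\<Sum>l\<in>UNIV. partial_deriv l (partial_deriv l (landau_U a k j)) y)
     = 2 * k $ j * (\<Sum>l\<in>UNIV. partial_deriv l (partial_deriv l lE) y) + (\<Sum>l\<in>UNIV. partial_deriv l (partial_deriv l ?h) y) * y $ j + 2 * partial_deriv j ?h y"
    unfolding lap by (simp add: sum.distrib sum_distrib_left sum_distrib_right)
  have adv: "(\<Sum>i\<in>UNIV. landau_U a k i y * (\<alpha> * k $ i + \<beta> * y $ i))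
     = 2 * lE y * (\<alpha> + \<beta> * (k \<bullet> y)) + ?h y * (\<alpha> * (k \<bullet> y) + \<beta> * (norm y * norm y))" for \<alpha> \<beta>
  proof -
    have "(\<Sum>i\<in>UNIV. landau_U a k i y * (\<alpha> * k $ i + \<beta> * y $ i))
      = 2 * lE y * (\<alpha> * (\<Sum>i\<in>UNIV. k $ i * k $ i) + \<beta> * (\<Sum>i\<in>UNIV. k $ i * y $ i))
        + ?h y * (\<alpha> * (\<Sum>i\<in>UNIV. k $ i * y $ i) + \<beta> * (\<Sum>i\<in>UNIV. y $ i * y $ i))"
      unfolding landau_U_def by (simp add: sum.distrib sum_distrib_left algebra_simps)
    then show ?thesis unfolding sum_axis_products by simp
  qed
  have advE: "(\<Sum>i\<in>UNIV. landau_U a k i y * partial_deriv i lE y)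
     = 2 * lE y * (lE y * lE y - a * lR y * (lE y * lE y) * (k \<bullet> y)) + ?h y * (lE y * lE y * (k \<bullet> y) - a * lR y * (lE y * lE y) * (norm y * norm y))"
    using adv[of "lE y * lE y" "- (a * lR y * (lE y * lE y))"] unfolding landau_gradients(1)[OF y] by simp
  have advh: "(\<Sum>i\<in>UNIV. landau_U a k i y * partial_deriv i ?h y)
     = 2 * lE y * (h_alpha y + h_beta y * (k \<bullet> y)) + ?h y * (h_alpha y * (k \<bullet> y) + h_beta y * (norm y * norm y))"
    using adv[of "h_alpha y" "h_beta y"] unfolding landau_gradients(2)[OF y] by simp
  have "(\<Sum>i\<in>UNIV. landau_U a k i y * partial_deriv i (landau_U a k j) y)
     = (\<Sum>i\<in>UNIV. 2 * k $ j * (landau_U a k i y * partial_deriv i lE y) + y $ j * (landau_U a k i y * partial_deriv i ?h y) + (if i = j then landau_U a k i y * ?h y else 0))"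
    unfolding landau_U_partial[OF y] by (intro sum.cong refl) (simp add: algebra_simps)
  also have "\<dots> = 2 * k $ j * (\<Sum>i\<in>UNIV. landau_U a k i y * partial_deriv i lE y) + y $ j * (\<Sum>i\<in>UNIV. landau_U a k i y * partial_deriv i ?h y) + landau_U a k j y * ?h y"
    by (simp add: sum.distrib sum_distrib_left)
  finally have A: "(\<Sum>i\<in>UNIV. landau_U a k i y * partial_deriv i (landau_U a k j) y)
     = 2 * k $ j * (\<Sum>i\<in>UNIV. landau_U a k i y * partial_deriv i lE y) + y $ j * (\<Sum>i\<in>UNIV. landau_U a k i y * partial_deriv i ?h y) + landau_U a k j y * ?h y" .
  have P: "partial_deriv j (\<lambda>y. 2 * ?h y) y = 2 * partial_deriv j ?h y" by (rule partial_deriv_cmult[OF d(2)[OF y]])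
  obtain s D where sD: "s \<noteq> 0" "D \<noteq> 0" "norm y = s" "lE y = 1 / D" "k \<bullet> y = a * s - D"
    using landau_relations[OF y] by blast
  have ce: "(\<Sum>i\<in>UNIV. landau_U a k i y * partial_deriv i lE y) - (\<Sum>l\<in>UNIV. partial_deriv l (partial_deriv l lE) y) + lE y * ?h y = 0"
    unfolding advE laplacian_landau_E[OF y n] landau_h_def sD(3,4,5) using sD(1,2) by (simp add: field_simps)
  have ch: "(\<Sum>i\<in>UNIV. landau_U a k i y * partial_deriv i ?h y) - (\<Sum>l\<in>UNIV. partial_deriv l (partial_deriv l ?h) y) + ?h y * ?h y = 0"
    unfolding advh laplacian_landau_h[OF y n] by (simp add: algebra_simps)
  have "- (\<Sum>l\<in>UNIV. partial_deriv l (partial_deriv l (landau_U a k j)) y)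
        + (\<Sum>i\<in>UNIV. landau_U a k i y * partial_deriv i (landau_U a k j) y) + partial_deriv j (\<lambda>y. 2 * ?h y) y
     = 2 * k $ j * ((\<Sum>i\<in>UNIV. landau_U a k i y * partial_deriv i lE y) - (\<Sum>l\<in>UNIV. partial_deriv l (partial_deriv l lE) y) + lE y * ?h y)
       + y $ j * ((\<Sum>i\<in>UNIV. landau_U a k i y * partial_deriv i ?h y) - (\<Sum>l\<in>UNIV. partial_deriv l (partial_deriv l ?h) y) + ?h y * ?h y)"
    unfolding L A P by (subst landau_U_def) (simp add: algebra_simps)
  then show ?thesis unfolding ce ch by simp
qed

lemma landau_weak:
  assumes "CARD('n) = 3"
  shows "weak_solution (landau_U a k) (\<lambda>j i y. landau_U a k j y * landau_U a k i y)"
  by (rule navier_stokes_weak[OF landau_U_cdiff cdiff_cmult[OF open_punctured landau_scalars_cdiff(3)] landau_momentum landau_divergence_free])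
     (use assms in auto)

lemma landau_scalar_bounds:
  assumes a2: "2 \<le> a" and y: "y \<noteq> 0"
  shows "0 < lE y" "lE y \<le> 2 / (a * norm y)" "\<bar>landau_h a k y\<bar> \<le> 16 / (a * norm y * norm y)"
proof -
  have s: "norm y > 0" using y by simp
  have "a / 2 * norm y \<le> (a - 1) * norm y" using a2 s by (intro mult_right_mono) auto
  then have D: "a * norm y / 2 \<le> a * norm y - k \<bullet> y" using landau_denominator[of y] by simp
  show E0: "0 < lE y" using landau_denominator_pos[OF y] by (simp add: landau_E_def)
  have "inverse (a * norm y - k \<bullet> y) \<le> inverse (a * norm y / 2)"
    using D a2 s by (intro le_imp_inverse_le) auto
  then show E: "lE y \<le> 2 / (a * norm y)" by (simp add: landau_E_def inverse_eq_divide)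
  have "\<bar>(k \<bullet> y) * lR y\<bar> \<le> 1"
    using Cauchy_Schwarz_ineq2[of k y] k s by (simp add: abs_mult field_simps)
  then have "\<bar>a * ((k \<bullet> y) * lR y)\<bar> \<le> a" using a2 by (simp add: abs_mult mult_left_le)
  moreover have "\<bar>2 * (X - 1)\<bar> \<le> 4 * a" if "\<bar>X\<bar> \<le> a" for X :: real
    using that a2 by (smt (verit))
  ultimately have m: "\<bar>2 * (a * ((k \<bullet> y) * lR y) - 1)\<bar> \<le> 4 * a" by blast
  have "\<bar>landau_h a k y\<bar> \<le> 4 * a * (2 / (a * norm y) * (2 / (a * norm y)))"
  proof -
    have "lE y * lE y \<le> 2 / (a * norm y) * (2 / (a * norm y))" using E E0 a2 by (intro mult_mono) auto
    then show ?thesis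
      unfolding landau_h_def abs_mult[of _ "lE y * lE y"] using m a2 by (intro mult_mono) auto
  qed
  also have "\<dots> = 16 / (a * norm y * norm y)" using a2 s by (simp add: field_simps)
  finally show "\<bar>landau_h a k y\<bar> \<le> 16 / (a * norm y * norm y)" .
qed

lemma landau_U_bound:
  assumes a2: "2 \<le> a" and y: "y \<noteq> 0"
  shows "\<bar>landau_U a k j y\<bar> \<le> 20 / a / norm y"
proof -
  note b = landau_scalar_bounds[OF a2 y]
  have kj: "\<bar>k $ j\<bar> \<le> 1" using component_le_norm_cart[of k j] k by simp
  have "\<bar>landau_U a k j y\<bar> \<le> \<bar>2 * lE y * k $ j\<bar> + \<bar>landau_h a k y * y $ j\<bar>" by (simp add: landau_U_def)
  also have "\<bar>2 * lE y * k $ j\<bar> \<le> (2 * (2 / (a * norm y))) * 1"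
    unfolding abs_mult[of "2 * lE y"] using b kj a2 by (intro mult_mono) auto
  also have "\<bar>landau_h a k y * y $ j\<bar> \<le> 16 / (a * norm y * norm y) * norm y"
    unfolding abs_mult using b(3) component_le_norm_cart[of y j] a2 by (intro mult_mono) auto
  also have "2 * (2 / (a * norm y)) * 1 + 16 / (a * norm y * norm y) * norm y = 20 / a / norm y"
    using a2 y by (simp add: field_simps)
  finally show ?thesis by simp
qed


lemma landau_homogeneous:
  assumes y: "y \<noteq> 0"
  shows "(\<Sum>l\<in>UNIV. y $ l * partial_deriv l (landau_U a k j) y) = - landau_U a k j y"
proof -
  obtain s D where sD: "s \<noteq> 0" "D \<noteq> 0" "norm y = s" "lE y = 1 / D" "k \<bullet> y = a * s - D"
    using landau_relations[OF y] by blast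
  have "(\<Sum>l\<in>UNIV. y $ l * partial_deriv l (landau_U a k j) y)
     = (\<Sum>l\<in>UNIV. (2 * k $ j * (lE y * lE y) + h_alpha y * y $ j) * (k $ l * y $ l)
        + (h_beta y * y $ j - 2 * k $ j * (a * lR y * (lE y * lE y))) * (y $ l * y $ l) + (if l = j then landau_h a k y * y $ j else 0))"
    unfolding landau_U_partial[OF y] landau_gradients[OF y] by (intro sum.cong refl) (simp add: algebra_simps)
  also have "\<dots> = (2 * k $ j * (lE y * lE y) + h_alpha y * y $ j) * (k \<bullet> y)
        + (h_beta y * y $ j - 2 * k $ j * (a * lR y * (lE y * lE y))) * (norm y * norm y) + landau_h a k y * y $ j"
    unfolding sum_axis_products[symmetric] by (simp add: sum.distrib sum_distrib_left)
  also have "\<dots> = - landau_U a k j y"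
    unfolding landau_U_def h_alpha_def h_beta_def landau_h_def sD(3,4,5)
    using sD(1,2) by (simp add: field_simps)
  finally show ?thesis .
qed

end

section \<open>Landau fields as curls\<close>

text \<open>The identities \<open>k \<times> (k \<times> y) = (k \<bullet> y) k - y\<close> and \<open>y \<times> (k \<times> y) = (y \<bullet> y) k - (k \<bullet> y) y\<close> in the first coordinate. The other
coordinates are obtained by cyclic permutation.\<close>

lemma landau_curl_algebra:
  fixes y1 y2 y3 k1 k2 k3 R E a s :: real
  assumes Rs: "R * s = 1" and s: "s * s = y1 * y1 + y2 * y2 + y3 * y3" and k: "k1 * k1 + k2 * k2 + k3 * k3 = 1"
    and E: "E * (a * s - (k1 * y1 + k2 * y2 + k3 * y3)) = 1"
  shows "2 * ((E\<^sup>2 * k2 + - a * R * E\<^sup>2 * y2) * (k1 * y2 - k2 * y1) + E * k1)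
      - 2 * ((E\<^sup>2 * k3 + - a * R * E\<^sup>2 * y3) * (k3 * y1 - k1 * y3) + E * (- k1))
    = 2 * E * k1 + 2 * (a * ((k1 * y1 + k2 * y2 + k3 * y3) * R) - 1) * (E * E) * y1"
proof -
  define p where "p = k1 * y1 + k2 * y2 + k3 * y3"
  have 1: "k2 * (k1 * y2 - k2 * y1) - k3 * (k3 * y1 - k1 * y3) = k1 * p - y1"
  proof -
    have "k2 * (k1 * y2 - k2 * y1) - k3 * (k3 * y1 - k1 * y3) = k1 * p - y1 * (k1 * k1 + k2 * k2 + k3 * k3)"
      by (simp add: p_def algebra_simps)
    then show ?thesis unfolding k by simp
  qed
  have 2: "y2 * (k1 * y2 - k2 * y1) - y3 * (k3 * y1 - k1 * y3) = k1 * (s * s) - y1 * p"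
    by (simp add: s p_def algebra_simps)
  have "2 * ((E\<^sup>2 * k2 + - a * R * E\<^sup>2 * y2) * (k1 * y2 - k2 * y1) + E * k1)
      - 2 * ((E\<^sup>2 * k3 + - a * R * E\<^sup>2 * y3) * (k3 * y1 - k1 * y3) + E * (- k1))
    = 4 * E * k1 + 2 * E\<^sup>2 * (k2 * (k1 * y2 - k2 * y1) - k3 * (k3 * y1 - k1 * y3))
      - 2 * a * R * E\<^sup>2 * (y2 * (k1 * y2 - k2 * y1) - y3 * (k3 * y1 - k1 * y3))"
    by (simp add: algebra_simps)
  also have "\<dots> = 4 * E * k1 + 2 * E\<^sup>2 * (k1 * p - y1) - 2 * a * E\<^sup>2 * (k1 * ((R * s) * s) - y1 * p * R)"
    unfolding 1 2 by (simp add: algebra_simps)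
  also have "\<dots> = 4 * E * k1 - 2 * E * k1 * (E * (a * s - p)) + 2 * (a * (p * R) - 1) * (E * E) * y1"
    unfolding Rs by (simp add: algebra_simps power2_eq_square)
  also have "\<dots> = 2 * E * k1 + 2 * (a * (p * R) - 1) * (E * E) * y1"
    unfolding E[folded p_def] by simp
  finally show ?thesis by (simp add: p_def)
qed

lemma landau_field_eq:
  fixes k y :: "real ^ 3"
  assumes a: "1 < a" and k: "norm k = 1" and y: "y \<noteq> 0"
  shows "landau_field k (ereal a) y = (\<chi> j. landau_U a k j y)"
proof -
  define A where "A = landau_potential k (ereal a)"
  let ?E = "landau_E a k" and ?R = "inverse (norm y)"
  have Az: "A z $ i = 2 * (?E z * (k \<times> z) $ i)" if "z \<in> -{0}" for z i
    unfolding A_def using landau_potential_eq[OF k, of z a] that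
    by (simp add: landau_E_def divide_inverse)
  have pE: "partial_deriv i ?E y = (?E y)\<^sup>2 * k $ i + - a * ?R * (?E y)\<^sup>2 * y $ i" and dE: "?E differentiable (at y)" for i
    using axial_gradient_partial(1)[OF axial_gradient_E[OF a k y], of i] axial_gradient_partial(2)[OF axial_gradient_E[OF a k y]]
    by simp_all
  have c: "(k \<times> z) $ 1 = k $ 2 * z $ 3 - k $ 3 * z $ 2" "(k \<times> z) $ 2 = k $ 3 * z $ 1 - k $ 1 * z $ 3"
    "(k \<times> z) $ 3 = k $ 1 * z $ 2 - k $ 2 * z $ 1" for z
    by (simp_all add: cross3_simps)
  have dc: "(\<lambda>z. (k \<times> z) $ j) differentiable (at y)" for j
    using exhaust_3[of j] by (auto simp: c)
  have pA: "partial_deriv i (\<lambda>z. A z $ j) y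
      = 2 * (((?E y)\<^sup>2 * k $ i + - a * ?R * (?E y)\<^sup>2 * y $ i) * (k \<times> y) $ j + ?E y * partial_deriv i (\<lambda>z. (k \<times> z) $ j) y)" for i j
  proof -
    have "partial_deriv i (\<lambda>z. A z $ j) y = partial_deriv i (\<lambda>z. 2 * (?E z * (k \<times> z) $ j)) y"
      by (rule partial_deriv_cong[OF open_punctured]) (use Az y in simp_all)
    also have "\<dots> = 2 * partial_deriv i (\<lambda>z. ?E z * (k \<times> z) $ j) y"
      by (rule partial_deriv_cmult) (intro differentiable_mult dE dc)
    also have "partial_deriv i (\<lambda>z. ?E z * (k \<times> z) $ j) y = partial_deriv i ?E y * (k \<times> y) $ j + ?E y * partial_deriv i (\<lambda>z. (k \<times> z) $ j) y"
      by (subst partial_deriv_mult[OF dE dc]) simp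
    finally show ?thesis unfolding pE .
  qed
  have pc: "partial_deriv i (\<lambda>z. (k \<times> z) $ 1) y = k $ 2 * (if i = 3 then 1 else 0) - k $ 3 * (if i = 2 then 1 else 0)"
    "partial_deriv i (\<lambda>z. (k \<times> z) $ 2) y = k $ 3 * (if i = 1 then 1 else 0) - k $ 1 * (if i = 3 then 1 else 0)"
    "partial_deriv i (\<lambda>z. (k \<times> z) $ 3) y = k $ 1 * (if i = 2 then 1 else 0) - k $ 2 * (if i = 1 then 1 else 0)" for i
    unfolding c by (subst partial_deriv_diff; simp add: partial_deriv_cmult)+
  have Rs: "?R * norm y = 1" using y by simp
  have s: "norm y * norm y = y $ 1 * y $ 1 + y $ 2 * y $ 2 + y $ 3 * y $ 3"
    using norm_eq_sum_squares[of y] by (simp add: sum_3 power2_eq_square)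
  have kk: "k $ 1 * k $ 1 + k $ 2 * k $ 2 + k $ 3 * k $ 3 = 1"
    using norm_eq_sum_squares[of k] k by (simp add: sum_3 power2_eq_square)
  have ky: "k \<bullet> y = k $ 1 * y $ 1 + k $ 2 * y $ 2 + k $ 3 * y $ 3" by (simp add: inner_vec_def sum_3)
  have E: "?E y * (a * norm y - (k $ 1 * y $ 1 + k $ 2 * y $ 2 + k $ 3 * y $ 3)) = 1"
    using landau_denominator_pos[OF a k y] by (simp add: landau_E_def ky)
  have U: "landau_U a k j y = 2 * ?E y * k $ j + 2 * (a * ((k $ 1 * y $ 1 + k $ 2 * y $ 2 + k $ 3 * y $ 3) * ?R) - 1) * (?E y * ?E y) * y $ j" for j
    by (simp add: landau_U_def landau_h_def ky)
  have 1: "partial_deriv 2 (\<lambda>z. A z $ 3) y - partial_deriv 3 (\<lambda>z. A z $ 2) y = landau_U a k 1 y"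
    using landau_curl_algebra[OF Rs s kk E] unfolding pA pc unfolding c U by simp
  have 2: "partial_deriv 3 (\<lambda>z. A z $ 1) y - partial_deriv 1 (\<lambda>z. A z $ 3) y = landau_U a k 2 y"
    using landau_curl_algebra[of ?R "norm y" "y $ 2" "y $ 3" "y $ 1" "k $ 2" "k $ 3" "k $ 1" "?E y" a] Rs s kk E
    unfolding pA pc unfolding c U by (simp add: add_ac)
  have 3: "partial_deriv 1 (\<lambda>z. A z $ 2) y - partial_deriv 2 (\<lambda>z. A z $ 1) y = landau_U a k 3 y"
    using landau_curl_algebra[of ?R "norm y" "y $ 3" "y $ 1" "y $ 2" "k $ 3" "k $ 1" "k $ 2" "?E y" a] Rs s kk E
    unfolding pA pc unfolding c U by (simp add: add_ac)
  show ?thesis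
    unfolding landau_field_def curl_def A_def[symmetric] 1 2 3 by (simp add: vec_eq_iff forall_3)
qed

text \<open>The field depends on \<open>x\<close> and \<open>k\<close> through their norms and inner products, so every renaming of
the coordinates carries it to the field with the renamed axis.\<close>

lemma landau_solution_of_axis:
  fixes u :: "real ^ 'n::finite \<Rightarrow> real ^ 'n" and k :: "real ^ 'n"
  assumes n: "CARD('n) = 3" and a: "1 < a" and k: "norm k = 1"
    and u: "\<And>x j. x \<noteq> 0 \<Longrightarrow> u x $ j = landau_U a k j x"
  shows "landau_solution u"
proof -
  obtain \<sigma> :: "3 \<Rightarrow> 'n" where \<sigma>: "bij \<sigma>"
    using finite_same_card_bij[of "UNIV :: 3 set" "UNIV :: 'n set"] n by auto
  let ?p = "\<lambda>x :: real ^ 'n. (\<chi> i. x $ \<sigma> i) :: real ^ 3"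
  have inner: "?p x \<bullet> ?p y = x \<bullet> y" for x y
    unfolding inner_vec_def using sum.reindex_bij_betw[OF \<sigma>, of "\<lambda>j. x $ j \<bullet> y $ j"] by simp
  have norm: "norm (?p x) = norm x" for x
    by (simp only: norm_eq_sqrt_inner inner)
  have nz: "?p x \<noteq> 0" if "x \<noteq> 0" for x using norm[of x] that by (metis norm_eq_zero)
  have "(\<chi> i. u x $ \<sigma> i) = landau_field (?p k) (ereal a) (?p x)" if x: "x \<noteq> 0" for x
  proof -
    have "landau_field (?p k) (ereal a) (?p x) = (\<chi> i. landau_U a (?p k) i (?p x))"
      using landau_field_eq[OF a _ nz[OF x]] k by (simp add: norm)
    also have "\<dots> = (\<chi> i. landau_U a k (\<sigma> i) x)"
      by (simp add: landau_U_def landau_E_def landau_h_def norm inner)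
    finally show ?thesis using u[OF x] by simp
  qed
  moreover have "norm (?p k) = 1" "1 < ereal a" using k a by (simp_all only: norm ereal_less(3) one_ereal_def ereal_less_eq less_ereal.simps)
  ultimately show ?thesis unfolding landau_solution_def using \<sigma> by blast
qed

section \<open>The flux of a Landau solution\<close>

text \<open>The gradient of \<open>cutoff\<close> at \<open>y\<close> is \<open>cutoff_slope y *\<^sub>R y\<close>.\<close>

definition cutoff_slope :: "real ^ 'n::finite \<Rightarrow> real" where
  "cutoff_slope y = - (32 / 3) * ((max 0 (1 - (max 0 ((4 - y \<bullet> y) / 3)) ^ 4)) ^ 3 * (max 0 ((4 - y \<bullet> y) / 3)) ^ 3)"

lemma cutoff_partial:
  fixes y :: "real ^ 'n::finite"
  shows "partial_deriv j cutoff y = cutoff_slope y * y $ j"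
proof -
  have d: "(\<lambda>y::real^'n. y \<bullet> y) differentiable (at y)" using cdiff_inner_self[of 1] by simp
  have "partial_deriv j (\<lambda>y::real^'n. y \<bullet> y) y = 2 * y $ j"
  proof -
    have "((\<lambda>y::real^'n. y \<bullet> y) has_derivative (\<lambda>v. y \<bullet> v + v \<bullet> y)) (at y)" by (auto intro!: derivative_eq_intros)
    from partial_deriv_eq[OF this, of j] show ?thesis by (simp add: inner_axis inner_commute)
  qed
  moreover have "((\<lambda>t. 1 - (max 0 (1 - (max 0 ((4 - t) / 3)) ^ 4)) ^ 4) has_real_derivative
     - (4 * (max 0 (1 - (max 0 ((4 - y \<bullet> y) / 3)) ^ 4)) ^ 3 * (- (4 * (max 0 ((4 - y \<bullet> y) / 3)) ^ 3 * (- 1 / 3))))) (at (y \<bullet> y))"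
  proof -
    have P: "((\<lambda>t. (max 0 t) ^ 4) has_real_derivative 4 * (max 0 t) ^ 3) (at t)" for t :: real
      using DERIV_pos_part_power[of 2 t] by simp
    have 1: "((\<lambda>t. (4 - t) / 3) has_real_derivative - 1 / 3) (at t)" for t :: real
      by (auto intro!: derivative_eq_intros)
    have 2: "((\<lambda>t. (max 0 ((4 - t) / 3)) ^ 4) has_real_derivative 4 * (max 0 ((4 - t) / 3)) ^ 3 * (- 1 / 3)) (at t)" for t :: real
      by (rule DERIV_chain2[OF P 1])
    have 3: "((\<lambda>t. 1 - (max 0 ((4 - t) / 3)) ^ 4) has_real_derivative - (4 * (max 0 ((4 - t) / 3)) ^ 3 * (- 1 / 3))) (at t)" for t :: real
      using DERIV_diff[OF DERIV_const 2, of 1 t] by simp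
    show ?thesis
      using DERIV_diff[OF DERIV_const DERIV_chain2[OF P 3], of 1 "y \<bullet> y"] by simp
  qed
  from partial_deriv_chain[OF d this, of j] show ?thesis
    unfolding cutoff_def[abs_def] cutoff_slope_def calculation by (simp add: field_simps)
qed

lemma cutoff_slope_nonpos: "cutoff_slope y \<le> 0"
  unfolding cutoff_slope_def by (simp add: mult_nonneg_nonneg)

lemma cutoff_slope_neg: "1 < norm y \<Longrightarrow> norm y < 2 \<Longrightarrow> cutoff_slope y < 0"
proof -
  assume y: "1 < norm y" "norm y < 2"
  have "1\<^sup>2 < (norm y)\<^sup>2" by (rule power_strict_mono) (use y in auto)
  then have t: "1 < y \<bullet> y" by (simp add: power2_norm_eq_inner)
  have "(norm y)\<^sup>2 < 2\<^sup>2" by (rule power_strict_mono) (use y in auto)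
  then have "y \<bullet> y < 4" by (simp add: power2_norm_eq_inner)
  then have x: "0 < (4 - y \<bullet> y) / 3" "(4 - y \<bullet> y) / 3 < 1" using t by auto
  have "((4 - y \<bullet> y) / 3) ^ 4 < 1" using x by (simp add: power_less_one_iff)
  then have "0 < (max 0 (1 - (max 0 ((4 - y \<bullet> y) / 3)) ^ 4)) ^ 3 * (max 0 ((4 - y \<bullet> y) / 3)) ^ 3"
    using x by (simp add: max_def)
  then show ?thesis by (simp add: cutoff_slope_def)
qed

lemma cutoff_slope_outside: "norm y < 1 \<or> 2 < norm y \<Longrightarrow> cutoff_slope y = 0"
proof -
  assume "norm y < 1 \<or> 2 < norm y"
  then consider "norm y \<le> 1" | "2 \<le> norm y" by linarith
  then have "y \<bullet> y \<le> 1 \<or> 4 \<le> y \<bullet> y"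
  proof cases
    case 1 then show ?thesis by (simp add: norm_le_square)
  next
    case 2
    then have "2\<^sup>2 \<le> (norm y)\<^sup>2" by (intro power_mono) auto
    then show ?thesis by (simp add: power2_norm_eq_inner)
  qed
  then show ?thesis
  proof
    assume "y \<bullet> y \<le> 1"
    then have "1 ^ 4 \<le> (max 0 ((4 - y \<bullet> y) / 3)) ^ 4" by (intro power_mono) auto
    then show ?thesis by (simp add: cutoff_slope_def max_def)
  qed (simp add: cutoff_slope_def max_def)
qed

lemma cutoff_slope_annular: "annular cutoff_slope"
  unfolding annular_def using cutoff_slope_outside by (intro exI[of _ 1] conjI exI[of _ 2]) auto

lemma cutoff_slope_cdiff: "cdiff 2 UNIV (cutoff_slope :: real ^ 'n::finite \<Rightarrow> real)"
proof -
  have 1: "cdiff m UNIV (\<lambda>y :: real ^ 'n. (4 - y \<bullet> y) / 3)" for m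
    using cdiff_cmult[OF open_UNIV cdiff_diff[OF open_UNIV cdiff_const cdiff_inner_self], of m "1/3" 4] by simp
  have 2: "cdiff 3 UNIV (\<lambda>y :: real ^ 'n. (max 0 ((4 - y \<bullet> y) / 3)) ^ 4)"
    using cdiff_pos_part_power[OF open_UNIV 1, of 3] by simp
  have 3: "cdiff 2 UNIV (\<lambda>y :: real ^ 'n. (max 0 ((4 - y \<bullet> y) / 3)) ^ 3)"
    using cdiff_pos_part_power[OF open_UNIV 1, of 2] by simp
  have 4: "cdiff 2 UNIV (\<lambda>y :: real ^ 'n. 1 - (max 0 ((4 - y \<bullet> y) / 3)) ^ 4)"
    by (rule cdiff_le[OF cdiff_diff[OF open_UNIV cdiff_const 2]]) simp
  have 5: "cdiff 2 UNIV (\<lambda>y :: real ^ 'n. (max 0 (1 - (max 0 ((4 - y \<bullet> y) / 3)) ^ 4)) ^ 3)"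
    using cdiff_pos_part_power[OF open_UNIV 4] by simp
  show ?thesis unfolding cutoff_slope_def[abs_def]
    by (intro cdiff_mult open_UNIV cdiff_const 3 5)
qed

lemma cutoff_slope_integral: "(\<integral>y. cutoff_slope y \<partial>(lborel :: (real ^ 'n::finite) measure)) < 0"
proof -
  have c: "continuous_on (-{0}) (cutoff_slope :: real ^ 'n \<Rightarrow> real)"
    using cdiff_continuous[OF cutoff_slope_cdiff] continuous_on_subset by blast
  have i: "integrable lborel (\<lambda>y :: real ^ 'n. - cutoff_slope y)"
    using integrable_annular[OF c cutoff_slope_annular] by simp
  have "\<not> (AE y in (lborel :: (real ^ 'n) measure). - cutoff_slope y = 0)"
  proof
    assume ae: "AE y in (lborel :: (real ^ 'n) measure). - cutoff_slope y = 0"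
    let ?B = "ball ((3/2) *\<^sub>R axis undefined 1 :: real ^ 'n) (1/2)"
    have "AE y in (lborel :: (real ^ 'n) measure). y \<notin> ?B"
      using ae
    proof eventually_elim
      case (elim y)
      show ?case
      proof
        assume "y \<in> ?B"
        then have d: "norm ((3/2) *\<^sub>R axis undefined 1 - y) < 1/2" by (simp add: dist_norm)
        have n: "norm ((3/2) *\<^sub>R axis undefined 1 :: real ^ 'n) = 3/2" by (simp add: norm_axis_1)
        have "1 < norm y" "norm y < 2"
          using norm_triangle_ineq2[of "(3/2) *\<^sub>R axis undefined 1" y] norm_triangle_ineq3[of "(3/2) *\<^sub>R axis undefined 1" y] d n by linarith+
        then show False using cutoff_slope_neg[of y] elim by simp
      qed
    qed
    then have "?B \<in> null_sets lborel" using AE_iff_null_sets[of ?B lborel] by simp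
    then show False using content_ball_pos[of "1/2" "(3/2) *\<^sub>R axis undefined 1 :: real ^ 'n"]
      by (simp add: null_sets_def measure_def)
  qed
  then have "(\<integral>y. - cutoff_slope y \<partial>(lborel :: (real ^ 'n) measure)) \<noteq> 0"
  proof -
    have "AE y in (lborel :: (real ^ 'n) measure). 0 \<le> - cutoff_slope y"
      by (rule AE_I2) (use cutoff_slope_nonpos in simp)
    from integral_nonneg_eq_0_iff_AE[OF i this] \<open>\<not> _\<close> show ?thesis by blast
  qed
  moreover have "(\<integral>y. - cutoff_slope y \<partial>(lborel :: (real ^ 'n) measure)) \<ge> 0"
    by (intro integral_nonneg_AE AE_I2) (use cutoff_slope_nonpos in simp)
  ultimately show ?thesis by simp
qed


lemma flux_pot_cdiff: "cdiff 3 UNIV (flux_pot e k j)"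
  unfolding flux_pot_def[abs_def] by (intro cdiff_mult cutoff_cdiff cdiff_diff) auto

lemma div_flux_pot_cdiff: "cdiff 2 UNIV (div_pot (flux_pot e) j)"
  by (rule div_pot_cdiff[OF open_UNIV]) (use flux_pot_cdiff in \<open>simp only: numeral_3_eq_3 numeral_2_eq_2\<close>)

lemma div_flux_pot_near:
  fixes y :: "real ^ 'n::finite"
  assumes "norm y < 1"
  shows "div_pot (flux_pot e) j y = (real CARD('n) - 1) * e j"
proof -
  have o: "open {y::real^'n. norm y < 1}" by (intro open_Collect_less continuous_intros)
  have "partial_deriv k (flux_pot e k j) y = e j - (if k = j then e j else 0)" for k
  proof -
    have "partial_deriv k (flux_pot e k j) y = partial_deriv k (\<lambda>y::real^'n. y $ k * e j - y $ j * e k) y"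
      by (rule partial_deriv_cong[OF o]) (use assms in \<open>simp_all add: flux_pot_def cutoff_near\<close>)
    also have "\<dots> = e j - (if k = j then e j else 0)"
      by (subst partial_deriv_diff) (simp_all add: partial_deriv_mult)
    finally show ?thesis .
  qed
  then show ?thesis by (simp add: div_pot_def sum_subtractf left_diff_distrib)
qed

lemma div_flux_pot_far:
  fixes y :: "real ^ 'n::finite"
  assumes "2 < norm y"
  shows "div_pot (flux_pot e) j y = 0"
proof -
  have o: "open {y::real^'n. 2 < norm y}" by (intro open_Collect_less continuous_intros)
  have "partial_deriv k (flux_pot e k j) y = partial_deriv k (\<lambda>_. 0) y" for k
    by (rule partial_deriv_cong[OF o]) (use assms in \<open>simp_all add: flux_pot_def cutoff_far\<close>)
  then show ?thesis by (simp add: div_pot_def)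
qed

lemma div_flux_pot_divergence: "(\<Sum>j\<in>UNIV. partial_deriv j (div_pot (flux_pot e) j) y) = 0"
  by (rule div_pot_divergence_free[OF open_UNIV UNIV_I cdiff_le[OF flux_pot_cdiff] flux_pot_antisym]) simp

text \<open>The test field equals \<open>2 *\<^sub>R e\<close> near the origin. Subtracting \<open>2 * cutoff y *\<^sub>R e\<close> leaves a field that is supported
in a shell, and the momentum equation turns its contribution into one of the pressure \<open>2 h\<close>. In the
contribution of \<open>2 * cutoff y *\<^sub>R e\<close> one integration by parts and the homogeneity \<open>y \<bullet> \<nabla>U = - U\<close> remove the
second derivatives.\<close>

lemma landau_flux_formula:
  fixes k :: "real ^ 'n::finite"
  assumes a: "1 < a" and k: "norm k = 1" and n: "CARD('n) = 3"
  shows "integral\<^sup>L lborel (weak_term (landau_U a k) (\<lambda>j i y. landau_U a k j y * landau_U a k i y) (div_pot (flux_pot e)))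
    = 2 * (\<integral>y. cutoff_slope y * ((\<Sum>j\<in>UNIV. landau_U a k j y * e j) * (1 + (\<Sum>j\<in>UNIV. landau_U a k j y * y $ j))
          + 2 * landau_h a k y * (\<Sum>j\<in>UNIV. e j * y $ j)) \<partial>lborel)"
proof -
  let ?U = "landau_U a k" and ?H = "\<lambda>j i y. landau_U a k j y * landau_U a k i y"
  let ?\<phi> = "div_pot (flux_pot e)"
  let ?c = "\<lambda>j (y :: real ^ 'n). 2 * e j * cutoff y"
  let ?\<psi> = "\<lambda>j y. ?\<phi> j y - ?c j y"
  let ?q = "\<lambda>y. 2 * landau_h a k y"
  let ?v = "\<lambda>y. \<Sum>j\<in>UNIV. ?U j y * e j"
  let ?V = "\<lambda>y. \<Sum>j\<in>UNIV. ?U j y * y $ j"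
  let ?ey = "\<lambda>y. \<Sum>j\<in>UNIV. e j * y $ j"
  note Uc = landau_U_cdiff[OF a k]
  have cU: "continuous_on (-{0}) (?U j)" for j using cdiff_continuous[OF Uc[of 0 j]] .
  have ch: "continuous_on (-{0}) (landau_h a k)" using cdiff_continuous[OF landau_scalars_cdiff(3)[OF a k, of 0]] .
  have ct: "continuous_on (-{0}) (cutoff_slope :: real ^ 'n \<Rightarrow> real)"
    using cdiff_continuous[OF cutoff_slope_cdiff] continuous_on_subset by blast
  have c0: "cdiff 2 UNIV (cutoff :: real ^ 'n \<Rightarrow> real)" by (rule cdiff_le[OF cutoff_cdiff]) simp
  have cc: "cdiff 2 UNIV (?c j)" for j by (rule cdiff_cmult[OF open_UNIV c0])
  have c\<psi>: "cdiff 2 UNIV (?\<psi> j)" for j by (rule cdiff_diff[OF open_UNIV div_flux_pot_cdiff cc])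
  have s\<psi>: "cdiff 2 (-{0}) (?\<psi> j)" for j by (rule cdiff_subset[OF c\<psi>]) simp
  have an: "annular (?\<psi> j)" for j
  proof -
    have z: "?\<psi> j y = 0" if "norm y < 1 \<or> 2 < norm y" for y
      using that div_flux_pot_near[of y e j] div_flux_pot_far[of y e j] n by (auto simp: cutoff_near cutoff_far)
    show ?thesis unfolding annular_def using z by (intro exI[of _ 1] conjI exI[of _ 2]) auto
  qed
  have dcut: "cutoff differentiable (at y)" for y :: "real ^ 'n" using c0 by (simp add: numeral_2_eq_2)
  have div\<psi>: "(\<Sum>j\<in>UNIV. partial_deriv j (?\<psi> j) y) = - 2 * (cutoff_slope y * ?ey y)" for y
  proof -
    have "partial_deriv j (?\<psi> j) y = partial_deriv j (?\<phi> j) y - 2 * e j * (cutoff_slope y * y $ j)" for j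
    proof -
      have d1: "?\<phi> j differentiable (at y)" using div_flux_pot_cdiff[of e j] by (simp add: numeral_2_eq_2)
      have d2: "?c j differentiable (at y)" using dcut by simp
      show ?thesis unfolding partial_deriv_diff[OF d1 d2] partial_deriv_cmult[OF dcut] cutoff_partial ..
    qed
    then have "(\<Sum>j\<in>UNIV. partial_deriv j (?\<psi> j) y) = 0 - (\<Sum>j\<in>UNIV. 2 * e j * (cutoff_slope y * y $ j))"
      using div_flux_pot_divergence[of e y] by (simp add: sum_subtractf)
    then show ?thesis by (simp add: sum_distrib_left sum_negf mult_ac)
  qed
  note nt = navier_stokes_tested[where \<phi> = ?\<psi>, OF Uc cdiff_cmult[OF open_punctured landau_scalars_cdiff(3)[OF a k]]
      landau_momentum[OF a k _ n] landau_divergence_free[OF a k _ n] s\<psi> an]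
  let ?I = "\<lambda>f. integral\<^sup>L lborel f"
  let ?r3 = "\<lambda>y. cutoff_slope y * (2 * landau_h a k y * ?ey y)"
  let ?r2 = "\<lambda>y. cutoff_slope y * (?v y * ?V y)"
  let ?r1 = "\<lambda>y. cutoff_slope y * ?v y"
  have ci: "integrable lborel (\<lambda>y. cutoff_slope y * f y)" if "continuous_on (-{0}) f" for f :: "real ^ 'n \<Rightarrow> real"
  proof (rule integrable_annular)
    show "continuous_on (-{0}) (\<lambda>y. cutoff_slope y * f y)" by (intro continuous_intros ct that)
    show "annular (\<lambda>y. cutoff_slope y * f y)" using annular_mult[OF cutoff_slope_annular, of f] by (simp add: mult.commute)
  qed
  have ir: "integrable lborel ?r1" "integrable lborel ?r2" "integrable lborel ?r3"
    by (intro ci continuous_intros cU ch)+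
  have t1: "?I (weak_term ?U ?H ?\<psi>) = 2 * ?I ?r3"
  proof -
    have "(\<lambda>y. ?q y * (\<Sum>j\<in>UNIV. partial_deriv j (?\<psi> j) y)) = (\<lambda>y. - 2 * ?r3 y)"
      unfolding div\<psi> by (simp add: fun_eq_iff)
    then have "?I (\<lambda>y. ?q y * (\<Sum>j\<in>UNIV. partial_deriv j (?\<psi> j) y)) = - 2 * ?I ?r3"
      by (simp only: Bochner_Integration.integral_mult_right_zero)
    then show ?thesis using nt(1) by linarith
  qed
  let ?lap = "\<lambda>y. \<Sum>l\<in>UNIV. partial_deriv l (partial_deriv l cutoff) y"
  have wc: "weak_term ?U ?H ?c y = 2 * (?v y * ?lap y) + 2 * ?r2 y" for y
  proof -
    have p1: "partial_deriv l (?c j) = (\<lambda>y. 2 * e j * partial_deriv l cutoff y)" for l j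
      using partial_deriv_cmult[OF dcut] by auto
    have d2: "partial_deriv l cutoff differentiable (at y)" for l using c0 by (simp add: numeral_2_eq_2)
    have p2: "partial_deriv l (partial_deriv l (?c j)) y = 2 * e j * partial_deriv l (partial_deriv l cutoff) y" for l j
      unfolding p1 by (rule partial_deriv_cmult[OF d2])
    have A: "(\<Sum>j\<in>UNIV. ?U j y * (\<Sum>l\<in>UNIV. partial_deriv l (partial_deriv l (?c j)) y)) = 2 * (?v y * ?lap y)"
      unfolding p2 sum_distrib_left[symmetric] by (simp add: sum_distrib_left sum_distrib_right mult_ac)
    have "(\<Sum>j\<in>UNIV. \<Sum>i\<in>UNIV. ?H j i y * partial_deriv j (?c i) y)
       = (\<Sum>j\<in>UNIV. \<Sum>i\<in>UNIV. 2 * cutoff_slope y * ((?U i y * e i) * (?U j y * y $ j)))"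
      unfolding p1 cutoff_partial by (intro sum.cong refl) simp
    also have "\<dots> = 2 * ?r2 y"
      unfolding sum_distrib_left[symmetric] sum_distrib_right[symmetric] by simp
    finally show ?thesis unfolding weak_term_def A by simp
  qed
  have cut1: "cdiff 1 (-{0}) (partial_deriv l cutoff :: real ^ 'n \<Rightarrow> real)" for l
    by (rule cdiff_subset[OF cdiff_partialD[OF c0]]) simp_all
  have cutann: "annular (partial_deriv l cutoff :: real ^ 'n \<Rightarrow> real)" for l
    unfolding cutoff_partial[abs_def] using annular_mult[OF cutoff_slope_annular, of "\<lambda>y. y $ l"] by (simp add: mult.commute)
  have v1: "cdiff 1 (-{0}) ?v" by (intro cdiff_sum cdiff_mult open_punctured Uc cdiff_const) simp
  note bp = integration_by_parts[OF v1 cut1 cutann]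
  have il: "integrable lborel (\<lambda>y. ?v y * ?lap y)"
    unfolding sum_distrib_left by (intro Bochner_Integration.integrable_sum bp(3))
  have t2: "?I (\<lambda>y. ?v y * ?lap y) = ?I ?r1"
  proof -
    have "?I (\<lambda>y. ?v y * ?lap y) = (\<Sum>l\<in>UNIV. ?I (\<lambda>y. ?v y * partial_deriv l (partial_deriv l cutoff) y))"
      unfolding sum_distrib_left by (intro Bochner_Integration.integral_sum bp(3))
    also have "\<dots> = - (\<Sum>l\<in>UNIV. ?I (\<lambda>y. partial_deriv l ?v y * partial_deriv l cutoff y))"
      using bp(1) by (simp add: sum_negf)
    also have "(\<Sum>l\<in>UNIV. ?I (\<lambda>y. partial_deriv l ?v y * partial_deriv l cutoff y))
       = ?I (\<lambda>y. \<Sum>l\<in>UNIV. partial_deriv l ?v y * partial_deriv l cutoff y)"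
      by (intro Bochner_Integration.integral_sum[symmetric] bp(2))
    also have "\<dots> = ?I (\<lambda>y. - ?r1 y)"
    proof (rule integral_cong_AE)
      show "(\<lambda>y. \<Sum>l\<in>UNIV. partial_deriv l ?v y * partial_deriv l cutoff y) \<in> borel_measurable lborel"
        by (intro borel_measurable_integrable Bochner_Integration.integrable_sum bp(2))
      show "(\<lambda>y. - ?r1 y) \<in> borel_measurable lborel" using ir(1) by simp
      show "AE y in lborel. (\<Sum>l\<in>UNIV. partial_deriv l ?v y * partial_deriv l cutoff y) = - ?r1 y"
        using AE_nonzero
      proof eventually_elim
        case (elim y)
        have dU: "?U j differentiable (at y)" for j using Uc[of 1 j] elim by simp
        have "partial_deriv l ?v y = (\<Sum>j\<in>UNIV. e j * partial_deriv l (?U j) y)" for l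
        proof -
          have "partial_deriv l ?v y = (\<Sum>j\<in>UNIV. partial_deriv l (\<lambda>y. ?U j y * e j) y)"
            by (rule partial_deriv_sum) (use dU in simp)
          also have "\<dots> = (\<Sum>j\<in>UNIV. e j * partial_deriv l (?U j) y)"
            by (intro sum.cong refl) (subst partial_deriv_mult[OF dU], simp_all)
          finally show ?thesis .
        qed
        then have "(\<Sum>l\<in>UNIV. partial_deriv l ?v y * partial_deriv l cutoff y)
           = (\<Sum>l\<in>UNIV. \<Sum>j\<in>UNIV. cutoff_slope y * (e j * (y $ l * partial_deriv l (?U j) y)))"
          unfolding cutoff_partial by (intro sum.cong refl) (simp add: sum_distrib_right sum_distrib_left mult_ac)
        also have "\<dots> = (\<Sum>j\<in>UNIV. \<Sum>l\<in>UNIV. cutoff_slope y * (e j * (y $ l * partial_deriv l (?U j) y)))" by (rule sum.swap)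
        also have "\<dots> = (\<Sum>j\<in>UNIV. cutoff_slope y * (e j * (- ?U j y)))"
          unfolding sum_distrib_left[symmetric] landau_homogeneous[OF a k elim] ..
        also have "\<dots> = - ?r1 y" by (simp add: sum_distrib_left sum_negf mult_ac)
        finally show ?case .
      qed
    qed
    finally show ?thesis using ir by simp
  qed
  have iwc: "integrable lborel (weak_term ?U ?H ?c)" unfolding wc[abs_def] using il ir by simp
  have "?I (weak_term ?U ?H ?\<phi>) = ?I (\<lambda>y. weak_term ?U ?H ?\<psi> y + weak_term ?U ?H ?c y)"
  proof (rule integral_cong_AE)
    show "weak_term ?U ?H ?\<phi> \<in> borel_measurable lborel"
    proof -
      have c2: "cdiff 2 (-{0}) (?\<phi> j)" for j by (rule cdiff_subset[OF div_flux_pot_cdiff]) simp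
      have "continuous_on (-{0}) (weak_term ?U ?H ?\<phi>)"
        unfolding weak_term_def[abs_def]
      proof (intro continuous_intros cU)
        show "continuous_on (-{0}) (partial_deriv l (partial_deriv l (?\<phi> j)))" for l j
          using c2[of j] by (simp add: numeral_2_eq_2)
        show "continuous_on (-{0}) (partial_deriv l (?\<phi> j))" for l j
          using cdiff_le[OF c2[of j], of 1] by simp
      qed
      then show ?thesis using borel_measurable_punctured by simp
    qed
    show "(\<lambda>y. weak_term ?U ?H ?\<psi> y + weak_term ?U ?H ?c y) \<in> borel_measurable lborel"
      using nt(2) iwc by (intro borel_measurable_add borel_measurable_integrable)
    show "AE y in lborel. weak_term ?U ?H ?\<phi> y = weak_term ?U ?H ?\<psi> y + weak_term ?U ?H ?c y"
      using AE_nonzero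
    proof eventually_elim
      case (elim y)
      have "weak_term ?U ?H (\<lambda>j z. ?\<psi> j z + ?c j z) y = weak_term ?U ?H ?\<psi> y + weak_term ?U ?H ?c y"
        by (rule weak_term_add[OF s\<psi> cdiff_subset[OF cc]]) (use elim in auto)
      then show ?case by simp
    qed
  qed
  also have "\<dots> = 2 * ?I ?r3 + (2 * ?I ?r1 + 2 * ?I ?r2)"
    using nt(2) iwc t1 t2 il ir unfolding wc[abs_def] by simp
  also have "\<dots> = 2 * ?I (\<lambda>y. ?r1 y + ?r2 y + ?r3 y)" using ir by simp
  also have "(\<lambda>y. ?r1 y + ?r2 y + ?r3 y) = (\<lambda>y. cutoff_slope y * (?v y * (1 + ?V y) + 2 * landau_h a k y * ?ey y))"
    by (simp add: fun_eq_iff algebra_simps)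
  finally show ?thesis .
qed

definition landau_flux :: "real \<Rightarrow> real ^ 'n::finite \<Rightarrow> ('n \<Rightarrow> real) \<Rightarrow> real" where
  "landau_flux a k e = integral\<^sup>L lborel (weak_term (landau_U a k) (\<lambda>j i y. landau_U a k j y * landau_U a k i y) (div_pot (flux_pot e)))"

text \<open>The radial component \<open>U \<bullet> y\<close>.\<close>

definition landau_V :: "real \<Rightarrow> real ^ 'n::finite \<Rightarrow> real ^ 'n \<Rightarrow> real" where
  "landau_V a k y = 2 * landau_E a k y * (k \<bullet> y) + landau_h a k y * (norm y * norm y)"

text \<open>Since \<open>U = 2 E k + h y\<close>, the density in \<open>landau_flux_formula\<close> has a part along \<open>k\<close> and a part along \<open>y\<close>.\<close>

definition axial_density :: "real \<Rightarrow> real ^ 'n::finite \<Rightarrow> real ^ 'n \<Rightarrow> real" where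
  "axial_density a k y = cutoff_slope y * (2 * landau_E a k y * (1 + landau_V a k y))"

definition radial_density :: "real \<Rightarrow> real ^ 'n::finite \<Rightarrow> real ^ 'n \<Rightarrow> real" where
  "radial_density a k y = cutoff_slope y * (landau_h a k y * (3 + landau_V a k y))"

definition landau_strength :: "real \<Rightarrow> real ^ 'n::finite \<Rightarrow> real" where
  "landau_strength a k = 2 * (\<integral>y. axial_density a k y + (k \<bullet> y) * radial_density a k y \<partial>lborel)"

lemma landau_V_eq: "(\<Sum>j\<in>UNIV. landau_U a k j y * y $ j) = landau_V a k y"
proof -
  have "(\<Sum>j\<in>UNIV. landau_U a k j y * y $ j)
     = 2 * landau_E a k y * (\<Sum>j\<in>UNIV. k $ j * y $ j) + landau_h a k y * (\<Sum>j\<in>UNIV. y $ j * y $ j)"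
    by (simp add: landau_U_def sum.distrib sum_distrib_left algebra_simps)
  then show ?thesis using norm_eq_sum_squares[of y] by (simp add: landau_V_def inner_vec_def power2_eq_square)
qed

context
  fixes a :: real and k :: "real ^ 'n::finite"
  assumes a: "1 < a" and k: "norm k = 1" and n: "CARD('n) = 3"
begin

lemma densities_continuous:
  "continuous_on (-{0}) (axial_density a k)" "continuous_on (-{0}) (radial_density a k)"
proof -
  have ct: "continuous_on (-{0}) (cutoff_slope :: real ^ 'n \<Rightarrow> real)"
    using cdiff_continuous[OF cutoff_slope_cdiff] continuous_on_subset by blast
  note E = cdiff_continuous[OF landau_scalars_cdiff(2)[OF a k, of 0]]
  note h = cdiff_continuous[OF landau_scalars_cdiff(3)[OF a k, of 0]]
  have V: "continuous_on (-{0}) (landau_V a k)"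
    unfolding landau_V_def[abs_def] by (intro continuous_intros E h)
  show "continuous_on (-{0}) (axial_density a k)" "continuous_on (-{0}) (radial_density a k)"
    unfolding axial_density_def[abs_def] radial_density_def[abs_def] by (intro continuous_intros E h V ct)+
qed

lemma densities_annular: "annular (\<lambda>y. f y * axial_density a k y)" "annular (\<lambda>y. f y * radial_density a k y)"
  using annular_mult[OF cutoff_slope_annular, of "\<lambda>y. f y * (2 * landau_E a k y * (1 + landau_V a k y))"]
    annular_mult[OF cutoff_slope_annular, of "\<lambda>y. f y * (landau_h a k y * (3 + landau_V a k y))"]
  by (simp_all add: axial_density_def radial_density_def mult_ac)

lemma densities_integrable:
  "integrable lborel (axial_density a k)" "continuous_on (-{0}) f \<Longrightarrow> integrable lborel (\<lambda>y. f y * radial_density a k y)"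
proof -
  show "integrable lborel (axial_density a k)"
    using integrable_annular[OF _ densities_annular(1)[of "\<lambda>_. 1"]] densities_continuous by simp
  show "continuous_on (-{0}) f \<Longrightarrow> integrable lborel (\<lambda>y. f y * radial_density a k y)"
    by (intro integrable_annular densities_annular continuous_intros densities_continuous)
qed

lemma landau_flux_eq:
  "landau_flux a k (\<lambda>j. e $ j) = 2 * ((k \<bullet> e) * (\<integral>y. axial_density a k y \<partial>lborel) + (\<integral>y. (e \<bullet> y) * radial_density a k y \<partial>lborel))"
proof -
  have e: "cutoff_slope y * ((\<Sum>j\<in>UNIV. landau_U a k j y * e $ j) * (1 + (\<Sum>j\<in>UNIV. landau_U a k j y * y $ j))
          + 2 * landau_h a k y * (\<Sum>j\<in>UNIV. e $ j * y $ j)) = (k \<bullet> e) * axial_density a k y + (e \<bullet> y) * radial_density a k y" for y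
  proof -
    have "(\<Sum>j\<in>UNIV. landau_U a k j y * e $ j)
       = 2 * landau_E a k y * (\<Sum>j\<in>UNIV. k $ j * e $ j) + landau_h a k y * (\<Sum>j\<in>UNIV. e $ j * y $ j)"
      by (simp add: landau_U_def sum.distrib sum_distrib_left algebra_simps)
    then show ?thesis unfolding landau_V_eq
      by (simp add: axial_density_def radial_density_def inner_vec_def algebra_simps)
  qed
  have c: "continuous_on (-{0}) (\<lambda>y. e \<bullet> y)" by (intro continuous_intros)
  show ?thesis unfolding landau_flux_def landau_flux_formula[OF a k n] e
    using densities_integrable(1) densities_integrable(2)[OF c] by simp
qed

lemma cutoff_slope_gradient: "\<exists>\<beta>. axial_gradient k cutoff_slope 0 \<beta> y"
proof -
  let ?P = "\<lambda>m t. (max 0 t) ^ m :: real"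
  have P4: "(?P 4 has_real_derivative 4 * ?P 3 t) (at t)" for t
    using DERIV_pos_part_power[of 2 t] by simp
  have P3: "(?P 3 has_real_derivative 3 * ?P 2 t) (at t)" for t
    using DERIV_pos_part_power[of 1 t] by (simp add: numeral_3_eq_3 power2_eq_square)
  have x: "((\<lambda>t. (4 - t) / 3) has_real_derivative - 1 / 3) (at t)" for t :: real
    by (auto intro!: derivative_eq_intros)
  have b: "\<exists>D. ((\<lambda>t. 1 - ?P 4 ((4 - t) / 3)) has_real_derivative D) (at t)" for t
    using DERIV_diff[OF DERIV_const DERIV_chain2[OF P4 x]] by blast
  then obtain D where D: "((\<lambda>t. 1 - ?P 4 ((4 - t) / 3)) has_real_derivative D) (at (y \<bullet> y))" by blast
  obtain D' where D': "((\<lambda>t. - (32 / 3) * (?P 3 (1 - ?P 4 ((4 - t) / 3)) * ?P 3 ((4 - t) / 3))) has_real_derivative D') (at (y \<bullet> y))"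
    using DERIV_cmult[OF DERIV_mult[OF DERIV_chain2[OF P3 D] DERIV_chain2[OF P3 x]]] by blast
  have q: "((\<lambda>y :: real ^ 'n. y \<bullet> y) has_derivative (\<lambda>v. 2 * (y \<bullet> v))) (at y)"
    by (auto intro!: derivative_eq_intros simp: inner_commute)
  have "((\<lambda>y :: real ^ 'n. - (32 / 3) * (?P 3 (1 - ?P 4 ((4 - y \<bullet> y) / 3)) * ?P 3 ((4 - y \<bullet> y) / 3))) has_derivative (\<lambda>v. D' * (2 * (y \<bullet> v)))) (at y)"
    using has_derivative_compose[OF q D'[unfolded has_field_derivative_def]] by simp
  then have "axial_gradient k cutoff_slope 0 (2 * D') y"
    unfolding axial_gradient_def cutoff_slope_def[abs_def] by (simp add: mult_ac)
  then show ?thesis by blast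
qed

lemma radial_density_gradient:
  assumes y: "y \<noteq> 0"
  shows "\<exists>\<alpha> \<beta>. axial_gradient k (radial_density a k) \<alpha> \<beta> y"
proof -
  obtain \<beta>0 where t: "axial_gradient k cutoff_slope 0 \<beta>0 y" using cutoff_slope_gradient by blast
  note E = axial_gradient_E[OF a k y] and h = axial_gradient_h[OF a k y]
  note N = axial_gradient_norm[OF y, of k]
  show ?thesis
    unfolding radial_density_def[abs_def] landau_V_def[abs_def]
    by (rule exI, rule exI, rule axial_gradient_mult[OF t axial_gradient_mult[OF h axial_gradient_add[OF axial_gradient_const
        axial_gradient_add[OF axial_gradient_mult[OF axial_gradient_mult[OF axial_gradient_const E] axial_gradient_axis]
          axial_gradient_mult[OF h axial_gradient_mult[OF N N]]]]]])
qed

lemma radial_density_cdiff: "cdiff 1 (-{0}) (radial_density a k)"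
proof -
  have ct: "cdiff 1 (-{0}) (cutoff_slope :: real ^ 'n \<Rightarrow> real)"
    by (rule cdiff_le[OF cdiff_subset[OF cutoff_slope_cdiff]]) simp_all
  have I: "cdiff 1 (-{0}) (\<lambda>y :: real ^ 'n. k \<bullet> y)"
    unfolding inner_vec_def inner_real_def by (intro cdiff_sum cdiff_mult open_punctured) auto
  show ?thesis unfolding radial_density_def[abs_def] landau_V_def[abs_def]
    by (intro cdiff_mult cdiff_add open_punctured ct I landau_scalars_cdiff[OF a k] cdiff_const)
qed

text \<open>For \<open>f\<close> orthogonal to \<open>k\<close> and \<open>e\<close>, the rotation field \<open>R = (e \<bullet> y) f - (f \<bullet> y) e\<close> is solenoidal and annihilates functions that
are symmetric about \<open>k\<close>. Hence \<open>(f \<bullet> f) (e \<bullet> y) r(y)\<close> is the divergence of \<open>(f \<bullet> y) r(y) R(y)\<close>, whose integral is zero.\<close>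

lemma radial_moment_orthogonal:
  assumes e: "k \<bullet> e = 0"
  shows "(\<integral>y. (e \<bullet> y) * radial_density a k y \<partial>lborel) = 0"
proof -
  let ?r = "radial_density a k"
  have "dim {k, e} \<le> card {k, e}" by (rule dim_le_card') simp
  also have "\<dots> \<le> 2" by (simp add: card_insert_if)
  finally have "dim {k, e} < DIM(real ^ 'n)" using n by simp
  then obtain f where f: "f \<noteq> 0" "\<And>z. z \<in> span {k, e} \<Longrightarrow> orthogonal f z"
    using orthogonal_to_subspace_exists by blast
  have fk: "k \<bullet> f = 0" and fe: "e \<bullet> f = 0"
    using f(2)[of k] f(2)[of e] by (auto simp: orthogonal_def span_base inner_commute)
  let ?R = "\<lambda>i y. (e \<bullet> y) * f $ i - (f \<bullet> y) * e $ i"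
  let ?g = "\<lambda>y. (f \<bullet> y) * ?r y"
  have cI: "cdiff m (-{0}) (\<lambda>y :: real ^ 'n. x \<bullet> y)" for x m
    unfolding inner_vec_def inner_real_def by (intro cdiff_sum cdiff_mult open_punctured) auto
  have dI: "partial_deriv i (\<lambda>y :: real ^ 'n. x \<bullet> y) y = x $ i" "(\<lambda>y :: real ^ 'n. x \<bullet> y) differentiable (at y)" for x i y
  proof -
    have "((\<lambda>y :: real ^ 'n. x \<bullet> y) has_derivative (\<lambda>v. x \<bullet> v)) (at y)" by (auto intro!: derivative_eq_intros)
    then show "partial_deriv i (\<lambda>y :: real ^ 'n. x \<bullet> y) y = x $ i" "(\<lambda>y :: real ^ 'n. x \<bullet> y) differentiable (at y)"
      using partial_deriv_eq by (force simp: inner_axis, auto simp: differentiable_def)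
  qed
  have cg: "cdiff 1 (-{0}) ?g" by (intro cdiff_mult open_punctured cI radial_density_cdiff)
  have cR: "cdiff 1 (-{0}) (?R i)" for i by (intro cdiff_diff cdiff_mult open_punctured cI cdiff_const)
  have cRg: "cdiff 1 (-{0}) (\<lambda>y. ?R i y * ?g y)" for i by (intro cdiff_mult open_punctured cR cg)
  have aRg: "annular (\<lambda>y. ?R i y * ?g y)" for i
    using densities_annular(2)[of "\<lambda>y. ?R i y * (f \<bullet> y)"] by (simp add: mult.assoc)
  have ii: "integrable lborel (partial_deriv i (\<lambda>y. ?R i y * ?g y))" for i
    by (rule integrable_annular[OF _ annular_partial[OF aRg]]) (use cRg[of i] in simp)
  have pw: "(\<Sum>i\<in>UNIV. partial_deriv i (\<lambda>y. ?R i y * ?g y) y) = (f \<bullet> f) * ((e \<bullet> y) * ?r y)" if y: "y \<noteq> 0" for y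
  proof -
    have d: "?R i differentiable (at y)" "?g differentiable (at y)" "?r differentiable (at y)" for i
      using cR[of i] cg radial_density_cdiff y by simp_all
    obtain \<alpha> \<beta> where ab: "axial_gradient k ?r \<alpha> \<beta> y" using radial_density_gradient[OF y] by blast
    have pR: "partial_deriv i (?R i) y = 0" for i
      using dI by (subst partial_deriv_diff) (simp_all add: partial_deriv_mult)
    have pg: "partial_deriv i ?g y = f $ i * ?r y + (f \<bullet> y) * (\<alpha> * k $ i + \<beta> * y $ i)" for i
      using partial_deriv_mult[OF dI(2)[of f y] d(3), of i] axial_gradient_partial(1)[OF ab, of i] dI(1) by simp
    have t: "partial_deriv i (\<lambda>y. ?R i y * ?g y) y = ?R i y * (f $ i * ?r y + (f \<bullet> y) * (\<alpha> * k $ i + \<beta> * y $ i))" for i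
      unfolding partial_deriv_mult[OF d(1) d(2)] pR pg by simp
    have "(\<Sum>i\<in>UNIV. partial_deriv i (\<lambda>y. ?R i y * ?g y) y) = (\<Sum>i\<in>UNIV. ?R i y * (f $ i * ?r y + (f \<bullet> y) * (\<alpha> * k $ i + \<beta> * y $ i)))"
      by (intro sum.cong refl) (rule t)
    also have "\<dots> = ?r y * ((e \<bullet> y) * (\<Sum>i\<in>UNIV. f $ i * f $ i) - (f \<bullet> y) * (\<Sum>i\<in>UNIV. e $ i * f $ i))
        + (f \<bullet> y) * \<alpha> * ((e \<bullet> y) * (\<Sum>i\<in>UNIV. k $ i * f $ i) - (f \<bullet> y) * (\<Sum>i\<in>UNIV. k $ i * e $ i))
        + (f \<bullet> y) * \<beta> * ((e \<bullet> y) * (\<Sum>i\<in>UNIV. f $ i * y $ i) - (f \<bullet> y) * (\<Sum>i\<in>UNIV. e $ i * y $ i))"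
      by (simp add: sum.distrib sum_subtractf sum_distrib_left algebra_simps)
    also have "\<dots> = ?r y * ((e \<bullet> y) * (f \<bullet> f) - (f \<bullet> y) * (e \<bullet> f)) + (f \<bullet> y) * \<alpha> * ((e \<bullet> y) * (k \<bullet> f) - (f \<bullet> y) * (k \<bullet> e))
        + (f \<bullet> y) * \<beta> * ((e \<bullet> y) * (f \<bullet> y) - (f \<bullet> y) * (e \<bullet> y))"
      by (simp add: inner_vec_def)
    finally show ?thesis using fk fe e by simp
  qed
  have c: "continuous_on (-{0}) (\<lambda>y. e \<bullet> y)" by (intro continuous_intros)
  have "0 = (\<Sum>i\<in>UNIV. \<integral>y. partial_deriv i (\<lambda>y. ?R i y * ?g y) y \<partial>lborel)"
    using integral_partial_deriv_zero[OF cRg aRg] by simp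
  also have "\<dots> = (\<integral>y. (\<Sum>i\<in>UNIV. partial_deriv i (\<lambda>y. ?R i y * ?g y) y) \<partial>lborel)"
    by (intro Bochner_Integration.integral_sum[symmetric] ii)
  also have "\<dots> = (\<integral>y. (f \<bullet> f) * ((e \<bullet> y) * ?r y) \<partial>lborel)"
  proof (rule integral_cong_AE)
    show "(\<lambda>y. \<Sum>i\<in>UNIV. partial_deriv i (\<lambda>y. ?R i y * ?g y) y) \<in> borel_measurable lborel"
      by (intro borel_measurable_integrable Bochner_Integration.integrable_sum ii)
    show "(\<lambda>y. (f \<bullet> f) * ((e \<bullet> y) * ?r y)) \<in> borel_measurable lborel"
      using densities_integrable(2)[OF c] by (intro borel_measurable_integrable integrable_mult_right)
    show "AE y in lborel. (\<Sum>i\<in>UNIV. partial_deriv i (\<lambda>y. ?R i y * ?g y) y) = (f \<bullet> f) * ((e \<bullet> y) * ?r y)"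
      using AE_nonzero by eventually_elim (rule pw)
  qed
  also have "\<dots> = (f \<bullet> f) * (\<integral>y. (e \<bullet> y) * ?r y \<partial>lborel)" by simp
  finally show ?thesis using f(1) by simp
qed

text \<open>The component of \<open>e\<close> orthogonal to the axis contributes nothing.\<close>

lemma landau_flux_axial: "landau_flux a k (\<lambda>j. e $ j) = landau_strength a k * (k \<bullet> e)"
proof -
  let ?f = "e - (k \<bullet> e) *\<^sub>R k"
  have kk: "k \<bullet> k = 1" using k by (simp add: power2_norm_eq_inner[symmetric])
  have 0: "(\<integral>y. (?f \<bullet> y) * radial_density a k y \<partial>lborel) = 0"
    by (rule radial_moment_orthogonal) (simp add: inner_diff_right kk)
  have c: "continuous_on (-{0}) (\<lambda>y. x \<bullet> y)" for x :: "real ^ 'n" by (intro continuous_intros)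
  note i = densities_integrable(2)[OF c]
  have "(\<lambda>y. (e \<bullet> y) * radial_density a k y) = (\<lambda>y. (?f \<bullet> y) * radial_density a k y + (k \<bullet> e) * ((k \<bullet> y) * radial_density a k y))"
    by (simp add: fun_eq_iff inner_diff_left algebra_simps)
  then have "(\<integral>y. (e \<bullet> y) * radial_density a k y \<partial>lborel) = (k \<bullet> e) * (\<integral>y. (k \<bullet> y) * radial_density a k y \<partial>lborel)"
    using i[of ?f] i[of k] 0 by simp
  then show ?thesis unfolding landau_flux_eq landau_strength_def
    using densities_integrable(1) i[of k] by (simp add: algebra_simps)
qed

end

definition landau_bracket :: "real \<Rightarrow> real ^ 'n::finite \<Rightarrow> real ^ 'n \<Rightarrow> real" where
  "landau_bracket a k y = 2 * landau_E a k y * (1 + landau_V a k y) + (k \<bullet> y) * (landau_h a k y * (3 + landau_V a k y))"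

text \<open>For large \<open>a\<close> the term \<open>2 E\<close> dominates: \<open>landau_V\<close> is \<open>O(1 / a)\<close>, and with \<open>c\<close> the cosine of the polar angle
\<open>(k \<bullet> y) h = 2 \<bar>y\<bar> E\<^sup>2 c (a c - 1)\<close> is bounded below through \<open>c (a c - 1) \<ge> - 1 / (4 a)\<close>. A fixed sign of the bracket is
what makes the flux nonzero.\<close>

lemma landau_bracket_bounds:
  fixes k :: "real ^ 'n::finite"
  assumes a: "80 \<le> a" and k: "norm k = 1" and y: "y \<noteq> 0"
  shows "1 / ((a + 1) * norm y) \<le> landau_bracket a k y" "landau_bracket a k y \<le> 57 / (a * norm y)"
proof -
  define r where "r = norm y"
  define c where "c = k \<bullet> y / r"
  define E where "E = landau_E a k y"
  define h where "h = landau_h a k y"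
  define V where "V = landau_V a k y"
  have r: "0 < r" using y by (simp add: r_def)
  have a1: "1 < a" and a2: "2 \<le> a" and a0: "0 < a" using a by auto
  note b = landau_scalar_bounds[OF a1 k a2 y, folded r_def E_def h_def]
  have ky: "k \<bullet> y = r * c" using r by (simp add: c_def)
  have "\<bar>k \<bullet> y\<bar> \<le> r" using Cauchy_Schwarz_ineq2[of k y] k by (simp add: r_def)
  then have c: "\<bar>c\<bar> \<le> 1" using r by (simp add: c_def)
  have Er: "E * r \<le> 2 / a" using b(2) r a0 by (simp add: field_simps)
  have hr: "\<bar>h\<bar> * (r * r) \<le> 16 / a" using b(3) r a0 by (simp add: field_simps)
  have V: "V = 2 * (E * r) * c + h * (r * r)" by (simp add: V_def landau_V_def E_def h_def ky r_def)
  have Er0: "0 < E * r" using b(1) r by simp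
  have "\<bar>2 * (E * r) * c\<bar> \<le> 2 * (2 / a) * 1"
    unfolding abs_mult by (intro mult_mono) (use Er Er0 c b(1) r a0 in auto)
  moreover have "\<bar>h * (r * r)\<bar> \<le> 16 / a" using hr r by (simp add: abs_mult)
  ultimately have "\<bar>V\<bar> \<le> 2 * (2 / a) * 1 + 16 / a" unfolding V
    using abs_triangle_ineq[of "2 * (E * r) * c" "h * (r * r)"] by linarith
  then have "\<bar>V\<bar> \<le> 20 / a" by simp
  also have "20 / a \<le> 1 / 4" using a by (simp add: field_simps)
  finally have Vb: "\<bar>V\<bar> \<le> 1 / 4" .
  have br: "landau_bracket a k y = 2 * E * (1 + V) + (r * c * h) * (3 + V)"
    by (simp add: landau_bracket_def E_def V_def h_def ky)
  have h: "h = 2 * (a * c - 1) * E\<^sup>2"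
    by (simp add: h_def landau_h_def E_def c_def r_def divide_inverse power2_eq_square)
  have rch: "r * c * h = 2 * E * (E * r) * (a * c\<^sup>2 - c)"
    by (simp add: h power2_eq_square algebra_simps)
  have "0 \<le> (2 * a * c - 1)\<^sup>2" by simp
  then have "- (1 / (4 * a)) \<le> a * c\<^sup>2 - c" using a0 by (simp add: field_simps power2_eq_square)
  then have "2 * E * (E * r) * (- (1 / (4 * a))) \<le> r * c * h"
    unfolding rch using b(1) Er0 by (intro mult_left_mono) auto
  moreover have "2 * E * (E * r) * (- (1 / (4 * a))) \<ge> 2 * E * (2 / a) * (- (1 / (4 * a)))"
    by (intro mult_right_mono_neg mult_left_mono) (use Er b(1) a0 in auto)
  moreover have "2 * E * (2 / a) * (- (1 / (4 * a))) \<ge> - (E / 20)"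
  proof -
    have "1 / (a * a) \<le> 1 / (80 * 80)" using a by (intro divide_left_mono mult_mono) auto
    then have "E * (1 / (a * a)) \<le> E * (1 / 20)" using b(1) by (intro mult_left_mono) auto
    then show ?thesis by (simp add: field_simps)
  qed
  ultimately have lo: "- (E / 20) \<le> r * c * h" by linarith
  have t1: "- (E / 20) * (13 / 4) \<le> (r * c * h) * (3 + V)"
  proof -
    have "- (E / 20) * (13 / 4) \<le> - (E / 20) * (3 + V)" using Vb b(1) by (intro mult_left_mono_neg) auto
    also have "\<dots> \<le> (r * c * h) * (3 + V)" using lo Vb by (intro mult_right_mono) auto
    finally show ?thesis .
  qed
  have t2: "2 * E * (3 / 4) \<le> 2 * E * (1 + V)" using b(1) Vb by (intro mult_left_mono) auto
  have "E \<le> landau_bracket a k y" unfolding br using t1 t2 b(1) by linarith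
  moreover have "1 / ((a + 1) * r) \<le> E"
  proof -
    have "a * r - r * c \<le> (a + 1) * r" using c r mult_left_mono[of "-1" c r] by (simp add: algebra_simps abs_le_iff)
    moreover have "0 < a * r - r * c" using landau_denominator_pos[OF a1 k y] by (simp add: r_def[symmetric] ky)
    ultimately have "inverse ((a + 1) * r) \<le> inverse (a * r - r * c)" by (intro le_imp_inverse_le) auto
    then show ?thesis by (simp add: E_def landau_E_def r_def[symmetric] ky divide_inverse)
  qed
  ultimately show "1 / ((a + 1) * norm y) \<le> landau_bracket a k y" by (simp add: r_def[symmetric])
  have u1: "2 * E * (1 + V) \<le> 2 * (2 / (a * r)) * (5 / 4)"
    using b(1,2) Vb a0 r by (intro mult_mono) auto
  have "\<bar>r * c * h\<bar> \<le> r * 1 * (16 / (a * r * r))"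
    unfolding abs_mult using b(3) c r by (intro mult_mono) auto
  also have "\<dots> = 16 / (a * r)" using r by simp
  finally have u2: "\<bar>r * c * h\<bar> \<le> 16 / (a * r)" .
  have "(r * c * h) * (3 + V) \<le> \<bar>(r * c * h) * (3 + V)\<bar>" by simp
  also have "\<dots> \<le> 16 / (a * r) * (13 / 4)" unfolding abs_mult[of "r * c * h"]
    by (intro mult_mono u2) (use Vb a0 r in auto)
  finally have "landau_bracket a k y \<le> 2 * (2 / (a * r)) * (5 / 4) + 16 / (a * r) * (13 / 4)"
    unfolding br using u1 by linarith
  also have "\<dots> = 57 / (a * r)" by simp
  finally show "landau_bracket a k y \<le> 57 / (a * norm y)" by (simp add: r_def)
qed

lemma landau_strength_eq:
  "landau_strength a k = 2 * (\<integral>y. cutoff_slope y * landau_bracket a k y \<partial>lborel)"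
proof -
  have "(\<lambda>y. axial_density a k y + (k \<bullet> y) * radial_density a k y) = (\<lambda>y. cutoff_slope y * landau_bracket a k y)"
    by (simp add: fun_eq_iff axial_density_def radial_density_def landau_bracket_def algebra_simps)
  then show ?thesis by (simp add: landau_strength_def)
qed

lemma bracket_density_measurable:
  fixes k :: "real ^ 'n::finite"
  assumes "1 < a" and "norm k = 1"
  shows "(\<lambda>y. cutoff_slope y * landau_bracket a k y) \<in> borel_measurable borel"
proof (rule borel_measurable_punctured)
  have ct: "continuous_on (-{0}) (cutoff_slope :: real ^ 'n \<Rightarrow> real)"
    using cdiff_continuous[OF cutoff_slope_cdiff] continuous_on_subset by blast
  note E = cdiff_continuous[OF landau_scalars_cdiff(2)[OF assms, of 0]]
  note h = cdiff_continuous[OF landau_scalars_cdiff(3)[OF assms, of 0]]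
  show "continuous_on (-{0}) (\<lambda>y. cutoff_slope y * landau_bracket a k y)"
    unfolding landau_bracket_def landau_V_def by (intro continuous_intros E h ct)
qed

lemma cutoff_slope_integrable: "integrable lborel (cutoff_slope :: real ^ 'n::finite \<Rightarrow> real)"
proof (rule integrable_annular[OF _ cutoff_slope_annular])
  show "continuous_on (-{0}) (cutoff_slope :: real ^ 'n \<Rightarrow> real)"
    using cdiff_continuous[OF cutoff_slope_cdiff] continuous_on_subset by blast
qed

lemma bracket_density_bounds:
  fixes k :: "real ^ 'n::finite"
  assumes a: "80 \<le> a" and k: "norm k = 1" and y: "y \<noteq> 0"
  shows "57 / a * cutoff_slope y \<le> cutoff_slope y * landau_bracket a k y"
    and "cutoff_slope y * landau_bracket a k y \<le> 1 / (2 * (a + 1)) * cutoff_slope y"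
proof -
  note b = landau_bracket_bounds[OF a k y]
  have "57 / a * cutoff_slope y \<le> cutoff_slope y * landau_bracket a k y
      \<and> cutoff_slope y * landau_bracket a k y \<le> 1 / (2 * (a + 1)) * cutoff_slope y"
  proof (cases "norm y < 1 \<or> 2 < norm y")
    case True then show ?thesis by (simp add: cutoff_slope_outside)
  next
    case False
    then have "57 / (a * norm y) \<le> 57 / (a * 1)" using a False by (intro divide_left_mono mult_left_mono mult_pos_pos) auto
    moreover have "1 / ((a + 1) * 2) \<le> 1 / ((a + 1) * norm y)"
      using a False y by (intro divide_left_mono mult_left_mono) auto
    ultimately have 1: "landau_bracket a k y \<le> 57 / a" and 2: "1 / (2 * (a + 1)) \<le> landau_bracket a k y"
      using b by (simp_all add: mult.commute)
    show ?thesis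
      using mult_right_mono_neg[OF 1 cutoff_slope_nonpos[of y]] mult_right_mono_neg[OF 2 cutoff_slope_nonpos[of y]]
      by (simp add: mult.commute)
  qed
  then show "57 / a * cutoff_slope y \<le> cutoff_slope y * landau_bracket a k y"
    and "cutoff_slope y * landau_bracket a k y \<le> 1 / (2 * (a + 1)) * cutoff_slope y" by auto
qed

lemma bracket_density_dominated:
  fixes k :: "real ^ 'n::finite"
  assumes a: "80 \<le> a" and k: "norm k = 1" and y: "y \<noteq> 0"
  shows "\<bar>cutoff_slope y * landau_bracket a k y\<bar> \<le> - cutoff_slope y"
proof -
  have "57 / a \<le> 1" using a by simp
  then have "- cutoff_slope y * (57 / a) \<le> - cutoff_slope y * 1"
    using cutoff_slope_nonpos[of y] by (intro mult_left_mono) auto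
  moreover have "1 / (2 * (a + 1)) * cutoff_slope y \<le> 0" 
    using cutoff_slope_nonpos[of y] a by (intro mult_nonneg_nonpos) auto
  ultimately show ?thesis using bracket_density_bounds[OF a k y] by (simp add: mult.commute)
qed

lemma bracket_density_integrable:
  fixes k :: "real ^ 'n::finite"
  assumes a: "80 \<le> a" and k: "norm k = 1"
  shows "integrable lborel (\<lambda>y. cutoff_slope y * landau_bracket a k y)"
proof (rule integrable_bound_punctured[OF integrable_minus[OF cutoff_slope_integrable]])
  show "(\<lambda>y. cutoff_slope y * landau_bracket a k y) \<in> borel_measurable borel"
    by (rule bracket_density_measurable[OF _ k]) (use a in simp)
qed (rule bracket_density_dominated[OF a k])

lemma landau_strength_bounds:
  fixes k :: "real ^ 'n::finite"
  assumes a: "80 \<le> a" and k: "norm k = 1"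
  defines "T \<equiv> (\<integral>y. cutoff_slope y \<partial>(lborel :: (real ^ 'n) measure))"
  shows "114 / a * T \<le> landau_strength a k" "landau_strength a k \<le> 1 / (a + 1) * T"
proof -
  note i = bracket_density_integrable[OF a k]
  have "(\<integral>y. 57 / a * cutoff_slope y \<partial>(lborel :: (real ^ 'n) measure)) \<le> (\<integral>y. cutoff_slope y * landau_bracket a k y \<partial>lborel)"
    by (rule integral_mono_AE[OF integrable_mult_right[OF cutoff_slope_integrable] i])
       (use AE_nonzero in eventually_elim, rule bracket_density_bounds(1)[OF a k])
  then show "114 / a * T \<le> landau_strength a k" by (simp add: landau_strength_eq T_def)
  have "(\<integral>y. cutoff_slope y * landau_bracket a k y \<partial>lborel) \<le> (\<integral>y. 1 / (2 * (a + 1)) * cutoff_slope y \<partial>(lborel :: (real ^ 'n) measure))"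
    by (rule integral_mono_AE[OF i integrable_mult_right[OF cutoff_slope_integrable]])
       (use AE_nonzero in eventually_elim, rule bracket_density_bounds(2)[OF a k])
  then have "landau_strength a k \<le> 2 * (1 / (2 * (a + 1)) * T)" by (simp add: landau_strength_eq T_def)
  also have "\<dots> = 1 / (a + 1) * T" using a by (simp add: field_simps)
  finally show "landau_strength a k \<le> 1 / (a + 1) * T" .
qed

lemma landau_strength_continuous:
  fixes k :: "real ^ 'n::finite"
  assumes k: "norm k = 1"
  shows "continuous_on {80..} (\<lambda>a. landau_strength a k)"
  unfolding continuous_on_sequentially
proof (intro allI ballI impI)
  fix x :: "nat \<Rightarrow> real" and a :: real
  assume a: "a \<in> {80..}" and "(\<forall>n. x n \<in> {80..}) \<and> x \<longlonglongrightarrow> a"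
  then have x: "\<And>n. 80 \<le> x n" and lim: "x \<longlonglongrightarrow> a" and a: "80 \<le> a" by auto
  have "(\<lambda>m. \<integral>y. cutoff_slope y * landau_bracket (x m) k y \<partial>lborel) \<longlonglongrightarrow> (\<integral>y. cutoff_slope y * landau_bracket a k y \<partial>lborel)"
  proof (rule dominated_convergence_punctured)
    show "integrable lborel (\<lambda>y :: real ^ 'n. - cutoff_slope y)" using cutoff_slope_integrable by simp
    show "(\<lambda>y. cutoff_slope y * landau_bracket (x m) k y) \<in> borel_measurable borel" for m
      by (rule bracket_density_measurable[OF _ k]) (use x[of m] in simp)
    show "(\<lambda>y. cutoff_slope y * landau_bracket a k y) \<in> borel_measurable borel"
      by (rule bracket_density_measurable[OF _ k]) (use a in simp)
    show "\<bar>cutoff_slope y * landau_bracket (x m) k y\<bar> \<le> - cutoff_slope y" if "y \<noteq> 0" for m y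
      by (rule bracket_density_dominated[OF x k that])
    fix y :: "real ^ 'n" assume y: "y \<noteq> 0"
    have E: "(\<lambda>m. landau_E (x m) k y) \<longlonglongrightarrow> landau_E a k y"
      unfolding landau_E_def using landau_denominator_pos[OF _ k y, of a] a by (intro tendsto_intros lim) auto
    have h: "(\<lambda>m. landau_h (x m) k y) \<longlonglongrightarrow> landau_h a k y"
      unfolding landau_h_def by (intro tendsto_intros lim E)
    show "(\<lambda>m. cutoff_slope y * landau_bracket (x m) k y) \<longlonglongrightarrow> cutoff_slope y * landau_bracket a k y"
      unfolding landau_bracket_def landau_V_def by (intro tendsto_intros E h)
  qed
  then have "(\<lambda>m. landau_strength (x m) k) \<longlonglongrightarrow> landau_strength a k"
    unfolding landau_strength_eq by (intro tendsto_intros)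
  then show "((\<lambda>a. landau_strength a k) \<circ> x) \<longlonglongrightarrow> landau_strength a k" by (simp add: comp_def)
qed

text \<open>The strength is negative and continuous in \<open>a\<close> and tends to zero for large \<open>a\<close>, so with \<open>k\<close> opposite to \<open>b\<close> the intermediate
value theorem applies. The bounds on the strength are uniform in \<open>k\<close>, hence so is \<open>c\<close>.\<close>

lemma landau_flux_realises:
  assumes n: "CARD('n::finite) = 3" and A: "80 \<le> A"
  obtains c where "0 < c" and
    "\<And>b :: real ^ 'n. b \<noteq> 0 \<Longrightarrow> norm b \<le> c \<Longrightarrow> \<exists>a k. A \<le> a \<and> norm k = 1 \<and> (\<forall>e. landau_flux a k (\<lambda>j. e $ j) = b \<bullet> e)"
proof -
  define T where "T = (\<integral>y. cutoff_slope y \<partial>(lborel :: (real ^ 'n) measure))"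
  have T: "T < 0" unfolding T_def by (rule cutoff_slope_integral)
  show thesis
  proof (rule that[of "- (1 / (A + 1) * T)"])
    show "0 < - (1 / (A + 1) * T)" using T A by (simp add: mult_neg_pos field_simps)
    fix b :: "real ^ 'n" assume b: "b \<noteq> 0" "norm b \<le> - (1 / (A + 1) * T)"
    define k where "k = - (1 / norm b) *\<^sub>R b"
    have k: "norm k = 1" using b by (simp add: k_def)
    define B where "B = max A (- (114 * T / norm b))"
    have B: "A \<le> B" "80 \<le> B" using A by (auto simp: B_def)
    have "- (114 * T / norm b) \<le> B" by (simp add: B_def)
    then have "- (114 * T) \<le> B * norm b" using b by (simp add: field_simps)
    then have "- norm b \<le> 114 / B * T" using B A by (simp add: field_simps)
    then have up: "- norm b \<le> landau_strength B k"
      using landau_strength_bounds(1)[OF B(2) k] by (simp add: T_def)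
    have lo: "landau_strength A k \<le> - norm b"
      using landau_strength_bounds(2)[OF A k] b(2) by (simp add: T_def)
    have "continuous_on {A..B} (\<lambda>a. landau_strength a k)"
      by (rule continuous_on_subset[OF landau_strength_continuous[OF k]]) (use A in auto)
    then obtain a where a: "A \<le> a" "landau_strength a k = - norm b"
      using IVT'[of "\<lambda>a. landau_strength a k", OF lo up B(1)] by blast
    have a1: "1 < a" using a A by simp
    have "landau_flux a k (\<lambda>j. e $ j) = b \<bullet> e" for e
      unfolding landau_flux_axial[OF a1 k n] a(2) using b(1) by (simp add: k_def)
    then show "\<exists>a k. A \<le> a \<and> norm k = 1 \<and> (\<forall>e. landau_flux a k (\<lambda>j. e $ j) = b \<bullet> e)"
      using a(1) k by blast
  qed
qed

section \<open>Small solutions are determined by their flux\<close>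

lemma div_flux_pot_partial_outside:
  fixes y :: "real ^ 'n::finite"
  assumes "norm y < 1 \<or> 2 < norm y"
  shows "partial_deriv l (div_pot (flux_pot e) j) y = 0"
  using assms
proof
  assume y: "norm y < 1"
  have o: "open {y::real^'n. norm y < 1}" by (intro open_Collect_less continuous_intros)
  have "partial_deriv l (div_pot (flux_pot e) j) y = partial_deriv l (\<lambda>_. (real CARD('n) - 1) * e j) y"
    by (rule partial_deriv_cong[OF o]) (use y div_flux_pot_near[of _ e j] in auto)
  then show ?thesis by simp
next
  assume y: "2 < norm y"
  have o: "open {y::real^'n. 2 < norm y}" by (intro open_Collect_less continuous_intros)
  have "partial_deriv l (div_pot (flux_pot e) j) y = partial_deriv l (\<lambda>_. 0) y"
    by (rule partial_deriv_cong[OF o]) (use y div_flux_pot_far[of _ e j] in auto)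
  then show ?thesis by simp
qed

lemma div_flux_pot_partial_annular:
  "annular (partial_deriv l (div_pot (flux_pot e) j :: real ^ 'n::finite \<Rightarrow> real))"
  unfolding annular_def using div_flux_pot_partial_outside[of _ l e j] by (intro exI[of _ 1] conjI exI[of _ 2]) auto

lemma div_flux_pot_partial_continuous:
  "continuous_on (-{0}) (partial_deriv l (div_pot (flux_pot e) j :: real ^ 'n::finite \<Rightarrow> real))"
  "continuous_on (-{0}) (partial_deriv i (partial_deriv l (div_pot (flux_pot e) j :: real ^ 'n::finite \<Rightarrow> real)))"
proof -
  have c: "cdiff 1 (-{0}) (partial_deriv l (div_pot (flux_pot e) j :: real ^ 'n \<Rightarrow> real))"
    by (rule cdiff_subset[OF cdiff_partialD[OF div_flux_pot_cdiff]]) simp_all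
  show "continuous_on (-{0}) (partial_deriv l (div_pot (flux_pot e) j :: real ^ 'n \<Rightarrow> real))" 
    by (rule cdiff_continuous[OF c])
  show "continuous_on (-{0}) (partial_deriv i (partial_deriv l (div_pot (flux_pot e) j :: real ^ 'n \<Rightarrow> real)))" 
    using c by simp
qed

lemma flux_integrable:
  fixes w :: "'n::finite \<Rightarrow> real ^ 'n \<Rightarrow> real"
  assumes "\<And>j. continuous_on (-{0}) (w j)" "\<And>j k. continuous_on (-{0}) (H j k)"
  shows "integrable lborel (weak_term w H (div_pot (flux_pot e)))"
proof (rule integrable_annular)
  show "continuous_on (-{0}) (weak_term w H (div_pot (flux_pot e)))"
    unfolding weak_term_def[abs_def] by (intro continuous_intros assms div_flux_pot_partial_continuous)
  show "annular (weak_term w H (div_pot (flux_pot e)))"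
    unfolding weak_term_def[abs_def]
    by (intro annular_add annular_sum annular_mult annular_partial div_flux_pot_partial_annular) auto
qed

definition flux_vector :: "('n::finite \<Rightarrow> real ^ 'n \<Rightarrow> real) \<Rightarrow> ('n \<Rightarrow> 'n \<Rightarrow> real ^ 'n \<Rightarrow> real) \<Rightarrow> real ^ 'n" where
  "flux_vector w H = (\<chi> m. integral\<^sup>L lborel (weak_term w H (div_pot (flux_pot (\<lambda>j. if j = m then 1 else 0)))))"

lemma flux_linear:
  fixes w :: "'n::finite \<Rightarrow> real ^ 'n \<Rightarrow> real"
  assumes "\<And>j. continuous_on (-{0}) (w j)" "\<And>j k. continuous_on (-{0}) (H j k)"
  shows "integral\<^sup>L lborel (weak_term w H (div_pot (flux_pot e))) = (\<Sum>m\<in>UNIV. e m * flux_vector w H $ m)"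
proof -
  let ?d = "\<lambda>m j. if j = m then 1 else 0 :: real"
  let ?\<phi> = "\<lambda>e. div_pot (flux_pot e) :: 'n \<Rightarrow> real ^ 'n \<Rightarrow> real"
  have dF: "flux_pot e k j differentiable (at y)" for e k j and y :: "real ^ 'n"
    using flux_pot_cdiff[of e k j] by (simp add: numeral_3_eq_3)
  have d\<phi>: "?\<phi> e j differentiable (at y)" "partial_deriv l (?\<phi> e j) differentiable (at y)" for e l j y
    using div_flux_pot_cdiff[of e j] by (simp_all add: numeral_2_eq_2)
  have s: "flux_pot e k j = (\<lambda>y. \<Sum>m\<in>UNIV. e m * flux_pot (?d m) k j y)" for k j
  proof
    fix y
    have "(\<Sum>m\<in>UNIV. e m * flux_pot (?d m) k j y) = cutoff y * (y $ k * (\<Sum>m\<in>UNIV. e m * ?d m j) - y $ j * (\<Sum>m\<in>UNIV. e m * ?d m k))"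
      by (simp only: flux_pot_def sum_distrib_left sum_subtractf[symmetric]) (intro sum.cong refl, simp add: algebra_simps)
    then show "flux_pot e k j y = (\<Sum>m\<in>UNIV. e m * flux_pot (?d m) k j y)" by (simp add: flux_pot_def if_distrib cong: if_cong)
  qed
  have lin: "partial_deriv i (\<lambda>y. \<Sum>m\<in>UNIV. e m * f m y) y = (\<Sum>m\<in>UNIV. e m * partial_deriv i (f m) y)"
    if "\<And>m. f m differentiable (at y)" for i y and f :: "'n \<Rightarrow> real ^ 'n \<Rightarrow> real"
    by (subst partial_deriv_sum) (use that in \<open>simp_all add: partial_deriv_cmult\<close>)
  have p0: "?\<phi> e j = (\<lambda>y. \<Sum>m\<in>UNIV. e m * ?\<phi> (?d m) j y)" for j
  proof
    fix y
    have "?\<phi> e j y = (\<Sum>k\<in>UNIV. \<Sum>m\<in>UNIV. e m * partial_deriv k (flux_pot (?d m) k j) y)"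
      unfolding div_pot_def by (intro sum.cong refl) (subst s, rule lin[OF dF])
    also have "\<dots> = (\<Sum>m\<in>UNIV. \<Sum>k\<in>UNIV. e m * partial_deriv k (flux_pot (?d m) k j) y)" by (rule sum.swap)
    finally show "?\<phi> e j y = (\<Sum>m\<in>UNIV. e m * ?\<phi> (?d m) j y)" by (simp add: div_pot_def sum_distrib_left)
  qed
  have p1: "partial_deriv l (?\<phi> e j) = (\<lambda>y. \<Sum>m\<in>UNIV. e m * partial_deriv l (?\<phi> (?d m) j) y)" for l j
    by (rule ext, subst p0, rule lin[OF d\<phi>(1)])
  have p2: "partial_deriv l (partial_deriv l (?\<phi> e j)) y = (\<Sum>m\<in>UNIV. e m * partial_deriv l (partial_deriv l (?\<phi> (?d m) j)) y)" for l j y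
    by (subst p1, rule lin[OF d\<phi>(2)])
  have "weak_term w H (?\<phi> e) y = (\<Sum>m\<in>UNIV. e m * weak_term w H (?\<phi> (?d m)) y)" for y
  proof -
    have "(\<Sum>j\<in>UNIV. w j y * (\<Sum>l\<in>UNIV. partial_deriv l (partial_deriv l (?\<phi> e j)) y))
       = (\<Sum>j\<in>UNIV. \<Sum>l\<in>UNIV. \<Sum>m\<in>UNIV. e m * (w j y * partial_deriv l (partial_deriv l (?\<phi> (?d m) j)) y))"
      unfolding p2 by (simp add: sum_distrib_left mult_ac)
    also have "\<dots> = (\<Sum>j\<in>UNIV. \<Sum>m\<in>UNIV. \<Sum>l\<in>UNIV. e m * (w j y * partial_deriv l (partial_deriv l (?\<phi> (?d m) j)) y))"
      by (rule sum.cong[OF refl], rule sum.swap)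
    also have "\<dots> = (\<Sum>m\<in>UNIV. \<Sum>j\<in>UNIV. \<Sum>l\<in>UNIV. e m * (w j y * partial_deriv l (partial_deriv l (?\<phi> (?d m) j)) y))"
      by (rule sum.swap)
    finally have A: "(\<Sum>j\<in>UNIV. w j y * (\<Sum>l\<in>UNIV. partial_deriv l (partial_deriv l (?\<phi> e j)) y))
       = (\<Sum>m\<in>UNIV. e m * (\<Sum>j\<in>UNIV. w j y * (\<Sum>l\<in>UNIV. partial_deriv l (partial_deriv l (?\<phi> (?d m) j)) y)))"
      by (simp add: sum_distrib_left)
    have "(\<Sum>j\<in>UNIV. \<Sum>k\<in>UNIV. H j k y * partial_deriv j (?\<phi> e k) y)
       = (\<Sum>j\<in>UNIV. \<Sum>k\<in>UNIV. \<Sum>m\<in>UNIV. e m * (H j k y * partial_deriv j (?\<phi> (?d m) k) y))"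
      unfolding p1 by (simp add: sum_distrib_left mult_ac)
    also have "\<dots> = (\<Sum>j\<in>UNIV. \<Sum>m\<in>UNIV. \<Sum>k\<in>UNIV. e m * (H j k y * partial_deriv j (?\<phi> (?d m) k) y))"
      by (rule sum.cong[OF refl], rule sum.swap)
    also have "\<dots> = (\<Sum>m\<in>UNIV. \<Sum>j\<in>UNIV. \<Sum>k\<in>UNIV. e m * (H j k y * partial_deriv j (?\<phi> (?d m) k) y))"
      by (rule sum.swap)
    finally have B: "(\<Sum>j\<in>UNIV. \<Sum>k\<in>UNIV. H j k y * partial_deriv j (?\<phi> e k) y)
       = (\<Sum>m\<in>UNIV. e m * (\<Sum>j\<in>UNIV. \<Sum>k\<in>UNIV. H j k y * partial_deriv j (?\<phi> (?d m) k) y))"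
      by (simp add: sum_distrib_left)
    show ?thesis unfolding weak_term_def A B by (simp add: distrib_left sum.distrib)
  qed
  then have "integral\<^sup>L lborel (weak_term w H (?\<phi> e)) = (\<integral>y. (\<Sum>m\<in>UNIV. e m * weak_term w H (?\<phi> (?d m)) y) \<partial>lborel)" by presburger
  also have "\<dots> = (\<Sum>m\<in>UNIV. \<integral>y. e m * weak_term w H (?\<phi> (?d m)) y \<partial>lborel)"
    by (intro Bochner_Integration.integral_sum integrable_mult_right flux_integrable assms)
  finally show ?thesis by (simp add: flux_vector_def)
qed

text \<open>All derivatives of the test fields are supported in the shell \<open>1 \<le> norm y \<le> 2\<close>.\<close>

lemma flux_bound:
  obtains C where "0 < C" and "\<And>(w :: 'n::finite \<Rightarrow> real ^ 'n \<Rightarrow> real) H \<epsilon>. (\<And>j. continuous_on (-{0}) (w j)) \<Longrightarrow> (\<And>j k. continuous_on (-{0}) (H j k)) \<Longrightarrow>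
      (\<And>j y. y \<noteq> 0 \<Longrightarrow> \<bar>w j y\<bar> \<le> \<epsilon> / norm y) \<Longrightarrow> (\<And>j k y. y \<noteq> 0 \<Longrightarrow> \<bar>H j k y\<bar> \<le> \<epsilon> / (norm y)\<^sup>2) \<Longrightarrow> 0 \<le> \<epsilon> \<Longrightarrow>
      norm (flux_vector w H) \<le> C * \<epsilon>"
proof -
  let ?\<phi> = "\<lambda>m. div_pot (flux_pot (\<lambda>j. if j = m then 1 else 0)) :: 'n \<Rightarrow> real ^ 'n \<Rightarrow> real"
  let ?G = "\<lambda>m y. (\<Sum>j\<in>UNIV. \<Sum>l\<in>UNIV. \<bar>partial_deriv l (partial_deriv l (?\<phi> m j)) y\<bar>) + (\<Sum>j\<in>UNIV. \<Sum>k\<in>UNIV. \<bar>partial_deriv j (?\<phi> m k) y\<bar>)"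
  have an: "annular f \<Longrightarrow> annular (\<lambda>y. \<bar>f y\<bar>)" for f :: "real ^ 'n \<Rightarrow> real" unfolding annular_def by auto
  have iG: "integrable lborel (?G m)" for m
  proof (rule integrable_annular)
    show "continuous_on (-{0}) (?G m)" by (intro continuous_intros div_flux_pot_partial_continuous)
    show "annular (?G m)" by (intro annular_add annular_sum an annular_partial div_flux_pot_partial_annular) auto
  qed
  have G0: "0 \<le> ?G m y" for m y by (intro add_nonneg_nonneg sum_nonneg) auto
  define C where "C = (\<Sum>m\<in>UNIV. integral\<^sup>L lborel (?G m)) + 1"
  have C: "0 < C" unfolding C_def using sum_nonneg[of UNIV "\<lambda>m. integral\<^sup>L lborel (?G m)"] Bochner_Integration.integral_nonneg[of lborel "?G _"] G0
    by (smt (verit, ccfv_threshold))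
  show thesis
  proof (rule that[OF C])
    fix w :: "'n \<Rightarrow> real ^ 'n \<Rightarrow> real" and H :: "'n \<Rightarrow> 'n \<Rightarrow> real ^ 'n \<Rightarrow> real" and \<epsilon> :: real
    assume wc: "\<And>j. continuous_on (-{0}) (w j)" and Hc: "\<And>j k. continuous_on (-{0}) (H j k)"
      and wb: "\<And>j y. y \<noteq> 0 \<Longrightarrow> \<bar>w j y\<bar> \<le> \<epsilon> / norm y" and Hb: "\<And>j k y. y \<noteq> 0 \<Longrightarrow> \<bar>H j k y\<bar> \<le> \<epsilon> / (norm y)\<^sup>2" and \<epsilon>: "0 \<le> \<epsilon>"
    have pw: "\<bar>weak_term w H (?\<phi> m) y\<bar> \<le> \<epsilon> * ?G m y" if y0: "y \<noteq> 0" for m y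
    proof (cases "norm y < 1")
      case True
      have o: "open {y::real^'n. norm y < 1}" by (intro open_Collect_less continuous_intros)
      have "partial_deriv l (partial_deriv l (?\<phi> m j)) y = partial_deriv l (\<lambda>_. 0) y" for l j
        by (rule partial_deriv_cong[OF o]) (use True div_flux_pot_partial_outside in auto)
      then have "weak_term w H (?\<phi> m) y = 0"
        unfolding weak_term_def using True div_flux_pot_partial_outside[of y] by simp
      then show ?thesis using G0[of m y] \<epsilon> by simp
    next
      case False
      have "\<epsilon> / norm y \<le> \<epsilon> / 1" by (rule divide_left_mono) (use False \<epsilon> in auto)
      then have wl: "\<bar>w j y\<bar> \<le> \<epsilon>" for j using wb[OF y0, of j] by simp
      have "1\<^sup>2 \<le> (norm y)\<^sup>2" by (rule power_mono) (use False in auto)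
      then have "\<epsilon> / (norm y)\<^sup>2 \<le> \<epsilon> / 1" by (intro divide_left_mono) (use False \<epsilon> in auto)
      then have Hl: "\<bar>H j k y\<bar> \<le> \<epsilon>" for j k using Hb[OF y0, of j k] by simp
      have "\<bar>\<Sum>j\<in>UNIV. w j y * (\<Sum>l\<in>UNIV. partial_deriv l (partial_deriv l (?\<phi> m j)) y)\<bar>
        \<le> (\<Sum>j\<in>UNIV. \<epsilon> * (\<Sum>l\<in>UNIV. \<bar>partial_deriv l (partial_deriv l (?\<phi> m j)) y\<bar>))"
        by (rule order_trans[OF sum_abs], intro sum_mono, subst abs_mult, intro mult_mono wl sum_abs \<epsilon>) simp
      moreover have "\<bar>\<Sum>j\<in>UNIV. \<Sum>k\<in>UNIV. H j k y * partial_deriv j (?\<phi> m k) y\<bar> \<le> (\<Sum>j\<in>UNIV. \<Sum>k\<in>UNIV. \<epsilon> * \<bar>partial_deriv j (?\<phi> m k) y\<bar>)"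
        by (rule order_trans[OF sum_abs], intro sum_mono, rule order_trans[OF sum_abs], intro sum_mono, subst abs_mult, intro mult_right_mono Hl) simp
      moreover have "\<epsilon> * ?G m y = (\<Sum>j\<in>UNIV. \<epsilon> * (\<Sum>l\<in>UNIV. \<bar>partial_deriv l (partial_deriv l (?\<phi> m j)) y\<bar>))
          + (\<Sum>j\<in>UNIV. \<Sum>k\<in>UNIV. \<epsilon> * \<bar>partial_deriv j (?\<phi> m k) y\<bar>)"
        by (simp only: distrib_left sum_distrib_left)
      ultimately show ?thesis unfolding weak_term_def by (intro order_trans[OF abs_triangle_ineq]) linarith
    qed
    have "\<bar>flux_vector w H $ m\<bar> \<le> \<epsilon> * integral\<^sup>L lborel (?G m)" for m
    proof -
      have "\<bar>flux_vector w H $ m\<bar> \<le> (\<integral>y. norm (weak_term w H (?\<phi> m) y) \<partial>lborel)"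
        unfolding flux_vector_def vec_lambda_beta real_norm_def[symmetric] by (rule integral_norm_bound)
      also have "\<dots> \<le> (\<integral>y. \<epsilon> * ?G m y \<partial>lborel)"
      proof (rule integral_mono_AE[OF integrable_norm[OF flux_integrable[OF wc Hc]] integrable_mult_right[OF iG]])
        show "AE y in lborel. norm (weak_term w H (?\<phi> m) y) \<le> \<epsilon> * ?G m y"
          using AE_nonzero by eventually_elim (use pw in simp)
      qed
      finally have "\<bar>flux_vector w H $ m\<bar> \<le> (\<integral>y. \<epsilon> * ?G m y \<partial>lborel)" .
      then show ?thesis by simp
    qed
    then have "norm (flux_vector w H) \<le> (\<Sum>m\<in>UNIV. \<epsilon> * integral\<^sup>L lborel (?G m))"
      by (intro order_trans[OF norm_le_l1_cart] sum_mono)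
    also have "\<dots> \<le> C * \<epsilon>" using \<epsilon> by (simp add: C_def algebra_simps sum_distrib_left)
    finally show "norm (flux_vector w H) \<le> C * \<epsilon>" .
  qed
qed

text \<open>This turns an estimate with a small factor into vanishing without any claim that a supremum is attained.\<close>

lemma bound_zero_by_halving:
  fixes f :: "'a \<Rightarrow> real"
  assumes start: "\<And>s. s \<in> S \<Longrightarrow> f s \<le> M0" "0 \<le> M0"
    and half: "\<And>M. 0 \<le> M \<Longrightarrow> (\<And>s. s \<in> S \<Longrightarrow> f s \<le> M) \<Longrightarrow> (\<And>s. s \<in> S \<Longrightarrow> f s \<le> M / 2)"
    and s: "s \<in> S"
  shows "f s \<le> 0"
proof -
  have "\<forall>s\<in>S. f s \<le> M0 / 2 ^ k" for k
  proof (induction k)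
    case 0 then show ?case using start by simp
  next
    case (Suc k)
    have "f s \<le> M0 / 2 ^ k / 2" if "s \<in> S" for s
      by (rule half[OF _ _ that]) (use Suc start(2) in auto)
    then show ?case by (simp add: mult.commute)
  qed
  then have "\<And>k. f s \<le> M0 / 2 ^ k" using s by blast
  moreover have "(\<lambda>k. M0 / 2 ^ k) \<longlonglongrightarrow> 0" by (rule LIMSEQ_divide_realpow_zero) simp
  ultimately show ?thesis by (intro LIMSEQ_le_const) auto
qed

lemma weak_term_diff_field:
  "weak_term (\<lambda>j y. v j y - U j y) (\<lambda>j k y. H j k y - G j k y) \<phi> y = weak_term v H \<phi> y - weak_term U G \<phi> y"
  by (simp add: weak_term_def left_diff_distrib sum_subtractf)

lemma annihilates_diff_field:
  assumes "integrable lborel (weak_term v H \<phi>)" "integrable lborel (weak_term U G \<phi>)"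
    and "integral\<^sup>L lborel (weak_term v H \<phi>) = integral\<^sup>L lborel (weak_term U G \<phi>)"
  shows "annihilates (\<lambda>j y. v j y - U j y) (\<lambda>j k y. H j k y - G j k y) \<phi>"
  unfolding annihilates_def weak_term_diff_field[abs_def] using assms by simp

text \<open>With \<open>w = v - U\<close> one has \<open>v \<otimes> v - U \<otimes> U = v \<otimes> w + w \<otimes> U\<close>, so \<open>\<bar>w\<bar> \<le> M / \<bar>y\<bar>\<close> gives \<open>K = 2 \<delta> M\<close> in \<open>stokes_estimate\<close>.\<close>

lemma small_solution_determined_by_flux:
  assumes N: "3 \<le> CARD('n::finite)"
  obtains \<delta> where "0 < \<delta>" and "\<And>(v :: 'n \<Rightarrow> real ^ 'n \<Rightarrow> real) U j x.
    (\<And>j. cdiff 1 (-{0}) (v j)) \<Longrightarrow> (\<And>j. cdiff 1 (-{0}) (U j)) \<Longrightarrow>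
    (\<And>y. y \<noteq> 0 \<Longrightarrow> (\<Sum>j\<in>UNIV. partial_deriv j (v j) y) = 0) \<Longrightarrow> (\<And>y. y \<noteq> 0 \<Longrightarrow> (\<Sum>j\<in>UNIV. partial_deriv j (U j) y) = 0) \<Longrightarrow>
    (\<And>j y. y \<noteq> 0 \<Longrightarrow> \<bar>v j y\<bar> \<le> \<delta> / norm y) \<Longrightarrow> (\<And>j y. y \<noteq> 0 \<Longrightarrow> \<bar>U j y\<bar> \<le> \<delta> / norm y) \<Longrightarrow>
    weak_solution v (\<lambda>j k y. v j y * v k y) \<Longrightarrow> weak_solution U (\<lambda>j k y. U j y * U k y) \<Longrightarrow>
    flux_vector v (\<lambda>j k y. v j y * v k y) = flux_vector U (\<lambda>j k y. U j y * U k y) \<Longrightarrow> x \<noteq> 0 \<Longrightarrow> v j x = U j x"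
proof -
  obtain C where C: "0 < C" and est: "\<And>(w :: 'n \<Rightarrow> real ^ 'n \<Rightarrow> real) H M K i x.
     (\<And>j. cdiff 1 (-{0}) (w j)) \<Longrightarrow> (\<And>y. y \<noteq> 0 \<Longrightarrow> (\<Sum>j\<in>UNIV. partial_deriv j (w j) y) = 0) \<Longrightarrow>
     (\<And>j y. y \<noteq> 0 \<Longrightarrow> \<bar>w j y\<bar> \<le> M / norm y) \<Longrightarrow>
     (\<And>j k. continuous_on (-{0}) (H j k)) \<Longrightarrow> (\<And>j k y. y \<noteq> 0 \<Longrightarrow> \<bar>H j k y\<bar> \<le> K / (norm y)\<^sup>2) \<Longrightarrow>
     weak_solution w H \<Longrightarrow> zero_flux w H \<Longrightarrow> x \<noteq> 0 \<Longrightarrow> \<bar>w i x\<bar> \<le> C * K / norm x"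
    using stokes_estimate[OF N] by blast
  define \<delta> where "\<delta> = 1 / (4 * C)"
  have \<delta>: "0 < \<delta>" using C by (simp add: \<delta>_def)
  show thesis
  proof (rule that[OF \<delta>])
    fix v U :: "'n \<Rightarrow> real ^ 'n \<Rightarrow> real" and j :: 'n and x :: "real ^ 'n"
    assume cv: "\<And>j. cdiff 1 (-{0}) (v j)" and cU: "\<And>j. cdiff 1 (-{0}) (U j)"
      and dv: "\<And>y. y \<noteq> 0 \<Longrightarrow> (\<Sum>j\<in>UNIV. partial_deriv j (v j) y) = 0" and dU: "\<And>y. y \<noteq> 0 \<Longrightarrow> (\<Sum>j\<in>UNIV. partial_deriv j (U j) y) = 0"
      and bv: "\<And>j y. y \<noteq> 0 \<Longrightarrow> \<bar>v j y\<bar> \<le> \<delta> / norm y" and bU: "\<And>j y. y \<noteq> 0 \<Longrightarrow> \<bar>U j y\<bar> \<le> \<delta> / norm y"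
      and wv: "weak_solution v (\<lambda>j k y. v j y * v k y)" and wU: "weak_solution U (\<lambda>j k y. U j y * U k y)"
      and fl: "flux_vector v (\<lambda>j k y. v j y * v k y) = flux_vector U (\<lambda>j k y. U j y * U k y)" and x: "x \<noteq> 0"
    let ?w = "\<lambda>j y. v j y - U j y" and ?H = "\<lambda>j k y. v j y * v k y - U j y * U k y"
    have ccv: "continuous_on (-{0}) (v j)" and ccU: "continuous_on (-{0}) (U j)" for j
      using cdiff_continuous[OF cv] cdiff_continuous[OF cU] by auto
    have cw: "cdiff 1 (-{0}) (?w j)" for j by (intro cdiff_diff open_punctured cv cU)
    have dw: "(\<Sum>j\<in>UNIV. partial_deriv j (?w j) y) = 0" if "y \<noteq> 0" for y
    proof -
      have d: "v j differentiable (at y)" "U j differentiable (at y)" for j using cv[of j] cU[of j] that by simp_all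
      show ?thesis unfolding partial_deriv_diff[OF d] sum_subtractf using dv[OF that] dU[OF that] by simp
    qed
    have ww: "weak_solution ?w ?H"
      unfolding weak_solution_def
    proof (intro allI impI, elim conjE)
      fix \<phi> :: "'n \<Rightarrow> real ^ 'n \<Rightarrow> real"
      assume \<phi>: "\<forall>j. cdiff 2 (-{0}) (\<phi> j)" "\<forall>j. annular (\<phi> j)" "\<forall>y. y \<noteq> 0 \<longrightarrow> (\<Sum>j\<in>UNIV. partial_deriv j (\<phi> j) y) = 0"
      have "annihilates v (\<lambda>j k y. v j y * v k y) \<phi>" "annihilates U (\<lambda>j k y. U j y * U k y) \<phi>"
        using wv wU \<phi> unfolding weak_solution_def by blast+
      then show "annihilates ?w ?H \<phi>" by (intro annihilates_diff_field) (simp_all add: annihilates_def)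
    qed
    have zf: "zero_flux ?w ?H"
      unfolding zero_flux_def
    proof (rule allI, rule annihilates_diff_field)
      have cvv: "continuous_on (-{0}) (\<lambda>y. v j y * v k y)" and cUU: "continuous_on (-{0}) (\<lambda>y. U j y * U k y)" for j k
        by (intro continuous_intros ccv ccU)+
      show "integrable lborel (weak_term v (\<lambda>j k y. v j y * v k y) (div_pot (flux_pot e)))"
        "integrable lborel (weak_term U (\<lambda>j k y. U j y * U k y) (div_pot (flux_pot e)))"
        "integral\<^sup>L lborel (weak_term v (\<lambda>j k y. v j y * v k y) (div_pot (flux_pot e)))
         = integral\<^sup>L lborel (weak_term U (\<lambda>j k y. U j y * U k y) (div_pot (flux_pot e)))" for e
        unfolding flux_linear[OF ccv cvv] flux_linear[OF ccU cUU] fl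
        by (intro flux_integrable ccv ccU cvv cUU)+ (rule refl)
    qed
    have Hc: "continuous_on (-{0}) (?H j k)" for j k by (intro continuous_intros ccv ccU)
    let ?f = "\<lambda>s :: 'n \<times> (real ^ 'n). \<bar>?w (fst s) (snd s)\<bar> * norm (snd s)"
    have "?f (j, x) \<le> 0"
    proof (rule bound_zero_by_halving[where S = "{s. snd s \<noteq> 0}" and ?M0.0 = "2 * \<delta>"])
      fix s :: "'n \<times> (real ^ 'n)" assume "s \<in> {s. snd s \<noteq> 0}"
      then obtain j y where s: "s = (j, y)" "y \<noteq> 0" by (cases s) auto
      have "\<bar>?w j y\<bar> \<le> \<delta> / norm y + \<delta> / norm y" using bv[OF s(2), of j] bU[OF s(2), of j] by linarith
      then show "?f s \<le> 2 * \<delta>" using s by (simp add: field_simps)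
    next
      fix M and s :: "'n \<times> (real ^ 'n)"
      assume M: "0 \<le> M" and ass: "\<And>s. s \<in> {s. snd s \<noteq> 0} \<Longrightarrow> ?f s \<le> M" and "s \<in> {s. snd s \<noteq> 0}"
      then obtain i z where s: "s = (i, z)" "z \<noteq> 0" by (cases s) auto
      have wM: "\<bar>?w j y\<bar> \<le> M / norm y" if "y \<noteq> 0" for j y using ass[of "(j, y)"] that by (simp add: field_simps)
      have HK: "\<bar>?H j k y\<bar> \<le> (2 * \<delta> * M) / (norm y)\<^sup>2" if y: "y \<noteq> 0" for j k y
      proof -
        have "?H j k y = v j y * ?w k y + ?w j y * U k y" by (simp add: algebra_simps)
        also have "\<bar>\<dots>\<bar> \<le> \<delta> / norm y * (M / norm y) + M / norm y * (\<delta> / norm y)"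
          by (intro order_trans[OF abs_triangle_ineq] add_mono; subst abs_mult; intro mult_mono bv bU wM y)
            (use \<delta> M in auto)
        also have "\<dots> = (2 * \<delta> * M) / (norm y)\<^sup>2" by (simp add: power2_eq_square)
        finally show ?thesis .
      qed
      have "\<bar>?w i z\<bar> \<le> C * (2 * \<delta> * M) / norm z" by (rule est[OF cw dw wM Hc HK ww zf s(2)])
      also have "C * (2 * \<delta> * M) = M / 2" using C by (simp add: \<delta>_def)
      finally show "?f s \<le> M / 2" using s by (simp add: field_simps)
    qed (use \<delta> x in auto)
    then have "\<bar>?w j x\<bar> \<le> 0" using x by (simp add: mult_le_0_iff)
    then show "v j x = U j x" by simp
  qed
qed

section \<open>Classification of small solutions\<close>

lemma weak_solution_zero: "weak_solution (\<lambda>j y. 0) (\<lambda>j k y. 0)"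
  by (simp add: weak_solution_def annihilates_def weak_term_def[abs_def])

lemma flux_vector_zero: "flux_vector (\<lambda>j y. 0) (\<lambda>j k y. 0) = 0"
  by (simp add: flux_vector_def weak_term_def[abs_def] vec_eq_iff)

text \<open>The comparison solution is \<open>0\<close> if the flux vanishes, and the Landau solution with the same flux otherwise. Its
parameter is at least \<open>A\<close>, which makes the Landau solution small enough for the uniqueness result.\<close>

lemma small_navier_stokes_classification:
  assumes N: "3 \<le> CARD('n::finite)"
  obtains \<delta> where "0 < \<delta>" and "\<And>u :: 'n \<Rightarrow> real ^ 'n \<Rightarrow> real.
    (\<And>j. cdiff 1 (-{0}) (u j)) \<Longrightarrow> (\<And>y. y \<noteq> 0 \<Longrightarrow> (\<Sum>j\<in>UNIV. partial_deriv j (u j) y) = 0) \<Longrightarrow>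
    weak_solution u (\<lambda>j k y. u j y * u k y) \<Longrightarrow> (\<And>j y. y \<noteq> 0 \<Longrightarrow> \<bar>u j y\<bar> \<le> \<delta> / norm y) \<Longrightarrow>
    (\<forall>j y. y \<noteq> 0 \<longrightarrow> u j y = 0) \<or>
      CARD('n) = 3 \<and> (\<exists>a k. 1 < a \<and> norm k = 1 \<and> (\<forall>j y. y \<noteq> 0 \<longrightarrow> u j y = landau_U a k j y))"
proof -
  obtain \<delta>0 where \<delta>0: "0 < \<delta>0" and unique: "\<And>(v :: 'n \<Rightarrow> real ^ 'n \<Rightarrow> real) U j x.
    (\<And>j. cdiff 1 (-{0}) (v j)) \<Longrightarrow> (\<And>j. cdiff 1 (-{0}) (U j)) \<Longrightarrow>
    (\<And>y. y \<noteq> 0 \<Longrightarrow> (\<Sum>j\<in>UNIV. partial_deriv j (v j) y) = 0) \<Longrightarrow> (\<And>y. y \<noteq> 0 \<Longrightarrow> (\<Sum>j\<in>UNIV. partial_deriv j (U j) y) = 0) \<Longrightarrow>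
    (\<And>j y. y \<noteq> 0 \<Longrightarrow> \<bar>v j y\<bar> \<le> \<delta>0 / norm y) \<Longrightarrow> (\<And>j y. y \<noteq> 0 \<Longrightarrow> \<bar>U j y\<bar> \<le> \<delta>0 / norm y) \<Longrightarrow>
    weak_solution v (\<lambda>j k y. v j y * v k y) \<Longrightarrow> weak_solution U (\<lambda>j k y. U j y * U k y) \<Longrightarrow>
    flux_vector v (\<lambda>j k y. v j y * v k y) = flux_vector U (\<lambda>j k y. U j y * U k y) \<Longrightarrow> x \<noteq> 0 \<Longrightarrow> v j x = U j x"
    using small_solution_determined_by_flux[OF N] by blast
  obtain C where C: "0 < C" and fb: "\<And>(w :: 'n \<Rightarrow> real ^ 'n \<Rightarrow> real) H \<epsilon>. (\<And>j. continuous_on (-{0}) (w j)) \<Longrightarrow> (\<And>j k. continuous_on (-{0}) (H j k)) \<Longrightarrow>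
      (\<And>j y. y \<noteq> 0 \<Longrightarrow> \<bar>w j y\<bar> \<le> \<epsilon> / norm y) \<Longrightarrow> (\<And>j k y. y \<noteq> 0 \<Longrightarrow> \<bar>H j k y\<bar> \<le> \<epsilon> / (norm y)\<^sup>2) \<Longrightarrow> 0 \<le> \<epsilon> \<Longrightarrow>
      norm (flux_vector w H) \<le> C * \<epsilon>"
    using flux_bound[where 'n = 'n] by blast
  \<comment> \<open>\<open>80\<close> is what the bounds on the flux require, \<open>20 / \<delta>0\<close> makes Landau solutions smaller than \<open>\<delta>0\<close>\<close>
  define A where "A = max 80 (20 / \<delta>0)"
  have A: "80 \<le> A" "20 / \<delta>0 \<le> A" by (auto simp: A_def)
  have "\<exists>c>0. CARD('n) = 3 \<longrightarrow> (\<forall>b :: real ^ 'n. b \<noteq> 0 \<longrightarrow> norm b \<le> c \<longrightarrow> (\<exists>a k. A \<le> a \<and> norm k = 1 \<and> (\<forall>e. landau_flux a k (\<lambda>j. e $ j) = b \<bullet> e)))"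
  proof (cases "CARD('n) = 3")
    case True
    obtain c where "0 < c" "\<And>b :: real ^ 'n. b \<noteq> 0 \<Longrightarrow> norm b \<le> c \<Longrightarrow> \<exists>a k. A \<le> a \<and> norm k = 1 \<and> (\<forall>e. landau_flux a k (\<lambda>j. e $ j) = b \<bullet> e)"
      using landau_flux_realises[OF True A(1)] by blast
    then show ?thesis by (intro exI[of _ c]) simp
  qed (auto intro: exI[of _ 1])
  then obtain c where c: "0 < c" and match: "\<And>b :: real ^ 'n. CARD('n) = 3 \<Longrightarrow> b \<noteq> 0 \<Longrightarrow> norm b \<le> c \<Longrightarrow> \<exists>a k. A \<le> a \<and> norm k = 1 \<and> (\<forall>e. landau_flux a k (\<lambda>j. e $ j) = b \<bullet> e)"
    by blast
  define \<delta> where "\<delta> = min \<delta>0 (min 1 (c / C))"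
  have \<delta>: "0 < \<delta>" "\<delta> \<le> \<delta>0" "\<delta> \<le> 1" "\<delta> \<le> c / C" using \<delta>0 c C by (auto simp: \<delta>_def)
  show thesis
  proof (rule that[OF \<delta>(1)])
    fix u :: "'n \<Rightarrow> real ^ 'n \<Rightarrow> real"
    assume cu: "\<And>j. cdiff 1 (-{0}) (u j)" and du: "\<And>y. y \<noteq> 0 \<Longrightarrow> (\<Sum>j\<in>UNIV. partial_deriv j (u j) y) = 0"
      and wu: "weak_solution u (\<lambda>j k y. u j y * u k y)" and bu: "\<And>j y. y \<noteq> 0 \<Longrightarrow> \<bar>u j y\<bar> \<le> \<delta> / norm y"
    let ?uu = "\<lambda>j k y. u j y * u k y"
    have ccu: "continuous_on (-{0}) (u j)" for j using cdiff_continuous[OF cu] .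
    have cuu: "continuous_on (-{0}) (?uu j k)" for j k by (intro continuous_intros ccu)
    have bu0: "\<bar>u j y\<bar> \<le> \<delta>0 / norm y" if "y \<noteq> 0" for j y
      using bu[OF that, of j] divide_right_mono[OF \<delta>(2), of "norm y"] by simp
    have buu: "\<bar>?uu j k y\<bar> \<le> \<delta> / (norm y)\<^sup>2" if "y \<noteq> 0" for j k y
    proof -
      have "\<bar>?uu j k y\<bar> \<le> \<delta> / norm y * (\<delta> / norm y)"
        unfolding abs_mult by (intro mult_mono bu that) (use \<delta> in auto)
      also have "\<dots> = \<delta> * \<delta> / (norm y)\<^sup>2" by (simp add: power2_eq_square)
      also have "\<dots> \<le> \<delta> / (norm y)\<^sup>2" using mult_left_mono[OF \<delta>(3), of \<delta>] \<delta>(1) by (intro divide_right_mono) auto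
      finally show ?thesis .
    qed
    define b where "b = flux_vector u ?uu"
    have "norm b \<le> C * \<delta>" unfolding b_def by (rule fb[OF ccu cuu bu buu]) (use \<delta> in auto)
    also have "C * \<delta> \<le> c" using \<delta>(4) C by (simp add: field_simps)
    finally have b: "norm b \<le> c" .
    have u_eq: "u j y = U j y" if "\<And>j. cdiff 1 (-{0}) (U j)" "\<And>y. y \<noteq> 0 \<Longrightarrow> (\<Sum>j\<in>UNIV. partial_deriv j (U j) y) = 0"
      "\<And>j y. y \<noteq> 0 \<Longrightarrow> \<bar>U j y\<bar> \<le> \<delta>0 / norm y" "weak_solution U (\<lambda>j k y. U j y * U k y)"
      "b = flux_vector U (\<lambda>j k y. U j y * U k y)" "y \<noteq> 0" for U j y
      by (rule unique[OF cu that(1) du that(2) bu0 that(3) wu that(4) that(5)[unfolded b_def] that(6)])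
    show "(\<forall>j y. y \<noteq> 0 \<longrightarrow> u j y = 0) \<or>
      CARD('n) = 3 \<and> (\<exists>a k. 1 < a \<and> norm k = 1 \<and> (\<forall>j y. y \<noteq> 0 \<longrightarrow> u j y = landau_U a k j y))"
    proof (cases "b = 0")
      case True
      have "u j y = 0" if y: "y \<noteq> 0" for j y
        by (rule u_eq[where U = "\<lambda>j y. 0", OF _ _ _ _ _ y])
           (use \<delta>0 True flux_vector_zero weak_solution_zero in auto)
      then show ?thesis by blast
    next
      case False
      have n: "CARD('n) = 3"
      proof (rule ccontr)
        assume "CARD('n) \<noteq> 3"
        then have "4 \<le> CARD('n)" using N by simp
        then have "zero_flux u ?uu"
        proof (rule zero_flux_of_dim_ge_4[OF _ _ _ wu])
          show "symb1 0 (\<lambda>y. 1 / norm y) (u j)" for j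
            by (rule symb1_of_bound[OF ccu, of _ \<delta>]) (use bu[of _ j] \<delta> in auto)
          show "symb1 0 (\<lambda>y. 1 / norm y / norm y) (?uu j k)" for j k
            by (rule symb1_of_bound[OF cuu, of _ _ \<delta>]) (use buu[of _ j k] \<delta> in \<open>auto simp: power2_eq_square\<close>)
        qed
        then have "b = 0" by (simp add: b_def flux_vector_def zero_flux_def annihilates_def vec_eq_iff)
        then show False using False by simp
      qed
      obtain a k where a: "A \<le> a" and k: "norm k = 1" and fl: "\<And>e. landau_flux a k (\<lambda>j. e $ j) = b \<bullet> e"
        using match[OF n False b] by blast
      have a1: "1 < a" and a2: "2 \<le> a" using a A by auto
      have "u j y = landau_U a k j y" if y: "y \<noteq> 0" for j y
      proof (rule u_eq[OF landau_U_cdiff[OF a1 k] landau_divergence_free[OF a1 k _ n] _ landau_weak[OF a1 k n] _ y])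
        show "\<bar>landau_U a k j y\<bar> \<le> \<delta>0 / norm y" if "y \<noteq> 0" for j y
        proof (rule order_trans[OF landau_U_bound[OF a1 k a2 that]], rule divide_right_mono)
          have "20 / \<delta>0 \<le> a" using a A by simp
          then show "20 / a \<le> \<delta>0" using a1 \<delta>0 by (simp add: field_simps)
        qed simp
        show "b = flux_vector (landau_U a k) (\<lambda>j i y. landau_U a k j y * landau_U a k i y)"
        proof -
          have "b $ m = landau_flux a k (\<lambda>j. if j = m then 1 else 0)" for m
          proof -
            have "(\<lambda>j. axis m 1 $ j) = (\<lambda>j. if j = m then 1 else 0 :: real)" by (auto simp: axis_def)
            then show ?thesis using fl[of "axis m 1"] by (simp add: inner_axis)
          qed
          then show ?thesis by (simp add: vec_eq_iff flux_vector_def landau_flux_def)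
        qed
      qed
      then show ?thesis using n a1 k by blast
    qed
  qed
qed

section \<open>Constancy of the director\<close>

text \<open>\<open>G\<close> is the squared norm of the gradient. Both \<open>u \<bullet> \<nabla>d\<close> and \<open>G d\<close> contain two small factors, and one of
them is estimated by the current bound \<open>M\<close>.\<close>

lemma small_director_constant:
  assumes N: "3 \<le> CARD('n::finite)"
  obtains \<delta> where "0 < \<delta>" and "\<And>(u :: 'n \<Rightarrow> real ^ 'n \<Rightarrow> real) (d :: 'n \<Rightarrow> real ^ 'n \<Rightarrow> real) G i j x.
    (\<And>i. cdiff 2 (-{0}) (d i)) \<Longrightarrow> (\<And>i y. y \<noteq> 0 \<Longrightarrow> \<bar>d i y\<bar> \<le> 1) \<Longrightarrow>
    (\<And>j y. y \<noteq> 0 \<Longrightarrow> \<bar>u j y\<bar> \<le> \<delta> / norm y) \<Longrightarrow> (\<And>i j y. y \<noteq> 0 \<Longrightarrow> \<bar>partial_deriv j (d i) y\<bar> \<le> \<delta> / norm y) \<Longrightarrow>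
    (\<And>y. y \<noteq> 0 \<Longrightarrow> G y = (\<Sum>j\<in>UNIV. \<Sum>i\<in>UNIV. (partial_deriv j (d i) y)\<^sup>2)) \<Longrightarrow>
    (\<And>i y. y \<noteq> 0 \<Longrightarrow> (\<Sum>j\<in>UNIV. partial_deriv j (partial_deriv j (d i)) y) + G y * d i y = (\<Sum>j\<in>UNIV. u j y * partial_deriv j (d i) y)) \<Longrightarrow>
    x \<noteq> 0 \<Longrightarrow> partial_deriv j (d i) x = 0"
proof -
  obtain C where C: "C > 0" and est: "\<And>g :: real ^ 'n \<Rightarrow> real. \<And>B M K i x.
     cdiff 2 (-{0}) g \<Longrightarrow> (\<And>y. y \<noteq> 0 \<Longrightarrow> \<bar>g y\<bar> \<le> B) \<Longrightarrow>
     (\<And>y j. y \<noteq> 0 \<Longrightarrow> \<bar>partial_deriv j g y\<bar> \<le> M / norm y) \<Longrightarrow>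
     (\<And>y. y \<noteq> 0 \<Longrightarrow> \<bar>\<Sum>j\<in>UNIV. partial_deriv j (partial_deriv j g) y\<bar> \<le> K / (norm y)\<^sup>2) \<Longrightarrow>
     x \<noteq> 0 \<Longrightarrow> \<bar>partial_deriv i g x\<bar> \<le> C * K / norm x"
    using gradient_estimate[OF N] by blast
  define n where "n = real CARD('n)"
  have n: "0 < n + n * n" using N by (simp add: n_def add_pos_pos)
  define \<delta> where "\<delta> = 1 / (2 * C * (n + n * n))"
  have \<delta>: "0 < \<delta>" using C n by (simp add: \<delta>_def)
  show thesis
  proof (rule that[OF \<delta>])
    fix u d :: "'n \<Rightarrow> real ^ 'n \<Rightarrow> real" and G :: "real ^ 'n \<Rightarrow> real" and i j :: 'n and x :: "real ^ 'n"
    assume cd: "\<And>i. cdiff 2 (-{0}) (d i)" and d1: "\<And>i y. y \<noteq> 0 \<Longrightarrow> \<bar>d i y\<bar> \<le> 1"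
      and bu: "\<And>j y. y \<noteq> 0 \<Longrightarrow> \<bar>u j y\<bar> \<le> \<delta> / norm y" and bd: "\<And>i j y. y \<noteq> 0 \<Longrightarrow> \<bar>partial_deriv j (d i) y\<bar> \<le> \<delta> / norm y"
      and G: "\<And>y. y \<noteq> 0 \<Longrightarrow> G y = (\<Sum>j\<in>UNIV. \<Sum>i\<in>UNIV. (partial_deriv j (d i) y)\<^sup>2)"
      and eq: "\<And>i y. y \<noteq> 0 \<Longrightarrow> (\<Sum>j\<in>UNIV. partial_deriv j (partial_deriv j (d i)) y) + G y * d i y = (\<Sum>j\<in>UNIV. u j y * partial_deriv j (d i) y)"
      and x: "x \<noteq> 0"
    let ?f = "\<lambda>(i, j, y). \<bar>partial_deriv j (d i) y\<bar> * norm y"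
    have "?f (i, j, x) \<le> 0"
    proof (rule bound_zero_by_halving[where S = "{(i, j, y). y \<noteq> 0}" and ?M0.0 = \<delta>])
      fix s assume "s \<in> {(i :: 'n, j :: 'n, y :: real ^ 'n). y \<noteq> 0}"
      then obtain i j y where s: "s = (i, j, y)" "y \<noteq> 0" by auto
      then show "?f s \<le> \<delta>" using bd[OF s(2), of j i] by (simp add: field_simps)
    next
      fix M s
      assume M: "0 \<le> M" and ass: "\<And>s. s \<in> {(i :: 'n, j :: 'n, y :: real ^ 'n). y \<noteq> 0} \<Longrightarrow> ?f s \<le> M"
        and "s \<in> {(i :: 'n, j :: 'n, y :: real ^ 'n). y \<noteq> 0}"
      then obtain i j z where s: "s = (i, j, z)" "z \<noteq> 0" by auto
      have bM: "\<bar>partial_deriv j (d i) y\<bar> \<le> M / norm y" if "y \<noteq> 0" for i j y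
        using ass[of "(i, j, y)"] that by (simp add: field_simps)
      have K: "\<bar>\<Sum>j\<in>UNIV. partial_deriv j (partial_deriv j (d i)) y\<bar> \<le> ((n + n * n) * (\<delta> * M)) / (norm y)\<^sup>2" if y: "y \<noteq> 0" for y
      proof -
        let ?q = "\<delta> * M / (norm y)\<^sup>2"
        have q: "\<delta> / norm y * (M / norm y) = ?q" by (simp add: power2_eq_square)
        have "\<bar>\<Sum>j\<in>UNIV. u j y * partial_deriv j (d i) y\<bar> \<le> (\<Sum>j\<in>(UNIV :: 'n set). ?q)"
          unfolding q[symmetric] by (rule order_trans[OF sum_abs], intro sum_mono, subst abs_mult, intro mult_mono bu bM y)
            (use \<delta> in auto)
        then have 1: "\<bar>\<Sum>j\<in>UNIV. u j y * partial_deriv j (d i) y\<bar> \<le> n * ?q" by (simp add: n_def)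
        have sq: "(partial_deriv j (d i) y)\<^sup>2 \<le> ?q" for i j
        proof -
          have "\<bar>partial_deriv j (d i) y\<bar> * \<bar>partial_deriv j (d i) y\<bar> \<le> \<delta> / norm y * (M / norm y)"
            by (intro mult_mono bd bM y) (use \<delta> in auto)
          then show ?thesis unfolding q by (simp add: power2_eq_square)
        qed
        have "G y \<le> (\<Sum>j\<in>(UNIV :: 'n set). \<Sum>i\<in>(UNIV :: 'n set). ?q)" unfolding G[OF y] by (intro sum_mono sq)
        then have "G y \<le> n * n * ?q" by (simp add: n_def)
        moreover have "0 \<le> G y" unfolding G[OF y] by (intro sum_nonneg) simp
        ultimately have 2: "\<bar>G y * d i y\<bar> \<le> n * n * ?q * 1"
          unfolding abs_mult by (intro mult_mono d1 y) auto
        have "(n + n * n) * (\<delta> * M) / (norm y)\<^sup>2 = n * ?q + n * n * ?q * 1" by (simp add: algebra_simps add_divide_distrib)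
        moreover have "(\<Sum>j\<in>UNIV. partial_deriv j (partial_deriv j (d i)) y) = (\<Sum>j\<in>UNIV. u j y * partial_deriv j (d i) y) - G y * d i y"
          using eq[OF y, of i] by simp
        ultimately show ?thesis using 1 2 by linarith
      qed
      have "\<bar>partial_deriv j (d i) z\<bar> \<le> C * ((n + n * n) * (\<delta> * M)) / norm z"
        by (rule est[OF cd d1 bM K s(2)])
      also have "C * ((n + n * n) * (\<delta> * M)) = M / 2" using C n by (simp add: \<delta>_def)
      finally show "?f s \<le> M / 2" using s by (simp add: field_simps)
    qed (use \<delta> x in auto)
    then show "partial_deriv j (d i) x = 0" using x by (simp add: mult_le_0_iff)
  qed
qed

section \<open>The Ericksen-Leslie system\<close>

lemma constant_of_zero_partials:
  fixes f :: "real ^ 'n::finite \<Rightarrow> real ^ 'm::finite"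
  assumes N: "2 \<le> CARD('n)" and f: "\<And>x. x \<noteq> 0 \<Longrightarrow> f differentiable (at x)"
    and z: "\<And>i x. x \<noteq> 0 \<Longrightarrow> partial_deriv i f x = 0"
  shows "\<exists>c. \<forall>x. x \<noteq> 0 \<longrightarrow> f x = c"
proof -
  have c: "connected (-{0 :: real ^ 'n})" by (rule connected_punctured_universe) (use N in simp)
  have D: "(f has_derivative (\<lambda>h. 0)) (at x)" if x: "x \<in> -{0}" for x
  proof -
    have d: "(f has_derivative frechet_derivative f (at x)) (at x)"
      using f[of x] x frechet_derivative_works by auto
    have l: "linear (frechet_derivative f (at x))" using d by (rule has_derivative_linear)
    have "frechet_derivative f (at x) v = 0" for v
    proof -
      have "frechet_derivative f (at x) v = frechet_derivative f (at x) (\<Sum>i\<in>UNIV. v $ i *\<^sub>R axis i 1)"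
        using basis_expansion[of v] by (simp add: scalar_mult_eq_scaleR)
      also have "\<dots> = (\<Sum>i\<in>UNIV. v $ i *\<^sub>R partial_deriv i f x)"
        unfolding partial_deriv_def by (simp add: linear_sum[OF l] linear_cmul[OF l])
      finally show ?thesis using z[of x] x by simp
    qed
    then have "frechet_derivative f (at x) = (\<lambda>h. 0)" by blast
    then show ?thesis using d by simp
  qed
  have "f x = f (axis undefined 1)" if "x \<noteq> 0" for x
    by (rule has_derivative_zero_unique_connected[OF open_punctured c D]) (use that in \<open>auto simp: axis_eq_0_iff\<close>)
  then show ?thesis by blast
qed

context
  fixes f :: "real ^ 'n::finite \<Rightarrow> real ^ 'm::finite"
  assumes smooth: "smooth_on (-{0}) f"
begin

lemma smooth_component: "cdiff k (-{0}) (\<lambda>y. f y $ j)"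
  by (rule Ck_on_component[OF open_punctured]) (use smooth in \<open>simp add: smooth_on_def\<close>)

lemma smooth_differentiable: "x \<noteq> 0 \<Longrightarrow> f differentiable (at x)"
  "x \<noteq> 0 \<Longrightarrow> partial_deriv i f differentiable (at x)"
proof -
  have "Ck_on (Suc (Suc 0)) (-{0}) f" using smooth unfolding smooth_on_def by blast
  then show "x \<noteq> 0 \<Longrightarrow> f differentiable (at x)" "x \<noteq> 0 \<Longrightarrow> partial_deriv i f differentiable (at x)"
    unfolding partial_deriv_def[abs_def] by auto
qed

lemma smooth_partial: "x \<noteq> 0 \<Longrightarrow> partial_deriv i f x $ j = partial_deriv i (\<lambda>y. f y $ j) x"
  using partial_deriv_component(1)[OF smooth_differentiable(1)] by simp

lemma smooth_partial2:
  assumes x: "x \<noteq> 0"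
  shows "partial_deriv i (partial_deriv i f) x $ j = partial_deriv i (partial_deriv i (\<lambda>y. f y $ j)) x"
proof -
  have "partial_deriv i (partial_deriv i f) x $ j = partial_deriv i (\<lambda>y. partial_deriv i f y $ j) x"
    using partial_deriv_component(1)[OF smooth_differentiable(2)[OF x]] by simp
  also have "\<dots> = partial_deriv i (partial_deriv i (\<lambda>y. f y $ j)) x"
    by (rule partial_deriv_cong[OF open_punctured]) (use x smooth_partial in auto)
  finally show ?thesis .
qed

lemma laplacian_component: "x \<noteq> 0 \<Longrightarrow> laplacian f x $ j = (\<Sum>i\<in>UNIV. partial_deriv i (partial_deriv i (\<lambda>y. f y $ j)) x)"
  by (simp add: laplacian_def smooth_partial2)

lemma advection_component: "x \<noteq> 0 \<Longrightarrow> advection u f x $ j = (\<Sum>i\<in>UNIV. u x $ i * partial_deriv i (\<lambda>y. f y $ j) x)"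
  by (simp add: advection_def smooth_partial)

lemma grad_norm_component: "x \<noteq> 0 \<Longrightarrow> (grad_norm f x)\<^sup>2 = (\<Sum>i\<in>UNIV. \<Sum>j\<in>UNIV. (partial_deriv i (\<lambda>y. f y $ j) x)\<^sup>2)"
  by (simp add: grad_norm_def sum_nonneg norm_eq_sum_squares smooth_partial power2_eq_square[symmetric])

lemma partial_le_grad_norm:
  assumes x: "x \<noteq> 0"
  shows "\<bar>partial_deriv i (\<lambda>y. f y $ j) x\<bar> \<le> grad_norm f x"
proof -
  have "(partial_deriv i (\<lambda>y. f y $ j) x)\<^sup>2 \<le> (\<Sum>j\<in>UNIV. (partial_deriv i (\<lambda>y. f y $ j) x)\<^sup>2)"
    by (rule member_le_sum[where f = "\<lambda>j. (partial_deriv i (\<lambda>y. f y $ j) x)\<^sup>2"]) auto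
  also have "\<dots> \<le> (\<Sum>i\<in>UNIV. \<Sum>j\<in>UNIV. (partial_deriv i (\<lambda>y. f y $ j) x)\<^sup>2)"
    by (rule member_le_sum[where f = "\<lambda>i. \<Sum>j\<in>UNIV. (partial_deriv i (\<lambda>y. f y $ j) x)\<^sup>2"]) (auto intro: sum_nonneg)
  finally have "(partial_deriv i (\<lambda>y. f y $ j) x)\<^sup>2 \<le> (grad_norm f x)\<^sup>2" unfolding grad_norm_component[OF x] .
  moreover have "0 \<le> grad_norm f x" by (simp add: grad_norm_def sum_nonneg)
  ultimately show ?thesis using abs_le_square_iff[of "partial_deriv i (\<lambda>y. f y $ j) x" "grad_norm f x"] by simp
qed

end

lemma div_ericksen_stress_zero:
  assumes z: "\<And>i x. x \<noteq> 0 \<Longrightarrow> partial_deriv i d x = 0" and x: "x \<noteq> 0"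
  shows "div_matrix (ericksen_stress d) x = 0"
proof -
  have "partial_deriv j (\<lambda>y. ericksen_stress d y $ i $ j) x = partial_deriv j (\<lambda>y. 0) x" for i j
    by (rule partial_deriv_cong[OF open_punctured]) (use x z in \<open>auto simp: ericksen_stress_def\<close>)
  then show ?thesis by (simp add: div_matrix_def vec_eq_iff)
qed

lemma navier_stokes_weak_solution:
  fixes u :: "real ^ 'n::finite \<Rightarrow> real ^ 'n"
  assumes u: "smooth_on (-{0}) u" and ns: "steady_navier_stokes u"
  shows "weak_solution (\<lambda>j y. u y $ j) (\<lambda>j k y. u y $ j * u y $ k)"
proof -
  obtain p where p: "smooth_on (-{0}) p"
    and eq: "\<And>x. x \<noteq> 0 \<Longrightarrow> - laplacian u x + advection u u x + grad p x = 0" and dv: "\<And>x. x \<noteq> 0 \<Longrightarrow> divergence u x = 0"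
    using ns unfolding steady_navier_stokes_def by blast
  show ?thesis
  proof (rule navier_stokes_weak)
    show "cdiff 2 (-{0}) (\<lambda>y. u y $ j)" for j by (rule smooth_component[OF u])
    show "cdiff 1 (-{0}) p" by (rule Ck_on_imp_cdiff) (use p in \<open>simp only: smooth_on_def\<close>)
    show "- (\<Sum>l\<in>UNIV. partial_deriv l (partial_deriv l (\<lambda>y. u y $ j)) y) + (\<Sum>i\<in>UNIV. u y $ i * partial_deriv i (\<lambda>y. u y $ j) y)
        + partial_deriv j p y = 0" if y: "y \<noteq> 0" for j y
    proof -
      have "(- laplacian u y + advection u u y + grad p y) $ j = 0" by (simp only: eq[OF y] zero_index)
      then show ?thesis by (simp add: laplacian_component[OF u y] advection_component[OF u y] grad_def)
    qed
    show "(\<Sum>j\<in>UNIV. partial_deriv j (\<lambda>y. u y $ j) y) = 0" if "y \<noteq> 0" for y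
      using dv[OF that] by (simp add: divergence_def)
  qed
qed

theorem theorem1p2:
  assumes "CARD('n::finite) \<ge> 3"
  shows "\<exists>\<epsilon>\<^sub>0 > 0. \<forall>(u :: real ^ 'n \<Rightarrow> real ^ 'n) (d :: real ^ 'n \<Rightarrow> real ^ 'n).
    smooth_on (- {0}) u \<and> smooth_on (- {0}) d \<and>
    (\<forall>x. x \<noteq> 0 \<longrightarrow> d x \<in> sphere 0 1) \<and>
    steady_ericksen_leslie u d \<and>
    (\<forall>x. x \<noteq> 0 \<longrightarrow> max (norm (u x)) (grad_norm d x) \<le> \<epsilon>\<^sub>0 / norm x)
    \<longrightarrow>
    (CARD('n) \<ge> 4 \<longrightarrow>
      (\<forall>x. x \<noteq> 0 \<longrightarrow> u x = 0) \<and> (\<exists>c. \<forall>x. x \<noteq> 0 \<longrightarrow> d x = c)) \<and>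
    (CARD('n) = 3 \<longrightarrow>
      (\<exists>c. \<forall>x. x \<noteq> 0 \<longrightarrow> d x = c) \<and>
      ((\<forall>x. x \<noteq> 0 \<longrightarrow> u x = 0) \<or> (landau_solution u \<and> steady_navier_stokes u)))"
proof -
  obtain \<delta>d where \<delta>d: "0 < \<delta>d" and director: "\<And>(u :: 'n \<Rightarrow> real ^ 'n \<Rightarrow> real) (d :: 'n \<Rightarrow> real ^ 'n \<Rightarrow> real) G i j x.
    (\<And>i. cdiff 2 (-{0}) (d i)) \<Longrightarrow> (\<And>i y. y \<noteq> 0 \<Longrightarrow> \<bar>d i y\<bar> \<le> 1) \<Longrightarrow>
    (\<And>j y. y \<noteq> 0 \<Longrightarrow> \<bar>u j y\<bar> \<le> \<delta>d / norm y) \<Longrightarrow> (\<And>i j y. y \<noteq> 0 \<Longrightarrow> \<bar>partial_deriv j (d i) y\<bar> \<le> \<delta>d / norm y) \<Longrightarrow>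
    (\<And>y. y \<noteq> 0 \<Longrightarrow> G y = (\<Sum>j\<in>UNIV. \<Sum>i\<in>UNIV. (partial_deriv j (d i) y)\<^sup>2)) \<Longrightarrow>
    (\<And>i y. y \<noteq> 0 \<Longrightarrow> (\<Sum>j\<in>UNIV. partial_deriv j (partial_deriv j (d i)) y) + G y * d i y = (\<Sum>j\<in>UNIV. u j y * partial_deriv j (d i) y)) \<Longrightarrow>
    x \<noteq> 0 \<Longrightarrow> partial_deriv j (d i) x = 0"
    using small_director_constant[OF assms] by blast
  obtain \<delta>u where \<delta>u: "0 < \<delta>u" and velocity: "\<And>u :: 'n \<Rightarrow> real ^ 'n \<Rightarrow> real.
    (\<And>j. cdiff 1 (-{0}) (u j)) \<Longrightarrow> (\<And>y. y \<noteq> 0 \<Longrightarrow> (\<Sum>j\<in>UNIV. partial_deriv j (u j) y) = 0) \<Longrightarrow>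
    weak_solution u (\<lambda>j k y. u j y * u k y) \<Longrightarrow> (\<And>j y. y \<noteq> 0 \<Longrightarrow> \<bar>u j y\<bar> \<le> \<delta>u / norm y) \<Longrightarrow>
    (\<forall>j y. y \<noteq> 0 \<longrightarrow> u j y = 0) \<or>
      CARD('n) = 3 \<and> (\<exists>a k. 1 < a \<and> norm k = 1 \<and> (\<forall>j y. y \<noteq> 0 \<longrightarrow> u j y = landau_U a k j y))"
    using small_navier_stokes_classification[OF assms] by blast
  have "(CARD('n) \<ge> 4 \<longrightarrow>
      (\<forall>x. x \<noteq> 0 \<longrightarrow> u x = 0) \<and> (\<exists>c. \<forall>x. x \<noteq> 0 \<longrightarrow> d x = c)) \<and>
    (CARD('n) = 3 \<longrightarrow>
      (\<exists>c. \<forall>x. x \<noteq> 0 \<longrightarrow> d x = c) \<and>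
      ((\<forall>x. x \<noteq> 0 \<longrightarrow> u x = 0) \<or> (landau_solution u \<and> steady_navier_stokes u)))"
    if u: "smooth_on (- {0}) u" and d: "smooth_on (- {0}) d" and sph: "\<forall>x. x \<noteq> 0 \<longrightarrow> d x \<in> sphere 0 1"
      and el: "steady_ericksen_leslie u d"
      and small: "\<forall>x. x \<noteq> 0 \<longrightarrow> max (norm (u x)) (grad_norm d x) \<le> min \<delta>d \<delta>u / norm x"
    for u d :: "real ^ 'n \<Rightarrow> real ^ 'n"
  proof -
    obtain p where p: "smooth_on (-{0}) p"
      and mom: "\<And>x. x \<noteq> 0 \<Longrightarrow> - laplacian u x + advection u u x + grad p x = - div_matrix (ericksen_stress d) x"
      and dv: "\<And>x. x \<noteq> 0 \<Longrightarrow> divergence u x = 0"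
      and dir: "\<And>x. x \<noteq> 0 \<Longrightarrow> laplacian d x + (grad_norm d x)\<^sup>2 *\<^sub>R d x = advection u d x"
      using el unfolding steady_ericksen_leslie_def by blast
    have bnd: "norm (u x) \<le> \<delta>d / norm x" "norm (u x) \<le> \<delta>u / norm x" "grad_norm d x \<le> \<delta>d / norm x" if "x \<noteq> 0" for x
    proof -
      have "min \<delta>d \<delta>u / norm x \<le> \<delta>d / norm x" "min \<delta>d \<delta>u / norm x \<le> \<delta>u / norm x"
        by (intro divide_right_mono; simp)+
      then show "norm (u x) \<le> \<delta>d / norm x" "norm (u x) \<le> \<delta>u / norm x" "grad_norm d x \<le> \<delta>d / norm x"
        using small that by force+
    qed
    have zero: "partial_deriv i (\<lambda>y. d y $ j) x = 0" if x: "x \<noteq> 0" for i j x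
    proof (rule director[where d = "\<lambda>i y. d y $ i" and u = "\<lambda>j y. u y $ j" and G = "\<lambda>y. (grad_norm d y)\<^sup>2", OF _ _ _ _ _ _ x])
      show "cdiff 2 (-{0}) (\<lambda>y. d y $ i)" for i by (rule smooth_component[OF d])
      show "\<bar>d y $ i\<bar> \<le> 1" if "y \<noteq> 0" for i y using sph that component_le_norm_cart[of "d y" i] by auto
      show "\<bar>u y $ j\<bar> \<le> \<delta>d / norm y" if "y \<noteq> 0" for j y
        using bnd(1)[OF that] component_le_norm_cart[of "u y" j] by linarith
      show "\<bar>partial_deriv j (\<lambda>y. d y $ i) y\<bar> \<le> \<delta>d / norm y" if "y \<noteq> 0" for i j y
        using bnd(3)[OF that] partial_le_grad_norm[OF d that, of j i] by linarith
      show "(grad_norm d y)\<^sup>2 = (\<Sum>j\<in>UNIV. \<Sum>i\<in>UNIV. (partial_deriv j (\<lambda>y. d y $ i) y)\<^sup>2)" if "y \<noteq> 0" for y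
        by (rule grad_norm_component[OF d that])
      show "(\<Sum>j\<in>UNIV. partial_deriv j (partial_deriv j (\<lambda>y. d y $ i)) y) + (grad_norm d y)\<^sup>2 * d y $ i
          = (\<Sum>j\<in>UNIV. u y $ j * partial_deriv j (\<lambda>y. d y $ i) y)" if y: "y \<noteq> 0" for i y
        using arg_cong[OF dir[OF y], of "\<lambda>v. v $ i"]
        by (simp add: laplacian_component[OF d y] advection_component[OF d y])
    qed
    have zero': "partial_deriv i d x = 0" if "x \<noteq> 0" for i x
      using zero[OF that] smooth_partial[OF d that] by (simp add: vec_eq_iff)
    have const: "\<exists>c. \<forall>x. x \<noteq> 0 \<longrightarrow> d x = c"
      by (rule constant_of_zero_partials[OF _ smooth_differentiable(1)[OF d] zero']) (use assms in auto)
    have ns: "steady_navier_stokes u"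
      unfolding steady_navier_stokes_def using p mom dv div_ericksen_stress_zero[OF zero'] by auto
    have "(\<forall>j y. y \<noteq> 0 \<longrightarrow> u y $ j = 0) \<or>
      CARD('n) = 3 \<and> (\<exists>a k. 1 < a \<and> norm k = 1 \<and> (\<forall>j y. y \<noteq> 0 \<longrightarrow> u y $ j = landau_U a k j y))"
    proof (rule velocity[OF _ _ navier_stokes_weak_solution[OF u ns]])
      show "cdiff 1 (-{0}) (\<lambda>y. u y $ j)" for j by (rule smooth_component[OF u])
      show "(\<Sum>j\<in>UNIV. partial_deriv j (\<lambda>y. u y $ j) y) = 0" if "y \<noteq> 0" for y
        using dv[OF that] by (simp add: divergence_def)
      show "\<bar>u y $ j\<bar> \<le> \<delta>u / norm y" if "y \<noteq> 0" for j y
        using bnd(2)[OF that] component_le_norm_cart[of "u y" j] by linarith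
    qed
    then show ?thesis
    proof
      assume "\<forall>j y. y \<noteq> 0 \<longrightarrow> u y $ j = 0"
      then have "\<forall>x. x \<noteq> 0 \<longrightarrow> u x = 0" by (simp add: vec_eq_iff)
      then show ?thesis using const by blast
    next
      assume *: "CARD('n) = 3 \<and> (\<exists>a k. 1 < a \<and> norm k = 1 \<and> (\<forall>j y. y \<noteq> 0 \<longrightarrow> u y $ j = landau_U a k j y))"
      then obtain a k where "1 < a" "norm k = 1" "\<And>x j. x \<noteq> 0 \<Longrightarrow> u x $ j = landau_U a k j x" by blast
      then have "landau_solution u" using * by (intro landau_solution_of_axis) auto
      then show ?thesis using * const ns by simp
    qed
  qed
  then show ?thesis using \<delta>d \<delta>u by (intro exI[of _ "min \<delta>d \<delta>u"]) auto
qed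

end
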